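(* The map $\eta_{\mathfrak l}:\mathfrak Z(\mathfrak g)\to\mathfrak Z(\mathfrak l)$ (uniquely determined as described in the context) is an algebra homomorphism with the following property. Let $M$ be a $\mathfrak g$-supermodule with infinitesimal character $\chi_\lambda$, $\lambda\in\mathfrak h^*$. Then every $z\in\mathfrak Z(\mathfrak g)$ (acting as $z\otimes 1$) acts on the Dirac cohomology $H_D(M)$ as $\eta_{\mathfrak l}(z)\in\mathfrak Z(\mathfrak l)$. In particular, if $V$ is a nonzero sub-$\mathfrak l$-supermodule of $H_D(M)$ with infinitesimal character $\chi^{\mathfrak l}_\mu$, $\mu\in\mathfrak h^*$, then $\chi_\lambda=\chi_\mu^{\mathfrak l}\circ\eta_{\mathfrak l}$.
   Context: Ground field $\mathbb C$; $p(\cdot)$ denotes parity. $\mathfrak g=\mathfrak g_0\oplus\mathfrak g_1$ is a basic classical Lie superalgebra with $\mathfrak g_1\neq0$, i.e. $\mathfrak{gl}(m|n)$ ($m,n\ge1$) or simple of type $A(m|n),B(m|n),C(n),D(m|n),F(4),G(3)$ or $D(2,1;\alpha)$ with $\alpha\in\mathbb R$; $(\cdot,\cdot)$ is a fixed non-degenerate invariant supersymmetric bilinear form with $(\mathfrak g_0,\mathfrak g_1)=0$. $\mathfrak h\subset\mathfrak g_0$ is a Cartan subalgebra, $\Phi$ the set of roots, $\mathfrak g^\alpha$ the root spaces, $\Phi^+$ a fixed positive system, $\mathfrak n^\pm=\bigoplus_{\alpha\in\Phi^+}\mathfrak g^{\pm\alpha}$. Parabolic subalgebra: given an additive map $f:\mathbb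 Z\Phi\to\mathbb Z$, put $\mathfrak l=\mathfrak h\oplus\bigoplus_{f(\alpha)=0}\mathfrak g^\alpha$, $\mathfrak u=\bigoplus_{f(\alpha)>0}\mathfrak g^\alpha$, $\bar{\mathfrak u}=\bigoplus_{f(\alpha)<0}\mathfrak g^{\alpha}$; then $\mathfrak p=\mathfrak l\ltimes\mathfrak u$ is parabolic with Levi subalgebra $\mathfrak l$. We fix such $\mathfrak p$ with all roots of $\mathfrak u$ in $\Phi^+$, and put $\Phi(\mathfrak l;\mathfrak h)^+=\Phi(\mathfrak l;\mathfrak h)\cap\Phi^+$, $\mathfrak s=\mathfrak u\oplus\bar{\mathfrak u}$, so that $\mathfrak g=\mathfrak l\oplus\mathfrak s$ orthogonally. Cubic Dirac operator: $C(\mathfrak s)$ is the Clifford superalgebra generated by $\mathfrak s$ with relations $vw+(-1)^{p(v)p(w)}wv=2(v,w)$. Let $X_1,\dots,X_{2s}$ be a homogeneous basis of $\mathfrak s$ and $X_i^*$ the dual basis, $(X_i^*,X_j)=\delta_{ij}$. Put $\phi_{\mathfrak s}=-\frac1{12}\sum_{i,j,k}(-1)^{p(X_i)p(X_j)+p(X_k)}([X_i,X_j],X_k)\,X_i^*\wedge X_j^*\wedge X_k^*$, viewed in $C(\mathfrak s)$ via super-antisymmetrization (quantization map) $\bigwedge\mathfrak s\cong C(\mathfrak s)$, and $D=D(\mathfrak g,\mathfrak l)=\sum_iX_i\otimes X_i^*+1\otimes\phi_{\mathfrak s}\in\mathfrak U(\mathfrak g)\otimes C(\mathfrak s)$. Diagonal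 embedding: $\nu_*:\mathfrak l\to C(\mathfrak s)$ is the Lie superalgebra morphism with values in the image of $\bigwedge^2\mathfrak s$ satisfying $[\nu_*(X),v]=[X,v]$ for $v\in\mathfrak s$; $\alpha(X)=X\otimes1+1\otimes\nu_*(X)$, extended to $\mathfrak U(\mathfrak l)\to\mathfrak U(\mathfrak g)\otimes C(\mathfrak s)$. $D$ commutes with $\alpha(\mathfrak l)$. $(\mathfrak U(\mathfrak g)\otimes C(\mathfrak s))^{\mathfrak l}$ denotes the elements supercommuting with $\alpha(\mathfrak l)$. Oscillator supermodule and Dirac cohomology: $\overline M(\mathfrak s)=C(\mathfrak s)/C(\mathfrak s)\mathfrak u\cong\bigwedge\bar{\mathfrak u}_0\otimes\mathrm{Sym}(\bar{\mathfrak u}_1)$ ($\bar{\mathfrak u}$ acts by multiplication, $\mathfrak u$ by contraction), graded by the parity of the degree in $\bigwedge\bar{\mathfrak u}_0$. $\mathfrak U(\mathfrak g)\otimes C(\mathfrak s)$ acts on $M\otimes\overline M(\mathfrak s)$ componentwise (with Koszul signs), $\mathfrak l$ acts through $\alpha$, and $H_D(M)=\ker D/(\ker D\cap\operatorname{im}D)$, an $\mathfrak l$-supermodule. Infinitesimal characters: $\mathfrak Z(\cdot)$ is the center of the enveloping superalgebra. If $p:\mathfrak U(\mathfrak g)\to S(\mathfrak h)$ is the projection along $\mathfrak n^-\mathfrak U(\mathfrak g)+\mathfrak U(\mathfrak g)\mathfrak n^+$, then $\chi_\lambda(z)=\lambda(p(z))$ for $z\in\mathfrak Z(\mathfrak g)$.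 $M$ has infinitesimal character $\chi_\lambda$ if every $z\in\mathfrak Z(\mathfrak g)$ acts on $M$ by the scalar $\chi_\lambda(z)$. $\chi^{\mathfrak l}_\mu$ is defined in the same way for $\mathfrak l$ with $\Phi(\mathfrak l;\mathfrak h)^+$. The map $\eta_{\mathfrak l}$: it is known that for every $z\in\mathfrak Z(\mathfrak g)$ there is a unique $\eta_{\mathfrak l}(z)\in\mathfrak Z(\mathfrak l)$ such that $z\otimes1=\alpha(\eta_{\mathfrak l}(z))+DA+AD$ for some $A\in(\mathfrak U(\mathfrak g)\otimes C(\mathfrak s))^{\mathfrak l}$. *)

theory Defs
  imports
    Complex_Main
    "HOL-Library.Poly_Mapping"
    "HOL-Library.Z2"
    "HOL-Library.Function_Algebras"
    "HOL-Combinatorics.Permutations"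
    "HOL-Computational_Algebra.Group_Closure"
    "HOL-Algebra.Module"
    "HOL-Algebra.QuotRing"
begin

section \<open>Super vector spaces over the complex numbers\<close>

definition CC :: "complex ring" where
  "CC = \<lparr>carrier = UNIV, mult = (*), one = 1, zero = 0, add = (+)\<rparr>"

text \<open>Parities are elements of the two-element field \<^typ>\<open>bit\<close>. The same record serves for
  superspaces (where the fields \<open>mult\<close> and \<open>one\<close> are ignored, as for modules) and for
  associative superalgebras.\<close>

record 'a superspace = "(complex, 'a) module" +
  hpart :: "bit \<Rightarrow> 'a set"

record 'a lie_superspace = "'a superspace" +
  lbr :: "'a \<Rightarrow> 'a \<Rightarrow> 'a"

definition koszul :: "bit \<Rightarrow> bit \<Rightarrow> complex" where
  "koszul p q = (if p = 1 \<and> q = 1 then - 1 else 1)"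

definition super_space :: "('a, 'z) superspace_scheme \<Rightarrow> bool" where
  "super_space V \<longleftrightarrow> module CC V \<and> (\<forall>p. submodule (hpart V p) CC V) \<and>
     hpart V 0 \<inter> hpart V 1 = {\<zero>\<^bsub>V\<^esub>} \<and> hpart V 0 <+>\<^bsub>V\<^esub> hpart V 1 = carrier V"

definition hproj :: "('a, 'z) superspace_scheme \<Rightarrow> bit \<Rightarrow> 'a \<Rightarrow> 'a" where
  "hproj V p x = (THE y. y \<in> hpart V p \<and> (\<exists>y' \<in> hpart V (p + 1). x = y \<oplus>\<^bsub>V\<^esub> y'))"

definition lspan :: "('a, 'z) superspace_scheme \<Rightarrow> 'a set \<Rightarrow> 'a set" where
  "lspan V S = \<Inter>{W. submodule W CC V \<and> S \<subseteq> W}"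

definition subspace_of :: "('a, 'z) superspace_scheme \<Rightarrow> 'a set \<Rightarrow> ('a, 'z) superspace_scheme" where
  "subspace_of V W = V\<lparr>carrier := W, hpart := (\<lambda>p. hpart V p \<inter> W)\<rparr>"

definition quot_space :: "'a superspace \<Rightarrow> 'a set \<Rightarrow> 'a set superspace" where
  "quot_space V N = \<lparr>carrier = a_rcosets\<^bsub>V\<^esub> N, mult = undefined, one = undefined,
     zero = N, add = set_add V, smult = (\<lambda>c P. \<Union>x\<in>P. N +>\<^bsub>V\<^esub> (c \<odot>\<^bsub>V\<^esub> x)),
     hpart = (\<lambda>p. (\<lambda>x. N +>\<^bsub>V\<^esub> x) ` hpart V p)\<rparr>"

definition is_linear ::
  "('a, 'z) superspace_scheme \<Rightarrow> ('b, 'y) superspace_scheme \<Rightarrow> ('a \<Rightarrow> 'b) \<Rightarrow> bool" where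
  "is_linear V W \<phi> \<longleftrightarrow> \<phi> \<in> carrier V \<rightarrow> carrier W \<and>
     (\<forall>x\<in>carrier V. \<forall>y\<in>carrier V. \<phi> (x \<oplus>\<^bsub>V\<^esub> y) = \<phi> x \<oplus>\<^bsub>W\<^esub> \<phi> y) \<and>
     (\<forall>c. \<forall>x\<in>carrier V. \<phi> (c \<odot>\<^bsub>V\<^esub> x) = c \<odot>\<^bsub>W\<^esub> \<phi> x)"

definition is_basis :: "('a, 'z) superspace_scheme \<Rightarrow> 'a set \<Rightarrow> nat \<Rightarrow> (nat \<Rightarrow> 'a) \<Rightarrow> bool" where
  "is_basis V W n X \<longleftrightarrow> (\<forall>i<n. X i \<in> W) \<and>
     (\<forall>v\<in>W. \<exists>!c. c \<in> extensional {..<n} \<and> v = (\<Oplus>\<^bsub>V\<^esub> i\<in>{..<n}. c i \<odot>\<^bsub>V\<^esub> X i))"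

definition finite_dim :: "('a, 'z) superspace_scheme \<Rightarrow> bool" where
  "finite_dim V \<longleftrightarrow> (\<exists>B. finite B \<and> B \<subseteq> carrier V \<and> lspan V B = carrier V)"


section \<open>Associative superalgebras\<close>

text \<open>The supercommutator, bilinear in its arguments.\<close>

definition scomm :: "'a superspace \<Rightarrow> 'a \<Rightarrow> 'a \<Rightarrow> 'a" where
  "scomm A a b = (a \<otimes>\<^bsub>A\<^esub> b) \<ominus>\<^bsub>A\<^esub>
     (\<Oplus>\<^bsub>A\<^esub> p\<in>{0, 1}. \<Oplus>\<^bsub>A\<^esub> q\<in>{0, 1}.
        koszul p q \<odot>\<^bsub>A\<^esub> (hproj A q b \<otimes>\<^bsub>A\<^esub> hproj A p a))"

definition scenter :: "'a superspace \<Rightarrow> 'a set" where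
  "scenter A = {z \<in> carrier A. \<forall>a\<in>carrier A. scomm A a z = \<zero>\<^bsub>A\<^esub>}"

subsection \<open>Presentations by generators and relations\<close>

text \<open>The free algebra on a set of letters is the monoid algebra of the free monoid; the
  monoid is written additively because this is what \<^typ>\<open>'a \<Rightarrow>\<^sub>0 'b\<close> expects.\<close>

datatype 'x fword = FWord (letters: "'x list")

instantiation fword :: (type) monoid_add
begin
definition zero_fword :: "'a fword" where "zero_fword = FWord []"
definition plus_fword :: "'a fword \<Rightarrow> 'a fword \<Rightarrow> 'a fword" where
  "plus_fword v w = FWord (letters v @ letters w)"
instance
  by standard (auto simp: zero_fword_def plus_fword_def)
end

type_synonym 'x free = "'x fword \<Rightarrow>\<^sub>0 complex"

definition const :: "complex \<Rightarrow> 'x free" where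
  "const c = Poly_Mapping.single 0 c"

definition gen :: "'x \<Rightarrow> 'x free" where
  "gen x = Poly_Mapping.single (FWord [x]) 1"

definition words_in :: "'x set \<Rightarrow> 'x free set" where
  "words_in S = {p. \<forall>w\<in>Poly_Mapping.keys p. set (letters w) \<subseteq> S}"

definition free_alg :: "('x, 'z) superspace_scheme \<Rightarrow> 'x free ring" where
  "free_alg V = \<lparr>carrier = words_in (carrier V), mult = (*), one = 1, zero = 0, add = (+)\<rparr>"

definition linear_rels :: "('x, 'z) superspace_scheme \<Rightarrow> 'x free set" where
  "linear_rels V =
     {gen (x \<oplus>\<^bsub>V\<^esub> y) - gen x - gen y | x y. x \<in> carrier V \<and> y \<in> carrier V} \<union>
     {gen (c \<odot>\<^bsub>V\<^esub> x) - const c * gen x | c x. x \<in> carrier V}"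

text \<open>\<open>weighted_words V d q\<close>: combinations of words \<open>x\<^sub>1 \<dots> x\<^sub>k\<close> in homogeneous letters
  with \<open>d (p(x\<^sub>1)) + \<dots> + d (p(x\<^sub>k)) = q\<close>.\<close>

definition weighted_words ::
  "('x, 'z) superspace_scheme \<Rightarrow> (bit \<Rightarrow> bit) \<Rightarrow> bit \<Rightarrow> 'x free set" where
  "weighted_words V d q = {P. \<forall>w\<in>Poly_Mapping.keys P. \<exists>ps.
     list_all2 (\<lambda>x p. x \<in> hpart V p) (letters w) ps \<and> sum_list (map d ps) = q}"

text \<open>\<open>pres V R\<close> is the tensor algebra of \<open>V\<close> modulo the two-sided ideal generated by \<open>R\<close>.\<close>

definition pres_ideal :: "('x, 'z) superspace_scheme \<Rightarrow> 'x free set \<Rightarrow> 'x free set" where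
  "pres_ideal V R = genideal (free_alg V) (linear_rels V \<union> R)"

definition pres_class :: "('x, 'z) superspace_scheme \<Rightarrow> 'x free set \<Rightarrow> 'x free \<Rightarrow> 'x free set" where
  "pres_class V R P = pres_ideal V R +>\<^bsub>free_alg V\<^esub> P"

definition pres :: "('x, 'z) superspace_scheme \<Rightarrow> 'x free set \<Rightarrow> 'x free set superspace" where
  "pres V R = (let A = free_alg V Quot pres_ideal V R in
     \<lparr>carrier = carrier A, mult = mult A, one = one A, zero = zero A, add = add A,
      smult = (\<lambda>c P. pres_class V R (const c) \<otimes>\<^bsub>A\<^esub> P),
      hpart = (\<lambda>q. pres_class V R ` weighted_words V (\<lambda>p. p) q)\<rparr>)"

text \<open>Extension of an action \<open>\<rho>\<close> of the generators on a space \<open>M\<close> to the presented algebra,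
  and of a map \<open>\<theta>\<close> from the generators into an algebra \<open>A\<close> to an algebra morphism. Both are
  evaluated on a representative.\<close>

definition alg_act :: "('m, 'z) superspace_scheme \<Rightarrow> ('x \<Rightarrow> 'm \<Rightarrow> 'm) \<Rightarrow> 'x free set \<Rightarrow> 'm \<Rightarrow> 'm" where
  "alg_act M \<rho> U m = (let P = (SOME P. P \<in> U) in
     \<Oplus>\<^bsub>M\<^esub> w\<in>Poly_Mapping.keys P. Poly_Mapping.lookup P w \<odot>\<^bsub>M\<^esub> foldr \<rho> (letters w) m)"

definition alg_ext :: "('a, 'z) superspace_scheme \<Rightarrow> ('x \<Rightarrow> 'a) \<Rightarrow> 'x free set \<Rightarrow> 'a" where
  "alg_ext A \<theta> U = alg_act A (\<lambda>x a. \<theta> x \<otimes>\<^bsub>A\<^esub> a) U \<one>\<^bsub>A\<^esub>"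

subsection \<open>Tensor products\<close>

definition pair_space ::
  "('a, 'y) superspace_scheme \<Rightarrow> ('b, 'z) superspace_scheme \<Rightarrow> ('a \<times> 'b \<Rightarrow>\<^sub>0 complex) superspace" where
  "pair_space V W = \<lparr>carrier = {P. Poly_Mapping.keys P \<subseteq> carrier V \<times> carrier W},
     mult = undefined, one = undefined, zero = 0, add = (+),
     smult = (\<lambda>c. Poly_Mapping.map ((*) c)),
     hpart = (\<lambda>q. {P. \<forall>(a, b)\<in>Poly_Mapping.keys P. \<exists>r. a \<in> hpart V r \<and> b \<in> hpart W (q + r)})\<rparr>"

definition pair :: "'a \<Rightarrow> 'b \<Rightarrow> ('a \<times> 'b \<Rightarrow>\<^sub>0 complex)" where
  "pair a b = Poly_Mapping.single (a, b) 1"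

definition bilinear_rels ::
  "('a, 'y) superspace_scheme \<Rightarrow> ('b, 'z) superspace_scheme \<Rightarrow> ('a \<times> 'b \<Rightarrow>\<^sub>0 complex) set" where
  "bilinear_rels V W = lspan (pair_space V W) (
     {pair (a \<oplus>\<^bsub>V\<^esub> a') b - pair a b - pair a' b
        | a a' b. a \<in> carrier V \<and> a' \<in> carrier V \<and> b \<in> carrier W} \<union>
     {pair a (b \<oplus>\<^bsub>W\<^esub> b') - pair a b - pair a b'
        | a b b'. a \<in> carrier V \<and> b \<in> carrier W \<and> b' \<in> carrier W} \<union>
     {pair (c \<odot>\<^bsub>V\<^esub> a) b - Poly_Mapping.map ((*) c) (pair a b)
        | c a b. a \<in> carrier V \<and> b \<in> carrier W} \<union>
     {pair a (c \<odot>\<^bsub>W\<^esub> b) - Poly_Mapping.map ((*) c) (pair a b)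
        | c a b. a \<in> carrier V \<and> b \<in> carrier W})"

definition tensor ::
  "('a, 'y) superspace_scheme \<Rightarrow> ('b, 'z) superspace_scheme
    \<Rightarrow> ('a \<times> 'b \<Rightarrow>\<^sub>0 complex) set superspace" where
  "tensor V W = quot_space (pair_space V W) (bilinear_rels V W)"

definition tens ::
  "('a, 'y) superspace_scheme \<Rightarrow> ('b, 'z) superspace_scheme \<Rightarrow> 'a \<Rightarrow> 'b
    \<Rightarrow> ('a \<times> 'b \<Rightarrow>\<^sub>0 complex) set" where
  "tens V W a b = bilinear_rels V W +>\<^bsub>pair_space V W\<^esub> pair a b"

text \<open>Given bilinear \<open>\<mu> : A \<times> M \<rightarrow> M\<close> and \<open>\<nu> : B \<times> N \<rightarrow> N\<close>, the operation
  \<open>(a \<otimes> b, m \<otimes> n) \<mapsto> (-1)\<^bsup>p(b) p(m)\<^esup> \<mu>(a, m) \<otimes> \<nu>(b, n)\<close> of \<open>A \<otimes> B\<close> on \<open>M \<otimes> N\<close>.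
  It provides the multiplication of \<open>A \<otimes> B\<close> as well as its action on a tensor product of modules.
  Note that the parity of the second module \<open>N\<close> does not enter.\<close>

definition pair_op ::
  "('b, 'y) superspace_scheme \<Rightarrow> ('m, 'z) superspace_scheme
    \<Rightarrow> ('a \<Rightarrow> 'm \<Rightarrow> 'm) \<Rightarrow> ('b \<Rightarrow> 'n \<Rightarrow> 'n)
    \<Rightarrow> ('a \<times> 'b \<Rightarrow>\<^sub>0 complex) \<Rightarrow> ('m \<times> 'n \<Rightarrow>\<^sub>0 complex) \<Rightarrow> ('m \<times> 'n \<Rightarrow>\<^sub>0 complex)" where
  "pair_op B M \<mu> \<nu> x y =
     (\<Sum>(a, b)\<in>Poly_Mapping.keys x. \<Sum>(m, n)\<in>Poly_Mapping.keys y. \<Sum>p\<in>{0, 1}. \<Sum>q\<in>{0, 1}.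
        Poly_Mapping.single (\<mu> a (hproj M q m), \<nu> (hproj B p b) n)
          (koszul p q * Poly_Mapping.lookup x (a, b) * Poly_Mapping.lookup y (m, n)))"

definition tensor_op ::
  "('b, 'x) superspace_scheme \<Rightarrow> ('m, 'y) superspace_scheme \<Rightarrow> ('n, 'z) superspace_scheme
    \<Rightarrow> ('a \<Rightarrow> 'm \<Rightarrow> 'm) \<Rightarrow> ('b \<Rightarrow> 'n \<Rightarrow> 'n)
    \<Rightarrow> ('a \<times> 'b \<Rightarrow>\<^sub>0 complex) set \<Rightarrow> ('m \<times> 'n \<Rightarrow>\<^sub>0 complex) set \<Rightarrow> ('m \<times> 'n \<Rightarrow>\<^sub>0 complex) set" where
  "tensor_op B M N \<mu> \<nu> P Q =
     (\<Union>x\<in>P. \<Union>y\<in>Q. bilinear_rels M N +>\<^bsub>pair_space M N\<^esub> pair_op B M \<mu> \<nu> x y)"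

definition super_tensor_algebra ::
  "'a superspace \<Rightarrow> 'b superspace \<Rightarrow> ('a \<times> 'b \<Rightarrow>\<^sub>0 complex) set superspace" where
  "super_tensor_algebra A B = (tensor A B)
     \<lparr>mult := tensor_op B A B (mult A) (mult B), one := tens A B \<one>\<^bsub>A\<^esub> \<one>\<^bsub>B\<^esub>\<rparr>"


section \<open>Lie superalgebras\<close>

definition lie_superalgebra :: "('g, 'z) lie_superspace_scheme \<Rightarrow> bool" where
  "lie_superalgebra G \<longleftrightarrow> super_space G \<and>
     (\<forall>x\<in>carrier G. is_linear G G (lbr G x)) \<and>
     (\<forall>y\<in>carrier G. is_linear G G (\<lambda>x. lbr G x y)) \<and>
     (\<forall>p q. \<forall>x\<in>hpart G p. \<forall>y\<in>hpart G q.
        lbr G x y \<in> hpart G (p + q) \<and>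
        lbr G x y = (- koszul p q) \<odot>\<^bsub>G\<^esub> lbr G y x \<and>
        (\<forall>z\<in>carrier G. lbr G x (lbr G y z) =
           lbr G (lbr G x y) z \<oplus>\<^bsub>G\<^esub> koszul p q \<odot>\<^bsub>G\<^esub> lbr G y (lbr G x z)))"

definition lie_hom ::
  "('g, 'y) lie_superspace_scheme \<Rightarrow> ('k, 'z) lie_superspace_scheme \<Rightarrow> ('g \<Rightarrow> 'k) \<Rightarrow> bool" where
  "lie_hom L G \<phi> \<longleftrightarrow> is_linear L G \<phi> \<and> (\<forall>p. \<forall>x\<in>hpart L p. \<phi> x \<in> hpart G p) \<and>
     (\<forall>x\<in>carrier L. \<forall>y\<in>carrier L. \<phi> (lbr L x y) = lbr G (\<phi> x) (\<phi> y))"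

text \<open>\<open>G\<close> is isomorphic to \<open>L / Z\<close>.\<close>

definition is_quotient_of ::
  "('g, 'y) lie_superspace_scheme \<Rightarrow> ('k, 'z) lie_superspace_scheme \<Rightarrow> 'k set \<Rightarrow> bool" where
  "is_quotient_of G L Z \<longleftrightarrow> (\<exists>\<phi>. lie_hom L G \<phi> \<and> \<phi> ` carrier L = carrier G \<and>
     {x \<in> carrier L. \<phi> x = \<zero>\<^bsub>G\<^esub>} = Z)"

definition simple_lie :: "('g, 'z) lie_superspace_scheme \<Rightarrow> bool" where
  "simple_lie G \<longleftrightarrow> lie_superalgebra G \<and>
     (\<exists>x\<in>carrier G. \<exists>y\<in>carrier G. lbr G x y \<noteq> \<zero>\<^bsub>G\<^esub>) \<and>
     (\<forall>J. submodule J CC G \<and> (J \<inter> hpart G 0) <+>\<^bsub>G\<^esub> (J \<inter> hpart G 1) = J \<and>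
        (\<forall>x\<in>carrier G. \<forall>y\<in>J. lbr G x y \<in> J) \<longrightarrow> J = {\<zero>\<^bsub>G\<^esub>} \<or> J = carrier G)"

subsection \<open>Basic classical Lie superalgebras\<close>

definition ixpar :: "nat \<Rightarrow> nat \<Rightarrow> bit" where
  "ixpar m i = (if i < m then 0 else 1)"

definition gl_super :: "nat \<Rightarrow> nat \<Rightarrow> (nat \<Rightarrow> nat \<Rightarrow> complex) lie_superspace" where
  "gl_super m n = \<lparr>
     carrier = {M. \<forall>i j. M i j \<noteq> 0 \<longrightarrow> i < m + n \<and> j < m + n},
     mult = undefined, one = undefined,
     zero = (\<lambda>i j. 0), add = (\<lambda>M N i j. M i j + N i j), smult = (\<lambda>c M i j. c * M i j),
     hpart = (\<lambda>p. {M. \<forall>i j. M i j \<noteq> 0 \<longrightarrow>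
                i < m + n \<and> j < m + n \<and> ixpar m i + ixpar m j = p}),
     lbr = (\<lambda>M N i j. \<Sum>k<m + n. M i k * N k j -
                koszul (ixpar m k + ixpar m j) (ixpar m i + ixpar m k) * (N i k * M k j))\<rparr>"

definition sl_super :: "nat \<Rightarrow> nat \<Rightarrow> (nat \<Rightarrow> nat \<Rightarrow> complex) lie_superspace" where
  "sl_super m n = subspace_of (gl_super m n)
     {M \<in> carrier (gl_super m n). (\<Sum>i<m. M i i) - (\<Sum>i\<in>{m..<m + n}. M i i) = 0}"

definition scalar_matrices :: "nat \<Rightarrow> (nat \<Rightarrow> nat \<Rightarrow> complex) set" where
  "scalar_matrices k = {\<lambda>i j. if i = j \<and> i < k then c else 0 | c. True}"

text \<open>The even supersymmetric form on \<open>\<complex>\<^bsup>p|2n\<^esup>\<close>: the standard symmetric form on the even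
  part and the standard symplectic form on the odd part.\<close>

definition osp_form :: "nat \<Rightarrow> nat \<Rightarrow> nat \<Rightarrow> nat \<Rightarrow> complex" where
  "osp_form p n i j =
     (if i < p \<and> j = i then 1
      else if p \<le> i \<and> i < p + n \<and> j = i + n then 1
      else if p \<le> j \<and> j < p + n \<and> i = j + n then - 1 else 0)"

definition osp_super :: "nat \<Rightarrow> nat \<Rightarrow> (nat \<Rightarrow> nat \<Rightarrow> complex) lie_superspace" where
  "osp_super p n = subspace_of (gl_super p (2 * n))
     {M \<in> carrier (gl_super p (2 * n)). \<forall>a<p + 2 * n. \<forall>b<p + 2 * n.
        (\<Sum>k<p + 2 * n. M k a * osp_form p n k b) +
        koszul (ixpar p a + ixpar p b) (ixpar p a) * (\<Sum>k<p + 2 * n. osp_form p n a k * M k b) = 0}"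

text \<open>The exceptional series are given by Kac's distinguished Cartan matrices, where the first
  simple root is the only odd one.\<close>

definition has_cartan_matrix :: "('g, 'z) lie_superspace_scheme \<Rightarrow> complex list list \<Rightarrow> bool" where
  "has_cartan_matrix G A \<longleftrightarrow> (\<exists>e f h. let I = {..<length A} in
     (\<forall>i\<in>I. e i \<in> hpart G (if i = 0 then 1 else 0) \<and> f i \<in> hpart G (if i = 0 then 1 else 0) \<and>
        h i \<in> hpart G 0) \<and>
     (\<forall>i\<in>I. \<forall>j\<in>I. lbr G (h i) (h j) = \<zero>\<^bsub>G\<^esub> \<and>
        lbr G (e i) (f j) = (if i = j then h i else \<zero>\<^bsub>G\<^esub>) \<and>
        lbr G (h i) (e j) = (A ! i ! j) \<odot>\<^bsub>G\<^esub> e j \<and>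
        lbr G (h i) (f j) = (- (A ! i ! j)) \<odot>\<^bsub>G\<^esub> f j) \<and>
     (\<forall>W. submodule W CC G \<and> (\<forall>x\<in>W. \<forall>y\<in>W. lbr G x y \<in> W) \<and> (\<forall>i\<in>I. e i \<in> W \<and> f i \<in> W)
        \<longrightarrow> W = carrier G))"

definition exceptional_type :: "('g, 'z) lie_superspace_scheme \<Rightarrow> complex list list \<Rightarrow> bool" where
  "exceptional_type G A \<longleftrightarrow> simple_lie G \<and> finite_dim G \<and> has_cartan_matrix G A"

definition cartan_D21 :: "complex \<Rightarrow> complex list list" where
  "cartan_D21 a = [[0, 1, a], [- 1, 2, 0], [- 1, 0, 2]]"

definition cartan_F4 :: "complex list list" where
  "cartan_F4 = [[0, 1, 0, 0], [- 1, 2, - 2, 0], [0, - 1, 2, - 1], [0, 0, - 1, 2]]"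

definition cartan_G3 :: "complex list list" where
  "cartan_G3 = [[0, 1, 0], [- 1, 2, - 3], [0, - 1, 2]]"

text \<open>For \<open>A(m|n)\<close> the quotient by scalar matrices only matters if \<open>m = n\<close>.\<close>

definition basic_classical :: "('g, 'z) lie_superspace_scheme \<Rightarrow> bool" where
  "basic_classical G \<longleftrightarrow> lie_superalgebra G \<and>
    ((\<exists>m n. m \<ge> 1 \<and> n \<ge> 1 \<and> is_quotient_of G (gl_super m n) {\<lambda>i j. 0}) \<or>
     \<comment> \<open>\<open>A(m|n)\<close>\<close>
     (\<exists>m n. m + n \<ge> 1 \<and> is_quotient_of G (sl_super (m + 1) (n + 1))
        (scalar_matrices (m + n + 2) \<inter> carrier (sl_super (m + 1) (n + 1)))) \<or>
     \<comment> \<open>\<open>B(m|n)\<close>\<close>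
     (\<exists>m n. n \<ge> 1 \<and> is_quotient_of G (osp_super (2 * m + 1) n) {\<lambda>i j. 0}) \<or>
     \<comment> \<open>\<open>C(n)\<close>\<close>
     (\<exists>n. n \<ge> 2 \<and> is_quotient_of G (osp_super 2 (n - 1)) {\<lambda>i j. 0}) \<or>
     \<comment> \<open>\<open>D(m|n)\<close>\<close>
     (\<exists>m n. m \<ge> 2 \<and> n \<ge> 1 \<and> is_quotient_of G (osp_super (2 * m) n) {\<lambda>i j. 0}) \<or>
     exceptional_type G cartan_F4 \<or> exceptional_type G cartan_G3 \<or>
     (\<exists>a::real. a \<noteq> 0 \<and> a \<noteq> - 1 \<and> exceptional_type G (cartan_D21 (complex_of_real a))))"

definition invariant_form :: "('g, 'z) lie_superspace_scheme \<Rightarrow> ('g \<Rightarrow> 'g \<Rightarrow> complex) \<Rightarrow> bool" where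
  "invariant_form G B \<longleftrightarrow>
     (\<forall>x\<in>carrier G. \<forall>y\<in>carrier G. \<forall>z\<in>carrier G. \<forall>c.
        B (x \<oplus>\<^bsub>G\<^esub> y) z = B x z + B y z \<and> B (c \<odot>\<^bsub>G\<^esub> x) z = c * B x z \<and>
        B z (x \<oplus>\<^bsub>G\<^esub> y) = B z x + B z y \<and> B z (c \<odot>\<^bsub>G\<^esub> x) = c * B z x \<and>
        B (lbr G x y) z = B x (lbr G y z)) \<and>
     (\<forall>p q. \<forall>x\<in>hpart G p. \<forall>y\<in>hpart G q. B x y = koszul p q * B y x) \<and>
     (\<forall>x\<in>hpart G 0. \<forall>y\<in>hpart G 1. B x y = 0) \<and>
     (\<forall>x\<in>carrier G. (\<forall>y\<in>carrier G. B x y = 0) \<longrightarrow> x = \<zero>\<^bsub>G\<^esub>)"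

subsection \<open>Roots and parabolic subalgebras\<close>

text \<open>Linear functionals on \<open>\<hh>\<close> are represented by functions vanishing outside \<open>\<hh>\<close>, so that
  sums, negatives and equality of functionals are those of functions.\<close>

definition dual_space :: "('g, 'z) superspace_scheme \<Rightarrow> 'g set \<Rightarrow> ('g \<Rightarrow> complex) set" where
  "dual_space G \<hh> = {a. (\<forall>x\<in>\<hh>. \<forall>y\<in>\<hh>. a (x \<oplus>\<^bsub>G\<^esub> y) = a x + a y) \<and>
     (\<forall>c. \<forall>x\<in>\<hh>. a (c \<odot>\<^bsub>G\<^esub> x) = c * a x) \<and> (\<forall>x. x \<notin> \<hh> \<longrightarrow> a x = 0)}"

definition root_space ::
  "('g, 'z) lie_superspace_scheme \<Rightarrow> 'g set \<Rightarrow> ('g \<Rightarrow> complex) \<Rightarrow> 'g set" where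
  "root_space G \<hh> a = {x \<in> carrier G. \<forall>y\<in>\<hh>. lbr G y x = a y \<odot>\<^bsub>G\<^esub> x}"

definition roots :: "('g, 'z) lie_superspace_scheme \<Rightarrow> 'g set \<Rightarrow> ('g \<Rightarrow> complex) set" where
  "roots G \<hh> = {a \<in> dual_space G \<hh>. a \<noteq> 0 \<and> root_space G \<hh> a \<noteq> {\<zero>\<^bsub>G\<^esub>}}"

text \<open>For a basic classical \<open>\<gg>\<close> the Cartan subalgebras of the reductive Lie algebra \<open>\<gg>\<^sub>0\<close> are
  the self-centralising abelian subalgebras \<open>\<hh> \<subseteq> \<gg>\<^sub>0\<close> acting diagonalisably on \<open>\<gg>\<close>,
  i.e. those with a root space decomposition \<open>\<gg> = \<hh> \<oplus> \<Oplus>\<^sub>\<alpha> \<gg>\<^sup>\<alpha>\<close>.\<close>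

definition cartan_subalgebra :: "('g, 'z) lie_superspace_scheme \<Rightarrow> 'g set \<Rightarrow> bool" where
  "cartan_subalgebra G \<hh> \<longleftrightarrow> submodule \<hh> CC G \<and> \<hh> \<subseteq> hpart G 0 \<and>
     {x \<in> carrier G. \<forall>y\<in>\<hh>. lbr G y x = \<zero>\<^bsub>G\<^esub>} = \<hh> \<and>
     lspan G (\<hh> \<union> (\<Union>a\<in>roots G \<hh>. root_space G \<hh> a)) = carrier G"

definition positive_system ::
  "('g, 'z) lie_superspace_scheme \<Rightarrow> 'g set \<Rightarrow> ('g \<Rightarrow> complex) set \<Rightarrow> bool" where
  "positive_system G \<hh> pos \<longleftrightarrow>
     pos \<union> uminus ` pos = roots G \<hh> \<and> pos \<inter> uminus ` pos = {} \<and>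
     (\<forall>a\<in>pos. \<forall>b\<in>pos. a + b \<in> roots G \<hh> \<longrightarrow> a + b \<in> pos)"

definition additive_on_root_lattice ::
  "('g, 'z) lie_superspace_scheme \<Rightarrow> 'g set \<Rightarrow> (('g \<Rightarrow> complex) \<Rightarrow> int) \<Rightarrow> bool" where
  "additive_on_root_lattice G \<hh> f \<longleftrightarrow>
     (\<forall>a\<in>group_closure (roots G \<hh>). \<forall>b\<in>group_closure (roots G \<hh>). f (a + b) = f a + f b)"

definition root_sum ::
  "('g, 'z) lie_superspace_scheme \<Rightarrow> 'g set \<Rightarrow> ('g \<Rightarrow> complex) set \<Rightarrow> 'g set" where
  "root_sum G \<hh> \<Psi> = lspan G (\<Union>a\<in>\<Psi>. root_space G \<hh> a)"

definition levi ::
  "('g, 'z) lie_superspace_scheme \<Rightarrow> 'g set \<Rightarrow> (('g \<Rightarrow> complex) \<Rightarrow> int) \<Rightarrow> 'g set" where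
  "levi G \<hh> f = lspan G (\<hh> \<union> root_sum G \<hh> {a \<in> roots G \<hh>. f a = 0})"

subsection \<open>Enveloping superalgebra, supermodules, infinitesimal characters\<close>

definition lie_rels :: "('g, 'z) lie_superspace_scheme \<Rightarrow> 'g free set" where
  "lie_rels L = {gen x * gen y - const (koszul p q) * gen y * gen x - gen (lbr L x y)
     | x y p q. x \<in> hpart L p \<and> y \<in> hpart L q}"

definition uea :: "('g, 'z) lie_superspace_scheme \<Rightarrow> 'g free set superspace" where
  "uea L = pres L (lie_rels L)"

definition uea_class :: "('g, 'z) lie_superspace_scheme \<Rightarrow> 'g free \<Rightarrow> 'g free set" where
  "uea_class L = pres_class L (lie_rels L)"

definition uea_gen :: "('g, 'z) lie_superspace_scheme \<Rightarrow> 'g \<Rightarrow> 'g free set" where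
  "uea_gen L x = uea_class L (gen x)"

definition supermodule ::
  "('g, 'z) lie_superspace_scheme \<Rightarrow> 'm superspace \<Rightarrow> ('g \<Rightarrow> 'm \<Rightarrow> 'm) \<Rightarrow> bool" where
  "supermodule G M \<rho> \<longleftrightarrow> super_space M \<and>
     (\<forall>x\<in>carrier G. is_linear M M (\<rho> x)) \<and>
     (\<forall>m\<in>carrier M. is_linear G M (\<lambda>x. \<rho> x m)) \<and>
     (\<forall>p q. \<forall>x\<in>hpart G p. \<forall>m\<in>hpart M q. \<rho> x m \<in> hpart M (p + q)) \<and>
     (\<forall>p q. \<forall>x\<in>hpart G p. \<forall>y\<in>hpart G q. \<forall>m\<in>carrier M.
        \<rho> (lbr G x y) m = \<rho> x (\<rho> y m) \<ominus>\<^bsub>M\<^esub> koszul p q \<odot>\<^bsub>M\<^esub> \<rho> y (\<rho> x m))"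

text \<open>Since \<open>\<hh>\<close> is abelian and even, \<open>S(\<hh>)\<close> is identified with the subalgebra
  \<open>uea_class L ` words_in \<hh>\<close> of the enveloping algebra generated by \<open>\<hh>\<close>.\<close>

definition hc_proj ::
  "('g, 'z) lie_superspace_scheme \<Rightarrow> 'g set \<Rightarrow> 'g set \<Rightarrow> 'g set \<Rightarrow> 'g free set \<Rightarrow> 'g free set" where
  "hc_proj L \<hh> np nm z = (THE q. q \<in> uea_class L ` words_in \<hh> \<and>
     z \<ominus>\<^bsub>uea L\<^esub> q \<in> lspan (uea L)
       ({uea_gen L y \<otimes>\<^bsub>uea L\<^esub> a | y a. y \<in> nm \<and> a \<in> carrier (uea L)} \<union>
        {a \<otimes>\<^bsub>uea L\<^esub> uea_gen L y | y a. y \<in> np \<and> a \<in> carrier (uea L)}))"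

definition sym_eval ::
  "('g, 'z) lie_superspace_scheme \<Rightarrow> 'g set \<Rightarrow> ('g \<Rightarrow> complex) \<Rightarrow> 'g free set \<Rightarrow> complex" where
  "sym_eval L \<hh> lam q = (THE c. \<exists>P\<in>words_in \<hh>. uea_class L P = q \<and>
     c = (\<Sum>w\<in>Poly_Mapping.keys P. Poly_Mapping.lookup P w * prod_list (map lam (letters w))))"

definition inf_char ::
  "('g, 'z) lie_superspace_scheme \<Rightarrow> 'g set \<Rightarrow> 'g set \<Rightarrow> 'g set \<Rightarrow> ('g \<Rightarrow> complex)
    \<Rightarrow> 'g free set \<Rightarrow> complex" where
  "inf_char L \<hh> np nm lam z = sym_eval L \<hh> lam (hc_proj L \<hh> np nm z)"


section \<open>The cubic Dirac operator\<close>

definition clifford_rels ::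
  "('g, 'z) superspace_scheme \<Rightarrow> ('g \<Rightarrow> 'g \<Rightarrow> complex) \<Rightarrow> 'g free set" where
  "clifford_rels V B = {gen v * gen w + const (koszul p q) * gen w * gen v - const (2 * B v w)
     | v w p q. v \<in> hpart V p \<and> w \<in> hpart V q}"

definition clifford :: "('g, 'z) superspace_scheme \<Rightarrow> ('g \<Rightarrow> 'g \<Rightarrow> complex) \<Rightarrow> 'g free set superspace" where
  "clifford V B = pres V (clifford_rels V B)"

definition clifford_gen ::
  "('g, 'z) superspace_scheme \<Rightarrow> ('g \<Rightarrow> 'g \<Rightarrow> complex) \<Rightarrow> 'g \<Rightarrow> 'g free set" where
  "clifford_gen V B v = pres_class V (clifford_rels V B) (gen v)"

text \<open>The image of \<open>v\<^sub>0 \<and> \<dots> \<and> v\<^bsub>k-1\<^esub>\<close> under the quantization map, for homogeneous \<open>v\<^sub>i\<close> of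
  parity \<open>p\<^sub>i\<close>; the product over inversions is the Koszul sign of the permutation.\<close>

definition quantize ::
  "('g, 'z) superspace_scheme \<Rightarrow> ('g \<Rightarrow> 'g \<Rightarrow> complex) \<Rightarrow> 'g list \<Rightarrow> bit list \<Rightarrow> 'g free set" where
  "quantize V B vs ps = (let C = clifford V B; k = length vs in
     \<Oplus>\<^bsub>C\<^esub> \<sigma>\<in>{\<sigma>. \<sigma> permutes {..<k}}.
       (1 / fact k * of_int (sign \<sigma>) *
          (\<Prod>(i, j)\<in>{(i, j). i < j \<and> j < k \<and> \<sigma> j < \<sigma> i}. koszul (ps ! \<sigma> i) (ps ! \<sigma> j))) \<odot>\<^bsub>C\<^esub>
       foldr (\<lambda>i a. clifford_gen V B (vs ! \<sigma> i) \<otimes>\<^bsub>C\<^esub> a) [0..<k] \<one>\<^bsub>C\<^esub>)"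

text \<open>\<open>X\<close> is a homogeneous basis of \<open>\<ss>\<close> indexed by \<open>{..<n}\<close>, \<open>px i\<close> the parity of \<open>X i\<close>, and
  \<open>Xd\<close> the dual basis.\<close>

definition homogeneous_dual_bases ::
  "('g, 'z) superspace_scheme \<Rightarrow> ('g \<Rightarrow> 'g \<Rightarrow> complex) \<Rightarrow> 'g set \<Rightarrow> nat
    \<Rightarrow> (nat \<Rightarrow> 'g) \<Rightarrow> (nat \<Rightarrow> bit) \<Rightarrow> (nat \<Rightarrow> 'g) \<Rightarrow> bool" where
  "homogeneous_dual_bases G B \<ss> n X px Xd \<longleftrightarrow>
     is_basis G \<ss> n X \<and> (\<forall>i<n. X i \<in> hpart G (px i)) \<and>
     is_basis G \<ss> n Xd \<and> (\<forall>i<n. \<forall>j<n. B (Xd i) (X j) = (if i = j then 1 else 0))"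

definition cubic_term ::
  "('g, 'z) lie_superspace_scheme \<Rightarrow> ('g \<Rightarrow> 'g \<Rightarrow> complex) \<Rightarrow> 'g set \<Rightarrow> nat
    \<Rightarrow> (nat \<Rightarrow> 'g) \<Rightarrow> (nat \<Rightarrow> bit) \<Rightarrow> (nat \<Rightarrow> 'g) \<Rightarrow> 'g free set" where
  "cubic_term G B \<ss> n X px Xd = (let V = subspace_of G \<ss>; C = clifford V B in
     (- 1 / 12) \<odot>\<^bsub>C\<^esub>
     (\<Oplus>\<^bsub>C\<^esub> i\<in>{..<n}. \<Oplus>\<^bsub>C\<^esub> j\<in>{..<n}. \<Oplus>\<^bsub>C\<^esub> k\<in>{..<n}.
       (koszul (px i) (px j) * (if px k = 1 then - 1 else 1) * B (lbr G (X i) (X j)) (X k)) \<odot>\<^bsub>C\<^esub>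
       quantize V B [Xd i, Xd j, Xd k] [px i, px j, px k]))"

definition dirac_operator ::
  "('g, 'z) lie_superspace_scheme \<Rightarrow> ('g \<Rightarrow> 'g \<Rightarrow> complex) \<Rightarrow> 'g set \<Rightarrow> nat
    \<Rightarrow> (nat \<Rightarrow> 'g) \<Rightarrow> (nat \<Rightarrow> bit) \<Rightarrow> (nat \<Rightarrow> 'g) \<Rightarrow> ('g free set \<times> 'g free set \<Rightarrow>\<^sub>0 complex) set" where
  "dirac_operator G B \<ss> n X px Xd =
     (let U = uea G; V = subspace_of G \<ss>; C = clifford V B; T = super_tensor_algebra U C in
     (\<Oplus>\<^bsub>T\<^esub> i\<in>{..<n}. tens U C (uea_gen G (X i)) (clifford_gen V B (Xd i))) \<oplus>\<^bsub>T\<^esub>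
     tens U C \<one>\<^bsub>U\<^esub> (cubic_term G B \<ss> n X px Xd))"

definition diagonal_morphism ::
  "('g, 'z) lie_superspace_scheme \<Rightarrow> ('g \<Rightarrow> 'g \<Rightarrow> complex) \<Rightarrow> 'g set \<Rightarrow> 'g set
    \<Rightarrow> ('g \<Rightarrow> 'g free set) \<Rightarrow> bool" where
  "diagonal_morphism G B \<ll> \<ss> \<nu> \<longleftrightarrow>
     (let L = subspace_of G \<ll>; V = subspace_of G \<ss>; C = clifford V B in
     is_linear L C \<nu> \<and> (\<forall>p. \<forall>x\<in>hpart L p. \<nu> x \<in> hpart C p) \<and>
     (\<forall>x\<in>\<ll>. \<forall>y\<in>\<ll>. \<nu> (lbr G x y) = scomm C (\<nu> x) (\<nu> y)) \<and>
     (\<forall>x\<in>\<ll>. \<nu> x \<in> lspan C {quantize V B [v, w] [p, q] | v w p q. v \<in> hpart V p \<and> w \<in> hpart V q}) \<and>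
     (\<forall>x\<in>\<ll>. \<forall>v\<in>\<ss>. scomm C (\<nu> x) (clifford_gen V B v) = clifford_gen V B (lbr G x v)))"

definition diagonal_gen ::
  "('g, 'z) lie_superspace_scheme \<Rightarrow> ('g \<Rightarrow> 'g \<Rightarrow> complex) \<Rightarrow> 'g set \<Rightarrow> ('g \<Rightarrow> 'g free set)
    \<Rightarrow> 'g \<Rightarrow> ('g free set \<times> 'g free set \<Rightarrow>\<^sub>0 complex) set" where
  "diagonal_gen G B \<ss> \<nu> x =
     (let U = uea G; C = clifford (subspace_of G \<ss>) B; T = super_tensor_algebra U C in
     tens U C (uea_gen G x) \<one>\<^bsub>C\<^esub> \<oplus>\<^bsub>T\<^esub> tens U C \<one>\<^bsub>U\<^esub> (\<nu> x))"

subsection \<open>Oscillator supermodule and Dirac cohomology\<close>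

definition osc_ideal ::
  "('g, 'z) superspace_scheme \<Rightarrow> ('g \<Rightarrow> 'g \<Rightarrow> complex) \<Rightarrow> 'g set \<Rightarrow> 'g free set set" where
  "osc_ideal V B \<uu> = lspan (clifford V B)
     {c \<otimes>\<^bsub>clifford V B\<^esub> clifford_gen V B v | c v. c \<in> carrier (clifford V B) \<and> v \<in> \<uu>}"

text \<open>The grading is by the parity of the number of even letters in a monomial with letters from
  the opposite nilradical \<open>\<uu>'\<close>, that is, by the degree in the exterior algebra of its even part;
  it is not the grading inherited from \<open>clifford V B\<close>.\<close>

definition oscillator ::
  "('g, 'z) superspace_scheme \<Rightarrow> ('g \<Rightarrow> 'g \<Rightarrow> complex) \<Rightarrow> 'g set \<Rightarrow> 'g set \<Rightarrow> 'g free set set superspace" where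
  "oscillator V B \<uu> \<uu>' = (quot_space (clifford V B) (osc_ideal V B \<uu>))
     \<lparr>hpart := (\<lambda>q. (\<lambda>P. osc_ideal V B \<uu> +>\<^bsub>clifford V B\<^esub> pres_class V (clifford_rels V B) P) `
        weighted_words (subspace_of V \<uu>') (\<lambda>p. p + 1) q)\<rparr>"

definition osc_act ::
  "('g, 'z) superspace_scheme \<Rightarrow> ('g \<Rightarrow> 'g \<Rightarrow> complex) \<Rightarrow> 'g set
    \<Rightarrow> 'g free set \<Rightarrow> 'g free set set \<Rightarrow> 'g free set set" where
  "osc_act V B \<uu> c P = (\<Union>a\<in>P. osc_ideal V B \<uu> +>\<^bsub>clifford V B\<^esub> (c \<otimes>\<^bsub>clifford V B\<^esub> a))"

text \<open>For a space \<open>W\<close> with an operator \<open>d\<close>: the cohomology \<open>ker d / (ker d \<inter> im d)\<close> and the map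
  induced on it by an operator \<open>t\<close> on \<open>W\<close>.\<close>

definition op_kernel :: "'w superspace \<Rightarrow> ('w \<Rightarrow> 'w) \<Rightarrow> 'w set" where
  "op_kernel W d = {w \<in> carrier W. d w = \<zero>\<^bsub>W\<^esub>}"

definition op_boundaries :: "'w superspace \<Rightarrow> ('w \<Rightarrow> 'w) \<Rightarrow> 'w set" where
  "op_boundaries W d = op_kernel W d \<inter> d ` carrier W"

definition op_cohomology :: "'w superspace \<Rightarrow> ('w \<Rightarrow> 'w) \<Rightarrow> 'w set superspace" where
  "op_cohomology W d = quot_space (subspace_of W (op_kernel W d)) (op_boundaries W d)"

definition cohomology_map :: "'w superspace \<Rightarrow> ('w \<Rightarrow> 'w) \<Rightarrow> ('w \<Rightarrow> 'w) \<Rightarrow> 'w set \<Rightarrow> 'w set" where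
  "cohomology_map W d t P = (\<Union>w\<in>P. op_boundaries W d +>\<^bsub>W\<^esub> t w)"

text \<open>A subspace \<open>V\<close> of \<open>H\<close> that is graded and stable under the operators \<open>act x\<close>, \<open>x \<in> \<ll>\<close>.\<close>

definition sub_supermodule :: "'v superspace \<Rightarrow> 'g set \<Rightarrow> ('g \<Rightarrow> 'v \<Rightarrow> 'v) \<Rightarrow> 'v set \<Rightarrow> bool" where
  "sub_supermodule H \<ll> act V \<longleftrightarrow> submodule V CC H \<and>
     (V \<inter> hpart H 0) <+>\<^bsub>H\<^esub> (V \<inter> hpart H 1) = V \<and>
     (\<forall>x\<in>\<ll>. \<forall>v\<in>V. act x v \<in> V)"

end

theory Submission
  imports Defs
begin

text \<open>
  Write \<open>{D, A} = D A + A D\<close>. The operator \<open>D\<close> is even for the grading of \<open>\<UU>(\<gg>) \<otimes> C(\<ss>)\<close>,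
  commutes with \<open>\<alpha>(\<ll>)\<close> because the tensors \<open>\<Sum> X\<^sub>i \<otimes> X\<^sub>i\<^sup>*\<close> and \<open>([x, y], z)\<close> are \<open>\<ll>\<close>-invariant, and
  commutes with \<open>z \<otimes> 1\<close> for \<open>z\<close> in the supercenter. Hence if \<open>z\<^sub>i \<otimes> 1 = \<alpha>(y\<^sub>i) + {D, A\<^sub>i}\<close> then
  \<open>z\<^sub>1 z\<^sub>2 \<otimes> 1 = \<alpha>(y\<^sub>1 y\<^sub>2) + {D, \<alpha>(y\<^sub>1) A\<^sub>2 + A\<^sub>1 (z\<^sub>2 \<otimes> 1)}\<close>, and uniqueness of \<open>\<eta>\<close> makes it
  multiplicative. On a vector \<open>v\<close> with \<open>D v = 0\<close> the elements \<open>z \<otimes> 1\<close> and \<open>\<alpha>(\<eta>(z))\<close> differ by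
  \<open>D (A v)\<close>, which again lies in the kernel of \<open>D\<close>, so they agree on \<open>H\<^sub>D(M)\<close>; comparing the two
  scalars on a nonzero vector gives the statement on infinitesimal characters.\<close>

section \<open>Complex vector spaces\<close>

text \<open>\<open>D\<close> is even, so supercommuting with \<open>D\<close> is plain commuting,
  while D A + A D is an anticommutator whatever the parity of \<open>A\<close>; hence
  \<open>A\<close> is never split into homogeneous parts. Koszul signs are expressed by powers of
  the parity automorphism, so that sign identities are checked on homogeneous elements and extended
  by linearity. \<open>D\<close> need not square to zero. D (A v) lies in the kernel of
  \<open>D\<close> because it is the difference of (z \<otimes> 1) v and \<alpha>(\<eta>(z)) v, and
  both operators commute with \<open>D\<close> and so preserve its kernel. Most of the length is due
  to quotients: the enveloping and Clifford algebras, the tensor products, the oscillator module and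
  the cohomology consist of cosets, and the maps on them are given by chosen representatives or by
  unions over cosets. Each map has to be shown independent of representatives, and the even and odd
  parts of the algebras have to be shown to meet in zero, before any algebra can start.\<close>

lemma CC_simps [simp]:
  "carrier CC = UNIV" "a \<otimes>\<^bsub>CC\<^esub> b = a * b" "\<one>\<^bsub>CC\<^esub> = 1" "\<zero>\<^bsub>CC\<^esub> = 0" "a \<oplus>\<^bsub>CC\<^esub> b = a + b"
  by (simp_all add: CC_def)

lemma cring_CC: "cring CC"
  by (rule cringI; (intro abelian_groupI comm_monoidI)?)
     (auto simp: algebra_simps intro: exI[of _ "- x" for x])

lemma CC_uminus [simp]: "\<ominus>\<^bsub>CC\<^esub> a = - a"
proof -
  interpret cring CC by (rule cring_CC)
  show ?thesis by (metis CC_simps(1,4,5) UNIV_I ab_left_minus minus_equality)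
qed

text \<open>The module laws are restated with the arithmetic of \<open>complex\<close> itself, so
  that simplification does not meet the operations of the record \<open>CC\<close>.\<close>

locale cvs =
  fixes V :: "(complex, 'a, 'z) module_scheme" (structure)
  assumes module_CC: "module CC V"

sublocale cvs \<subseteq> module CC V by (rule module_CC)

context cvs begin

lemma sm_closed [simp, intro]: "x \<in> carrier V \<Longrightarrow> c \<odot> x \<in> carrier V"
  by simp

lemma sm_add_l: "x \<in> carrier V \<Longrightarrow> (a + b) \<odot> x = a \<odot> x \<oplus> b \<odot> x"
  using smult_l_distr[of a b x] by simp

lemma sm_add_r: "x \<in> carrier V \<Longrightarrow> y \<in> carrier V \<Longrightarrow> a \<odot> (x \<oplus> y) = a \<odot> x \<oplus> a \<odot> y"
  using smult_r_distr[of a x y] by simp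

lemma sm_sm [simp]: "x \<in> carrier V \<Longrightarrow> a \<odot> (b \<odot> x) = (a * b) \<odot> x"
  using smult_assoc1[of a b x] by simp

lemma sm_one [simp]: "x \<in> carrier V \<Longrightarrow> 1 \<odot> x = x"
  using smult_one[of x] by simp

lemma sm_zero_l [simp]: "x \<in> carrier V \<Longrightarrow> 0 \<odot> x = \<zero>"
  using smult_l_null[of x] by simp

lemma sm_zero_r [simp]: "a \<odot> \<zero> = \<zero>"
  using smult_r_null[of a] by simp

lemma sm_neg_one: "x \<in> carrier V \<Longrightarrow> \<ominus> x = (- 1) \<odot> x"
  using smult_l_minus[of 1 x] by simp

lemma diff_sm: "x \<in> carrier V \<Longrightarrow> y \<in> carrier V \<Longrightarrow> x \<ominus> y = x \<oplus> (- 1) \<odot> y"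
  by (simp add: a_minus_def sm_neg_one)

lemma diff_eq_zero_iff: "x \<in> carrier V \<Longrightarrow> y \<in> carrier V \<Longrightarrow> x \<ominus> y = \<zero> \<longleftrightarrow> x = y"
  by (metis M.add.inv_closed M.minus_eq M.r_neg M.minus_equality M.minus_minus)

lemma add_diff: "x \<in> carrier V \<Longrightarrow> y \<in> carrier V \<Longrightarrow> x \<oplus> y \<ominus> x = y"
  using M.a_comm[of x y] by (simp add: a_minus_def M.a_assoc M.r_neg)

lemma sm_eq_zero: "c \<odot> x = \<zero> \<Longrightarrow> c \<noteq> 0 \<Longrightarrow> x \<in> carrier V \<Longrightarrow> x = \<zero>"
  by (metis sm_sm sm_one sm_zero_r left_inverse)

lemma sm_cancel: "a \<odot> x = b \<odot> x \<Longrightarrow> x \<in> carrier V \<Longrightarrow> x \<noteq> \<zero> \<Longrightarrow> a = b"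
  using sm_eq_zero[of "a - b" x] sm_add_l[of x a "- b"] sm_neg_one[of "b \<odot> x"]
  by (auto simp: M.r_neg) (metis M.r_neg sm_closed right_minus_eq)

lemma sm_finsum:
  "f \<in> A \<rightarrow> carrier V \<Longrightarrow> a \<odot> (\<Oplus>i\<in>A. f i) = (\<Oplus>i\<in>A. a \<odot> f i)"
proof (cases "finite A")
  case True then show "f \<in> A \<rightarrow> carrier V \<Longrightarrow> ?thesis" using finsum_smult_ldistr by simp
qed (simp add: M.finsum_infinite)

lemma submoduleD:
  assumes "submodule W CC V"
  shows "W \<subseteq> carrier V" "\<zero> \<in> W" "x \<in> W \<Longrightarrow> y \<in> W \<Longrightarrow> x \<oplus> y \<in> W"
    "x \<in> W \<Longrightarrow> c \<odot> x \<in> W" "x \<in> W \<Longrightarrow> \<ominus> x \<in> W" "x \<in> W \<Longrightarrow> y \<in> W \<Longrightarrow> x \<ominus> y \<in> W"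
    "x \<in> W \<Longrightarrow> x \<in> carrier V"
proof -
  note E = submoduleE[OF assms]
  show "W \<subseteq> carrier V" "x \<in> W \<Longrightarrow> y \<in> W \<Longrightarrow> x \<oplus> y \<in> W"
    "x \<in> W \<Longrightarrow> c \<odot> x \<in> W" "x \<in> W \<Longrightarrow> \<ominus> x \<in> W" "x \<in> W \<Longrightarrow> x \<in> carrier V"
    using E by auto
  show "x \<in> W \<Longrightarrow> y \<in> W \<Longrightarrow> x \<ominus> y \<in> W" using E by (auto simp: a_minus_def)
  show "\<zero> \<in> W" using assms subgroup.one_closed[of W "add_monoid V"]
    by (auto simp: submodule_def)
qed

lemma submoduleI':
  assumes "W \<subseteq> carrier V" "\<zero> \<in> W" "\<And>x y. x \<in> W \<Longrightarrow> y \<in> W \<Longrightarrow> x \<oplus> y \<in> W"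
    "\<And>c x. x \<in> W \<Longrightarrow> c \<odot> x \<in> W"
  shows "submodule W CC V"
  by (rule submoduleI) (use assms sm_neg_one in \<open>auto simp: subset_iff\<close>)

lemma submodule_finsum:
  assumes "submodule W CC V" "\<And>i. i \<in> A \<Longrightarrow> g i \<in> W"
  shows "(\<Oplus>i\<in>A. g i) \<in> W"
proof (cases "finite A")
  case True
  have "A \<subseteq> A \<Longrightarrow> (\<Oplus>i\<in>A. g i) \<in> W" using True
  proof (induction rule: finite_subset_induct')
    case empty then show ?case using submoduleD(2)[OF assms(1)] by simp
  next
    case (insert a F)
    then have "g \<in> F \<rightarrow> carrier V" "g a \<in> carrier V" using assms submoduleD(1) by blast+
    then show ?case using insert assms(2) submoduleD(3)[OF assms(1)] by (auto simp: M.finsum_insert)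
  qed
  then show ?thesis by simp
qed (simp add: M.finsum_infinite submoduleD(2)[OF assms(1)])

end

text \<open>Negatives need not be supplied: \<open>(- 1) \<odot> x\<close> is one, by
  \<open>ld\<close>, \<open>one\<close> and \<open>z0\<close>. The law \<open>z0\<close> has to be
  listed, because it follows from the others only once cancellation is available.\<close>

lemma cvsI:
  fixes V (structure)
  assumes zero: "\<zero> \<in> carrier V"
    and add: "\<And>x y. x \<in> carrier V \<Longrightarrow> y \<in> carrier V \<Longrightarrow> x \<oplus> y \<in> carrier V"
    and sm: "\<And>c x. x \<in> carrier V \<Longrightarrow> c \<odot> x \<in> carrier V"
    and assoc: "\<And>x y z. x \<in> carrier V \<Longrightarrow> y \<in> carrier V \<Longrightarrow> z \<in> carrier V \<Longrightarrow> (x \<oplus> y) \<oplus> z = x \<oplus> (y \<oplus> z)"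
    and comm: "\<And>x y. x \<in> carrier V \<Longrightarrow> y \<in> carrier V \<Longrightarrow> x \<oplus> y = y \<oplus> x"
    and zl: "\<And>x. x \<in> carrier V \<Longrightarrow> \<zero> \<oplus> x = x"
    and ld: "\<And>a b x. x \<in> carrier V \<Longrightarrow> (a + b) \<odot> x = a \<odot> x \<oplus> b \<odot> x"
    and rd: "\<And>a x y. x \<in> carrier V \<Longrightarrow> y \<in> carrier V \<Longrightarrow> a \<odot> (x \<oplus> y) = a \<odot> x \<oplus> a \<odot> y"
    and ss: "\<And>a b x. x \<in> carrier V \<Longrightarrow> (a * b) \<odot> x = a \<odot> (b \<odot> x)"
    and one: "\<And>x. x \<in> carrier V \<Longrightarrow> 1 \<odot> x = x"
    and z0: "\<And>x. x \<in> carrier V \<Longrightarrow> 0 \<odot> x = \<zero>"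
  shows "cvs V"
proof -
  have "\<exists>y\<in>carrier V. y \<oplus> x = \<zero>" if x: "x \<in> carrier V" for x
  proof
    show "(- 1) \<odot> x \<oplus> x = \<zero>"
      using ld[of x "- 1" 1] one[OF x] z0[OF x] x by simp
  qed (simp add: sm x)
  then show ?thesis unfolding cvs_def
    by (intro moduleI cring_CC abelian_groupI)
       (simp_all add: zero add sm assoc zl ld rd ss one, simp add: comm)
qed

subsection \<open>Linear maps and spans\<close>

lemma linI:
  assumes "\<And>x. x \<in> carrier V \<Longrightarrow> \<phi> x \<in> carrier W"
    "\<And>x y. x \<in> carrier V \<Longrightarrow> y \<in> carrier V \<Longrightarrow> \<phi> (x \<oplus>\<^bsub>V\<^esub> y) = \<phi> x \<oplus>\<^bsub>W\<^esub> \<phi> y"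
    "\<And>c x. x \<in> carrier V \<Longrightarrow> \<phi> (c \<odot>\<^bsub>V\<^esub> x) = c \<odot>\<^bsub>W\<^esub> \<phi> x"
  shows "is_linear V W \<phi>"
  using assms by (simp add: is_linear_def)

lemma linD:
  assumes "is_linear V W \<phi>"
  shows "x \<in> carrier V \<Longrightarrow> \<phi> x \<in> carrier W"
    "x \<in> carrier V \<Longrightarrow> y \<in> carrier V \<Longrightarrow> \<phi> (x \<oplus>\<^bsub>V\<^esub> y) = \<phi> x \<oplus>\<^bsub>W\<^esub> \<phi> y"
    "x \<in> carrier V \<Longrightarrow> \<phi> (c \<odot>\<^bsub>V\<^esub> x) = c \<odot>\<^bsub>W\<^esub> \<phi> x"
  using assms by (auto simp: is_linear_def)

locale cvs2 = V: cvs V + W: cvs W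
  for V :: "('a, 'y) superspace_scheme" and W :: "('b, 'z) superspace_scheme"
begin

lemma lin_zero: "is_linear V W \<phi> \<Longrightarrow> \<phi> \<zero>\<^bsub>V\<^esub> = \<zero>\<^bsub>W\<^esub>"
  using linD(3)[of V W \<phi> "\<zero>\<^bsub>V\<^esub>" 0] linD(1)[of V W \<phi> "\<zero>\<^bsub>V\<^esub>"] by simp

lemma lin_minus: "is_linear V W \<phi> \<Longrightarrow> x \<in> carrier V \<Longrightarrow> \<phi> (\<ominus>\<^bsub>V\<^esub> x) = \<ominus>\<^bsub>W\<^esub> \<phi> x"
  using linD(3)[of V W \<phi> x "- 1"] linD(1)[of V W \<phi> x] by (simp add: V.sm_neg_one W.sm_neg_one)

lemma lin_diff:
  "is_linear V W \<phi> \<Longrightarrow> x \<in> carrier V \<Longrightarrow> y \<in> carrier V \<Longrightarrow> \<phi> (x \<ominus>\<^bsub>V\<^esub> y) = \<phi> x \<ominus>\<^bsub>W\<^esub> \<phi> y"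
  using lin_minus[of \<phi> y] linD(2)[of V W \<phi> x] by (simp add: a_minus_def)

lemma lin_finsum:
  assumes "is_linear V W \<phi>" "f \<in> A \<rightarrow> carrier V"
  shows "\<phi> (\<Oplus>\<^bsub>V\<^esub> i\<in>A. f i) = (\<Oplus>\<^bsub>W\<^esub> i\<in>A. \<phi> (f i))"
proof (cases "finite A")
  case True then show ?thesis using assms(2)
  proof (induction A rule: finite_induct)
    case empty then show ?case by (simp add: lin_zero[OF assms(1)])
  next
    case (insert a F)
    then have "f a \<in> carrier V" "f \<in> F \<rightarrow> carrier V" by auto
    moreover from this have "(\<lambda>i. \<phi> (f i)) \<in> F \<rightarrow> carrier W"
      using linD(1)[OF assms(1)] by auto
    ultimately show ?case using insert linD[OF assms(1)]
      by (simp add: V.M.finsum_insert W.M.finsum_insert)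
  qed
qed (simp add: V.M.finsum_infinite W.M.finsum_infinite lin_zero[OF assms(1)])

lemma lin_kernel_submodule:
  assumes "is_linear V W \<phi>"
  shows "submodule {x \<in> carrier V. \<phi> x = \<zero>\<^bsub>W\<^esub>} CC V"
  by (rule V.submoduleI') (auto simp: linD[OF assms] lin_zero[OF assms])

lemma lin_image_submodule:
  assumes "is_linear V W \<phi>" "submodule U CC V"
  shows "submodule (\<phi> ` U) CC W"
proof (rule W.submoduleI')
  note U = V.submoduleD[OF assms(2)] and L = linD[OF assms(1)]
  show "\<phi> ` U \<subseteq> carrier W" using U(1) L(1) by auto
  show "\<zero>\<^bsub>W\<^esub> \<in> \<phi> ` U" using lin_zero[OF assms(1)] U(2) by force
  show "x \<oplus>\<^bsub>W\<^esub> y \<in> \<phi> ` U" if "x \<in> \<phi> ` U" "y \<in> \<phi> ` U" for x y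
    using that L(2) U(3,7) by (smt (verit) image_iff)
  show "c \<odot>\<^bsub>W\<^esub> x \<in> \<phi> ` U" if "x \<in> \<phi> ` U" for c x
    using that L(3) U(4,7) by (smt (verit) image_iff)
qed

end

lemma (in cvs) submodule_Inter:
  assumes "\<And>W. W \<in> F \<Longrightarrow> submodule W CC V" "F \<noteq> {}"
  shows "submodule (\<Inter>F) CC V"
proof (rule submoduleI')
  obtain W0 where "W0 \<in> F" using assms(2) by auto
  then show "\<Inter>F \<subseteq> carrier V" using submoduleD(1)[OF assms(1)] by blast
qed (use submoduleD[OF assms(1)] in auto)

locale cvss = cvs V for V :: "('a, 'z) superspace_scheme" (structure)
begin

lemma lspan_submodule: "S \<subseteq> carrier V \<Longrightarrow> submodule (lspan V S) CC V"
  unfolding lspan_def by (rule submodule_Inter) (use carrier_is_submodule in auto)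

lemma lspan_superset: "S \<subseteq> lspan V S" by (auto simp: lspan_def)

lemma lspan_minimal: "submodule W CC V \<Longrightarrow> S \<subseteq> W \<Longrightarrow> lspan V S \<subseteq> W"
  by (auto simp: lspan_def)

lemma lspan_induct [consumes 2, case_names zero add smult base]:
  assumes "x \<in> lspan V S" "S \<subseteq> carrier V" "P \<zero>"
    "\<And>x y. x \<in> carrier V \<Longrightarrow> y \<in> carrier V \<Longrightarrow> P x \<Longrightarrow> P y \<Longrightarrow> P (x \<oplus> y)"
    "\<And>c x. x \<in> carrier V \<Longrightarrow> P x \<Longrightarrow> P (c \<odot> x)" "\<And>x. x \<in> S \<Longrightarrow> P x"
  shows "P x"
proof -
  have "submodule {x \<in> carrier V. P x} CC V"
    by (rule submoduleI') (use assms in auto)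
  from lspan_minimal[OF this, of S] show ?thesis using assms by blast
qed

end

subsection \<open>Quotients\<close>

locale quot = cvss V for V :: "'a superspace" (structure) +
  fixes N :: "'a set"
  assumes N: "submodule N CC V"
begin

abbreviation cls :: "'a \<Rightarrow> 'a set" where "cls x \<equiv> N +> x"
abbreviation "Q \<equiv> quot_space V N"

lemma abelian_subgroup_N: "abelian_subgroup N V"
  using N by (intro abelian_subgroupI3 additive_subgroup.intro) (auto simp: submodule_def intro: M.abelian_group_axioms)

lemma cls_add: "x \<in> carrier V \<Longrightarrow> y \<in> carrier V \<Longrightarrow> cls x <+> cls y = cls (x \<oplus> y)"
  by (rule abelian_subgroup.a_rcos_sum[OF abelian_subgroup_N])

lemma cls_eq_iff: "x \<in> carrier V \<Longrightarrow> y \<in> carrier V \<Longrightarrow> cls x = cls y \<longleftrightarrow> x \<ominus> y \<in> N"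
  using abelian_subgroup.a_rcos_module[OF abelian_subgroup_N, of y x]
    abelian_subgroup.a_rcos_self[OF abelian_subgroup_N, of x]
    abelian_subgroup.a_repr_independence'[OF abelian_subgroup_N, of x y]
  by (auto simp: a_minus_def)

lemma cls_self: "x \<in> carrier V \<Longrightarrow> x \<in> cls x"
  by (rule abelian_subgroup.a_rcos_self[OF abelian_subgroup_N])

lemma cls_memD: "y \<in> cls x \<Longrightarrow> x \<in> carrier V \<Longrightarrow> y \<in> carrier V \<and> cls y = cls x"
  by (metis M.a_rcosetsI abelian_subgroup.a_elemrcos_carrier abelian_subgroup.a_repr_independence'
      abelian_subgroup_N M.abelian_group_axioms abelian_subgroup.axioms(1) additive_subgroup.a_subset)

lemma N_carrier: "N \<subseteq> carrier V" by (rule submoduleD[OF N])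

lemma cls_zero: "cls \<zero> = N"
  by (rule M.a_coset_add_zero) (rule N_carrier)

text \<open>Scalar multiplication, the action on the oscillator module and induced maps on
  cohomology are all written as unions over a coset; such a union collapses once the member sets are
  constant on it.\<close>

lemma UN_cls:
  assumes "x \<in> carrier V" "\<And>y. y \<in> carrier V \<Longrightarrow> cls y = cls x \<Longrightarrow> g y = c"
  shows "(\<Union>y\<in>cls x. g y) = c"
  using cls_memD[OF _ assms(1)] cls_self[OF assms(1)] assms(2) by blast

lemma carrier_Q: "carrier Q = cls ` carrier V"
  by (auto simp: quot_space_def A_RCOSETS_def RCOSETS_def a_r_coset_def)

lemma Q_simps [simp]: "zero Q = N" "add Q = set_add V"
  by (simp_all add: quot_space_def)

lemma smult_Q: assumes "x \<in> carrier V" shows "c \<odot>\<^bsub>Q\<^esub> cls x = cls (c \<odot> x)"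
proof -
  have "cls (c \<odot> y) = cls (c \<odot> x)" if "y \<in> carrier V" "cls y = cls x" for y
  proof -
    have "c \<odot> y \<ominus> c \<odot> x = c \<odot> (y \<ominus> x)" using that assms by (simp add: diff_sm sm_add_r)
    then show ?thesis using that assms submoduleD(4)[OF N] by (simp add: cls_eq_iff)
  qed
  then have "(\<Union>y\<in>cls x. cls (c \<odot> y)) = cls (c \<odot> x)" by (intro UN_cls assms)
  then show ?thesis by (simp add: quot_space_def)
qed

lemma cvs_Q: "cvs Q"
proof -
  have zero: "\<zero>\<^bsub>Q\<^esub> = cls \<zero>" by (simp add: cls_zero)
  show ?thesis
  proof (rule cvsI)
    fix X Y assume "X \<in> carrier Q" "Y \<in> carrier Q"
    then obtain x y where "x \<in> carrier V" "y \<in> carrier V" "X = cls x" "Y = cls y"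
      by (auto simp: carrier_Q)
    then show "X \<oplus>\<^bsub>Q\<^esub> Y = Y \<oplus>\<^bsub>Q\<^esub> X" by (simp add: cls_add M.a_comm)
  qed (auto simp del: Q_simps(1) simp add: zero carrier_Q cls_add smult_Q M.a_assoc sm_add_l sm_add_r)
qed

lemma cls_linear: "is_linear V Q cls"
  by (rule linI) (auto simp: carrier_Q cls_add smult_Q)

end

subsection \<open>Linear combinations\<close>

text \<open>Linear extension of \<open>F\<close> to the free vector space on the keys. Evaluation of
  words and factorization through tensor products are both instances.\<close>

definition lc :: "('v, 'z) superspace_scheme \<Rightarrow> ('k \<Rightarrow> 'v) \<Rightarrow> ('k \<Rightarrow>\<^sub>0 complex) \<Rightarrow> 'v" where
  "lc V F P = (\<Oplus>\<^bsub>V\<^esub> k\<in>Poly_Mapping.keys P. Poly_Mapping.lookup P k \<odot>\<^bsub>V\<^esub> F k)"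

lemma poly_mapping_sum_single:
  fixes P :: "'k \<Rightarrow>\<^sub>0 complex"
  shows "P = (\<Sum>k\<in>Poly_Mapping.keys P. Poly_Mapping.single k (Poly_Mapping.lookup P k))"
  by (rule poly_mapping_eqI)
     (auto simp: lookup_sum lookup_single when_def sum.delta in_keys_iff)

text \<open>All intermediate mappings keep their keys in \<open>S\<close>, which is where closure
  facts about \<open>F\<close> are available.\<close>

lemma poly_mapping_span_induct [consumes 1, case_names zero single add]:
  fixes P :: "'k \<Rightarrow>\<^sub>0 complex"
  assumes "Poly_Mapping.keys P \<subseteq> S" "R 0" "\<And>k c. k \<in> S \<Longrightarrow> R (Poly_Mapping.single k c)"
    "\<And>P P'. Poly_Mapping.keys P \<subseteq> S \<Longrightarrow> Poly_Mapping.keys P' \<subseteq> S \<Longrightarrow> R P \<Longrightarrow> R P' \<Longrightarrow> R (P + P')"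
  shows "R P"
proof -
  let ?f = "\<lambda>K. \<Sum>k\<in>K. Poly_Mapping.single k (Poly_Mapping.lookup P k)"
  have "Poly_Mapping.keys (?f K) \<subseteq> S \<and> R (?f K)" if "finite K" "K \<subseteq> S" for K
    using that
  proof (induction K rule: finite_induct)
    case (insert k K)
    then show ?case using assms(3)[of k] assms(4)
      by (auto split: if_splits intro!: assms(4) dest!: subsetD[OF keys_add])
  qed (simp add: assms(2))
  from this[of "Poly_Mapping.keys P"] show ?thesis
    using assms(1) poly_mapping_sum_single[of P] by simp
qed

lemma keys_map_times: "Poly_Mapping.keys (Poly_Mapping.map ((*) (c::complex)) P) \<subseteq> Poly_Mapping.keys P"
  by (auto simp: in_keys_iff Poly_Mapping.map.rep_eq when_def split: if_splits)

lemma lookup_map_times: "Poly_Mapping.lookup (Poly_Mapping.map ((*) (c::complex)) P) k = c * Poly_Mapping.lookup P k"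
  by (auto simp: Poly_Mapping.map.rep_eq when_def)

lemma keys_diff_subset: "Poly_Mapping.keys (P - Q) \<subseteq> Poly_Mapping.keys P \<union> Poly_Mapping.keys (Q :: 'a \<Rightarrow>\<^sub>0 complex)"
  by (auto simp: in_keys_iff lookup_minus)

context cvss begin

text \<open>Cancellation can make the keys of \<open>P + P'\<close> fewer than expected. Padding
  with zero coefficients gives a common index set on which sums can be added.\<close>

lemma lc_superset:
  assumes "finite K" "Poly_Mapping.keys P \<subseteq> K" "\<And>k. k \<in> K \<Longrightarrow> F k \<in> carrier V"
  shows "lc V F P = (\<Oplus>k\<in>K. Poly_Mapping.lookup P k \<odot> F k)"
  unfolding lc_def
  by (rule M.add.finprod_mono_neutral_cong_left) (use assms in \<open>auto simp: in_keys_iff\<close>)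

lemma lc_zero [simp]: "lc V F 0 = \<zero>"
  by (simp add: lc_def)

lemma lc_closed:
  assumes "Poly_Mapping.keys P \<subseteq> S" "\<And>k. k \<in> S \<Longrightarrow> F k \<in> carrier V"
  shows "lc V F P \<in> carrier V"
  unfolding lc_def by (rule M.finsum_closed) (use assms in auto)

lemma lc_single: "F k \<in> carrier V \<Longrightarrow> lc V F (Poly_Mapping.single k c) = c \<odot> F k"
  using lc_superset[of "{k}" "Poly_Mapping.single k c" F] by (simp add: M.finsum_singleton lookup_single)

lemma lc_add:
  assumes "Poly_Mapping.keys P \<subseteq> S" "Poly_Mapping.keys P' \<subseteq> S" "\<And>k. k \<in> S \<Longrightarrow> F k \<in> carrier V"
  shows "lc V F (P + P') = lc V F P \<oplus> lc V F P'"
proof -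
  let ?K = "Poly_Mapping.keys P \<union> Poly_Mapping.keys P'"
  have K: "finite ?K" "\<And>k. k \<in> ?K \<Longrightarrow> F k \<in> carrier V" using assms by auto
  have "lc V F R = (\<Oplus>k\<in>?K. Poly_Mapping.lookup R k \<odot> F k)"
    if "Poly_Mapping.keys R \<subseteq> ?K" for R
    by (rule lc_superset) (use that K in auto)
  moreover have "(\<Oplus>k\<in>?K. Poly_Mapping.lookup (P + P') k \<odot> F k) =
    (\<Oplus>k\<in>?K. Poly_Mapping.lookup P k \<odot> F k \<oplus> Poly_Mapping.lookup P' k \<odot> F k)"
    by (rule M.add.finprod_cong) (use K in \<open>auto simp: lookup_add sm_add_l simp_implies_def\<close>)
  moreover have "\<dots> = (\<Oplus>k\<in>?K. Poly_Mapping.lookup P k \<odot> F k) \<oplus> (\<Oplus>k\<in>?K. Poly_Mapping.lookup P' k \<odot> F k)"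
    by (rule M.finsum_addf) (use K in auto)
  ultimately show ?thesis using keys_add[of P P'] by simp
qed

lemma lc_scale:
  assumes "Poly_Mapping.keys P \<subseteq> S" "\<And>k. k \<in> S \<Longrightarrow> F k \<in> carrier V"
  shows "lc V F (Poly_Mapping.map ((*) c) P) = c \<odot> lc V F P"
proof -
  let ?K = "Poly_Mapping.keys P"
  have K: "finite ?K" "\<And>k. k \<in> ?K \<Longrightarrow> F k \<in> carrier V" using assms by auto
  have "lc V F (Poly_Mapping.map ((*) c) P) = (\<Oplus>k\<in>?K. Poly_Mapping.lookup (Poly_Mapping.map ((*) c) P) k \<odot> F k)"
    by (rule lc_superset) (use K keys_map_times[of c P] in auto)
  also have "\<dots> = (\<Oplus>k\<in>?K. c \<odot> (Poly_Mapping.lookup P k \<odot> F k))"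
    by (rule M.add.finprod_cong) (use K in \<open>auto simp: lookup_map_times simp_implies_def\<close>)
  also have "\<dots> = c \<odot> lc V F P"
    unfolding lc_def by (rule sm_finsum[symmetric]) (use K in auto)
  finally show ?thesis .
qed

lemma map_times_minus_one: "Poly_Mapping.map ((*) (- 1)) P = - (P :: 'k \<Rightarrow>\<^sub>0 complex)"
  by (rule poly_mapping_eqI) (simp add: lookup_map_times)

lemma lc_diff:
  assumes "Poly_Mapping.keys P \<subseteq> S" "Poly_Mapping.keys P' \<subseteq> S" "\<And>k. k \<in> S \<Longrightarrow> F k \<in> carrier V"
  shows "lc V F (P - P') = lc V F P \<ominus> lc V F P'"
proof -
  have "lc V F (P - P') = lc V F P \<oplus> lc V F (Poly_Mapping.map ((*) (- 1)) P')"
    using lc_add[of P S "- P'" F] assms by (simp add: map_times_minus_one)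
  then show ?thesis using lc_scale[of P' S F "- 1"] lc_closed[of _ S F] assms by (simp add: diff_sm)
qed

end

section \<open>Graded spaces\<close>

lemma koszul_simps [simp]:
  "koszul 0 p = 1" "koszul p 0 = 1" "koszul 1 1 = -1"
  "koszul p q * koszul p q = 1" "koszul p q * (koszul p q * c) = c" 
  by (auto simp: koszul_def)

lemma koszul_sym: "koszul p q = koszul q p" by (auto simp: koszul_def)

lemma koszul_add_l: "koszul (p + q) r = koszul p r * koszul q r"
  by (cases p; cases q; cases r) (auto simp: koszul_def)

lemma koszul_add_r: "koszul r (p + q) = koszul r p * koszul r q"
  by (cases p; cases q; cases r) (auto simp: koszul_def)

lemma bit_add_self [simp]: "p + p = (0::bit)" "p + (p + q) = q"
  by (cases p; simp) (cases p; cases q; simp)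

declare add_bit_eq_xor [simp del]

locale sspace =
  fixes V :: "('a, 'z) superspace_scheme" (structure)
  assumes super_space: "super_space V"

sublocale sspace \<subseteq> cvss V
  by (rule cvss.intro, rule cvs.intro) (use super_space in \<open>simp add: super_space_def\<close>)

context sspace begin

lemma hpart_submodule: "submodule (hpart V p) CC V"
  using super_space by (simp add: super_space_def)

lemmas hpartD = submoduleD[OF hpart_submodule]

lemma hpart_inter: "x \<in> hpart V 0 \<Longrightarrow> x \<in> hpart V 1 \<Longrightarrow> x = \<zero>"
  using super_space by (auto simp: super_space_def)

lemma hpart_inter': "x \<in> hpart V p \<Longrightarrow> x \<in> hpart V q \<Longrightarrow> p \<noteq> q \<Longrightarrow> x = \<zero>"
  using hpart_inter by (cases p; cases q) auto

lemma hpart_ex: assumes "x \<in> carrier V" shows "\<exists>y\<in>hpart V p. \<exists>y'\<in>hpart V (p + 1). x = y \<oplus> y'"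
proof -
  from assms have "x \<in> hpart V 0 <+> hpart V 1" using super_space by (simp add: super_space_def)
  then obtain y y' where "y \<in> hpart V 0" "y' \<in> hpart V 1" "x = y \<oplus> y'"
    by (auto simp: set_add_def set_mult_def)
  moreover from this have "x = y' \<oplus> y" using hpartD(7) by (simp add: M.a_comm)
  ultimately show ?thesis by (cases p; simp) (metis, metis)
qed

text \<open>Two decompositions of \<open>x\<close> differ by an element that lies in both graded
  parts, hence by zero; this makes the \<open>THE\<close> in \<open>hproj\<close>
  determinate.\<close>

lemma hproj_eqI:
  assumes "y \<in> hpart V p" "y' \<in> hpart V (p + 1)" "x = y \<oplus> y'"
  shows "hproj V p x = y"
  unfolding hproj_def
proof (rule the_equality)
  show "y \<in> hpart V p \<and> (\<exists>y'\<in>hpart V (p + 1). x = y \<oplus> y')" using assms by auto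
next
  fix z assume "z \<in> hpart V p \<and> (\<exists>z'\<in>hpart V (p + 1). x = z \<oplus> z')"
  then obtain z' where z: "z \<in> hpart V p" "z' \<in> hpart V (p + 1)" "x = z \<oplus> z'" by auto
  note c = z(1,2)[THEN hpartD(7)] assms(1,2)[THEN hpartD(7)]
  have eq: "z \<ominus> y = y' \<ominus> z'"
  proof -
    have "z \<ominus> y = (z \<oplus> z') \<oplus> (\<ominus> z' \<oplus> \<ominus> y)" using c
      by (simp add: a_minus_def M.a_assoc M.r_neg1 M.r_neg2)
    also have "\<dots> = (y \<oplus> y') \<oplus> (\<ominus> y \<oplus> \<ominus> z')" using z(3) assms(3) c by (simp add: M.a_comm)
    also have "\<dots> = (y' \<oplus> y) \<oplus> (\<ominus> y \<oplus> \<ominus> z')" using c by (simp add: M.a_comm)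
    also have "\<dots> = y' \<ominus> z'" using c by (simp add: a_minus_def M.a_assoc M.r_neg1 M.r_neg2)
    finally show ?thesis .
  qed
  have "z \<ominus> y \<in> hpart V p" using z assms hpartD by simp
  moreover have "z \<ominus> y \<in> hpart V (p + 1)" unfolding eq using z assms hpartD by simp
  ultimately have "z \<ominus> y = \<zero>" by (rule hpart_inter') (cases p; simp)
  then show "z = y" using c by (simp add: diff_eq_zero_iff)
qed

lemma hproj_in [simp, intro]: "x \<in> carrier V \<Longrightarrow> hproj V p x \<in> hpart V p"
  using hpart_ex[of x p] hproj_eqI by auto

lemma hproj_closed [simp, intro]: "x \<in> carrier V \<Longrightarrow> hproj V p x \<in> carrier V"
  using hproj_in hpartD(7) by blast

lemma hproj_decomp: assumes "x \<in> carrier V" shows "x = hproj V 0 x \<oplus> hproj V 1 x"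
proof -
  obtain y y' where y: "y \<in> hpart V 0" "y' \<in> hpart V 1" "x = y \<oplus> y'" using hpart_ex[OF assms, of 0] by auto
  then have "hproj V 0 x = y" by (intro hproj_eqI) auto
  moreover have "hproj V 1 x = y'" using y by (intro hproj_eqI) (auto simp: M.a_comm hpartD(7))
  ultimately show ?thesis using y by simp
qed

lemma hproj_hom: assumes "x \<in> hpart V q" shows "hproj V p x = (if p = q then x else \<zero>)"
proof (cases "p = q")
  case True then show ?thesis using hproj_eqI[of x p \<zero> x] assms hpartD by (auto simp: hpartD(7))
next
  case False then have "q = p + 1" by (cases p; cases q) auto
  then show ?thesis using hproj_eqI[of \<zero> p x x] False assms hpartD by (auto simp: hpartD(7))
qed

lemma hproj_linear: "is_linear V V (hproj V p)"
proof (rule linI)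
  fix x y assume xy: "x \<in> carrier V" "y \<in> carrier V"
  obtain a a' where a: "a \<in> hpart V p" "a' \<in> hpart V (p+1)" "x = a \<oplus> a'" using hpart_ex[OF xy(1)] by blast
  obtain b b' where b: "b \<in> hpart V p" "b' \<in> hpart V (p+1)" "y = b \<oplus> b'" using hpart_ex[OF xy(2)] by blast
  have "hproj V p (x \<oplus> y) = a \<oplus> b"
    by (rule hproj_eqI[of _ _ "a' \<oplus> b'"]) (use a b hpartD(3,7) in \<open>auto simp: M.a_ac\<close>)
  then show "hproj V p (x \<oplus> y) = hproj V p x \<oplus> hproj V p y"
    using hproj_eqI[OF a] hproj_eqI[OF b] by simp
next
  fix c x assume x: "x \<in> carrier V"
  obtain a a' where a: "a \<in> hpart V p" "a' \<in> hpart V (p+1)" "x = a \<oplus> a'" using hpart_ex[OF x] by blast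
  have "hproj V p (c \<odot> x) = c \<odot> a"
    by (rule hproj_eqI[of _ _ "c \<odot> a'"]) (use a hpartD(4,7) in \<open>auto simp: sm_add_r\<close>)
  then show "hproj V p (c \<odot> x) = c \<odot> hproj V p x" using hproj_eqI[OF a] by simp
qed auto

lemmas hproj_add = linD(2)[OF hproj_linear] and hproj_sm = linD(3)[OF hproj_linear]

lemma hpart_cases:
  assumes "x \<in> carrier V" "\<And>p x. x \<in> hpart V p \<Longrightarrow> P x"
    "\<And>x y. x \<in> carrier V \<Longrightarrow> y \<in> carrier V \<Longrightarrow> P x \<Longrightarrow> P y \<Longrightarrow> P (x \<oplus> y)"
  shows "P x"
  using hproj_decomp[OF assms(1)] assms(2)[OF hproj_in[OF assms(1)]] assms(3) hproj_closed[OF assms(1)] by metis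

end

text \<open>The powers of the parity automorphism. With it, the supercommutator with an element of
  parity \<open>p\<close> becomes \<open>b \<mapsto> a b - parity V p b a\<close>, without a case distinction on the second argument.\<close>

definition parity :: "('a, 'z) superspace_scheme \<Rightarrow> bit \<Rightarrow> 'a \<Rightarrow> 'a" where
  "parity V p x = hproj V 0 x \<oplus>\<^bsub>V\<^esub> koszul p 1 \<odot>\<^bsub>V\<^esub> hproj V 1 x"

context sspace begin

lemma parity_linear: "is_linear V V (parity V p)"
  by (rule linI) (auto simp: parity_def hproj_add hproj_sm sm_add_r M.a_ac mult.commute)

lemmas parity_add = linD(2)[OF parity_linear] and parity_sm = linD(3)[OF parity_linear]

lemma parity_closed [simp, intro]: "x \<in> carrier V \<Longrightarrow> parity V p x \<in> carrier V"
  using linD(1)[OF parity_linear] .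

lemma parity_hom: "x \<in> hpart V q \<Longrightarrow> parity V p x = koszul p q \<odot> x"
  using hpartD(7)[of x] by (cases q) (auto simp: parity_def hproj_hom)

lemma parity_0 [simp]: "x \<in> carrier V \<Longrightarrow> parity V 0 x = x"
  using hproj_decomp[of x] by (simp add: parity_def)

lemma parity_hpart: "x \<in> hpart V q \<Longrightarrow> parity V p x \<in> hpart V q"
  by (simp add: parity_hom hpartD)

lemma parity_parity: 
  assumes "x \<in> carrier V" shows "parity V p (parity V q x) = parity V (p + q) x"
  using assms
  by (rule hpart_cases) (auto simp: parity_hom parity_sm koszul_add_l mult.commute parity_add hpartD)

end

text \<open>For quotients, \<open>hpart V 0 \<inter> hpart V 1 = {\<zero>}\<close> is obtained from a linear map acting with
  different signs on the two parts.\<close>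

lemma sspaceI:
  fixes V (structure)
  assumes "cvs V" "\<And>p. submodule (hpart V p) CC V"
    "carrier V \<subseteq> hpart V 0 <+> hpart V 1"
    "is_linear V V s" "\<And>p x. x \<in> hpart V p \<Longrightarrow> s x = koszul 1 p \<odot> x"
  shows "sspace V"
proof -
  interpret cvs V by fact
  note H = submoduleD[OF assms(2)]
  have "x = \<zero>" if "x \<in> hpart V 0" "x \<in> hpart V 1" for x
  proof -
    have x: "x \<in> carrier V" using that H(7) by blast
    have "x = (- 1) \<odot> x" using assms(5)[OF that(1)] assms(5)[OF that(2)] x by simp
    then have "2 \<odot> x = \<zero>" using sm_add_l[OF x, of 1 1] sm_add_l[OF x, of 1 "-1"] x by simp
    then show ?thesis by (rule sm_eq_zero) (use x in auto)
  qed
  moreover have "hpart V 0 <+> hpart V 1 = carrier V"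
    using assms(3) H(7) by (auto simp: set_add_def set_mult_def) 
  ultimately show ?thesis using assms(2) H(2)
    by (auto simp: sspace_def super_space_def module_CC)
qed

section \<open>Superalgebras given by generators and relations\<close>

text \<open>Algebras without a grading come first: the two parts of a presented algebra are
  separated by an algebra endomorphism, so multiplication has to be available before the
  grading.\<close>

locale calg = cvss A for A :: "'a superspace" (structure) +
  assumes ring_A: "ring A"
    and sm_mult_l: "\<And>c a b. a \<in> carrier A \<Longrightarrow> b \<in> carrier A \<Longrightarrow> (c \<odot> a) \<otimes> b = c \<odot> (a \<otimes> b)"
    and sm_mult_r: "\<And>c a b. a \<in> carrier A \<Longrightarrow> b \<in> carrier A \<Longrightarrow> a \<otimes> (c \<odot> b) = c \<odot> (a \<otimes> b)"

sublocale calg \<subseteq> A: ring A by (rule ring_A)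

locale superalg = sspace A + calg A for A :: "'a superspace" (structure) +
  assumes one_even: "\<one> \<in> hpart A 0"
    and mult_hpart: "\<And>a b p q. a \<in> hpart A p \<Longrightarrow> b \<in> hpart A q \<Longrightarrow> a \<otimes> b \<in> hpart A (p + q)"

subsection \<open>The free algebra\<close>

lemma words_in_const [simp]: "const c \<in> words_in S"
  by (auto simp: words_in_def const_def zero_fword_def split: if_splits)

lemma words_in_gen [simp]: "x \<in> S \<Longrightarrow> gen x \<in> words_in S"
  by (auto simp: words_in_def gen_def)

lemma words_in_0 [simp]: "0 \<in> words_in S" and words_in_1 [simp]: "1 \<in> words_in S"
  by (auto simp: words_in_def zero_fword_def)

lemma words_in_add [simp]: "P \<in> words_in S \<Longrightarrow> Q \<in> words_in S \<Longrightarrow> P + Q \<in> words_in S"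
  using keys_add[of P Q] by (auto simp: words_in_def)

lemma words_in_diff [simp]: "P \<in> words_in S \<Longrightarrow> Q \<in> words_in S \<Longrightarrow> P - Q \<in> words_in S"
  using keys_diff_subset[of P Q] by (auto simp: words_in_def)

lemma words_in_mult [simp]: "P \<in> words_in S \<Longrightarrow> Q \<in> words_in S \<Longrightarrow> P * Q \<in> words_in S"
  using keys_mult[of P Q] by (auto simp: words_in_def plus_fword_def) fastforce

lemma words_in_single: "set xs \<subseteq> S \<Longrightarrow> Poly_Mapping.single (FWord xs) c \<in> words_in S"
  by (auto simp: words_in_def split: if_splits)

lemma words_in_iff: "P \<in> words_in S \<longleftrightarrow> Poly_Mapping.keys P \<subseteq> {w. set (letters w) \<subseteq> S}"
  by (auto simp: words_in_def)

lemma const_mult: "const c * P = Poly_Mapping.map ((*) c) P"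
  by (simp add: const_def mult_map_scale_conv_mult)

lemma const_one [simp]: "const 1 = 1" "const 0 = 0"
  by (simp_all add: const_def)

lemma const_add: "const (a + b) = const a + const b" "const (a * b) = const a * const b"
  by (simp_all add: const_def single_add mult_single)

lemma const_commute: "const c * P = P * const c"
proof -
  have "Poly_Mapping.keys P \<subseteq> UNIV" by simp
  then show ?thesis
    by (induction P rule: poly_mapping_span_induct)
       (auto simp: const_def mult_single algebra_simps)
qed

lemma words_in_induct [consumes 1, case_names zero single add]:
  assumes "P \<in> words_in S" "Q 0"
    "\<And>xs c. set xs \<subseteq> S \<Longrightarrow> Q (Poly_Mapping.single (FWord xs) c)"
    "\<And>P P'. P \<in> words_in S \<Longrightarrow> P' \<in> words_in S \<Longrightarrow> Q P \<Longrightarrow> Q P' \<Longrightarrow> Q (P + P')"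
  shows "Q P"
proof -
  have "Poly_Mapping.keys P \<subseteq> {w. set (letters w) \<subseteq> S}" using assms(1) by (simp add: words_in_iff)
  then show ?thesis
  proof (induction P rule: poly_mapping_span_induct)
    case (single k c) then show ?case using assms(3)[of "letters k" c] by simp
  qed (use assms in \<open>auto simp: words_in_iff\<close>)
qed

lemma free_alg_simps [simp]:
  "carrier (free_alg V) = words_in (carrier V)" "mult (free_alg V) = (*)" "one (free_alg V) = 1"
  "zero (free_alg V) = 0" "add (free_alg V) = (+)"
  by (simp_all add: free_alg_def)

lemma ring_free_alg: "ring (free_alg V)"
proof (rule ringI)
  \<comment> \<open>The negative is written \<open>0 - x\<close> because \<open>words_in\<close> is
    already known to be closed under differences.\<close>
  have "\<exists>y\<in>words_in (carrier V). y + x = 0" if "x \<in> words_in (carrier V)" for x :: "'a free"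
    by (rule bexI[of _ "0 - x"]) (use that in \<open>auto intro: words_in_diff simp del: diff_0\<close>)
  then show "abelian_group (free_alg V)"
    by (intro abelian_groupI) (auto simp: add.assoc intro: add.commute)
  show "monoid (free_alg V)" by (rule monoidI) (auto simp: mult.assoc)
qed (auto simp: algebra_simps)

lemma free_alg_minus: 
  assumes "P \<in> words_in (carrier V)" "Q \<in> words_in (carrier V)"
  shows "P \<ominus>\<^bsub>free_alg V\<^esub> Q = P - Q"
proof -
  interpret ring "free_alg V" by (rule ring_free_alg)
  have Q: "0 - Q \<in> words_in (carrier V)" by (rule words_in_diff) (use assms in auto)
  have "\<ominus>\<^bsub>free_alg V\<^esub> Q = 0 - Q"
    by (rule minus_equality) (use assms Q in auto)
  then show ?thesis by (simp add: a_minus_def)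
qed

subsection \<open>Representations of the free algebra\<close>

text \<open>Operators attached to the letters make \<open>M\<close> a module over the free algebra,
  and \<open>ev P\<close> is the operator of \<open>P\<close>. With \<open>foldr\<close> the last
  letter acts first, as it should for a left module.\<close>

locale free_rep = M: cvss M for M :: "('m, 'z) superspace_scheme" +
  fixes S :: "'x set" and \<rho> :: "'x \<Rightarrow> 'm \<Rightarrow> 'm"
  assumes \<rho>_linear: "x \<in> S \<Longrightarrow> is_linear M M (\<rho> x)"
begin

definition word_act :: "'x fword \<Rightarrow> 'm \<Rightarrow> 'm" where "word_act w m = foldr \<rho> (letters w) m"

definition ev :: "'x free \<Rightarrow> 'm \<Rightarrow> 'm" where "ev P m = lc M (\<lambda>w. word_act w m) P"

lemma word_act_linear: "set (letters w) \<subseteq> S \<Longrightarrow> is_linear M M (word_act w)"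
proof -
  have "is_linear M M (foldr \<rho> xs)" if "set xs \<subseteq> S" for xs
    using that
  proof (induction xs)
    case (Cons x xs)
    then have "is_linear M M (\<rho> x)" "is_linear M M (foldr \<rho> xs)" using \<rho>_linear by auto
    from linD[OF this(1)] linD[OF this(2)] show ?case by (intro linI) simp_all
  qed (simp add: is_linear_def)
  then show "set (letters w) \<subseteq> S \<Longrightarrow> ?thesis" by (simp add: word_act_def[abs_def])
qed

lemma word_act_closed: "set (letters w) \<subseteq> S \<Longrightarrow> m \<in> carrier M \<Longrightarrow> word_act w m \<in> carrier M"
  using linD(1)[OF word_act_linear] .

lemma ev_closed: "P \<in> words_in S \<Longrightarrow> m \<in> carrier M \<Longrightarrow> ev P m \<in> carrier M"
  unfolding ev_def by (rule M.lc_closed[of _ "{w. set (letters w) \<subseteq> S}"])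
    (auto simp: words_in_iff word_act_closed)

lemma ev_add: "P \<in> words_in S \<Longrightarrow> Q \<in> words_in S \<Longrightarrow> m \<in> carrier M \<Longrightarrow> ev (P + Q) m = ev P m \<oplus>\<^bsub>M\<^esub> ev Q m"
  unfolding ev_def by (rule M.lc_add[of _ "{w. set (letters w) \<subseteq> S}"])
    (auto simp: words_in_iff word_act_closed)

lemma ev_diff: "P \<in> words_in S \<Longrightarrow> Q \<in> words_in S \<Longrightarrow> m \<in> carrier M \<Longrightarrow> ev (P - Q) m = ev P m \<ominus>\<^bsub>M\<^esub> ev Q m"
  unfolding ev_def by (rule M.lc_diff[of _ "{w. set (letters w) \<subseteq> S}"])
    (auto simp: words_in_iff word_act_closed)

lemma ev_zero [simp]: "ev 0 m = \<zero>\<^bsub>M\<^esub>" by (simp add: ev_def)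

lemma ev_single: "set (letters w) \<subseteq> S \<Longrightarrow> m \<in> carrier M \<Longrightarrow> ev (Poly_Mapping.single w c) m = c \<odot>\<^bsub>M\<^esub> word_act w m"
  unfolding ev_def by (simp add: M.lc_single word_act_closed)

lemma ev_const [simp]: "m \<in> carrier M \<Longrightarrow> ev (const c) m = c \<odot>\<^bsub>M\<^esub> m"
  by (simp add: const_def ev_single zero_fword_def word_act_def)

lemma ev_one [simp]: "m \<in> carrier M \<Longrightarrow> ev 1 m = m"
  using ev_const[of m 1] by simp

lemma ev_gen [simp]: "x \<in> S \<Longrightarrow> m \<in> carrier M \<Longrightarrow> ev (gen x) m = \<rho> x m"
  using linD(1)[OF \<rho>_linear] by (simp add: gen_def ev_single word_act_def)

lemma ev_linear: assumes "P \<in> words_in S" shows "is_linear M M (ev P)"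
  using assms
proof (induction P rule: words_in_induct)
  case (single xs c)
  note L = linD[OF word_act_linear[of "FWord xs"]]
  show ?case by (rule linI)
    (use single L in \<open>auto simp: ev_single M.sm_add_r mult.commute\<close>)
next
  case (add P Q)
  show ?case
    by (rule linI) (use add ev_closed linD[OF add(3)] linD[OF add(4)] in \<open>auto simp: ev_add M.sm_add_r M.a_ac\<close>)
qed (auto simp: is_linear_def)

text \<open>On monomials this is \<open>foldr\<close> over a concatenated word; linearity of
  \<open>word_act\<close> carries the scalar of the second monomial past the first.\<close>

lemma ev_mult:
  assumes "P \<in> words_in S" "Q \<in> words_in S" "m \<in> carrier M"
  shows "ev (P * Q) m = ev P (ev Q m)"
  using assms(1)
proof (induction P rule: words_in_induct)
  case (single xs c)
  note L = linD[OF word_act_linear[of "FWord xs"]]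
  show ?case using assms(2)
  proof (induction Q rule: words_in_induct)
    case (single ys d)
    have "word_act (FWord xs) (d \<odot>\<^bsub>M\<^esub> word_act (FWord ys) m) = d \<odot>\<^bsub>M\<^esub> word_act (FWord (xs @ ys)) m"
      using \<open>set xs \<subseteq> S\<close> single assms(3) by (simp add: L word_act_closed) (simp add: word_act_def)
    then show ?case using \<open>set xs \<subseteq> S\<close> single assms(3)
      by (simp add: mult_single ev_single plus_fword_def word_act_closed)
  next
    case (add Q Q')
    have w: "Poly_Mapping.single (FWord xs) c \<in> words_in S" using single by (simp add: words_in_single)
    show ?case using add w assms(3) linD(2)[OF ev_linear[OF w]] ev_closed
      by (simp add: distrib_left ev_add)
  qed (use single assms(3) L in \<open>simp_all add: ev_single cvs2.lin_zero[OF cvs2.intro word_act_linear] M.cvs_axioms\<close>)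
next
  case (add P P')
  then show ?case using assms ev_closed by (simp add: distrib_right ev_add)
qed simp

lemma ev_scale: "P \<in> words_in S \<Longrightarrow> m \<in> carrier M \<Longrightarrow> ev (const c * P) m = c \<odot>\<^bsub>M\<^esub> ev P m"
  by (simp add: ev_mult ev_closed)

end

subsection \<open>Presented algebras\<close>

locale presentation = cvss V for V :: "('x, 'z) superspace_scheme" (structure) +
  fixes R :: "'x free set"
  assumes R_words: "R \<subseteq> words_in (carrier V)"
begin

abbreviation "Fr \<equiv> free_alg V"
abbreviation "W \<equiv> words_in (carrier V)"
abbreviation "cl \<equiv> pres_class V R"
abbreviation "Pr \<equiv> pres V R"

lemma rels_words: "linear_rels V \<union> R \<subseteq> W"
  using R_words by (auto simp: linear_rels_def)

lemma ideal_pres: "ideal (pres_ideal V R) Fr"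
  unfolding pres_ideal_def by (rule ring.genideal_ideal[OF ring_free_alg]) (use rels_words in simp)

sublocale I: ideal "pres_ideal V R" Fr by (rule ideal_pres)

lemma cl_eq_iff: "P \<in> W \<Longrightarrow> Q \<in> W \<Longrightarrow> cl P = cl Q \<longleftrightarrow> P - Q \<in> pres_ideal V R"
  using I.quotient_eq_iff_same_a_r_cos[OF I.ideal_axioms, of P Q] free_alg_minus[of P V Q]
  by (simp add: pres_class_def)

lemma rel_in: "r \<in> linear_rels V \<union> R \<Longrightarrow> r \<in> pres_ideal V R"
  unfolding pres_ideal_def using ring.genideal_self[OF ring_free_alg, of "linear_rels V \<union> R" V] rels_words by auto

lemma cl_rel: "r \<in> linear_rels V \<union> R \<Longrightarrow> cl r = cl 0"
  using rel_in rels_words by (subst cl_eq_iff) auto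

lemma cl_self: "P \<in> W \<Longrightarrow> P \<in> cl P"
  unfolding pres_class_def by (rule I.a_rcos_self) simp

lemma cl_memD: "Q \<in> cl P \<Longrightarrow> P \<in> W \<Longrightarrow> Q \<in> W \<and> cl Q = cl P"
  using I.a_elemrcos_carrier[of P Q] I.a_repr_independence'[of Q P] 
  by (auto simp: pres_class_def intro: ring_free_alg ring.is_abelian_group)

lemma carrier_Pr: "carrier Pr = cl ` W"
  by (auto simp: pres_def Let_def FactRing_def A_RCOSETS_def RCOSETS_def a_r_coset_def pres_class_def)

text \<open>The record \<open>Pr\<close> has more fields than the quotient ring, so the ring laws
  are carried over field by field.\<close>

lemma ring_Pr: "ring Pr"
proof -
  let ?Q = "Fr Quot pres_ideal V R"
  interpret Q: ring ?Q by (rule I.quotient_is_ring)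
  have eq: "carrier Pr = carrier ?Q" "mult Pr = mult ?Q" "one Pr = one ?Q" "zero Pr = zero ?Q" "add Pr = add ?Q"
    by (simp_all add: pres_def Let_def)
  have "\<exists>y\<in>carrier ?Q. y \<oplus>\<^bsub>?Q\<^esub> x = \<zero>\<^bsub>?Q\<^esub>" if "x \<in> carrier ?Q" for x
    using that Q.l_neg Q.a_inv_closed by blast
  then show ?thesis
    by (intro ringI abelian_groupI monoidI)
       (simp_all only: eq Q.a_closed Q.zero_closed Q.a_assoc Q.l_zero Q.m_closed Q.one_closed Q.m_assoc
          Q.l_one Q.r_one Q.l_distr Q.r_distr, simp only: Q.a_comm)
qed

lemma cl_closed [simp, intro]: "P \<in> W \<Longrightarrow> cl P \<in> carrier Pr" by (simp add: carrier_Pr)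

lemma cl_add: "P \<in> W \<Longrightarrow> Q \<in> W \<Longrightarrow> cl P \<oplus>\<^bsub>Pr\<^esub> cl Q = cl (P + Q)"
  using I.a_rcos_sum[of P Q] by (simp add: pres_def Let_def FactRing_def pres_class_def)

lemma cl_mult: "P \<in> W \<Longrightarrow> Q \<in> W \<Longrightarrow> cl P \<otimes>\<^bsub>Pr\<^esub> cl Q = cl (P * Q)"
  using I.rcoset_mult_add[of P Q] by (simp add: pres_def Let_def FactRing_def pres_class_def)

lemma cl_one: "\<one>\<^bsub>Pr\<^esub> = cl 1"
  by (simp add: pres_def Let_def FactRing_def pres_class_def)

lemma cl_zero: "\<zero>\<^bsub>Pr\<^esub> = cl 0"
  using I.a_coset_add_zero[OF I.a_subset] by (simp add: pres_def Let_def FactRing_def pres_class_def)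

lemma cl_smult: "P \<in> W \<Longrightarrow> c \<odot>\<^bsub>Pr\<^esub> cl P = cl (const c * P)"
  using cl_mult[of "const c" P] by (simp add: pres_def Let_def FactRing_def)

lemma cl_cases: assumes "U \<in> carrier Pr" obtains P where "P \<in> W" "U = cl P"
  using assms by (auto simp: carrier_Pr)

lemma cvss_Pr: "cvss Pr"
proof (rule cvss.intro, rule cvsI)
  interpret Pr: ring Pr by (rule ring_Pr)
  show "\<And>x y z. x \<in> carrier Pr \<Longrightarrow> y \<in> carrier Pr \<Longrightarrow> z \<in> carrier Pr \<Longrightarrow>
     x \<oplus>\<^bsub>Pr\<^esub> y \<oplus>\<^bsub>Pr\<^esub> z = x \<oplus>\<^bsub>Pr\<^esub> (y \<oplus>\<^bsub>Pr\<^esub> z)" by (rule Pr.a_assoc)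
  show "\<And>x y. x \<in> carrier Pr \<Longrightarrow> y \<in> carrier Pr \<Longrightarrow> x \<oplus>\<^bsub>Pr\<^esub> y = y \<oplus>\<^bsub>Pr\<^esub> x" by (rule Pr.a_comm)
qed (auto elim!: cl_cases simp: cl_zero cl_add cl_smult const_add distrib_left distrib_right mult.assoc)

lemma cl_gen_add: "x \<in> carrier V \<Longrightarrow> y \<in> carrier V \<Longrightarrow> cl (gen (x \<oplus> y)) = cl (gen x + gen y)"
  using rel_in[of "gen (x \<oplus> y) - gen x - gen y"]
  by (subst cl_eq_iff) (auto simp: linear_rels_def diff_diff_eq)

lemma cl_gen_smult: "x \<in> carrier V \<Longrightarrow> cl (gen (c \<odot> x)) = cl (const c * gen x)"
  using rel_in[of "gen (c \<odot> x) - const c * gen x"]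
  by (subst cl_eq_iff) (auto simp: linear_rels_def)

lemma gen_linear: "is_linear V Pr (\<lambda>x. cl (gen x))"
  by (rule linI) (auto simp: cl_gen_add cl_gen_smult cl_add cl_smult)

text \<open>Monomials span the algebra, and each grows from the unit by multiplying letters on the
  left. The zero element is covered as \<open>0\<close> times the unit.\<close>

lemma Pr_induct [consumes 1, case_names add smult one gen]:
  assumes "U \<in> carrier Pr"
    "\<And>U U'. U \<in> carrier Pr \<Longrightarrow> U' \<in> carrier Pr \<Longrightarrow> Q U \<Longrightarrow> Q U' \<Longrightarrow> Q (U \<oplus>\<^bsub>Pr\<^esub> U')"
    "\<And>c U. U \<in> carrier Pr \<Longrightarrow> Q U \<Longrightarrow> Q (c \<odot>\<^bsub>Pr\<^esub> U)"
    "Q \<one>\<^bsub>Pr\<^esub>"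
    "\<And>x U. x \<in> carrier V \<Longrightarrow> U \<in> carrier Pr \<Longrightarrow> Q U \<Longrightarrow> Q (cl (gen x) \<otimes>\<^bsub>Pr\<^esub> U)"
  shows "Q U"
proof -
  have s1: "Q (cl (Poly_Mapping.single (FWord xs) 1))" if "set xs \<subseteq> carrier V" for xs
    using that
  proof (induction xs)
    case Nil
    have "Poly_Mapping.single (FWord []) 1 = (1 :: 'x free)" by (metis single_one zero_fword_def)
    then show ?case using assms(4) by (simp add: cl_one)
  next
    case (Cons x xs)
    have "Poly_Mapping.single (FWord (x # xs)) 1 = gen x * Poly_Mapping.single (FWord xs) (1::complex)"
      by (simp add: gen_def mult_single plus_fword_def)
    then show ?case using Cons assms(5)[of x "cl (Poly_Mapping.single (FWord xs) 1)"] words_in_single[of xs "carrier V" 1]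
      by (simp add: cl_mult)
  qed
  have s: "Q (cl (Poly_Mapping.single (FWord xs) c))" if "set xs \<subseteq> carrier V" for xs c
    using assms(3)[OF cl_closed[OF words_in_single[OF that]] s1[OF that], of c] words_in_single[OF that]
    by (simp add: cl_smult const_mult)
  obtain P where P: "P \<in> W" "U = cl P" using assms(1) by (rule cl_cases)
  from P(1) have "Q (cl P)"
  proof (induction P rule: words_in_induct)
    case zero
    then show ?case using assms(3)[of "cl 1" 0] assms(4) cl_smult[of 1 0] by (simp add: cl_one)
  next
    case (add P P')
    then show ?case using assms(2)[of "cl P" "cl P'"] by (simp add: cl_add)
  qed (rule s)
  then show ?thesis using P by simp
qed

end

locale pres_rep = presentation V R + free_rep M "carrier V" \<rho>
  for V :: "('x, 'y) superspace_scheme" and R and M :: "('m, 'z) superspace_scheme" and \<rho> +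
  assumes \<rho>_linear2: "m \<in> carrier M \<Longrightarrow> is_linear V M (\<lambda>x. \<rho> x m)"
    and \<rho>_rels: "r \<in> R \<Longrightarrow> m \<in> carrier M \<Longrightarrow> ev r m = \<zero>\<^bsub>M\<^esub>"
begin

lemma ev_linear_rels: "r \<in> linear_rels V \<Longrightarrow> m \<in> carrier M \<Longrightarrow> ev r m = \<zero>\<^bsub>M\<^esub>"
  using linD[OF \<rho>_linear] linD[OF \<rho>_linear2]
  by (auto simp: linear_rels_def ev_diff ev_scale M.diff_eq_zero_iff M.add_diff)

text \<open>The annihilator of \<open>M\<close> is a two-sided ideal, so it contains the ideal
  generated by the relations as soon as it contains the relations themselves.\<close>

lemma ideal_ev: "ideal {P \<in> W. \<forall>m\<in>carrier M. ev P m = \<zero>\<^bsub>M\<^esub>} Fr"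
proof -
  let ?K = "{P \<in> W. \<forall>m\<in>carrier M. ev P m = \<zero>\<^bsub>M\<^esub>}"
  have "\<ominus>\<^bsub>Fr\<^esub> P = 0 - P" if "P \<in> W" for P
    by (rule I.minus_equality) (use that words_in_diff[OF words_in_0 that] in simp_all)
  then have "inv\<^bsub>add_monoid Fr\<^esub> P = 0 - P" if "P \<in> W" for P
    using that by (metis a_inv_def)
  then have "subgroup ?K (add_monoid Fr)"
    by unfold_locales (auto simp: ev_add ev_diff M.diff_eq_zero_iff simp del: diff_0)
  moreover have "\<zero>\<^bsub>M\<^esub> = ev P \<zero>\<^bsub>M\<^esub>" if "P \<in> W" for P
    using cvs2.lin_zero[OF cvs2.intro ev_linear[OF that]] by (simp add: M.cvs_axioms)
  ultimately show ?thesis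
    by (intro idealI ring_free_alg) (auto simp: ev_mult ev_closed)
qed

lemma ev_ideal: "P \<in> pres_ideal V R \<Longrightarrow> m \<in> carrier M \<Longrightarrow> ev P m = \<zero>\<^bsub>M\<^esub>"
proof -
  have "linear_rels V \<union> R \<subseteq> {P \<in> W. \<forall>m\<in>carrier M. ev P m = \<zero>\<^bsub>M\<^esub>}"
    using rels_words ev_linear_rels \<rho>_rels by blast
  then have "pres_ideal V R \<subseteq> {P \<in> W. \<forall>m\<in>carrier M. ev P m = \<zero>\<^bsub>M\<^esub>}"
    unfolding pres_ideal_def by (rule ring.genideal_minimal[OF ring_free_alg ideal_ev])
  then show "P \<in> pres_ideal V R \<Longrightarrow> m \<in> carrier M \<Longrightarrow> ?thesis" by blast
qed

text \<open>\<open>alg_act\<close> evaluates a representative picked by \<open>SOME\<close>. Two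
  representatives differ by an element of the relation ideal, which acts as zero.\<close>

lemma act_cl: assumes "P \<in> W" "m \<in> carrier M" shows "alg_act M \<rho> (cl P) m = ev P m"
proof -
  let ?P = "SOME Q. Q \<in> cl P"
  have "?P \<in> cl P" using cl_self[OF assms(1)] by (rule someI)
  from cl_memD[OF this assms(1)] have Q: "?P \<in> W" "cl ?P = cl P" by blast+
  have "ev ?P m = ev P m"
    using ev_ideal[of "?P - P" m] Q assms ev_diff[of ?P P m] cl_eq_iff[of ?P P] ev_closed
    by (simp add: M.diff_eq_zero_iff)
  then show ?thesis by (simp add: alg_act_def ev_def lc_def word_act_def Let_def)
qed

abbreviation "act \<equiv> alg_act M \<rho>"

lemma act_closed [simp, intro]: "U \<in> carrier Pr \<Longrightarrow> m \<in> carrier M \<Longrightarrow> act U m \<in> carrier M"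
  by (auto elim!: cl_cases simp: act_cl ev_closed)

lemma act_linear1: "m \<in> carrier M \<Longrightarrow> is_linear Pr M (\<lambda>U. act U m)"
  by (rule linI) (auto elim!: cl_cases simp: act_cl ev_closed cl_add cl_smult ev_add ev_scale)

lemma act_linear2: "U \<in> carrier Pr \<Longrightarrow> is_linear M M (act U)"
  by (rule linI) (auto elim!: cl_cases simp: act_cl ev_closed linD[OF ev_linear])

lemma act_mult: "U \<in> carrier Pr \<Longrightarrow> U' \<in> carrier Pr \<Longrightarrow> m \<in> carrier M \<Longrightarrow> act (U \<otimes>\<^bsub>Pr\<^esub> U') m = act U (act U' m)"
  by (auto elim!: cl_cases simp: act_cl ev_closed cl_mult ev_mult)

lemma act_one: "m \<in> carrier M \<Longrightarrow> act \<one>\<^bsub>Pr\<^esub> m = m"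
  by (simp add: cl_one act_cl)

lemma act_gen: "x \<in> carrier V \<Longrightarrow> m \<in> carrier M \<Longrightarrow> act (cl (gen x)) m = \<rho> x m"
  by (simp add: act_cl)

end

lemma (in presentation) calg_Pr: "calg Pr"
proof -
  show ?thesis
  proof (intro calg.intro calg_axioms.intro cvss_Pr ring_Pr)
    fix c a b assume "a \<in> carrier Pr" "b \<in> carrier Pr"
    then obtain P Q where P: "P \<in> W" "a = cl P" "Q \<in> W" "b = cl Q" by (auto elim!: cl_cases)
    then show "(c \<odot>\<^bsub>Pr\<^esub> a) \<otimes>\<^bsub>Pr\<^esub> b = c \<odot>\<^bsub>Pr\<^esub> (a \<otimes>\<^bsub>Pr\<^esub> b)"
      by (simp add: cl_mult cl_smult mult.assoc)
    have "P * (const c * Q) = const c * (P * Q)" by (metis const_commute mult.assoc)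
    then show "a \<otimes>\<^bsub>Pr\<^esub> (c \<odot>\<^bsub>Pr\<^esub> b) = c \<odot>\<^bsub>Pr\<^esub> (a \<otimes>\<^bsub>Pr\<^esub> b)"
      using P by (simp add: cl_mult cl_smult)
  qed
qed

subsection \<open>Algebra morphisms out of a presented algebra\<close>

lemma (in calg) mult_linear_r: "a \<in> carrier A \<Longrightarrow> is_linear A A (\<lambda>b. a \<otimes> b)"
  by (rule linI) (simp_all add: A.r_distr sm_mult_r)

lemma (in calg) mult_linear_l: "b \<in> carrier A \<Longrightarrow> is_linear A A (\<lambda>a. a \<otimes> b)"
  by (rule linI) (simp_all add: A.l_distr sm_mult_l)

text \<open>A linear map from the generators into an algebra is read as a representation of the free
  algebra on \<open>A\<close> by left multiplications; applying it to the unit gives the algebra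
  morphism.\<close>

locale alg_map = V: cvss V + A: calg A
  for V :: "('x, 'z) superspace_scheme" and A :: "'a superspace" +
  fixes \<theta> :: "'x \<Rightarrow> 'a"
  assumes \<theta>_linear: "is_linear V A \<theta>"
begin

lemmas \<theta>D = linD[OF \<theta>_linear]

abbreviation lm where "lm \<equiv> \<lambda>x a. \<theta> x \<otimes>\<^bsub>A\<^esub> a"

sublocale free_rep A "carrier V" lm
  by unfold_locales (rule A.mult_linear_r, simp add: \<theta>D)

lemma word_act_mult:
  "set (letters w) \<subseteq> carrier V \<Longrightarrow> a \<in> carrier A \<Longrightarrow> word_act w a = word_act w \<one>\<^bsub>A\<^esub> \<otimes>\<^bsub>A\<^esub> a"
proof -
  assume a: "a \<in> carrier A"
  have "foldr lm xs a = foldr lm xs \<one>\<^bsub>A\<^esub> \<otimes>\<^bsub>A\<^esub> a \<and> foldr lm xs \<one>\<^bsub>A\<^esub> \<in> carrier A" if "set xs \<subseteq> carrier V" for xs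
    using that by (induction xs) (simp_all add: a \<theta>D A.A.m_assoc)
  then show "set (letters w) \<subseteq> carrier V \<Longrightarrow> ?thesis" by (simp add: word_act_def)
qed

text \<open>Left multiplications commute with right multiplication by \<open>a\<close>, so the
  operator of \<open>P\<close> is determined by its value on the unit.\<close>

lemma ev_mult_right:
  assumes "P \<in> words_in (carrier V)" "a \<in> carrier A"
  shows "ev P a = ev P \<one>\<^bsub>A\<^esub> \<otimes>\<^bsub>A\<^esub> a"
  using assms(1)
proof (induction P rule: words_in_induct)
  case zero then show ?case using assms by simp
next
  case (single xs c)
  then show ?case using assms(2) word_act_mult[of "FWord xs" a] word_act_closed[of "FWord xs" "\<one>\<^bsub>A\<^esub>"]
    by (simp add: ev_single A.sm_mult_l)
next
  case (add P P')
  then show ?case using assms(2) ev_closed by (simp add: ev_add A.A.l_distr)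
qed

end

text \<open>By \<open>ev_mult_right\<close>, relations that vanish on the unit vanish as
  operators.\<close>

locale pres_map = presentation V R + alg_map V A \<theta>
  for V :: "('x, 'z) superspace_scheme" and R and A :: "'a superspace" and \<theta> +
  assumes \<theta>_rels: "r \<in> R \<Longrightarrow> ev r \<one>\<^bsub>A\<^esub> = \<zero>\<^bsub>A\<^esub>"
begin

sublocale pres_rep V R A lm
proof unfold_locales
  show "is_linear V A (\<lambda>x. \<theta> x \<otimes>\<^bsub>A\<^esub> m)" if "m \<in> carrier A" for m
    using that by (intro linI) (auto simp: \<theta>D A.A.l_distr A.sm_mult_l)
  show "ev r m = \<zero>\<^bsub>A\<^esub>" if "r \<in> R" "m \<in> carrier A" for r m
    using that ev_mult_right[of r m] \<theta>_rels[of r] R_words by auto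
qed

abbreviation "ext \<equiv> alg_ext A \<theta>"

lemma ext_cl: "P \<in> W \<Longrightarrow> ext (cl P) = ev P \<one>\<^bsub>A\<^esub>"
  by (simp add: alg_ext_def act_cl)

lemma ext_linear: "is_linear Pr A ext"
  using act_linear1[of "\<one>\<^bsub>A\<^esub>"] by (simp add: alg_ext_def[abs_def])

lemma ext_one: "ext \<one>\<^bsub>Pr\<^esub> = \<one>\<^bsub>A\<^esub>"
  by (simp add: alg_ext_def act_one)

lemma ext_gen: "x \<in> carrier V \<Longrightarrow> ext (cl (gen x)) = \<theta> x"
  by (simp add: alg_ext_def act_gen \<theta>D)

lemma ext_mult: "U \<in> carrier Pr \<Longrightarrow> U' \<in> carrier Pr \<Longrightarrow> ext (U \<otimes>\<^bsub>Pr\<^esub> U') = ext U \<otimes>\<^bsub>A\<^esub> ext U'"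
  by (auto elim!: cl_cases simp: cl_mult ext_cl ev_mult ev_closed ev_mult_right[of _ "ev _ _"])

end

subsection \<open>The grading of a presented algebra\<close>

lemma weighted_words_induct [consumes 1, case_names zero single add]:
  assumes "P \<in> weighted_words V d q" "Q 0"
    "\<And>xs ps c. list_all2 (\<lambda>x p. x \<in> hpart V p) xs ps \<Longrightarrow> sum_list (map d ps) = q \<Longrightarrow>
       Q (Poly_Mapping.single (FWord xs) c)"
    "\<And>P P'. P \<in> weighted_words V d q \<Longrightarrow> P' \<in> weighted_words V d q \<Longrightarrow> Q P \<Longrightarrow> Q P' \<Longrightarrow> Q (P + P')"
  shows "Q P"
proof -
  let ?S = "{w. \<exists>ps. list_all2 (\<lambda>x p. x \<in> hpart V p) (letters w) ps \<and> sum_list (map d ps) = q}"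
  have S: "P \<in> weighted_words V d q \<longleftrightarrow> Poly_Mapping.keys P \<subseteq> ?S" for P
    by (auto simp: weighted_words_def)
  have "Poly_Mapping.keys P \<subseteq> ?S" using assms(1) by (simp add: S)
  then show ?thesis
  proof (induction P rule: poly_mapping_span_induct)
    case (single k c) then show ?case using assms(3)[of "letters k"] by auto
  qed (use assms in \<open>auto simp: S\<close>)
qed

lemma weighted_words_single:
  "list_all2 (\<lambda>x p. x \<in> hpart V p) xs ps \<Longrightarrow> sum_list (map d ps) = q \<Longrightarrow>
    Poly_Mapping.single (FWord xs) c \<in> weighted_words V d q"
  by (auto simp: weighted_words_def split: if_splits)

lemma weighted_words_add [intro]:
  "P \<in> weighted_words V d q \<Longrightarrow> P' \<in> weighted_words V d q \<Longrightarrow> P + P' \<in> weighted_words V d q"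
  using keys_add[of P P'] by (auto simp: weighted_words_def)

lemma weighted_words_diff [intro]:
  "P \<in> weighted_words V d q \<Longrightarrow> P' \<in> weighted_words V d q \<Longrightarrow> P - P' \<in> weighted_words V d q"
  using keys_diff_subset[of P P'] by (auto simp: weighted_words_def)

lemma weighted_words_zero [simp]: "0 \<in> weighted_words V d q"
  by (simp add: weighted_words_def)

lemma weighted_words_mult [intro]:
  assumes "P \<in> weighted_words V d p" "Q \<in> weighted_words V d q"
  shows "P * Q \<in> weighted_words V d (p + q)"
  unfolding weighted_words_def
proof (intro CollectI ballI)
  fix w assume "w \<in> Poly_Mapping.keys (P * Q)"
  then obtain u v where w: "w = u + v" "u \<in> Poly_Mapping.keys P" "v \<in> Poly_Mapping.keys Q"
    using keys_mult[of P Q] by auto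
  obtain ps qs where "list_all2 (\<lambda>x p. x \<in> hpart V p) (letters u) ps" "sum_list (map d ps) = p"
    "list_all2 (\<lambda>x p. x \<in> hpart V p) (letters v) qs" "sum_list (map d qs) = q"
    using assms w unfolding weighted_words_def by blast
  then show "\<exists>ps. list_all2 (\<lambda>x p. x \<in> hpart V p) (letters w) ps \<and> sum_list (map d ps) = p + q"
    by (intro exI[of _ "ps @ qs"]) (auto simp: w plus_fword_def intro: list_all2_appendI)
qed

lemma weighted_words_const [simp]: "const c \<in> weighted_words V d 0"
  unfolding const_def zero_fword_def by (rule weighted_words_single[of _ _ "[]"]) auto

lemma weighted_words_gen: "x \<in> hpart V p \<Longrightarrow> gen x \<in> weighted_words V d (d p)"
  unfolding gen_def by (rule weighted_words_single[of _ _ "[p]"]) auto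

lemma weighted_words_const_mult [intro]:
  "P \<in> weighted_words V d q \<Longrightarrow> const c * P \<in> weighted_words V d q"
  using weighted_words_mult[OF weighted_words_const[of c], of P V d q] by simp

lemma foldr_mult_gen:
  "Poly_Mapping.single (FWord (x # xs)) (1::complex) = gen x * Poly_Mapping.single (FWord xs) 1"
  by (simp add: gen_def mult_single plus_fword_def)

lemma single_Nil: "Poly_Mapping.single (FWord []) (1::complex) = 1"
  by (metis single_one zero_fword_def)

lemma hom_parity:
  assumes "sspace V" "sspace W" "is_linear V W \<phi>" "\<And>p x. x \<in> hpart V p \<Longrightarrow> \<phi> x \<in> hpart W p"
    "x \<in> carrier V"
  shows "\<phi> (parity V p x) = parity W p (\<phi> x)"
proof -
  interpret V: sspace V by fact
  interpret W: sspace W by fact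
  show ?thesis
    using assms(5)
  proof (rule V.hpart_cases)
    show "\<phi> (parity V p x) = parity W p (\<phi> x)" if "x \<in> hpart V q" for q x
      using that assms(4)[OF that] V.hpartD(7)[OF that] linD(3)[OF assms(3)]
      by (simp add: V.parity_hom W.parity_hom)
  qed (simp add: V.parity_add W.parity_add linD[OF assms(3)])
qed

locale graded_presentation = presentation V R + sspace V for V :: "('x, 'z) superspace_scheme" and R +
  assumes R_graded: "r \<in> R \<Longrightarrow> \<exists>q. r \<in> weighted_words V (\<lambda>p. p) q"
begin

abbreviation "wt \<equiv> weighted_words V (\<lambda>p. p)"

lemma list_hpart: "list_all2 (\<lambda>x p. x \<in> hpart V p) xs ps \<Longrightarrow> set xs \<subseteq> carrier V"
  by (induction rule: list_all2_induct) (auto simp: hpartD(7))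

lemma wt_words: "wt q \<subseteq> W"
  using list_hpart by (auto simp: weighted_words_def words_in_def) blast

lemma hpart_Pr: "hpart Pr q = cl ` wt q"
  by (simp add: pres_def Let_def)

interpretation Pr: calg Pr by (rule calg_Pr)

text \<open>The sign involution, given on generators. Homogeneous relations are sent to multiples of
  their own classes, so it descends to \<open>Pr\<close> and acts by \<open>koszul 1 q\<close> on
  the part of parity \<open>q\<close>; this is the map that \<open>sspaceI\<close> asks for.\<close>

interpretation par: alg_map V Pr "\<lambda>x. cl (gen (parity V 1 x))"
  by unfold_locales (rule linI; simp add: parity_add parity_sm linD[OF gen_linear])

lemma par_ev: assumes "P \<in> wt q" shows "par.ev P \<one>\<^bsub>Pr\<^esub> = koszul 1 q \<odot>\<^bsub>Pr\<^esub> cl P"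
  using assms
proof (induction P rule: weighted_words_induct)
  case zero then show ?case by (simp add: cl_zero[symmetric])
next
  case (single xs ps c)
  from single(1) have "foldr par.lm xs \<one>\<^bsub>Pr\<^esub> =
      koszul 1 (sum_list ps) \<odot>\<^bsub>Pr\<^esub> cl (Poly_Mapping.single (FWord xs) 1)"
  proof (induction rule: list_all2_induct)
    case Nil then show ?case by (simp add: single_Nil cl_one[symmetric])
  next
    case (Cons x xs p ps)
    have x: "x \<in> carrier V" using Cons hpartD(7) by auto
    have w: "Poly_Mapping.single (FWord xs) 1 \<in> W" using list_hpart[OF Cons(2)] by (simp add: words_in_single)
    have "cl (gen (parity V 1 x)) = koszul 1 p \<odot>\<^bsub>Pr\<^esub> cl (gen x)"
      using Cons(1) x by (simp add: parity_hom linD[OF gen_linear])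
    then show ?case using Cons x w
      by (simp add: Pr.sm_mult_l Pr.sm_mult_r foldr_mult_gen cl_mult[symmetric] koszul_add_r mult.commute)
  qed
  moreover have "Poly_Mapping.single (FWord xs) 1 \<in> W" "set xs \<subseteq> carrier V"
    using list_hpart[OF single(1)] by (simp_all add: words_in_single)
  moreover from this have "cl (Poly_Mapping.single (FWord xs) c) = c \<odot>\<^bsub>Pr\<^esub> cl (Poly_Mapping.single (FWord xs) 1)"
    using cl_smult[of "Poly_Mapping.single (FWord xs) 1" c] by (simp add: const_mult)
  ultimately show ?case using single by (simp add: par.ev_single par.word_act_def mult.commute)
next
  case (add P P')
  then have "P \<in> W" "P' \<in> W" using wt_words by auto
  then show ?case using add by (simp add: par.ev_add Pr.sm_add_r cl_add[symmetric])
qed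

interpretation par: pres_map V R Pr "\<lambda>x. cl (gen (parity V 1 x))"
proof unfold_locales
  fix r assume r: "r \<in> R"
  then obtain q where "r \<in> wt q" using R_graded by blast
  then show "par.ev r \<one>\<^bsub>Pr\<^esub> = \<zero>\<^bsub>Pr\<^esub>" using par_ev[of r q] cl_rel[of r] r by (simp add: cl_zero[symmetric])
qed

lemma hpart_Pr_submodule: "submodule (hpart Pr q) CC Pr"
proof (rule Pr.submoduleI')
  show "hpart Pr q \<subseteq> carrier Pr" using wt_words by (auto simp: hpart_Pr)
  show "\<zero>\<^bsub>Pr\<^esub> \<in> hpart Pr q" by (auto simp: hpart_Pr cl_zero)
  show "x \<oplus>\<^bsub>Pr\<^esub> y \<in> hpart Pr q" if "x \<in> hpart Pr q" "y \<in> hpart Pr q" for x y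
    using that wt_words[of q] by (auto simp: hpart_Pr cl_add subset_iff)
  show "c \<odot>\<^bsub>Pr\<^esub> x \<in> hpart Pr q" if "x \<in> hpart Pr q" for c x
    using that wt_words[of q] by (auto simp: hpart_Pr cl_smult subset_iff)
qed

lemma mult_hpart_Pr: "U \<in> hpart Pr p \<Longrightarrow> U' \<in> hpart Pr q \<Longrightarrow> U \<otimes>\<^bsub>Pr\<^esub> U' \<in> hpart Pr (p + q)"
  using wt_words[of p] wt_words[of q] by (auto simp: hpart_Pr cl_mult subset_iff)

lemma gen_hpart: "x \<in> hpart V p \<Longrightarrow> cl (gen x) \<in> hpart Pr p"
  using weighted_words_gen[of x V p "\<lambda>p. p"] by (simp add: hpart_Pr)

lemma one_hpart_Pr: "\<one>\<^bsub>Pr\<^esub> \<in> hpart Pr 0"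
  using weighted_words_const[of 1 V "\<lambda>p. p"] by (simp add: hpart_Pr cl_one del: weighted_words_const)

text \<open>A generator splits into an even and an odd component, and the four products with the
  components of \<open>U\<close> are sorted by total parity.\<close>

lemma decomp_Pr: "U \<in> carrier Pr \<Longrightarrow> \<exists>U0\<in>hpart Pr 0. \<exists>U1\<in>hpart Pr 1. U = U0 \<oplus>\<^bsub>Pr\<^esub> U1"
proof (induction U rule: Pr_induct)
  note H = Pr.submoduleD[OF hpart_Pr_submodule]
  case (add U U')
  then obtain a b a' b' where "a \<in> hpart Pr 0" "b \<in> hpart Pr 1" "U = a \<oplus>\<^bsub>Pr\<^esub> b"
    "a' \<in> hpart Pr 0" "b' \<in> hpart Pr 1" "U' = a' \<oplus>\<^bsub>Pr\<^esub> b'" by blast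
  moreover from this have "U \<oplus>\<^bsub>Pr\<^esub> U' = (a \<oplus>\<^bsub>Pr\<^esub> a') \<oplus>\<^bsub>Pr\<^esub> (b \<oplus>\<^bsub>Pr\<^esub> b')"
    using H(7) by (simp add: Pr.M.a_ac)
  ultimately show ?case using H(3) by blast
next
  note H = Pr.submoduleD[OF hpart_Pr_submodule]
  case (smult c U)
  then obtain a b where "a \<in> hpart Pr 0" "b \<in> hpart Pr 1" "U = a \<oplus>\<^bsub>Pr\<^esub> b" by blast
  moreover from this have "c \<odot>\<^bsub>Pr\<^esub> U = c \<odot>\<^bsub>Pr\<^esub> a \<oplus>\<^bsub>Pr\<^esub> c \<odot>\<^bsub>Pr\<^esub> b"
    using H(7) by (simp add: Pr.sm_add_r)
  ultimately show ?case using H(4) by blast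
next
  case one
  then show ?case using one_hpart_Pr Pr.submoduleD(2)[OF hpart_Pr_submodule, of 1] by force
next
  note H = Pr.submoduleD[OF hpart_Pr_submodule]
  case (gen x U)
  then obtain a b where ab: "a \<in> hpart Pr 0" "b \<in> hpart Pr 1" "U = a \<oplus>\<^bsub>Pr\<^esub> b" by blast
  let ?g = "\<lambda>p. cl (gen (hproj V p x))"
  have g: "?g p \<in> hpart Pr p" for p using gen by (intro gen_hpart) auto
  have "cl (gen x) = ?g 0 \<oplus>\<^bsub>Pr\<^esub> ?g 1"
    using linD(2)[OF gen_linear, of "hproj V 0 x" "hproj V 1 x"] hproj_decomp[of x] gen by simp
  then have "cl (gen x) \<otimes>\<^bsub>Pr\<^esub> U =
      (?g 0 \<otimes>\<^bsub>Pr\<^esub> a \<oplus>\<^bsub>Pr\<^esub> ?g 1 \<otimes>\<^bsub>Pr\<^esub> b) \<oplus>\<^bsub>Pr\<^esub> (?g 0 \<otimes>\<^bsub>Pr\<^esub> b \<oplus>\<^bsub>Pr\<^esub> ?g 1 \<otimes>\<^bsub>Pr\<^esub> a)"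
    using ab g[THEN H(7)] H(7)[OF ab(1)] H(7)[OF ab(2)]
    by (simp add: Pr.A.l_distr Pr.A.r_distr Pr.M.a_ac)
  moreover have "?g 0 \<otimes>\<^bsub>Pr\<^esub> a \<oplus>\<^bsub>Pr\<^esub> ?g 1 \<otimes>\<^bsub>Pr\<^esub> b \<in> hpart Pr 0"
    using mult_hpart_Pr[OF g[of 0] ab(1)] mult_hpart_Pr[OF g[of 1] ab(2)] H(3) by simp
  moreover have "?g 0 \<otimes>\<^bsub>Pr\<^esub> b \<oplus>\<^bsub>Pr\<^esub> ?g 1 \<otimes>\<^bsub>Pr\<^esub> a \<in> hpart Pr 1"
    using mult_hpart_Pr[OF g[of 0] ab(2)] mult_hpart_Pr[OF g[of 1] ab(1)] H(3) by simp
  ultimately show ?case by blast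
qed

lemma superalg_Pr: "superalg Pr"
proof -
  have "sspace Pr"
  proof (rule sspaceI)
    show "carrier Pr \<subseteq> hpart Pr 0 <+>\<^bsub>Pr\<^esub> hpart Pr 1"
      using decomp_Pr by (fastforce simp: set_add_def set_mult_def)
    show "is_linear Pr Pr par.ext" by (rule par.ext_linear)
    show "par.ext x = koszul 1 p \<odot>\<^bsub>Pr\<^esub> x" if "x \<in> hpart Pr p" for p x
      using that par_ev wt_words[of p] by (auto simp: hpart_Pr par.ext_cl subset_iff)
  qed (use hpart_Pr_submodule Pr.cvs_axioms in auto)
  then show ?thesis using calg_Pr
    by (intro superalg.intro superalg_axioms.intro) (auto intro: one_hpart_Pr mult_hpart_Pr)
qed

text \<open>Each homogeneous part is spanned by words in homogeneous letters, so the parities can be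
  added up letter by letter.\<close>

lemma hpart_Pr_induct [consumes 1, case_names zero add smult word]:
  assumes "U \<in> hpart Pr q" "Q \<zero>\<^bsub>Pr\<^esub>"
    "\<And>U U'. U \<in> hpart Pr q \<Longrightarrow> U' \<in> hpart Pr q \<Longrightarrow> Q U \<Longrightarrow> Q U' \<Longrightarrow> Q (U \<oplus>\<^bsub>Pr\<^esub> U')"
    "\<And>c U. U \<in> hpart Pr q \<Longrightarrow> Q U \<Longrightarrow> Q (c \<odot>\<^bsub>Pr\<^esub> U)"
    "\<And>xs ps. list_all2 (\<lambda>x p. x \<in> hpart V p) xs ps \<Longrightarrow> sum_list ps = q \<Longrightarrow>
       Q (foldr (\<lambda>x a. cl (gen x) \<otimes>\<^bsub>Pr\<^esub> a) xs \<one>\<^bsub>Pr\<^esub>)"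
  shows "Q U"
proof -
  have w: "foldr (\<lambda>x a. cl (gen x) \<otimes>\<^bsub>Pr\<^esub> a) xs \<one>\<^bsub>Pr\<^esub> = cl (Poly_Mapping.single (FWord xs) 1)"
    if "set xs \<subseteq> carrier V" for xs
    using that by (induction xs) (simp_all add: single_Nil cl_one foldr_mult_gen cl_mult words_in_single)
  obtain P where P: "P \<in> wt q" "U = cl P" using assms(1) by (auto simp: hpart_Pr)
  from P(1) have "Q (cl P)"
  proof (induction P rule: weighted_words_induct)
    case zero then show ?case using assms(2) by (simp add: cl_zero)
  next
    case (single xs ps c)
    note xs = list_hpart[OF single(1)]
    have "cl (Poly_Mapping.single (FWord xs) 1) \<in> hpart Pr q"
      unfolding hpart_Pr by (intro imageI weighted_words_single[OF single])
    then have "Q (c \<odot>\<^bsub>Pr\<^esub> cl (Poly_Mapping.single (FWord xs) 1))"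
      using assms(4) assms(5)[OF single(1)] single(2) w[OF xs] by simp
    then show ?case using cl_smult[of "Poly_Mapping.single (FWord xs) 1" c] xs
      by (simp add: const_mult words_in_single)
  next
    case (add P P')
    then show ?case using assms(3)[of "cl P" "cl P'"] wt_words[of q] by (auto simp: hpart_Pr cl_add subset_iff)
  qed
  then show ?thesis using P by simp
qed

end

lemma (in pres_rep) act_hpart:
  assumes "graded_presentation V R" "sspace M"
    "\<And>p q x m. x \<in> hpart V p \<Longrightarrow> m \<in> hpart M q \<Longrightarrow> \<rho> x m \<in> hpart M (p + q)"
    "U \<in> hpart Pr p" "m \<in> hpart M q"
  shows "act U m \<in> hpart M (p + q)"
proof -
  interpret G: graded_presentation V R by fact
  interpret Mg: sspace M by fact
  interpret P: superalg Pr by (rule G.superalg_Pr)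
  note H = P.hpartD(7)
  have m: "m \<in> carrier M" using assms(5) by (rule Mg.hpartD)
  from assms(4) show ?thesis
  proof (induction U rule: G.hpart_Pr_induct)
    case zero
    then show ?case using cvs2.lin_zero[OF cvs2.intro act_linear1[OF m]] Mg.hpartD(2)
      by (simp add: P.cvs_axioms M.cvs_axioms)
  next
    case (word xs ps)
    from word(1) have "act (foldr (\<lambda>x a. cl (gen x) \<otimes>\<^bsub>Pr\<^esub> a) xs \<one>\<^bsub>Pr\<^esub>) m \<in> hpart M (sum_list ps + q)
      \<and> foldr (\<lambda>x a. cl (gen x) \<otimes>\<^bsub>Pr\<^esub> a) xs \<one>\<^bsub>Pr\<^esub> \<in> carrier Pr"
    proof (induction rule: list_all2_induct)
      case (Cons x xs p ps)
      have "x \<in> carrier V" using Cons(1) G.hpartD(7) by auto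
      then show ?case using Cons m assms(3) by (simp add: act_mult act_gen add.assoc)
    qed (simp add: act_one m assms(5))
    then show ?case using word by simp
  qed (use H m in \<open>auto simp: linD[OF act_linear1] Mg.hpartD\<close>)
qed

section \<open>Tensor products\<close>

lemma pair_space_simps [simp]:
  "carrier (pair_space V W) = {P. Poly_Mapping.keys P \<subseteq> carrier V \<times> carrier W}"
  "zero (pair_space V W) = 0" "add (pair_space V W) = (+)"
  "smult (pair_space V W) = (\<lambda>c. Poly_Mapping.map ((*) c))"
  by (simp_all add: pair_space_def)

lemma cvss_pair_space: "cvss (pair_space V W)"
proof (rule cvss.intro, rule cvsI)
  fix a b :: complex and x y :: "'a \<times> 'b \<Rightarrow>\<^sub>0 complex"
  show "a \<odot>\<^bsub>pair_space V W\<^esub> x \<in> carrier (pair_space V W)" if "x \<in> carrier (pair_space V W)"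
    using that keys_map_times[of a x] by auto
  show "x \<oplus>\<^bsub>pair_space V W\<^esub> y \<in> carrier (pair_space V W)"
    if "x \<in> carrier (pair_space V W)" "y \<in> carrier (pair_space V W)"
    using that keys_add[of x y] by auto
qed (auto intro!: poly_mapping_eqI simp: lookup_map_times lookup_add algebra_simps)

lemma pair_in [simp]: "a \<in> carrier V \<Longrightarrow> b \<in> carrier W \<Longrightarrow> pair a b \<in> carrier (pair_space V W)"
  by (simp add: pair_def)

lemma (in cvss) finsum_bit:
  fixes g :: "bit \<Rightarrow> _"
  assumes "\<And>p. g p \<in> carrier V"
  shows "(\<Oplus>p\<in>{0, 1}. g p) = g 0 \<oplus> g 1"
  using assms by (subst M.finsum_insert) (auto simp: M.finsum_singleton)

lemma (in cvss) lc_fun_add: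
  assumes "Poly_Mapping.keys P \<subseteq> S" "\<And>k. k \<in> S \<Longrightarrow> F k \<in> carrier V" "\<And>k. k \<in> S \<Longrightarrow> F' k \<in> carrier V"
    "\<And>k. k \<in> S \<Longrightarrow> F'' k = F k \<oplus> F' k"
  shows "lc V F'' P = lc V F P \<oplus> lc V F' P"
proof -
  have "lc V F'' P = (\<Oplus>k\<in>Poly_Mapping.keys P.
      Poly_Mapping.lookup P k \<odot> F k \<oplus> Poly_Mapping.lookup P k \<odot> F' k)"
    unfolding lc_def by (rule M.add.finprod_cong) (use assms in \<open>auto simp: sm_add_r simp_implies_def subset_iff\<close>)
  also have "\<dots> = lc V F P \<oplus> lc V F' P"
    unfolding lc_def by (rule M.finsum_addf) (use assms in auto)
  finally show ?thesis .
qed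

lemma (in cvss) lc_fun_scale:
  assumes "Poly_Mapping.keys P \<subseteq> S" "\<And>k. k \<in> S \<Longrightarrow> F k \<in> carrier V"
    "\<And>k. k \<in> S \<Longrightarrow> F' k = c \<odot> F k"
  shows "lc V F' P = c \<odot> lc V F P"
proof -
  have "lc V F' P = (\<Oplus>k\<in>Poly_Mapping.keys P. c \<odot> (Poly_Mapping.lookup P k \<odot> F k))"
    unfolding lc_def by (rule M.add.finprod_cong) (use assms in \<open>auto simp: simp_implies_def subset_iff mult.commute\<close>)
  also have "\<dots> = c \<odot> lc V F P"
    unfolding lc_def by (rule sm_finsum[symmetric]) (use assms in auto)
  finally show ?thesis .
qed

locale tensor_space = V: cvss V + W: cvss W
  for V :: "('a, 'y) superspace_scheme" and W :: "('b, 'z) superspace_scheme"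
begin

abbreviation "Ps \<equiv> pair_space V W"
abbreviation "Tn \<equiv> tensor V W"

sublocale Ps: cvss Ps by (rule cvss_pair_space)

text \<open>Names the spanning set inside \<open>bilinear_rels\<close>, so that minimality of the
  span can be applied to it.\<close>

definition bilinear_gens :: "('a \<times> 'b \<Rightarrow>\<^sub>0 complex) set" where
  "bilinear_gens = {pair (a \<oplus>\<^bsub>V\<^esub> a') b - pair a b - pair a' b
        | a a' b. a \<in> carrier V \<and> a' \<in> carrier V \<and> b \<in> carrier W} \<union>
     {pair a (b \<oplus>\<^bsub>W\<^esub> b') - pair a b - pair a b'
        | a b b'. a \<in> carrier V \<and> b \<in> carrier W \<and> b' \<in> carrier W} \<union>
     {pair (c \<odot>\<^bsub>V\<^esub> a) b - Poly_Mapping.map ((*) c) (pair a b)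
        | c a b. a \<in> carrier V \<and> b \<in> carrier W} \<union>
     {pair a (c \<odot>\<^bsub>W\<^esub> b) - Poly_Mapping.map ((*) c) (pair a b)
        | c a b. a \<in> carrier V \<and> b \<in> carrier W}"

lemma bilinear_rels_eq: "bilinear_rels V W = lspan Ps bilinear_gens"
  by (simp add: bilinear_rels_def bilinear_gens_def)

lemma minus_Ps: "x \<in> carrier Ps \<Longrightarrow> y \<in> carrier Ps \<Longrightarrow> x \<ominus>\<^bsub>Ps\<^esub> y = x - y"
  using Ps.diff_sm[of x y] by (simp add: Ps.map_times_minus_one)

lemma diff_in_Ps: "x \<in> carrier Ps \<Longrightarrow> y \<in> carrier Ps \<Longrightarrow> x - y \<in> carrier Ps"
  using Ps.M.minus_closed[of x y] minus_Ps[of x y] by metis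

lemma bilinear_gens_closed: "bilinear_gens \<subseteq> carrier Ps"
proof -
  have "Poly_Mapping.map ((*) c) (pair a b) \<in> carrier Ps" if "a \<in> carrier V" "b \<in> carrier W" for c a b
    using Ps.sm_closed[OF pair_in[OF that], of c] by simp
  then show ?thesis unfolding bilinear_gens_def
    by (auto simp del: pair_space_simps(1) intro!: diff_in_Ps pair_in)
qed

sublocale Q: quot Ps "bilinear_rels V W"
  by (rule quot.intro[OF cvss_pair_space], rule quot_axioms.intro)
     (unfold bilinear_rels_eq, rule Ps.lspan_submodule[OF bilinear_gens_closed])

abbreviation "cls \<equiv> \<lambda>P. bilinear_rels V W +>\<^bsub>Ps\<^esub> P"
abbreviation "tn \<equiv> tens V W"

lemma cvss_Tn: "cvss Tn"
  unfolding tensor_def by (rule cvss.intro) (rule Q.cvs_Q)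

sublocale Tn: cvss Tn by (rule cvss_Tn)

lemma cls_linear: "is_linear Ps Tn cls"
  unfolding tensor_def by (rule Q.cls_linear)

lemma carrier_Tn: "carrier Tn = cls ` carrier Ps"
  unfolding tensor_def by (rule Q.carrier_Q)

lemma tn_closed [simp, intro]: "a \<in> carrier V \<Longrightarrow> b \<in> carrier W \<Longrightarrow> tn a b \<in> carrier Tn"
  by (simp add: carrier_Tn tens_def del: pair_space_simps)

lemma cls_gen_eq:
  assumes "x - y \<in> bilinear_gens" "x \<in> carrier Ps" "y \<in> carrier Ps" shows "cls x = cls y"
  using assms Ps.lspan_superset[of bilinear_gens]
  by (subst Q.cls_eq_iff) (auto simp: minus_Ps bilinear_rels_eq simp del: pair_space_simps)

lemma tn_add_l: "a \<in> carrier V \<Longrightarrow> a' \<in> carrier V \<Longrightarrow> b \<in> carrier W \<Longrightarrow> tn (a \<oplus>\<^bsub>V\<^esub> a') b = tn a b \<oplus>\<^bsub>Tn\<^esub> tn a' b"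
proof -
  assume a: "a \<in> carrier V" "a' \<in> carrier V" "b \<in> carrier W"
  have "cls (pair (a \<oplus>\<^bsub>V\<^esub> a') b) = cls (pair a b \<oplus>\<^bsub>Ps\<^esub> pair a' b)"
  proof (rule cls_gen_eq)
    show "pair (a \<oplus>\<^bsub>V\<^esub> a') b - (pair a b \<oplus>\<^bsub>Ps\<^esub> pair a' b) \<in> bilinear_gens"
      using a by (auto simp: bilinear_gens_def diff_diff_eq)
  qed (use a in \<open>auto intro: Ps.M.a_closed simp del: pair_space_simps\<close>)
  then show ?thesis using a linD(2)[OF cls_linear, of "pair a b" "pair a' b"]
    by (simp add: tens_def del: pair_space_simps)
qed

lemma tn_add_r: "a \<in> carrier V \<Longrightarrow> b \<in> carrier W \<Longrightarrow> b' \<in> carrier W \<Longrightarrow> tn a (b \<oplus>\<^bsub>W\<^esub> b') = tn a b \<oplus>\<^bsub>Tn\<^esub> tn a b'"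
proof -
  assume a: "a \<in> carrier V" "b \<in> carrier W" "b' \<in> carrier W"
  have "cls (pair a (b \<oplus>\<^bsub>W\<^esub> b')) = cls (pair a b \<oplus>\<^bsub>Ps\<^esub> pair a b')"
  proof (rule cls_gen_eq)
    show "pair a (b \<oplus>\<^bsub>W\<^esub> b') - (pair a b \<oplus>\<^bsub>Ps\<^esub> pair a b') \<in> bilinear_gens"
      using a by (auto simp: bilinear_gens_def diff_diff_eq)
  qed (use a in \<open>auto intro: Ps.M.a_closed simp del: pair_space_simps\<close>)
  then show ?thesis using a linD(2)[OF cls_linear, of "pair a b" "pair a b'"]
    by (simp add: tens_def del: pair_space_simps)
qed

lemma tn_sm_l: "a \<in> carrier V \<Longrightarrow> b \<in> carrier W \<Longrightarrow> tn (c \<odot>\<^bsub>V\<^esub> a) b = c \<odot>\<^bsub>Tn\<^esub> tn a b"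
proof -
  assume a: "a \<in> carrier V" "b \<in> carrier W"
  have "pair (c \<odot>\<^bsub>V\<^esub> a) b - c \<odot>\<^bsub>Ps\<^esub> pair a b \<in> bilinear_gens"
    using a by (auto simp: bilinear_gens_def)
  then have "cls (pair (c \<odot>\<^bsub>V\<^esub> a) b) = cls (c \<odot>\<^bsub>Ps\<^esub> pair a b)"
    by (rule cls_gen_eq) (use a in \<open>simp_all del: pair_space_simps\<close>)
  then show ?thesis using a linD(3)[OF cls_linear, of "pair a b"]
    by (simp add: tens_def del: pair_space_simps)
qed

lemma tn_sm_r: "a \<in> carrier V \<Longrightarrow> b \<in> carrier W \<Longrightarrow> tn a (c \<odot>\<^bsub>W\<^esub> b) = c \<odot>\<^bsub>Tn\<^esub> tn a b"
proof -
  assume a: "a \<in> carrier V" "b \<in> carrier W"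
  have "pair a (c \<odot>\<^bsub>W\<^esub> b) - c \<odot>\<^bsub>Ps\<^esub> pair a b \<in> bilinear_gens"
    using a by (auto simp: bilinear_gens_def)
  then have "cls (pair a (c \<odot>\<^bsub>W\<^esub> b)) = cls (c \<odot>\<^bsub>Ps\<^esub> pair a b)"
    by (rule cls_gen_eq) (use a in \<open>simp_all del: pair_space_simps\<close>)
  then show ?thesis using a linD(3)[OF cls_linear, of "pair a b"]
    by (simp add: tens_def del: pair_space_simps)
qed

lemma tn_linear_l: "b \<in> carrier W \<Longrightarrow> is_linear V Tn (\<lambda>a. tn a b)"
  by (rule linI) (simp_all add: tn_add_l tn_sm_l)

lemma tn_linear_r: "a \<in> carrier V \<Longrightarrow> is_linear W Tn (\<lambda>b. tn a b)"
  by (rule linI) (simp_all add: tn_add_r tn_sm_r)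

lemma tn_zero_l [simp]: "b \<in> carrier W \<Longrightarrow> tn \<zero>\<^bsub>V\<^esub> b = \<zero>\<^bsub>Tn\<^esub>"
  using tn_sm_l[of "\<zero>\<^bsub>V\<^esub>" b 0] by simp

lemma tn_zero_r [simp]: "a \<in> carrier V \<Longrightarrow> tn a \<zero>\<^bsub>W\<^esub> = \<zero>\<^bsub>Tn\<^esub>"
  using tn_sm_r[of a "\<zero>\<^bsub>W\<^esub>" 0] by simp

lemma cls_single:
  "a \<in> carrier V \<Longrightarrow> b \<in> carrier W \<Longrightarrow> cls (Poly_Mapping.single (a, b) c) = c \<odot>\<^bsub>Tn\<^esub> tn a b"
  using linD(3)[OF cls_linear pair_in, of a b c] by (simp add: pair_def tens_def)

lemma Tn_induct [consumes 1, case_names add smult tens]: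
  assumes "t \<in> carrier Tn"
    "\<And>t t'. t \<in> carrier Tn \<Longrightarrow> t' \<in> carrier Tn \<Longrightarrow> Q t \<Longrightarrow> Q t' \<Longrightarrow> Q (t \<oplus>\<^bsub>Tn\<^esub> t')"
    "\<And>c t. t \<in> carrier Tn \<Longrightarrow> Q t \<Longrightarrow> Q (c \<odot>\<^bsub>Tn\<^esub> t)"
    "\<And>a b. a \<in> carrier V \<Longrightarrow> b \<in> carrier W \<Longrightarrow> Q (tn a b)"
  shows "Q t"
proof -
  obtain P where P: "P \<in> carrier Ps" "t = cls P" using assms(1) by (auto simp: carrier_Tn)
  from P(1) have "Poly_Mapping.keys P \<subseteq> carrier V \<times> carrier W" by simp
  then have "Q (cls P)"
  proof (induction P rule: poly_mapping_span_induct)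
    case zero
    have "Q (0 \<odot>\<^bsub>Tn\<^esub> tn \<zero>\<^bsub>V\<^esub> \<zero>\<^bsub>W\<^esub>)" by (intro assms) auto
    moreover have "cls 0 = \<zero>\<^bsub>Tn\<^esub>" using Q.cls_zero by (simp add: tensor_def)
    ultimately show ?case by simp
  next
    case (single k c)
    then show ?case using assms(3,4) by (auto simp: cls_single)
  next
    case (add P P')
    then show ?case using linD(2)[OF cls_linear, of P P'] linD(1)[OF cls_linear] assms(2)[of "cls P" "cls P'"] by simp
  qed
  then show ?thesis using P by simp
qed

end

text \<open>Universal property of the tensor product. The linear extension of a bilinear
  \<open>F\<close> vanishes on the bilinear relations, so \<open>lift\<close> may use any
  representative of a coset.\<close>

locale bilinear_map = tensor_space V W + Z: cvss Z
  for V :: "('a, 'y) superspace_scheme" and W :: "('b, 'z) superspace_scheme"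
    and Z :: "('c, 'w) superspace_scheme" +
  fixes F :: "'a \<times> 'b \<Rightarrow> 'c"
  assumes F1: "b \<in> carrier W \<Longrightarrow> is_linear V Z (\<lambda>a. F (a, b))"
    and F2: "a \<in> carrier V \<Longrightarrow> is_linear W Z (\<lambda>b. F (a, b))"
begin

lemma F_closed: "k \<in> carrier V \<times> carrier W \<Longrightarrow> F k \<in> carrier Z"
  using linD(1)[OF F1] by auto

lemma lc_F_linear: "is_linear Ps Z (lc Z F)"
  by (rule linI) (use F_closed in \<open>auto intro!: Z.lc_closed[of _ "carrier V \<times> carrier W"]
     Z.lc_add[of _ "carrier V \<times> carrier W"] Z.lc_scale[of _ "carrier V \<times> carrier W"]\<close>)

lemma lc_F_pair: "a \<in> carrier V \<Longrightarrow> b \<in> carrier W \<Longrightarrow> lc Z F (pair a b) = F (a, b)"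
  using F_closed[of "(a, b)"] by (simp add: pair_def Z.lc_single)

lemma lc_F_rels: "r \<in> bilinear_rels V W \<Longrightarrow> lc Z F r = \<zero>\<^bsub>Z\<^esub>"
proof -
  interpret cvs2 Ps Z by unfold_locales
  note L = lin_diff[OF lc_F_linear, unfolded minus_Ps]
  have diff: "lc Z F (x - y) = lc Z F x \<ominus>\<^bsub>Z\<^esub> lc Z F y" if "x \<in> carrier Ps" "y \<in> carrier Ps" for x y
    using lin_diff[OF lc_F_linear that] minus_Ps[OF that] by simp
  have sm: "lc Z F (Poly_Mapping.map ((*) c) x) = c \<odot>\<^bsub>Z\<^esub> lc Z F x" "Poly_Mapping.map ((*) c) x \<in> carrier Ps"
    if "x \<in> carrier Ps" for c x
    using linD(3)[OF lc_F_linear that, of c] Ps.sm_closed[OF that, of c] by simp_all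
  have "lc Z F r = \<zero>\<^bsub>Z\<^esub>" if "r \<in> bilinear_gens" for r
    using that F_closed unfolding bilinear_gens_def
    by (auto simp: diff sm lc_F_pair diff_in_Ps linD[OF F1] linD[OF F2] Z.add_diff Z.diff_eq_zero_iff
        simp del: pair_space_simps)
  then have "bilinear_gens \<subseteq> {x \<in> carrier Ps. lc Z F x = \<zero>\<^bsub>Z\<^esub>}" using bilinear_gens_closed by auto
  from Ps.lspan_minimal[OF lin_kernel_submodule[OF lc_F_linear] this]
  show "r \<in> bilinear_rels V W \<Longrightarrow> ?thesis" by (auto simp: bilinear_rels_eq)
qed

lemma lc_F_cls: 
  assumes "x \<in> carrier Ps" "y \<in> carrier Ps" "cls x = cls y" shows "lc Z F x = lc Z F y"
proof -
  interpret cvs2 Ps Z by unfold_locales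
  have "lc Z F (x \<ominus>\<^bsub>Ps\<^esub> y) = \<zero>\<^bsub>Z\<^esub>" using assms by (intro lc_F_rels) (simp add: Q.cls_eq_iff del: pair_space_simps)
  then show ?thesis using assms linD(1)[OF lc_F_linear]
    by (simp add: lin_diff[OF lc_F_linear] Z.diff_eq_zero_iff del: pair_space_simps)
qed

definition lift :: "('a \<times> 'b \<Rightarrow>\<^sub>0 complex) set \<Rightarrow> 'c" where "lift t = lc Z F (SOME P. P \<in> t)"

lemma lift_cls: assumes "x \<in> carrier Ps" shows "lift (cls x) = lc Z F x"
proof -
  have "(SOME P. P \<in> cls x) \<in> cls x" using Q.cls_self[OF assms] by (rule someI)
  from Q.cls_memD[OF this assms] lc_F_cls assms show ?thesis unfolding lift_def by blast
qed

lemma lift_linear: "is_linear Tn Z lift"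
proof (rule linI)
  fix c and t assume t: "t \<in> carrier Tn"
  then obtain x where x: "x \<in> carrier Ps" "t = cls x" by (auto simp: carrier_Tn)
  then show "lift t \<in> carrier Z" using linD(1)[OF lc_F_linear x(1)] by (simp add: lift_cls del: pair_space_simps)
  have "lift (cls (c \<odot>\<^bsub>Ps\<^esub> x)) = lc Z F (c \<odot>\<^bsub>Ps\<^esub> x)" using x by (intro lift_cls Ps.sm_closed)
  then show "lift (c \<odot>\<^bsub>Tn\<^esub> t) = c \<odot>\<^bsub>Z\<^esub> lift t"
    using x linD(3)[OF lc_F_linear x(1)] linD(3)[OF cls_linear x(1)] by (simp add: lift_cls del: pair_space_simps)
next
  fix t t' assume "t \<in> carrier Tn" "t' \<in> carrier Tn"
  then obtain x x' where x: "x \<in> carrier Ps" "t = cls x" "x' \<in> carrier Ps" "t' = cls x'" by (auto simp: carrier_Tn)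
  have "lift (cls (x \<oplus>\<^bsub>Ps\<^esub> x')) = lc Z F (x \<oplus>\<^bsub>Ps\<^esub> x')" using x by (intro lift_cls Ps.M.add.m_closed)
  then show "lift (t \<oplus>\<^bsub>Tn\<^esub> t') = lift t \<oplus>\<^bsub>Z\<^esub> lift t'"
    using x linD(2)[OF lc_F_linear x(1,3)] linD(2)[OF cls_linear x(1,3)] by (simp add: lift_cls del: pair_space_simps)
qed

lemma lift_tn: "a \<in> carrier V \<Longrightarrow> b \<in> carrier W \<Longrightarrow> lift (tn a b) = F (a, b)"
  using lift_cls[OF pair_in, of a b] by (simp add: lc_F_pair tens_def)

end

subsection \<open>The action of a tensor product\<close>

text \<open>The Koszul sign is read off from \<open>B\<close> and \<open>M\<close> alone, so
  \<open>N\<close> enters as a bare vector space. This admits the oscillator module, whose grading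
  by exterior degree differs from the one inherited from the Clifford algebra.\<close>

locale tensor_operation = A: cvss A + B: sspace B + M: sspace M + N: cvss N
  for A :: "('a, 'u) superspace_scheme" and B :: "('b, 'v) superspace_scheme"
    and M :: "('m, 'w) superspace_scheme" and N :: "('n, 'x) superspace_scheme" +
  fixes \<mu> :: "'a \<Rightarrow> 'm \<Rightarrow> 'm" and \<nu> :: "'b \<Rightarrow> 'n \<Rightarrow> 'n"
  assumes \<mu>1: "m \<in> carrier M \<Longrightarrow> is_linear A M (\<lambda>a. \<mu> a m)"
    and \<mu>2: "a \<in> carrier A \<Longrightarrow> is_linear M M (\<mu> a)"
    and \<nu>1: "n \<in> carrier N \<Longrightarrow> is_linear B N (\<lambda>b. \<nu> b n)"
    and \<nu>2: "b \<in> carrier B \<Longrightarrow> is_linear N N (\<nu> b)"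
begin

sublocale S: tensor_space A B by unfold_locales
sublocale T: tensor_space M N by unfold_locales

lemmas linears = linD[OF \<mu>1] linD[OF \<mu>2] linD[OF \<nu>1] linD[OF \<nu>2]

abbreviation "op \<equiv> tensor_op B M N \<mu> \<nu>"

text \<open>The class of \<open>pair_op\<close> on two pure tensors. The inner sum over the parity
  of the module element is absorbed: its signed components add up to
  \<open>parity M p\<close>.\<close>

definition op_pure :: "'a \<times> 'b \<Rightarrow> 'm \<times> 'n \<Rightarrow> ('m \<times> 'n \<Rightarrow>\<^sub>0 complex) set" where
  "op_pure k l = (\<Oplus>\<^bsub>T.Tn\<^esub> p\<in>{0, 1}. T.tn (\<mu> (fst k) (parity M p (fst l))) (\<nu> (hproj B p (snd k)) (snd l)))"

lemma op_pure_eq: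
  assumes "k \<in> carrier A \<times> carrier B" "l \<in> carrier M \<times> carrier N"
  shows "op_pure k l = T.tn (\<mu> (fst k) (parity M 0 (fst l))) (\<nu> (hproj B 0 (snd k)) (snd l)) \<oplus>\<^bsub>T.Tn\<^esub>
    T.tn (\<mu> (fst k) (parity M 1 (fst l))) (\<nu> (hproj B 1 (snd k)) (snd l))"
  unfolding op_pure_def
  by (rule T.Tn.finsum_bit) (use assms in \<open>auto simp: linears\<close>)

lemma op_pure_closed: "k \<in> carrier A \<times> carrier B \<Longrightarrow> l \<in> carrier M \<times> carrier N \<Longrightarrow> op_pure k l \<in> carrier T.Tn"
  by (simp add: op_pure_eq) (auto simp: linears)

lemma op_pure_hom:
  assumes "a \<in> carrier A" "b \<in> hpart B p" "m \<in> carrier M" "n \<in> carrier N"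
  shows "op_pure (a, b) (m, n) = T.tn (\<mu> a (parity M p m)) (\<nu> b n)"
proof -
  have b: "b \<in> carrier B" using assms(2) by (rule B.hpartD)
  have "\<nu> \<zero>\<^bsub>B\<^esub> n = \<zero>\<^bsub>N\<^esub>" using cvs2.lin_zero[OF cvs2.intro \<nu>1[OF assms(4)]] by (simp add: B.cvs_axioms N.cvs_axioms)
  then show ?thesis using assms b
    by (cases p) (simp_all add: op_pure_eq B.hproj_hom linears)
qed

lemma op_pure_bilinear_l: "l \<in> carrier M \<times> carrier N \<Longrightarrow> bilinear_map A B T.Tn (\<lambda>k. op_pure k l)"
  by unfold_locales
     (rule linI; auto simp: op_pure_eq linears B.hproj_add B.hproj_sm T.tn_add_l T.tn_add_r T.tn_sm_l T.tn_sm_r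
       T.Tn.M.a_ac T.Tn.sm_add_r)+

lemma op_pure_bilinear_r: "k \<in> carrier A \<times> carrier B \<Longrightarrow> bilinear_map M N T.Tn (op_pure k)"
  by unfold_locales
     (rule linI; auto simp: op_pure_eq linears M.parity_add M.parity_sm T.tn_add_l T.tn_add_r T.tn_sm_l T.tn_sm_r
       T.Tn.M.a_ac T.Tn.sm_add_r simp del: M.parity_0)+

lemma op_lift_bilinear:
  assumes "y \<in> carrier T.Ps" shows "bilinear_map A B T.Tn (\<lambda>k. lc T.Tn (op_pure k) y)"
proof -
  have y: "Poly_Mapping.keys y \<subseteq> carrier M \<times> carrier N" using assms by simp
  note C = op_pure_closed
  note L = bilinear_map.F1[OF op_pure_bilinear_l, THEN linD(2)] bilinear_map.F1[OF op_pure_bilinear_l, THEN linD(3)]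
    bilinear_map.F2[OF op_pure_bilinear_l, THEN linD(2)] bilinear_map.F2[OF op_pure_bilinear_l, THEN linD(3)]
  show ?thesis
    by unfold_locales
       (rule linI; (rule T.Tn.lc_closed[OF y] T.Tn.lc_fun_add[OF y] T.Tn.lc_fun_scale[OF y]);
         use C L in \<open>auto\<close>)+
qed

text \<open>Passes from the type class sum of formal combinations, in which \<open>pair_op\<close>
  is written, to \<open>finsum\<close> in the target record.\<close>

lemma linear_sum:
  assumes "is_linear T.Ps Z \<phi>" "cvss Z" "finite I" "\<And>i. i \<in> I \<Longrightarrow> f i \<in> carrier T.Ps"
  shows "\<phi> (sum f I) = (\<Oplus>\<^bsub>Z\<^esub> i\<in>I. \<phi> (f i)) \<and> sum f I \<in> carrier T.Ps"
proof -
  interpret Z: cvss Z by fact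
  interpret cvs2 T.Ps Z by unfold_locales
  show ?thesis using assms(3,4)
  proof (induction I rule: finite_induct)
    case empty then show ?case using lin_zero[OF assms(1)] by simp
  next
    case (insert i I)
    then have "(\<lambda>i. \<phi> (f i)) \<in> I \<rightarrow> carrier Z" using linD(1)[OF assms(1)] by auto
    then show ?case using insert linD(1,2)[OF assms(1)] T.Ps.M.add.m_closed[of "f i" "sum f I"]
      by (simp add: Z.M.finsum_insert)
  qed
qed

text \<open>\<open>pair_op\<close> is a raw fourfold sum over keys and parities. Taking classes term
  by term turns it into two nested linear extensions of \<open>op_pure\<close>, and the universal
  property then applies in each argument.\<close>

lemma cls_pair_op:
  assumes "x \<in> carrier S.Ps" "y \<in> carrier T.Ps"
  shows "T.cls (pair_op B M \<mu> \<nu> x y) = lc T.Tn (\<lambda>k. lc T.Tn (op_pure k) y) x"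
    and "pair_op B M \<mu> \<nu> x y \<in> carrier T.Ps"
proof -
  let ?f = "\<lambda>k l p q. Poly_Mapping.single (\<mu> (fst k) (hproj M q (fst l)), \<nu> (hproj B p (snd k)) (snd l))
    (koszul p q * Poly_Mapping.lookup x k * Poly_Mapping.lookup y l)"
  have x: "Poly_Mapping.keys x \<subseteq> carrier A \<times> carrier B" and y: "Poly_Mapping.keys y \<subseteq> carrier M \<times> carrier N"
    using assms by auto
  have po: "pair_op B M \<mu> \<nu> x y = (\<Sum>k\<in>Poly_Mapping.keys x. \<Sum>l\<in>Poly_Mapping.keys y. \<Sum>p\<in>{0,1}. \<Sum>q\<in>{0,1}. ?f k l p q)"
    by (simp add: pair_op_def case_prod_unfold)
  note LS = linear_sum[OF T.cls_linear T.cvss_Tn]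
  have f: "?f k l p q \<in> carrier T.Ps" if "k \<in> Poly_Mapping.keys x" "l \<in> Poly_Mapping.keys y" for k l p q
  proof -
    have "fst k \<in> carrier A" "snd k \<in> carrier B" "fst l \<in> carrier M" "snd l \<in> carrier N" using that x y by auto
    then show ?thesis by (simp add: linears)
  qed
  have s1: "T.cls (\<Sum>p\<in>{0,1}. \<Sum>q\<in>{0,1}. ?f k l p q) =
      Poly_Mapping.lookup x k \<odot>\<^bsub>T.Tn\<^esub> (Poly_Mapping.lookup y l \<odot>\<^bsub>T.Tn\<^esub> op_pure k l)"
    "(\<Sum>p\<in>{0,1}. \<Sum>q\<in>{0,1}. ?f k l p q) \<in> carrier T.Ps"
    if k: "k \<in> Poly_Mapping.keys x" and l: "l \<in> Poly_Mapping.keys y" for k l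
  proof -
    have kl: "fst k \<in> carrier A" "snd k \<in> carrier B" "fst l \<in> carrier M" "snd l \<in> carrier N" using k l x y by auto
    have kl': "k \<in> carrier A \<times> carrier B" "l \<in> carrier M \<times> carrier N" using k l x y by auto
    let ?c = "Poly_Mapping.lookup x k" and ?d = "Poly_Mapping.lookup y l"
    have q: "T.cls (\<Sum>q\<in>{0,1}. ?f k l p q) = (?c * ?d) \<odot>\<^bsub>T.Tn\<^esub> T.tn (\<mu> (fst k) (parity M p (fst l))) (\<nu> (hproj B p (snd k)) (snd l))"
      "(\<Sum>q\<in>{0,1}. ?f k l p q) \<in> carrier T.Ps" for p
    proof -
      have "T.cls (\<Sum>q\<in>{0,1}. ?f k l p q) = (\<Oplus>\<^bsub>T.Tn\<^esub> q\<in>{0,1}. T.cls (?f k l p q)) \<and> (\<Sum>q\<in>{0,1}. ?f k l p q) \<in> carrier T.Ps"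
        by (rule LS) (use f[OF k l] in auto)
      moreover have "(\<Oplus>\<^bsub>T.Tn\<^esub> q\<in>{0,1}. T.cls (?f k l p q)) = T.cls (?f k l p 0) \<oplus>\<^bsub>T.Tn\<^esub> T.cls (?f k l p 1)"
        by (rule T.Tn.finsum_bit) (rule linD(1)[OF T.cls_linear f[OF k l]])
      moreover have "\<dots> = (?c * ?d) \<odot>\<^bsub>T.Tn\<^esub> T.tn (\<mu> (fst k) (parity M p (fst l))) (\<nu> (hproj B p (snd k)) (snd l))"
        using kl by (simp add: T.cls_single linears parity_def T.tn_add_l T.tn_sm_l T.Tn.sm_add_r mult_ac)
      ultimately show "T.cls (\<Sum>q\<in>{0,1}. ?f k l p q) = (?c * ?d) \<odot>\<^bsub>T.Tn\<^esub> T.tn (\<mu> (fst k) (parity M p (fst l))) (\<nu> (hproj B p (snd k)) (snd l))"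
      "(\<Sum>q\<in>{0,1}. ?f k l p q) \<in> carrier T.Ps" by auto
    qed
    have "T.cls (\<Sum>p\<in>{0,1}. \<Sum>q\<in>{0,1}. ?f k l p q) = (\<Oplus>\<^bsub>T.Tn\<^esub> p\<in>{0,1}. T.cls (\<Sum>q\<in>{0,1}. ?f k l p q))
      \<and> (\<Sum>p\<in>{0,1}. \<Sum>q\<in>{0,1}. ?f k l p q) \<in> carrier T.Ps"
      by (rule LS) (use q(2) in auto)
    moreover have "(\<Oplus>\<^bsub>T.Tn\<^esub> p\<in>{0,1}. T.cls (\<Sum>q\<in>{0,1}. ?f k l p q)) = T.cls (\<Sum>q\<in>{0,1}. ?f k l 0 q) \<oplus>\<^bsub>T.Tn\<^esub> T.cls (\<Sum>q\<in>{0,1}. ?f k l 1 q)"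
      by (rule T.Tn.finsum_bit) (rule linD(1)[OF T.cls_linear q(2)])
    moreover have "\<dots> = ?c \<odot>\<^bsub>T.Tn\<^esub> (?d \<odot>\<^bsub>T.Tn\<^esub> op_pure k l)"
      unfolding q(1) using kl kl' by (simp add: op_pure_eq linears T.Tn.sm_add_r)
    ultimately show "T.cls (\<Sum>p\<in>{0,1}. \<Sum>q\<in>{0,1}. ?f k l p q) = ?c \<odot>\<^bsub>T.Tn\<^esub> (?d \<odot>\<^bsub>T.Tn\<^esub> op_pure k l)"
      "(\<Sum>p\<in>{0,1}. \<Sum>q\<in>{0,1}. ?f k l p q) \<in> carrier T.Ps" by auto
  qed
  have c: "op_pure k l \<in> carrier T.Tn" if "k \<in> Poly_Mapping.keys x" "l \<in> Poly_Mapping.keys y" for k l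
    by (rule op_pure_closed) (use that x y in auto)
  let ?g = "\<lambda>k. \<Sum>l\<in>Poly_Mapping.keys y. \<Sum>p\<in>{0,1}. \<Sum>q\<in>{0,1}. ?f k l p q"
  have s2: "T.cls (?g k) = Poly_Mapping.lookup x k \<odot>\<^bsub>T.Tn\<^esub> lc T.Tn (op_pure k) y" "?g k \<in> carrier T.Ps"
    if k: "k \<in> Poly_Mapping.keys x" for k
  proof -
    have "T.cls (?g k) = (\<Oplus>\<^bsub>T.Tn\<^esub> l\<in>Poly_Mapping.keys y. T.cls (\<Sum>p\<in>{0,1}. \<Sum>q\<in>{0,1}. ?f k l p q)) \<and> ?g k \<in> carrier T.Ps"
      by (rule LS) (use s1(2)[OF k] in auto)
    moreover have "(\<Oplus>\<^bsub>T.Tn\<^esub> l\<in>Poly_Mapping.keys y. T.cls (\<Sum>p\<in>{0,1}. \<Sum>q\<in>{0,1}. ?f k l p q)) =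
      (\<Oplus>\<^bsub>T.Tn\<^esub> l\<in>Poly_Mapping.keys y. Poly_Mapping.lookup x k \<odot>\<^bsub>T.Tn\<^esub> (Poly_Mapping.lookup y l \<odot>\<^bsub>T.Tn\<^esub> op_pure k l))"
      by (rule T.Tn.M.add.finprod_cong') (use s1(1)[OF k] c[OF k] in auto)
    moreover have "\<dots> = Poly_Mapping.lookup x k \<odot>\<^bsub>T.Tn\<^esub> lc T.Tn (op_pure k) y"
      unfolding lc_def by (rule T.Tn.sm_finsum[symmetric]) (use c[OF k] in auto)
    ultimately show "T.cls (?g k) = Poly_Mapping.lookup x k \<odot>\<^bsub>T.Tn\<^esub> lc T.Tn (op_pure k) y" "?g k \<in> carrier T.Ps" by auto
  qed
  have "T.cls (\<Sum>k\<in>Poly_Mapping.keys x. ?g k) = (\<Oplus>\<^bsub>T.Tn\<^esub> k\<in>Poly_Mapping.keys x. T.cls (?g k)) \<and> (\<Sum>k\<in>Poly_Mapping.keys x. ?g k) \<in> carrier T.Ps"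
    by (rule LS) (use s2(2) in auto)
  moreover have "(\<Oplus>\<^bsub>T.Tn\<^esub> k\<in>Poly_Mapping.keys x. T.cls (?g k)) = lc T.Tn (\<lambda>k. lc T.Tn (op_pure k) y) x"
    unfolding lc_def[of _ _ x]
    by (rule T.Tn.M.add.finprod_cong'[OF refl _ s2(1)])
       (use T.Tn.lc_closed[OF subset_refl c] in \<open>auto intro!: T.Tn.sm_closed\<close>)
  ultimately show "T.cls (pair_op B M \<mu> \<nu> x y) = lc T.Tn (\<lambda>k. lc T.Tn (op_pure k) y) x"
    "pair_op B M \<mu> \<nu> x y \<in> carrier T.Ps" unfolding po by auto
qed

text \<open>Both representatives may be changed: first \<open>y\<close>, for each fixed key of
  \<open>x\<close>, by bilinearity of \<open>op_pure k\<close>; then \<open>x\<close>, by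
  bilinearity of the extension over \<open>y\<close>.\<close>

lemma op_cls:
  assumes x: "x \<in> carrier S.Ps" and y: "y \<in> carrier T.Ps"
  shows "op (S.cls x) (T.cls y) = T.cls (pair_op B M \<mu> \<nu> x y)"
proof -
  have eq: "T.cls (pair_op B M \<mu> \<nu> x' y') = T.cls (pair_op B M \<mu> \<nu> x y)"
    if "x' \<in> S.cls x" "y' \<in> T.cls y" for x' y'
  proof -
    note x' = S.Q.cls_memD[OF that(1) x] and y' = T.Q.cls_memD[OF that(2) y]
    have "lc T.Tn (op_pure k) y' = lc T.Tn (op_pure k) y" if "k \<in> carrier A \<times> carrier B" for k
      using bilinear_map.lc_F_cls[OF op_pure_bilinear_r[OF that], of y' y] y y' by blast
    then have "lc T.Tn (\<lambda>k. lc T.Tn (op_pure k) y') x' = lc T.Tn (\<lambda>k. lc T.Tn (op_pure k) y) x'"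
      unfolding lc_def[of _ _ x'] 
      using x' T.Tn.lc_closed[OF _ op_pure_closed, of y "carrier M \<times> carrier N"] y
      by (intro T.Tn.M.add.finprod_cong') auto
    also have "\<dots> = lc T.Tn (\<lambda>k. lc T.Tn (op_pure k) y) x"
      using bilinear_map.lc_F_cls[OF op_lift_bilinear[OF y], of x' x] x x' by blast
    finally show ?thesis using cls_pair_op x y x' y' by simp
  qed
  have "x \<in> S.cls x" "y \<in> T.cls y" using S.Q.cls_self[OF x] T.Q.cls_self[OF y] by auto
  then show ?thesis unfolding tensor_op_def using eq by blast
qed

lemma op_linear_l: assumes "u \<in> carrier T.Tn" shows "is_linear S.Tn T.Tn (\<lambda>t. op t u)"
proof -
  obtain y where y: "y \<in> carrier T.Ps" "u = T.cls y" using assms by (auto simp: T.carrier_Tn)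
  interpret b: bilinear_map A B T.Tn "\<lambda>k. lc T.Tn (op_pure k) y" by (rule op_lift_bilinear[OF y(1)])
  have "op t u = b.lift t" if "t \<in> carrier S.Tn" for t
    using that y by (auto simp: S.carrier_Tn op_cls cls_pair_op b.lift_cls simp del: pair_space_simps)
  then show ?thesis using linD[OF b.lift_linear] by (intro linI) simp_all
qed

lemma op_closed [intro, simp]: "t \<in> carrier S.Tn \<Longrightarrow> u \<in> carrier T.Tn \<Longrightarrow> op t u \<in> carrier T.Tn"
  using linD(1)[OF op_linear_l] .

lemma op_tens_lift:
  assumes "a \<in> carrier A" "b \<in> carrier B" "y \<in> carrier T.Ps"
  shows "op (S.tn a b) (T.cls y) = lc T.Tn (op_pure (a, b)) y"
proof -
  have "op (S.tn a b) (T.cls y) = lc T.Tn (\<lambda>k. lc T.Tn (op_pure k) y) (pair a b)"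
    unfolding tens_def using assms by (simp add: op_cls cls_pair_op del: pair_space_simps)
  also have "\<dots> = lc T.Tn (op_pure (a, b)) y"
    using bilinear_map.lc_F_pair[OF op_lift_bilinear[OF assms(3)] assms(1,2)] .
  finally show ?thesis .
qed

text \<open>For a pure tensor on the left the operation is a lift in the right argument; sums and
  multiples of such follow from linearity on the left.\<close>

lemma op_linear_r: assumes "t \<in> carrier S.Tn" shows "is_linear T.Tn T.Tn (op t)"
  using assms
proof (induction t rule: S.Tn_induct)
  case (add t t')
  show ?case by (rule linI)
    (use add linD[OF add(3)] linD[OF add(4)] linD[OF op_linear_l] in \<open>auto simp: T.Tn.M.a_ac T.Tn.sm_add_r\<close>)
next
  case (smult c t)
  show ?case by (rule linI)
    (use smult linD[OF smult(2)] linD[OF op_linear_l] in \<open>auto simp: T.Tn.sm_add_r mult.commute\<close>)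
next
  case (tens a b)
  interpret b: bilinear_map M N T.Tn "op_pure (a, b)" by (rule op_pure_bilinear_r) (use tens in auto)
  have "op (S.tn a b) u = b.lift u" if "u \<in> carrier T.Tn" for u
    using that tens by (auto simp: T.carrier_Tn op_tens_lift b.lift_cls simp del: pair_space_simps)
  then show ?case using linD[OF b.lift_linear] by (intro linI) simp_all
qed

lemma op_tens:
  assumes "a \<in> carrier A" "b \<in> hpart B p" "m \<in> carrier M" "n \<in> carrier N"
  shows "op (S.tn a b) (T.tn m n) = T.tn (\<mu> a (parity M p m)) (\<nu> b n)"
proof -
  have b: "b \<in> carrier B" using assms(2) by (rule B.hpartD)
  have "op (S.tn a b) (T.tn m n) = lc T.Tn (op_pure (a, b)) (pair m n)"
    unfolding tens_def[of M N] using assms b by (intro op_tens_lift pair_in)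
  also have "\<dots> = op_pure (a, b) (m, n)"
    using assms b by (intro bilinear_map.lc_F_pair[OF op_pure_bilinear_r]) auto
  finally show ?thesis using op_pure_hom[OF assms] by simp
qed

end

subsection \<open>Actions of superalgebras\<close>

locale calg_action = A: calg A + M: cvss M
  for A :: "'a superspace" and M :: "('m, 'z) superspace_scheme" +
  fixes \<mu> :: "'a \<Rightarrow> 'm \<Rightarrow> 'm"
  assumes \<mu>1: "m \<in> carrier M \<Longrightarrow> is_linear A M (\<lambda>a. \<mu> a m)"
    and \<mu>2: "a \<in> carrier A \<Longrightarrow> is_linear M M (\<mu> a)"
    and \<mu>_mult: "a \<in> carrier A \<Longrightarrow> b \<in> carrier A \<Longrightarrow> m \<in> carrier M \<Longrightarrow> \<mu> (a \<otimes>\<^bsub>A\<^esub> b) m = \<mu> a (\<mu> b m)"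
    and \<mu>_one: "m \<in> carrier M \<Longrightarrow> \<mu> \<one>\<^bsub>A\<^esub> m = m"

locale graded_action = calg_action A M \<mu> + A: superalg A + M: sspace M
  for A :: "'a superspace" and M :: "('m, 'z) superspace_scheme" and \<mu> +
  assumes \<mu>_hpart: "a \<in> hpart A p \<Longrightarrow> m \<in> hpart M q \<Longrightarrow> \<mu> a m \<in> hpart M (p + q)"
begin

text \<open>On homogeneous elements this is multiplicativity of \<open>koszul p\<close> in its
  second argument.\<close>

lemma \<mu>_parity:
  assumes "a \<in> carrier A" "m \<in> carrier M"
  shows "parity M p (\<mu> a m) = \<mu> (parity A p a) (parity M p m)"
proof -
  note L = linD[OF \<mu>1] linD[OF \<mu>2]
  have 1: "parity M p (\<mu> a m) = \<mu> (parity A p a) (parity M p m)" if "a \<in> hpart A r" "m \<in> hpart M s" for a m r s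
    using that \<mu>_hpart[OF that] A.hpartD(7)[OF that(1)] M.hpartD(7)[OF that(2)]
    by (simp add: A.parity_hom M.parity_hom L koszul_add_r mult.commute)
  have 2: "parity M p (\<mu> a m) = \<mu> (parity A p a) (parity M p m)" if "a \<in> hpart A r" "m \<in> carrier M" for a m r
    using that(2)
    by (rule M.hpart_cases) (use that(1) 1 A.hpartD(7)[OF that(1)] in \<open>auto simp: L M.parity_add\<close>)
  show ?thesis using assms(1)
    by (rule A.hpart_cases) (use assms(2) 2 in \<open>auto simp: L M.parity_add A.parity_add\<close>)
qed

end

lemma (in superalg) graded_action_self: "graded_action A A (mult A)"
proof -
  have "calg_action A A (mult A)"
    by (intro calg_action.intro calg_action_axioms.intro calg_axioms cvss_axioms)
       (simp_all add: mult_linear_l mult_linear_r A.m_assoc)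
  then show ?thesis
    by (intro graded_action.intro graded_action_axioms.intro superalg_axioms sspace_axioms)
       (auto intro: mult_hpart)
qed

lemma (in superalg) parity_mult:
  "a \<in> carrier A \<Longrightarrow> b \<in> carrier A \<Longrightarrow> parity A p (a \<otimes> b) = parity A p a \<otimes> parity A p b"
  using graded_action.\<mu>_parity[OF graded_action_self] .

lemma (in superalg) parity_one: "parity A p \<one> = \<one>"
  using parity_hom[OF one_even] by simp

locale super_tensor = A: superalg A + B: superalg B
  for A :: "'a superspace" and B :: "'b superspace"
begin

sublocale tensor_space A B by unfold_locales

sublocale mul: tensor_operation A B A B "mult A" "mult B"
  by (intro tensor_operation.intro tensor_operation_axioms.intro A.cvss_axioms B.sspace_axioms A.sspace_axioms
      B.cvss_axioms A.mult_linear_l A.mult_linear_r B.mult_linear_l B.mult_linear_r)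

abbreviation "T \<equiv> super_tensor_algebra A B"

text \<open>These rules push the operations of \<open>T\<close> down to \<open>Tn\<close>. Later
  calculations with the ring laws of \<open>T\<close> switch them off so that those laws still
  match.\<close>

lemma T_simps [simp]:
  "carrier T = carrier Tn" "zero T = zero Tn" "add T = add Tn" "smult T = smult Tn" "hpart T = hpart Tn"
  "mult T = mul.op" "one T = tn \<one>\<^bsub>A\<^esub> \<one>\<^bsub>B\<^esub>"
  by (simp_all add: super_tensor_algebra_def)

lemma cvss_T: "cvss T"
  by (rule cvss.intro, rule cvsI)
     (simp_all add: Tn.M.a_assoc Tn.sm_add_l Tn.sm_add_r, simp add: Tn.M.a_comm)

lemma hpart_T: "hpart Tn q = cls ` hpart Ps q"
  by (simp add: tensor_def quot_space_def)

lemma hpart_Ps: "hpart Ps q = {P. Poly_Mapping.keys P \<subseteq> {(a, b). \<exists>r. a \<in> hpart A r \<and> b \<in> hpart B (q + r)}}"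
  by (auto simp: pair_space_def)

lemma hpart_Ps_carrier: "hpart Ps q \<subseteq> carrier Ps"
  using A.hpartD(7) B.hpartD(7) by (auto simp: hpart_Ps subset_iff) blast+

lemma tn_hpart: assumes "a \<in> hpart A p" "b \<in> hpart B q" shows "tn a b \<in> hpart Tn (p + q)"
proof -
  have "pair a b \<in> hpart Ps (p + q)"
    using assms by (auto simp: hpart_Ps pair_def intro!: exI[of _ p] simp: add.commute)
  then show ?thesis unfolding hpart_T tens_def by (rule imageI)
qed

lemma hpart_Tn_submodule: "submodule (hpart Tn q) CC Tn"
  unfolding hpart_T
proof (rule cvs2.lin_image_submodule[OF _ cls_linear])
  show "cvs2 Ps Tn" by unfold_locales
  show "submodule (hpart Ps q) CC Ps"
  proof (rule Ps.submoduleI')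
    show "hpart Ps q \<subseteq> carrier Ps" by (rule hpart_Ps_carrier)
    show "x \<oplus>\<^bsub>Ps\<^esub> y \<in> hpart Ps q" if "x \<in> hpart Ps q" "y \<in> hpart Ps q" for x y
      using that keys_add[of x y] unfolding hpart_Ps by auto
    show "c \<odot>\<^bsub>Ps\<^esub> x \<in> hpart Ps q" if "x \<in> hpart Ps q" for c x
      using that keys_map_times[of c x] unfolding hpart_Ps by auto
  qed (simp add: hpart_Ps)
qed

lemma hpart_Tn_induct [consumes 1, case_names add smult tens]:
  assumes "t \<in> hpart Tn q"
    "\<And>t t'. t \<in> hpart Tn q \<Longrightarrow> t' \<in> hpart Tn q \<Longrightarrow> Q t \<Longrightarrow> Q t' \<Longrightarrow> Q (t \<oplus>\<^bsub>Tn\<^esub> t')"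
    "\<And>c t. t \<in> hpart Tn q \<Longrightarrow> Q t \<Longrightarrow> Q (c \<odot>\<^bsub>Tn\<^esub> t)"
    "\<And>a b r s. a \<in> hpart A r \<Longrightarrow> b \<in> hpart B s \<Longrightarrow> r + s = q \<Longrightarrow> Q (tn a b)"
  shows "Q t"
proof -
  let ?S = "{(a, b). \<exists>r. a \<in> hpart A r \<and> b \<in> hpart B (q + r)}"
  obtain P where P: "P \<in> hpart Ps q" "t = cls P" using assms(1) by (auto simp: hpart_T)
  from P(1) have "Poly_Mapping.keys P \<subseteq> ?S" by (simp add: hpart_Ps)
  then have "Q (cls P)"
  proof (induction P rule: poly_mapping_span_induct)
    case zero
    have z: "tn \<zero>\<^bsub>A\<^esub> \<zero>\<^bsub>B\<^esub> \<in> hpart Tn q"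
      using tn_hpart[OF A.hpartD(2) B.hpartD(2), of 0 q] by simp
    have "Q (0 \<odot>\<^bsub>Tn\<^esub> tn \<zero>\<^bsub>A\<^esub> \<zero>\<^bsub>B\<^esub>)"
      by (intro assms(3)[OF z] assms(4)[of _ 0 _ q]) (simp_all add: A.hpartD B.hpartD)
    moreover have "cls 0 = \<zero>\<^bsub>Tn\<^esub>" using Q.cls_zero by (simp add: tensor_def)
    ultimately show ?case by simp
  next
    case (single k c)
    then obtain a b r where k: "k = (a, b)" "a \<in> hpart A r" "b \<in> hpart B (q + r)" by auto
    have "r + (q + r) = q" by (metis bit_add_self(2) add.commute)
    then have "tn a b \<in> hpart Tn q" "Q (tn a b)" using tn_hpart[OF k(2,3)] assms(4)[OF k(2,3)] by simp_all
    then show ?case using assms(3) k cls_single[of a b c] A.hpartD(7) B.hpartD(7) by simp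
  next
    case (add P P')
    then have "P \<in> hpart Ps q" "P' \<in> hpart Ps q" by (simp_all add: hpart_Ps)
    moreover from this have "cls (P + P') = cls P \<oplus>\<^bsub>Tn\<^esub> cls P'"
      using linD(2)[OF cls_linear, of P P'] hpart_Ps_carrier[of q] by auto
    ultimately show ?case using add assms(2)[of "cls P" "cls P'"] by (simp add: hpart_T)
  qed
  then show ?thesis using P by simp
qed

text \<open>There is no case for scalar multiples: a scalar is moved into the first factor, which
  stays homogeneous. The induction therefore carries all multiples of \<open>t\<close> at
  once.\<close>

lemma Tn_hom_induct [consumes 1, case_names add tens]:
  assumes "t \<in> carrier Tn"
    "\<And>t t'. t \<in> carrier Tn \<Longrightarrow> t' \<in> carrier Tn \<Longrightarrow> Q t \<Longrightarrow> Q t' \<Longrightarrow> Q (t \<oplus>\<^bsub>Tn\<^esub> t')"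
    "\<And>a b r s. a \<in> hpart A r \<Longrightarrow> b \<in> hpart B s \<Longrightarrow> Q (tn a b)"
  shows "Q t"
proof -
  let ?R = "\<lambda>t. Q t \<and> (\<forall>c. Q (c \<odot>\<^bsub>Tn\<^esub> t))"
  have 1: "?R (tn a b)" if "a \<in> hpart A r" "b \<in> hpart B s" for a b r s
    using assms(3)[OF that] assms(3)[OF A.hpartD(4)[OF that(1)] that(2)] that A.hpartD(7) B.hpartD(7)
    by (simp add: tn_sm_l[symmetric])
  have add: "?R (t \<oplus>\<^bsub>Tn\<^esub> t')" if "?R t" "?R t'" "t \<in> carrier Tn" "t' \<in> carrier Tn" for t t'
    using that assms(2) by (simp add: Tn.sm_add_r)
  have 2: "?R (tn a b)" if "a \<in> hpart A r" "b \<in> carrier B" for a b r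
    using that(2) by (rule B.hpart_cases) (use 1[OF that(1)] add that(1)[THEN A.hpartD(7)] in \<open>auto simp: tn_add_r\<close>)
  have 3: "?R (tn a b)" if "a \<in> carrier A" "b \<in> carrier B" for a b
    using that(1) by (rule A.hpart_cases) (use 2 add that(2) in \<open>auto simp: tn_add_l\<close>)
  from assms(1) have "?R t"
    by (induction t rule: Tn_induct) (use 3 add in \<open>auto\<close>)
  then show ?thesis by blast
qed

lemma sspace_T: "sspace T"
proof (rule sspaceI)
  \<comment> \<open>Parity on both factors multiplies a tensor of parity \<open>p\<close> by
    \<open>koszul 1 p\<close>, as \<open>sspaceI\<close> requires.\<close>
  interpret b: bilinear_map A B Tn "\<lambda>k. tn (parity A 1 (fst k)) (parity B 1 (snd k))"
    by unfold_locales (rule linI; simp add: A.parity_add A.parity_sm B.parity_add B.parity_sm tn_add_l tn_add_r tn_sm_l tn_sm_r)+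
  show "cvs T" using cvss_T by (simp add: cvss_def)
  show "submodule (hpart T p) CC T" for p
    using Tn.submoduleD[OF hpart_Tn_submodule] cvss_T
    by (intro cvs.submoduleI') (auto simp: cvss_def)
  show "is_linear T T b.lift" using b.lift_linear by (simp add: is_linear_def)
  show "b.lift t = koszul 1 p \<odot>\<^bsub>T\<^esub> t" if "t \<in> hpart T p" for t p
    using that unfolding T_simps
  proof (induction rule: hpart_Tn_induct)
    case (tens a b r s)
    then show ?case using A.hpartD(7) B.hpartD(7)
      by (auto simp: b.lift_tn A.parity_hom B.parity_hom tn_sm_l tn_sm_r koszul_add_r mult.commute)
  qed (use Tn.submoduleD(7)[OF hpart_Tn_submodule] linD[OF b.lift_linear] in \<open>auto simp: Tn.sm_add_r mult.commute\<close>)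
  have "\<exists>x\<in>hpart Tn 0. \<exists>y\<in>hpart Tn 1. t = x \<oplus>\<^bsub>Tn\<^esub> y" if "t \<in> carrier Tn" for t
    using that
  proof (induction t rule: Tn_hom_induct)
    case (add t t')
    then obtain x y x' y' where e: "x \<in> hpart Tn 0" "y \<in> hpart Tn 1" "t = x \<oplus>\<^bsub>Tn\<^esub> y"
      "x' \<in> hpart Tn 0" "y' \<in> hpart Tn 1" "t' = x' \<oplus>\<^bsub>Tn\<^esub> y'" by blast
    then have "t \<oplus>\<^bsub>Tn\<^esub> t' = (x \<oplus>\<^bsub>Tn\<^esub> x') \<oplus>\<^bsub>Tn\<^esub> (y \<oplus>\<^bsub>Tn\<^esub> y')"
      using Tn.submoduleD(7)[OF hpart_Tn_submodule] by (simp add: Tn.M.a_ac)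
    then show ?case using e Tn.submoduleD(3)[OF hpart_Tn_submodule] by blast
  next
    case (tens a b r s)
    have t: "tn a b \<in> hpart Tn (r + s)" "tn a b \<in> carrier Tn" using tens tn_hpart A.hpartD(7) B.hpartD(7) by auto
    note z = Tn.submoduleD(2)[OF hpart_Tn_submodule]
    show ?case
    proof (cases "r + s = 0")
      case True then show ?thesis using t z[of 1] by (intro bexI[of _ "tn a b"] bexI[of _ "\<zero>\<^bsub>Tn\<^esub>"]) auto
    next
      case False then have "r + s = 1" by simp
      then show ?thesis using t z[of 0] by (intro bexI[of _ "tn a b"] bexI[of _ "\<zero>\<^bsub>Tn\<^esub>"]) auto
    qed
  qed
  then show "carrier T \<subseteq> hpart T 0 <+>\<^bsub>T\<^esub> hpart T 1"
    unfolding T_simps set_add_def set_mult_def by (fastforce simp: super_tensor_algebra_def)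
qed

interpretation Ts: sspace T by (rule sspace_T)

lemma parity_tn: 
  assumes "a \<in> carrier A" "b \<in> carrier B"
  shows "parity T p (tn a b) = tn (parity A p a) (parity B p b)"
proof -
  have 1: "parity T p (tn a b) = tn (parity A p a) (parity B p b)" if "a \<in> hpart A r" "b \<in> hpart B s" for a b r s
    using that A.hpartD(7) B.hpartD(7) tn_hpart[OF that]
    by (simp add: Ts.parity_hom[of _ "r + s"] A.parity_hom B.parity_hom tn_sm_l tn_sm_r koszul_add_r mult.commute)
  note L = Ts.parity_add[unfolded T_simps]
  have 2: "parity T p (tn a b) = tn (parity A p a) (parity B p b)" if "a \<in> hpart A r" "b \<in> carrier B" for a b r
    using that(2) by (rule B.hpart_cases)
      (use 1[OF that(1)] that(1)[THEN A.hpartD(7)] in \<open>auto simp: tn_add_r B.parity_add L\<close>)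
  show ?thesis using assms(1)
    by (rule A.hpart_cases) (use 2 assms(2) in \<open>auto simp: tn_add_l A.parity_add L\<close>)
qed

end

locale super_tensor_module = super_tensor A B + M: graded_action A M \<mu> + N: calg_action B N \<nu>
  for A :: "'a superspace" and B :: "'b superspace"
    and M :: "('m, 'w) superspace_scheme" and \<mu>
    and N :: "('n, 'x) superspace_scheme" and \<nu>
begin

sublocale act: tensor_operation A B M N \<mu> \<nu>
  by (intro tensor_operation.intro tensor_operation_axioms.intro A.cvss_axioms B.sspace_axioms M.M.sspace_axioms
      N.M.cvss_axioms M.\<mu>1 M.\<mu>2 N.\<mu>1 N.\<mu>2)

text \<open>The sign check behind associativity. Both sides carry \<open>parity A q\<close> on
  \<open>a'\<close> and \<open>parity M (q + s)\<close> on \<open>m\<close>: on the left because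
  \<open>b \<otimes> b'\<close> has parity \<open>q + s\<close>, on the right because
  \<open>parity M q\<close> distributes over the action and powers of parity add up.\<close>

lemma tn_tn_act:
  assumes "a \<in> hpart A p" "b \<in> hpart B q" "a' \<in> hpart A r" "b' \<in> hpart B s" "m \<in> carrier M" "n \<in> carrier N"
  shows "act.op (mul.op (tn a b) (tn a' b')) (act.T.tn m n) = act.op (tn a b) (act.op (tn a' b') (act.T.tn m n))"
proof -
  note c = assms(1,3)[THEN A.hpartD(7)] assms(2,4)[THEN B.hpartD(7)] assms(5,6)
  note L = act.linears
  have bb: "b \<otimes>\<^bsub>B\<^esub> b' \<in> hpart B (q + s)" using B.mult_hpart assms by blast
  have "mul.op (tn a b) (tn a' b') = tn (a \<otimes>\<^bsub>A\<^esub> parity A q a') (b \<otimes>\<^bsub>B\<^esub> b')"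
    using mul.op_tens[OF c(1) assms(2) c(2) c(4)] .
  then have "act.op (mul.op (tn a b) (tn a' b')) (act.T.tn m n) =
      act.T.tn (\<mu> (a \<otimes>\<^bsub>A\<^esub> parity A q a') (parity M (q + s) m)) (\<nu> (b \<otimes>\<^bsub>B\<^esub> b') n)"
    using act.op_tens[OF _ bb c(5,6), of "a \<otimes>\<^bsub>A\<^esub> parity A q a'"] c by simp
  also have "\<dots> = act.T.tn (\<mu> a (\<mu> (parity A q a') (parity M (q + s) m))) (\<nu> b (\<nu> b' n))"
    using c by (simp add: M.\<mu>_mult N.\<mu>_mult)
  also have "\<mu> (parity A q a') (parity M (q + s) m) = parity M q (\<mu> a' (parity M s m))"
    using c by (simp add: M.\<mu>_parity M.M.parity_parity)
  also have "act.T.tn (\<mu> a (parity M q (\<mu> a' (parity M s m)))) (\<nu> b (\<nu> b' n)) =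
      act.op (tn a b) (act.T.tn (\<mu> a' (parity M s m)) (\<nu> b' n))"
    using c by (intro act.op_tens[OF _ assms(2), symmetric]) (simp_all add: L)
  also have "act.T.tn (\<mu> a' (parity M s m)) (\<nu> b' n) = act.op (tn a' b') (act.T.tn m n)"
    using act.op_tens[OF c(2) assms(4) c(5,6)] by simp
  finally show ?thesis .
qed

lemma act_assoc:
  assumes "t \<in> carrier Tn" "t' \<in> carrier Tn" "u \<in> carrier act.T.Tn"
  shows "act.op (mul.op t t') u = act.op t (act.op t' u)"
  using assms(1)
proof (induction t rule: Tn_hom_induct)
  case (add t1 t2)
  then show ?case using assms(2,3) by (simp add: linD[OF mul.op_linear_l] linD[OF act.op_linear_l])
next
  case (tens a b p q)
  then have ab: "tn a b \<in> carrier Tn" using A.hpartD(7) B.hpartD(7) by blast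
  show ?case using assms(2)
  proof (induction t' rule: Tn_hom_induct)
    case (add t1 t2)
    then show ?case using ab assms(3)
      by (simp add: linD[OF mul.op_linear_r] linD[OF act.op_linear_l] linD[OF act.op_linear_r])
  next
    case tt: (tens a' b' r s)
    then have ab': "tn a' b' \<in> carrier Tn" using A.hpartD(7) B.hpartD(7) by blast
    show ?case using assms(3)
      by (induction u rule: act.T.Tn_induct)
         (use ab ab' tn_tn_act[OF tens tt] in \<open>simp_all add: linD[OF act.op_linear_r]\<close>)
  qed
qed

lemma act_one:
  assumes "u \<in> carrier act.T.Tn" shows "act.op (tn \<one>\<^bsub>A\<^esub> \<one>\<^bsub>B\<^esub>) u = u"
  using assms
  by (induction u rule: act.T.Tn_induct)
     (simp_all add: linD[OF act.op_linear_r] act.op_tens[OF _ B.one_even] M.\<mu>_one N.\<mu>_one)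

end

context super_tensor begin

text \<open>\<open>T\<close> acts on itself, so associativity and the left unit law of its
  multiplication are the module laws just proved. The right unit law is separate, in
  \<open>mul_tn_one\<close>.\<close>

interpretation self: super_tensor_module A B A "mult A" B "mult B"
  by (intro super_tensor_module.intro super_tensor_axioms A.graded_action_self
      graded_action.axioms(1) B.graded_action_self)

lemma mul_tn_one:
  assumes "u \<in> carrier Tn" shows "mul.op u (tn \<one>\<^bsub>A\<^esub> \<one>\<^bsub>B\<^esub>) = u"
  using assms
proof (induction u rule: Tn_hom_induct)
  case (tens a b r s)
  then show ?case using A.hpartD(7) B.hpartD(7) by (simp add: mul.op_tens A.parity_one)
qed (simp add: linD[OF mul.op_linear_l])

lemma mul_hpart:
  assumes "t \<in> hpart Tn p" "t' \<in> hpart Tn q" shows "mul.op t t' \<in> hpart Tn (p + q)"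
proof -
  note H = Tn.submoduleD[OF hpart_Tn_submodule]
  note L = linD[OF mul.op_linear_r] linD[OF mul.op_linear_l]
  from assms(1) show ?thesis
  proof (induction rule: hpart_Tn_induct)
    case (tens a b r s)
    then have ab: "tn a b \<in> carrier Tn" using A.hpartD(7) B.hpartD(7) by blast
    from assms(2) show ?case
    proof (induction rule: hpart_Tn_induct)
      case tt: (tens a' b' r' s')
      have "mul.op (tn a b) (tn a' b') = tn (a \<otimes>\<^bsub>A\<^esub> parity A s a') (b \<otimes>\<^bsub>B\<^esub> b')"
        by (rule mul.op_tens) (use tens tt A.hpartD(7) B.hpartD(7) in auto)
      also have "\<dots> \<in> hpart Tn ((r + r') + (s + s'))"
        using tens tt by (intro tn_hpart A.mult_hpart B.mult_hpart A.parity_hpart)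
      also have "(r + r') + (s + s') = p + q" using tens tt by (simp add: ac_simps)
      finally show ?case .
    qed (use ab H in \<open>auto simp: L\<close>)
  qed (use assms(2)[THEN H(7)] H in \<open>auto simp: L\<close>)
qed

lemma superalg_T: "superalg T"
proof (intro superalg.intro superalg_axioms.intro calg.intro calg_axioms.intro cvss_T sspace_T)
  interpret T: cvss T by (rule cvss_T)
  show "ring T"
  proof (rule ringI)
    show "abelian_group T" by (rule T.M.abelian_group_axioms)
    show "monoid T" by (rule monoidI) (auto simp: self.act_assoc self.act_one mul_tn_one)
  qed (auto simp: linD[OF mul.op_linear_r] linD[OF mul.op_linear_l])
  show "\<one>\<^bsub>T\<^esub> \<in> hpart T 0" using tn_hpart[OF A.one_even B.one_even] by simp
qed (auto simp: linD[OF mul.op_linear_r] linD[OF mul.op_linear_l] mul_hpart)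

end

sublocale super_tensor \<subseteq> T: superalg T by (rule superalg_T)

lemma (in super_tensor_module) calg_action_T: "calg_action T act.T.Tn act.op"
  by (intro calg_action.intro calg_action_axioms.intro T.calg_axioms act.T.Tn.cvss_axioms)
     (use act.op_linear_l act.op_linear_r in \<open>auto simp: act_assoc act_one is_linear_def\<close>)

section \<open>Supercommutators and the supercenter\<close>

context superalg begin

lemma scomm_eq:
  assumes "a \<in> carrier A" "b \<in> carrier A"
  shows "scomm A a b = a \<otimes> b \<ominus> (parity A 0 b \<otimes> hproj A 0 a \<oplus> parity A 1 b \<otimes> hproj A 1 a)"
proof -
  have q: "(\<Oplus>q\<in>{0, 1}. koszul p q \<odot> (hproj A q b \<otimes> hproj A p a)) = parity A p b \<otimes> hproj A p a" for p
    using assms by (subst finsum_bit) (auto simp: parity_def A.l_distr sm_mult_l)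
  show ?thesis unfolding scomm_def q using assms by (subst finsum_bit) auto
qed

lemma scomm_hom:
  assumes "a \<in> hpart A p" "b \<in> carrier A"
  shows "scomm A a b = a \<otimes> b \<ominus> parity A p b \<otimes> a"
  using assms hpartD(7)[OF assms(1)] by (cases p) (simp_all add: scomm_eq hproj_hom)

lemma scomm_eq_zero_iff:
  "a \<in> hpart A p \<Longrightarrow> b \<in> carrier A \<Longrightarrow> scomm A a b = \<zero> \<longleftrightarrow> a \<otimes> b = parity A p b \<otimes> a"
  using hpartD(7)[of a p] by (simp add: scomm_hom diff_eq_zero_iff)

lemma scomm_eq_zeroI:
  assumes "a \<in> carrier A" "b \<in> carrier A" "\<And>p. hproj A p a \<otimes> b = parity A p b \<otimes> hproj A p a"
  shows "scomm A a b = \<zero>"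
proof -
  have "a \<otimes> b = hproj A 0 a \<otimes> b \<oplus> hproj A 1 a \<otimes> b"
    using hproj_decomp[OF assms(1)] assms A.l_distr[of "hproj A 0 a" "hproj A 1 a" b] by simp
  then show ?thesis using assms by (simp add: scomm_eq diff_eq_zero_iff del: parity_0)
qed

lemma scomm_linear: assumes "a \<in> hpart A p" shows "is_linear A A (scomm A a)"
  by (rule linI)
     (use hpartD(7)[OF assms] in \<open>auto simp: scomm_hom[OF assms] parity_add parity_sm A.l_distr A.r_distr
        sm_mult_l sm_mult_r diff_sm sm_add_r M.a_ac mult.commute\<close>)

text \<open>The Leibniz rule of a superderivation: the terms with \<open>a\<close> between
  \<open>parity A p b\<close> and \<open>c\<close> occur twice with opposite signs.\<close>

lemma scomm_mult:
  assumes "a \<in> hpart A p" "b \<in> carrier A" "c \<in> carrier A"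
  shows "scomm A a (b \<otimes> c) = scomm A a b \<otimes> c \<oplus> parity A p b \<otimes> scomm A a c"
proof -
  have a: "a \<in> carrier A" using assms(1) by (rule hpartD)
  have "scomm A a b \<otimes> c = a \<otimes> (b \<otimes> c) \<ominus> parity A p b \<otimes> (a \<otimes> c)"
    using assms a by (simp add: scomm_hom a_minus_def A.l_distr A.l_minus A.m_assoc)
  moreover have "parity A p b \<otimes> scomm A a c = parity A p b \<otimes> (a \<otimes> c) \<ominus> parity A p b \<otimes> (parity A p c \<otimes> a)"
    using assms a by (simp add: scomm_hom a_minus_def A.r_distr A.r_minus)
  ultimately show ?thesis using assms a
    by (simp add: scomm_hom parity_mult A.m_assoc a_minus_def M.a_assoc M.r_neg1 M.r_neg2)
qed

lemma scomm_one: "a \<in> hpart A p \<Longrightarrow> scomm A a \<one> = \<zero>"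
  using hpartD(7)[of a p] by (simp add: scomm_eq_zero_iff parity_one)

lemma scenter_iff:
  "z \<in> scenter A \<longleftrightarrow> z \<in> carrier A \<and> (\<forall>p. \<forall>a\<in>hpart A p. a \<otimes> z = parity A p z \<otimes> a)"
proof
  assume z: "z \<in> scenter A"
  then have "z \<in> carrier A" "\<And>a. a \<in> carrier A \<Longrightarrow> scomm A a z = \<zero>" by (auto simp: scenter_def)
  then show "z \<in> carrier A \<and> (\<forall>p. \<forall>a\<in>hpart A p. a \<otimes> z = parity A p z \<otimes> a)"
    using scomm_eq_zero_iff hpartD(7) by blast
next
  assume "z \<in> carrier A \<and> (\<forall>p. \<forall>a\<in>hpart A p. a \<otimes> z = parity A p z \<otimes> a)"
  then show "z \<in> scenter A" unfolding scenter_def by (auto intro!: scomm_eq_zeroI)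
qed

lemma scenter_closed: "z \<in> scenter A \<Longrightarrow> z \<in> carrier A"
  by (simp add: scenter_iff)

lemma scenterD: "z \<in> scenter A \<Longrightarrow> a \<in> hpart A p \<Longrightarrow> a \<otimes> z = parity A p z \<otimes> a"
  by (simp add: scenter_iff)

text \<open>Apply the involution \<open>parity A p\<close> to the relation for
  \<open>parity A p a\<close>. This form is used in \<open>center_D\<close>, where moving
  \<open>z\<close> past the second factor of a tensor produces
  \<open>parity U (px i) z\<close>.\<close>

lemma scenterD': 
  assumes "z \<in> scenter A" "a \<in> hpart A p" shows "a \<otimes> parity A p z = z \<otimes> a"
proof -
  have c: "a \<in> carrier A" "z \<in> carrier A" using assms hpartD(7) scenter_closed by auto
  have pp: "parity A p (parity A p x) = x" if "x \<in> carrier A" for x using that by (simp add: parity_parity)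
  have "a \<otimes> parity A p z = parity A p (parity A p a \<otimes> z)" using c by (simp add: parity_mult pp)
  also have "\<dots> = parity A p (parity A p z \<otimes> parity A p a)"
    using scenterD[OF assms(1) parity_hpart[OF assms(2)], of p] by simp
  also have "\<dots> = z \<otimes> a" using c by (simp add: parity_mult pp)
  finally show ?thesis .
qed

lemma scenter_one: "\<one> \<in> scenter A"
  using hpartD(7) by (auto simp: scenter_iff parity_one)

lemma scenter_add: "z \<in> scenter A \<Longrightarrow> z' \<in> scenter A \<Longrightarrow> z \<oplus> z' \<in> scenter A"
  using hpartD(7) by (auto simp: scenter_iff A.l_distr A.r_distr parity_add)

lemma scenter_sm: "z \<in> scenter A \<Longrightarrow> c \<odot> z \<in> scenter A"
  using hpartD(7) by (auto simp: scenter_iff sm_mult_l sm_mult_r parity_sm)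

lemma supercommuting_mult:
  assumes "a \<in> carrier A" "b \<in> carrier A" "b' \<in> carrier A"
    "a \<otimes> b = parity A p b \<otimes> a" "a \<otimes> b' = parity A p b' \<otimes> a"
  shows "a \<otimes> (b \<otimes> b') = parity A p (b \<otimes> b') \<otimes> a"
proof -
  have "a \<otimes> (b \<otimes> b') = (parity A p b \<otimes> a) \<otimes> b'"
    using assms by (simp add: A.m_assoc[symmetric])
  also have "\<dots> = parity A p b \<otimes> (parity A p b' \<otimes> a)"
    using assms by (simp add: A.m_assoc)
  finally show ?thesis using assms by (simp add: parity_mult A.m_assoc)
qed

lemma scenter_mult: "z \<in> scenter A \<Longrightarrow> z' \<in> scenter A \<Longrightarrow> z \<otimes> z' \<in> scenter A"
  using hpartD(7) by (auto simp: scenter_iff intro!: supercommuting_mult)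

end

section \<open>Lie superalgebras\<close>

definition graded_sub :: "('a, 'z) superspace_scheme \<Rightarrow> 'a set \<Rightarrow> bool" where
  "graded_sub V W \<longleftrightarrow> submodule W CC V \<and> (\<forall>x\<in>W. \<forall>p. hproj V p x \<in> W)"

lemma subspace_of_simps [simp]:
  "carrier (subspace_of V W) = W" "zero (subspace_of V W) = zero V" "add (subspace_of V W) = add V"
  "smult (subspace_of V W) = smult V" "hpart (subspace_of V W) p = hpart V p \<inter> W"
  "mult (subspace_of V W) = mult V" "one (subspace_of V W) = one V"
  by (simp_all add: subspace_of_def)

lemma lbr_subspace_of [simp]: "lbr (subspace_of G W) = lbr G"
  by (simp add: subspace_of_def)

lemma (in cvss) cvss_subspace_of: "submodule W CC V \<Longrightarrow> cvss (subspace_of V W)"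
  by (rule cvss.intro, rule cvsI)
     (auto simp: submoduleD M.a_assoc sm_add_l sm_add_r intro: M.a_comm dest: submoduleD(7))

lemma (in sspace) sspace_subspace_of:
  assumes "graded_sub V W" shows "sspace (subspace_of V W)"
proof (rule sspaceI)
  have W: "submodule W CC V" and h: "\<And>x p. x \<in> W \<Longrightarrow> hproj V p x \<in> W"
    using assms by (auto simp: graded_sub_def)
  note D = submoduleD[OF W]
  show cv: "cvs (subspace_of V W)" using cvss_subspace_of[OF W] by (simp add: cvss_def)
  show "submodule (hpart (subspace_of V W) p) CC (subspace_of V W)" for p
    by (rule cvs.submoduleI'[OF cv]) (auto simp: D hpartD)
  show "carrier (subspace_of V W) \<subseteq> hpart (subspace_of V W) 0 <+>\<^bsub>subspace_of V W\<^esub> hpart (subspace_of V W) 1"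
  proof
    fix x assume x: "x \<in> carrier (subspace_of V W)"
    then have "hproj V 0 x \<in> hpart (subspace_of V W) 0" "hproj V 1 x \<in> hpart (subspace_of V W) 1"
      "x = hproj V 0 x \<oplus> hproj V 1 x"
      using h D(7) hproj_decomp by auto
    then show "x \<in> hpart (subspace_of V W) 0 <+>\<^bsub>subspace_of V W\<^esub> hpart (subspace_of V W) 1"
      unfolding set_add_def set_mult_def by auto
  qed
  show "is_linear (subspace_of V W) (subspace_of V W) (parity V 1)"
  proof (rule linI)
    show "parity V 1 x \<in> carrier (subspace_of V W)" if "x \<in> carrier (subspace_of V W)" for x
      using that h D(3,4) by (simp add: parity_def)
  qed (use D(7) in \<open>auto simp: parity_add parity_sm\<close>)
qed (simp add: parity_hom)

locale lie_super =
  fixes G :: "('g, 'z) lie_superspace_scheme" (structure)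
  assumes lie_superalgebra: "lie_superalgebra G"

sublocale lie_super \<subseteq> sspace G
  using lie_superalgebra by unfold_locales (simp add: lie_superalgebra_def)

context lie_super begin

abbreviation br where "br \<equiv> lbr G"

lemma br_linear: "x \<in> carrier G \<Longrightarrow> is_linear G G (br x)" "y \<in> carrier G \<Longrightarrow> is_linear G G (\<lambda>x. br x y)"
  using lie_superalgebra by (auto simp: lie_superalgebra_def)

lemmas brD = linD[OF br_linear(1)] linD[OF br_linear(2)]

lemma br_hpart: "x \<in> hpart G p \<Longrightarrow> y \<in> hpart G q \<Longrightarrow> br x y \<in> hpart G (p + q)"
  using lie_superalgebra unfolding lie_superalgebra_def by blast

lemma br_anti: "x \<in> hpart G p \<Longrightarrow> y \<in> hpart G q \<Longrightarrow> br x y = (- koszul p q) \<odot> br y x"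
  using lie_superalgebra unfolding lie_superalgebra_def by blast

lemma br_jacobi: "x \<in> hpart G p \<Longrightarrow> y \<in> hpart G q \<Longrightarrow> z \<in> carrier G \<Longrightarrow>
    br x (br y z) = br (br x y) z \<oplus> koszul p q \<odot> br y (br x z)"
  using lie_superalgebra unfolding lie_superalgebra_def by blast

text \<open>For even \<open>h\<close> the Jacobi identity has no sign and therefore extends to
  inhomogeneous \<open>x\<close>. It makes weights add under the bracket.\<close>

lemma br_derivation:
  assumes "h \<in> hpart G 0" "x \<in> carrier G" "y \<in> carrier G"
  shows "br h (br x y) = br (br h x) y \<oplus> br x (br h y)"
  using assms(2)
proof (rule hpart_cases)
  have h: "h \<in> carrier G" using assms(1) by (rule hpartD)
  show "br h (br x y) = br (br h x) y \<oplus> br x (br h y)" if "x \<in> hpart G p" for p x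
    using br_jacobi[OF assms(1) that assms(3)] hpartD(7)[OF that] assms h by (simp add: brD)
  show "br h (br (x \<oplus> x') y) = br (br h (x \<oplus> x')) y \<oplus> br (x \<oplus> x') (br h y)"
    if "x \<in> carrier G" "x' \<in> carrier G" "br h (br x y) = br (br h x) y \<oplus> br x (br h y)"
      "br h (br x' y) = br (br h x') y \<oplus> br x' (br h y)" for x x'
    using that assms h by (simp add: brD M.a_ac)
qed

lemma br_even_hproj:
  assumes "h \<in> hpart G 0" "x \<in> carrier G" shows "br h (hproj G p x) = hproj G p (br h x)"
proof -
  have h: "h \<in> carrier G" using assms(1) by (rule hpartD)
  have "hproj G p (br h x) = br h (hproj G p x)"
  proof (rule hproj_eqI)
    show "br h (hproj G p x) \<in> hpart G p" using br_hpart[OF assms(1) hproj_in[OF assms(2)], of p] by simp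
    show "br h (hproj G (p + 1) x) \<in> hpart G (p + 1)"
      using br_hpart[OF assms(1) hproj_in[OF assms(2)], of "p + 1"] by simp
    have "x = hproj G p x \<oplus> hproj G (p + 1) x"
      using hproj_decomp[OF assms(2)] assms by (cases p) (simp_all add: M.a_comm)
    then show "br h x = br h (hproj G p x) \<oplus> br h (hproj G (p + 1) x)"
      using brD(2)[OF h, of "hproj G p x" "hproj G (p + 1) x"] assms by simp
  qed
  then show ?thesis by simp
qed

lemma graded_sub_lspan:
  assumes "S \<subseteq> carrier G" "\<And>x p. x \<in> S \<Longrightarrow> hproj G p x \<in> lspan G S"
  shows "graded_sub G (lspan G S)"
proof -
  note sub = submoduleD[OF lspan_submodule[OF assms(1)]]
  have "hproj G p x \<in> lspan G S" if "x \<in> lspan G S" for x p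
    using that assms(1)
    by (induction rule: lspan_induct) (use assms(2) sub hproj_hom[OF hpartD(2)] in \<open>auto simp: hproj_add hproj_sm\<close>)
  then show ?thesis using lspan_submodule[OF assms(1)] by (simp add: graded_sub_def)
qed

lemma br_lspan:
  assumes "S \<subseteq> carrier G" "S' \<subseteq> carrier G" "submodule W CC G"
    "\<And>x y. x \<in> S \<Longrightarrow> y \<in> S' \<Longrightarrow> br x y \<in> W" "x \<in> lspan G S" "y \<in> lspan G S'"
  shows "br x y \<in> W"
proof -
  note W = submoduleD[OF assms(3)]
  have z: "br \<zero> y = \<zero>" "br y \<zero> = \<zero>" if "y \<in> carrier G" for y
    using that cvs2.lin_zero[OF cvs2.intro[OF cvs_axioms cvs_axioms] br_linear(1)]
      cvs2.lin_zero[OF cvs2.intro[OF cvs_axioms cvs_axioms] br_linear(2)] by auto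
  have 1: "br x y \<in> W" if "x \<in> S" for x
    using assms(6,2)
    by (induction rule: lspan_induct) (use assms that W z in \<open>auto simp: brD subset_iff\<close>)
  have y: "y \<in> carrier G" using submoduleD(7)[OF lspan_submodule[OF assms(2)] assms(6)] .
  show ?thesis using assms(5,1)
    by (induction rule: lspan_induct) (use y 1 W z in \<open>auto simp: brD\<close>)
qed

end

subsection \<open>Levi subalgebras and their complements\<close>

locale cartan_grading = lie_super G for G :: "('g, 'z) lie_superspace_scheme" (structure) +
  fixes \<hh> :: "'g set" and f :: "('g \<Rightarrow> complex) \<Rightarrow> int"
  assumes cartan: "cartan_subalgebra G \<hh>"
    and additive: "additive_on_root_lattice G \<hh> f"
begin

lemma h_even: "h \<in> \<hh> \<Longrightarrow> h \<in> hpart G 0" and h_sub: "submodule \<hh> CC G"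
  using cartan by (auto simp: cartan_subalgebra_def)

lemma h_carrier: "h \<in> \<hh> \<Longrightarrow> h \<in> carrier G" using h_even hpartD(7) by blast

text \<open>Adjoining \<open>0\<close> makes \<open>\<hh>\<close> itself a weight space
  (\<open>root_space_0\<close>), so the Cartan part needs no case of its own in spans and
  brackets.\<close>

definition weights :: "('g \<Rightarrow> complex) set" where "weights = insert 0 (roots G \<hh>)"

text \<open>This is the self-centralising property of a Cartan subalgebra.\<close>

lemma root_space_0: "root_space G \<hh> 0 = \<hh>"
proof -
  have "root_space G \<hh> 0 = {x \<in> carrier G. \<forall>y\<in>\<hh>. br y x = \<zero>}" by (auto simp: root_space_def)
  then show ?thesis using cartan by (simp add: cartan_subalgebra_def)
qed

lemma root_space_carrier: "root_space G \<hh> a \<subseteq> carrier G" by (auto simp: root_space_def)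

lemma root_space_hproj: "x \<in> root_space G \<hh> a \<Longrightarrow> hproj G p x \<in> root_space G \<hh> a"
  using h_even by (auto simp: root_space_def br_even_hproj hproj_sm)

lemma br_root_space:
  assumes "x \<in> root_space G \<hh> a" "y \<in> root_space G \<hh> b" shows "br x y \<in> root_space G \<hh> (a + b)"
  using assms h_even h_carrier
  by (auto simp: root_space_def br_derivation brD sm_add_l)

lemma weights_dual: "a \<in> weights \<Longrightarrow> a \<in> dual_space G \<hh>"
  by (auto simp: weights_def roots_def dual_space_def)

text \<open>A sum of two weights need not be a weight; the nonzero vector \<open>x\<close> is the
  witness that it is one.\<close>

lemma weight_add:
  assumes "a \<in> weights" "b \<in> weights" "x \<in> root_space G \<hh> (a + b)" "x \<noteq> \<zero>"
  shows "a + b \<in> weights"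
  using assms(3,4) weights_dual[OF assms(1)] weights_dual[OF assms(2)]
  by (auto simp: weights_def roots_def dual_space_def algebra_simps)

lemma weights_closure: "weights \<subseteq> group_closure (roots G \<hh>)"
  by (auto simp: weights_def intro: group_closure.base)

lemma f_add: "a \<in> weights \<Longrightarrow> b \<in> weights \<Longrightarrow> f (a + b) = f a + f b"
  using additive weights_closure by (auto simp: additive_on_root_lattice_def)

lemma f_zero: "f 0 = 0"
  using f_add[of 0 0] by (simp add: weights_def)

text \<open>For \<open>J = {0}\<close> this is the Levi subalgebra (\<open>levi_eq\<close>), for
  \<open>J = - {0}\<close> its complement (\<open>complement_eq\<close>), so that one bracket lemma
  serves both.\<close>

definition weight_span :: "int set \<Rightarrow> 'g set" where
  "weight_span J = lspan G (\<Union>a\<in>{a \<in> weights. f a \<in> J}. root_space G \<hh> a)"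

lemma UN_carrier: "(\<Union>a\<in>A. root_space G \<hh> a) \<subseteq> carrier G" using root_space_carrier by blast

lemma weight_span_graded: "graded_sub G (weight_span J)"
  unfolding weight_span_def
  by (rule graded_sub_lspan[OF UN_carrier]) (rule subsetD[OF lspan_superset], use root_space_hproj in blast)

text \<open>Bracketing with degree \<open>0\<close> keeps the degree under \<open>f\<close>. A
  vanishing bracket is treated apart, because then the sum of the two weights need not be a
  weight.\<close>

lemma br_weight_span:
  assumes "x \<in> weight_span {0}" "y \<in> weight_span J" shows "br x y \<in> weight_span J"
  using assms unfolding weight_span_def
proof (elim br_lspan[OF UN_carrier UN_carrier lspan_submodule[OF UN_carrier], rotated -2])
  let ?S = "\<Union>a\<in>{a \<in> weights. f a \<in> J}. root_space G \<hh> a"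
  fix x y assume "x \<in> (\<Union>a\<in>{a \<in> weights. f a \<in> {0}}. root_space G \<hh> a)" "y \<in> ?S"
  then obtain a b where ab: "a \<in> weights" "f a = 0" "x \<in> root_space G \<hh> a" "b \<in> weights" "f b \<in> J" "y \<in> root_space G \<hh> b"
    by auto
  note xy = br_root_space[OF ab(3,6)]
  show "br x y \<in> lspan G ?S"
  proof (cases "br x y = \<zero>")
    case True then show ?thesis using submoduleD(2)[OF lspan_submodule[OF UN_carrier]] by simp
  next
    case False
    then have "a + b \<in> weights" "f (a + b) \<in> J" using weight_add[OF ab(1,4) xy] f_add ab by auto
    then show ?thesis using xy by (intro subsetD[OF lspan_superset]) blast
  qed
qed

text \<open>\<open>levi\<close> and \<open>\<ss>\<close> are spans of sets that contain spans; this
  flattens them to the span of a single union of weight spaces.\<close>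

lemma lspan_Un_lspan:
  assumes "A \<subseteq> carrier G" "B \<subseteq> carrier G" shows "lspan G (A \<union> lspan G B) = lspan G (A \<union> B)"
proof
  have AB: "A \<union> B \<subseteq> carrier G" using assms by blast
  note sup = lspan_superset[of "A \<union> B"] lspan_superset[of B] lspan_superset[of "A \<union> lspan G B"]
  have "lspan G B \<subseteq> lspan G (A \<union> B)"
    by (rule lspan_minimal[OF lspan_submodule[OF AB]]) (use sup in blast)
  then show "lspan G (A \<union> lspan G B) \<subseteq> lspan G (A \<union> B)"
    by (intro lspan_minimal[OF lspan_submodule[OF AB]]) (use sup in blast)
  have "A \<union> lspan G B \<subseteq> carrier G" using assms submoduleD(1)[OF lspan_submodule[OF assms(2)]] by blast
  then show "lspan G (A \<union> B) \<subseteq> lspan G (A \<union> lspan G B)"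
    by (intro lspan_minimal lspan_submodule) (use sup in blast)+
qed

lemma levi_eq: "levi G \<hh> f = weight_span {0}"
proof -
  have "levi G \<hh> f = lspan G (\<hh> \<union> (\<Union>a\<in>{a \<in> roots G \<hh>. f a = 0}. root_space G \<hh> a))"
    unfolding levi_def root_sum_def by (rule lspan_Un_lspan) (use h_carrier UN_carrier in auto)
  also have "\<hh> \<union> (\<Union>a\<in>{a \<in> roots G \<hh>. f a = 0}. root_space G \<hh> a) =
      (\<Union>a\<in>{a \<in> weights. f a \<in> {0}}. root_space G \<hh> a)"
    using root_space_0 f_zero by (auto simp: weights_def)
  finally show ?thesis by (simp add: weight_span_def)
qed

lemma complement_eq:
  "lspan G (root_sum G \<hh> {a \<in> roots G \<hh>. f a > 0} \<union> root_sum G \<hh> {a \<in> roots G \<hh>. f a < 0}) =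
    weight_span (- {0})"
proof -
  let ?P = "\<Union>a\<in>{a \<in> roots G \<hh>. f a > 0}. root_space G \<hh> a"
  let ?N = "\<Union>a\<in>{a \<in> roots G \<hh>. f a < 0}. root_space G \<hh> a"
  have w: "{a \<in> weights. f a \<in> - {0}} = {a \<in> roots G \<hh>. f a < 0} \<union> {a \<in> roots G \<hh>. f a > 0}"
    using f_zero by (auto simp: weights_def)
  have "lspan G (lspan G ?P \<union> lspan G ?N) = lspan G (lspan G ?P \<union> ?N)"
    by (rule lspan_Un_lspan) (use UN_carrier submoduleD(1)[OF lspan_submodule[OF UN_carrier]] in auto)
  also have "\<dots> = lspan G (?N \<union> ?P)"
    unfolding Un_commute[of _ ?N] by (rule lspan_Un_lspan) (use UN_carrier in auto)
  also have "?N \<union> ?P = (\<Union>a\<in>{a \<in> weights. f a \<in> - {0}}. root_space G \<hh> a)"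
    unfolding w by (simp add: UN_Un)
  finally show ?thesis by (simp add: weight_span_def root_sum_def)
qed

end

section \<open>Supercommutators with \<open>x \<otimes> 1\<close> and \<open>1 \<otimes> v\<close>
  in a tensor product of superalgebras\<close>

context superalg begin

lemma scomm_add_l:
  assumes "a \<in> hpart A p" "a' \<in> hpart A p" "b \<in> carrier A"
  shows "scomm A (a \<oplus> a') b = scomm A a b \<oplus> scomm A a' b"
proof -
  have "a \<in> carrier A" "a' \<in> carrier A" using assms hpartD(7) by auto
  then show ?thesis using assms hpartD(3)[OF assms(1,2)]
    by (simp add: scomm_hom A.l_distr A.r_distr diff_sm sm_add_r M.a_ac)
qed

end

context super_tensor begin

text \<open>For \<open>c\<close> of parity \<open>q\<close>, the sign \<open>koszul q p\<close> from
  moving \<open>x\<close> past \<open>c\<close> cancels against the sign that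
  \<open>parity T p\<close> puts on \<open>c\<close>.\<close>

lemma scomm_tn_l:
  assumes x: "x \<in> hpart A p" and u: "u \<in> carrier A" and c: "c \<in> carrier B"
  shows "scomm T (tn x \<one>\<^bsub>B\<^esub>) (tn u c) = tn (scomm A x u) c"
  using c
proof (rule B.hpart_cases)
  have xc: "x \<in> carrier A" using x by (rule A.hpartD)
  have x1: "tn x \<one>\<^bsub>B\<^esub> \<in> hpart T p" using tn_hpart[OF x B.one_even] by simp
  have sc: "scomm A x u \<in> carrier A" using linD(1)[OF A.scomm_linear[OF x] u] .
  show "scomm T (tn x \<one>\<^bsub>B\<^esub>) (tn u (c \<oplus>\<^bsub>B\<^esub> c')) = tn (scomm A x u) (c \<oplus>\<^bsub>B\<^esub> c')"
    if "c \<in> carrier B" "c' \<in> carrier B" "scomm T (tn x \<one>\<^bsub>B\<^esub>) (tn u c) = tn (scomm A x u) c"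
      "scomm T (tn x \<one>\<^bsub>B\<^esub>) (tn u c') = tn (scomm A x u) c'" for c c'
    using that u sc linD(2)[OF T.scomm_linear[OF x1], of "tn u c" "tn u c'"] by (simp add: tn_add_r)
  show "scomm T (tn x \<one>\<^bsub>B\<^esub>) (tn u c) = tn (scomm A x u) c" if "c \<in> hpart B q" for c q
  proof -
    have c: "c \<in> carrier B" using that by (rule B.hpartD)
    have "tn x \<one>\<^bsub>B\<^esub> \<otimes>\<^bsub>T\<^esub> tn u c = tn (x \<otimes>\<^bsub>A\<^esub> u) c"
      using mul.op_tens[OF xc B.one_even u c] u c by simp
    moreover have "tn (parity A p u) c \<otimes>\<^bsub>T\<^esub> tn x \<one>\<^bsub>B\<^esub> = koszul q p \<odot>\<^bsub>Tn\<^esub> tn (parity A p u \<otimes>\<^bsub>A\<^esub> x) c"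
      using mul.op_tens[OF A.parity_closed[OF u] that xc B.A.one_closed] xc x u c
      by (simp add: A.parity_hom A.sm_mult_r tn_sm_l)
    then have "parity T p (tn u c) \<otimes>\<^bsub>T\<^esub> tn x \<one>\<^bsub>B\<^esub> = tn (parity A p u \<otimes>\<^bsub>A\<^esub> x) c"
      using u c that xc by (simp add: parity_tn B.parity_hom tn_sm_r linD[OF mul.op_linear_l] koszul_sym[of q p])
    ultimately show ?thesis using u c xc
      by (simp add: T.scomm_hom[OF x1] A.scomm_hom[OF x] T.diff_sm A.diff_sm tn_add_l tn_sm_l)
  qed
qed

text \<open>Here a sign remains: it comes from moving \<open>v\<close> past \<open>u\<close> and is
  recorded as \<open>parity A p u\<close>.\<close>

lemma scomm_tn_r:
  assumes v: "v \<in> hpart B p" and u: "u \<in> carrier A" and c: "c \<in> carrier B"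
  shows "scomm T (tn \<one>\<^bsub>A\<^esub> v) (tn u c) = tn (parity A p u) (scomm B v c)"
proof -
  have vc: "v \<in> carrier B" using v by (rule B.hpartD)
  have v1: "tn \<one>\<^bsub>A\<^esub> v \<in> hpart T p" using tn_hpart[OF A.one_even v] by simp
  have "tn \<one>\<^bsub>A\<^esub> v \<otimes>\<^bsub>T\<^esub> tn u c = tn (parity A p u) (v \<otimes>\<^bsub>B\<^esub> c)"
    using mul.op_tens[OF A.A.one_closed v u c] u by simp
  moreover have "tn (parity A p u) c' \<otimes>\<^bsub>T\<^esub> tn \<one>\<^bsub>A\<^esub> v = tn (parity A p u) (c' \<otimes>\<^bsub>B\<^esub> v)"
    if "c' \<in> carrier B" for c'
    using that
  proof (rule B.hpart_cases)
    show "tn (parity A p u) c' \<otimes>\<^bsub>T\<^esub> tn \<one>\<^bsub>A\<^esub> v = tn (parity A p u) (c' \<otimes>\<^bsub>B\<^esub> v)" if "c' \<in> hpart B q" for c' q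
      using mul.op_tens[OF A.parity_closed[OF u] that A.A.one_closed vc] u by (simp add: A.parity_one)
  qed (use u vc in \<open>simp add: tn_add_r linD[OF mul.op_linear_l] B.A.l_distr\<close>)
  ultimately show ?thesis using u c vc
    by (simp add: T.scomm_hom[OF v1] B.scomm_hom[OF v] T.diff_sm B.diff_sm tn_add_r tn_sm_r parity_tn)
qed

end

section \<open>The cubic Dirac operator\<close>

subsection \<open>Finite linear combinations with coefficients in the complex numbers\<close>

text \<open>Coordinates for invariance proofs. The vectors \<open>F k\<close> may be dependent:
  identities are proved by comparing coefficients, never read off in the other direction.\<close>

definition comb :: "('v, 'z) superspace_scheme \<Rightarrow> 'k set \<Rightarrow> ('k \<Rightarrow> 'v) \<Rightarrow> ('k \<Rightarrow> complex) \<Rightarrow> 'v" where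
  "comb V I F t = (\<Oplus>\<^bsub>V\<^esub> k\<in>I. t k \<odot>\<^bsub>V\<^esub> F k)"

locale combination = cvss V for V :: "('v, 'z) superspace_scheme" (structure) +
  fixes I :: "'k set" and F :: "'k \<Rightarrow> 'v"
  assumes fin: "finite I" and F_closed: "\<And>k. k \<in> I \<Longrightarrow> F k \<in> carrier V"
begin

lemma comb_closed [simp, intro]: "comb V I F t \<in> carrier V"
  unfolding comb_def by (rule M.finsum_closed) (use F_closed in auto)

lemma comb_cong: "(\<And>k. k \<in> I \<Longrightarrow> t k = t' k) \<Longrightarrow> comb V I F t = comb V I F t'"
  unfolding comb_def by (rule M.add.finprod_cong') (use F_closed in auto)

lemma comb_zero: "(\<And>k. k \<in> I \<Longrightarrow> t k = 0) \<Longrightarrow> comb V I F t = \<zero>"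
  using comb_cong[of t "\<lambda>k. 0"] M.finsum_0 unfolding comb_def
  by (metis (no_types, lifting) F_closed M.add.finprod_one_eqI sm_zero_l)

lemma comb_add: "comb V I F t \<oplus> comb V I F t' = comb V I F (\<lambda>k. t k + t' k)"
proof -
  have "comb V I F (\<lambda>k. t k + t' k) = (\<Oplus>k\<in>I. t k \<odot> F k \<oplus> t' k \<odot> F k)"
    unfolding comb_def by (rule M.add.finprod_cong') (use F_closed sm_add_l in auto)
  then show ?thesis unfolding comb_def by (subst (asm) M.finsum_addf) (use F_closed in auto)
qed

lemma comb_scale: "c \<odot> comb V I F t = comb V I F (\<lambda>k. c * t k)"
proof -
  have "c \<odot> comb V I F t = (\<Oplus>k\<in>I. c \<odot> (t k \<odot> F k))"
    unfolding comb_def by (rule sm_finsum) (use F_closed in auto)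
  also have "\<dots> = comb V I F (\<lambda>k. c * t k)"
    unfolding comb_def by (rule M.add.finprod_cong') (use F_closed in auto)
  finally show ?thesis .
qed

lemma comb_sum:
  assumes "finite J" shows "(\<Oplus>j\<in>J. comb V I F (t j)) = comb V I F (\<lambda>k. \<Sum>j\<in>J. t j k)"
  using assms
proof (induction J rule: finite_induct)
  case empty then show ?case using comb_zero[of "\<lambda>k. 0"] by simp
next
  case (insert j J)
  then show ?case by (simp add: M.finsum_insert comb_add)
qed

lemma comb_delta: "k \<in> I \<Longrightarrow> comb V I F (\<lambda>m. if m = k then c else 0) = c \<odot> F k"
proof -
  assume k: "k \<in> I"
  have "comb V I F (\<lambda>m. if m = k then c else 0) = (\<Oplus>m\<in>I. if k = m then c \<odot> F m else \<zero>)"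
    unfolding comb_def by (rule M.add.finprod_cong') (use F_closed in auto)
  also have "\<dots> = c \<odot> F k" by (rule M.finsum_singleton) (use k fin F_closed in auto)
  finally show ?thesis .
qed

end

lemma comb_comb:
  assumes "combination V J F" "finite I"
  shows "comb V I (\<lambda>i. comb V J F (t i)) s = comb V J F (\<lambda>j. \<Sum>i\<in>I. s i * t i j)"
proof -
  interpret combination V J F by fact
  have "comb V I (\<lambda>i. comb V J F (t i)) s = (\<Oplus>\<^bsub>V\<^esub> i\<in>I. comb V J F (\<lambda>j. s i * t i j))"
    unfolding comb_def[of V I] comb_scale ..
  then show ?thesis using comb_sum[OF assms(2)] by simp
qed

lemma (in cvs2) lin_comb:
  assumes "is_linear V W \<phi>" "\<And>k. k \<in> I \<Longrightarrow> F k \<in> carrier V"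
  shows "\<phi> (comb V I F t) = comb W I (\<lambda>k. \<phi> (F k)) t"
proof -
  have "\<phi> (comb V I F t) = (\<Oplus>\<^bsub>W\<^esub> k\<in>I. \<phi> (t k \<odot>\<^bsub>V\<^esub> F k))"
    unfolding comb_def by (rule lin_finsum[OF assms(1)]) (use assms in auto)
  also have "\<dots> = comb W I (\<lambda>k. \<phi> (F k)) t"
    unfolding comb_def by (rule W.M.add.finprod_cong') (use assms linD[OF assms(1)] in auto)
  finally show ?thesis .
qed

subsection \<open>The superalgebras involved\<close>

lemma lie_graded_presentation:
  assumes "sspace L" "\<And>p q x y. x \<in> hpart L p \<Longrightarrow> y \<in> hpart L q \<Longrightarrow> lbr L x y \<in> hpart L (p + q)"
  shows "graded_presentation L (lie_rels L)"
proof -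
  interpret sspace L by fact
  have r: "r \<in> words_in (carrier L) \<and> (\<exists>q. r \<in> weighted_words L (\<lambda>p. p) q)" if rr: "r \<in> lie_rels L" for r
  proof -
    obtain x y p q where xy: "x \<in> hpart L p" "y \<in> hpart L q"
      and r: "r = gen x * gen y - const (koszul p q) * gen y * gen x - gen (lbr L x y)"
      using rr by (auto simp: lie_rels_def)
    note w = weighted_words_gen[of _ L _ "\<lambda>p. p"]
    have "gen y * gen x \<in> weighted_words L (\<lambda>p. p) (p + q)"
      using weighted_words_mult[OF w[OF xy(2)] w[OF xy(1)]] by (simp add: add.commute)
    then have "const (koszul p q) * gen y * gen x \<in> weighted_words L (\<lambda>p. p) (p + q)"
      unfolding mult.assoc by (rule weighted_words_const_mult)
    moreover have "gen x * gen y \<in> weighted_words L (\<lambda>p. p) (p + q)"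
      by (intro weighted_words_mult w xy)
    moreover have "gen (lbr L x y) \<in> weighted_words L (\<lambda>p. p) (p + q)"
      by (intro w assms(2) xy)
    ultimately have "r \<in> weighted_words L (\<lambda>p. p) (p + q)"
      unfolding r by (intro weighted_words_diff)
    moreover have "r \<in> words_in (carrier L)"
      unfolding r using xy assms(2)[OF xy] hpartD(7) by (intro words_in_diff words_in_mult words_in_const words_in_gen) auto
    ultimately show ?thesis by blast
  qed
  show ?thesis
    by (intro graded_presentation.intro graded_presentation_axioms.intro presentation.intro
        presentation_axioms.intro cvss_axioms sspace_axioms) (use r in auto)
qed

lemma clifford_graded_presentation:
  assumes "sspace V" "\<And>p q x y. x \<in> hpart V p \<Longrightarrow> y \<in> hpart V q \<Longrightarrow> p \<noteq> q \<Longrightarrow> B x y = 0"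
  shows "graded_presentation V (clifford_rels V B)"
proof -
  interpret sspace V by fact
  have r: "r \<in> words_in (carrier V) \<and> (\<exists>q. r \<in> weighted_words V (\<lambda>p. p) q)" if rr: "r \<in> clifford_rels V B" for r
  proof -
    obtain x y p q where xy: "x \<in> hpart V p" "y \<in> hpart V q"
      and r: "r = gen x * gen y + const (koszul p q) * gen y * gen x - const (2 * B x y)"
      using rr by (auto simp: clifford_rels_def)
    note w = weighted_words_gen[of _ V _ "\<lambda>p. p"]
    have "gen y * gen x \<in> weighted_words V (\<lambda>p. p) (p + q)"
      using weighted_words_mult[OF w[OF xy(2)] w[OF xy(1)]] by (simp add: add.commute)
    then have "const (koszul p q) * gen y * gen x \<in> weighted_words V (\<lambda>p. p) (p + q)"
      unfolding mult.assoc by (rule weighted_words_const_mult)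
    moreover have "gen x * gen y \<in> weighted_words V (\<lambda>p. p) (p + q)"
      by (intro weighted_words_mult w xy)
    \<comment> \<open>A constant has parity \<open>0\<close>, so for \<open>p \<noteq> q\<close> it
      has to vanish; that is evenness of the form.\<close>
    moreover have "const (2 * B x y) \<in> weighted_words V (\<lambda>p. p) (p + q)"
      using assms(2)[OF xy] by (cases "p = q") simp_all
    ultimately have "r \<in> weighted_words V (\<lambda>p. p) (p + q)"
      unfolding r by (intro weighted_words_diff weighted_words_add)
    moreover have "r \<in> words_in (carrier V)"
      unfolding r using xy hpartD(7) by (intro words_in_diff words_in_add words_in_mult words_in_const words_in_gen) auto
    ultimately show ?thesis by blast
  qed
  show ?thesis
    by (intro graded_presentation.intro graded_presentation_axioms.intro presentation.intro
        presentation_axioms.intro cvss_axioms sspace_axioms) (use r in auto)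
qed

text \<open>What the computation takes from the root decomposition is collected here:
  \<open>\<ll>\<close> and \<open>\<ss>\<close> are graded, and bracketing with \<open>\<ll>\<close>
  preserves both. The rest of the input is the form, the dual bases and the commutators of
  \<open>\<nu>\<close>.\<close>

locale dirac = lie_super G for G :: "'g lie_superspace" (structure) +
  fixes B :: "'g \<Rightarrow> 'g \<Rightarrow> complex" and \<ll> \<ss> :: "'g set" and n :: nat
    and X Xd :: "nat \<Rightarrow> 'g" and px :: "nat \<Rightarrow> bit" and \<nu> :: "'g \<Rightarrow> 'g free set"
  assumes form: "invariant_form G B"
    and l_graded: "graded_sub G \<ll>" and s_graded: "graded_sub G \<ss>"
    and br_ll: "x \<in> \<ll> \<Longrightarrow> y \<in> \<ll> \<Longrightarrow> lbr G x y \<in> \<ll>"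
    and br_ls: "x \<in> \<ll> \<Longrightarrow> y \<in> \<ss> \<Longrightarrow> lbr G x y \<in> \<ss>"
    and bases: "homogeneous_dual_bases G B \<ss> n X px Xd"
    and diag: "diagonal_morphism G B \<ll> \<ss> \<nu>"
begin

abbreviation "L \<equiv> subspace_of G \<ll>"
abbreviation "S \<equiv> subspace_of G \<ss>"
abbreviation "U \<equiv> uea G"
abbreviation "UL \<equiv> uea L"
abbreviation "C \<equiv> clifford S B"

lemma l_carrier: "x \<in> \<ll> \<Longrightarrow> x \<in> carrier G" and s_carrier: "x \<in> \<ss> \<Longrightarrow> x \<in> carrier G"
  using l_graded s_graded submoduleD(7) by (auto simp: graded_sub_def)

lemma form_lin:
  assumes "x \<in> carrier G" "y \<in> carrier G" "z \<in> carrier G"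
  shows "B (x \<oplus> y) z = B x z + B y z" "B (c \<odot> x) z = c * B x z"
    "B z (x \<oplus> y) = B z x + B z y" "B z (c \<odot> x) = c * B z x"
    "B (br x y) z = B x (br y z)"
  using form[unfolded invariant_form_def, THEN conjunct1, rule_format, OF assms, of c] by auto

lemma form_sym: "x \<in> hpart G p \<Longrightarrow> y \<in> hpart G q \<Longrightarrow> B x y = koszul p q * B y x"
  using form[unfolded invariant_form_def, THEN conjunct2, THEN conjunct1, rule_format, of x p y q] .

lemma form_even: "x \<in> hpart G p \<Longrightarrow> y \<in> hpart G q \<Longrightarrow> p \<noteq> q \<Longrightarrow> B x y = 0"
  using form[unfolded invariant_form_def, THEN conjunct2, THEN conjunct2, THEN conjunct1, rule_format]
    form_sym[of x p y q]
  by (cases p; cases q) auto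

lemma form_zero: "z \<in> carrier G \<Longrightarrow> B \<zero> z = 0" "z \<in> carrier G \<Longrightarrow> B z \<zero> = 0"
  using form_lin(2)[of \<zero> \<zero> z 0] form_lin(4)[of \<zero> \<zero> z 0] by simp_all

sublocale Ls: sspace L by (rule sspace_subspace_of[OF l_graded])
sublocale Ss: sspace S by (rule sspace_subspace_of[OF s_graded])

sublocale U: graded_presentation G "lie_rels G"
  by (rule lie_graded_presentation[OF sspace_axioms br_hpart])

sublocale UL: graded_presentation L "lie_rels L"
  by (rule lie_graded_presentation[OF Ls.sspace_axioms]) (use br_hpart br_ll in auto)

sublocale Cl: graded_presentation S "clifford_rels S B"
  by (rule clifford_graded_presentation[OF Ss.sspace_axioms]) (use form_even in auto)

lemma Pr_eq: "pres G (lie_rels G) = U" "pres L (lie_rels L) = UL" "pres S (clifford_rels S B) = C"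
  by (simp_all add: uea_def clifford_def)

sublocale Us: superalg U using U.superalg_Pr by (simp add: Pr_eq)
sublocale ULs: superalg UL using UL.superalg_Pr by (simp add: Pr_eq)
sublocale Cs: superalg C using Cl.superalg_Pr by (simp add: Pr_eq)

sublocale ST: super_tensor U C by (intro super_tensor.intro Us.superalg_axioms Cs.superalg_axioms)

abbreviation "T \<equiv> super_tensor_algebra U C"
abbreviation "tn \<equiv> tens U C"
abbreviation "gu \<equiv> uea_gen G"
abbreviation "gc \<equiv> clifford_gen S B"

lemma gu_eq: "gu x = U.cl (gen x)" by (simp add: uea_gen_def uea_class_def)
lemma gc_eq: "gc x = Cl.cl (gen x)" by (simp add: clifford_gen_def)

lemma gu_linear: "is_linear G U gu"
  using U.gen_linear by (simp add: Pr_eq gu_eq[abs_def])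

lemma gc_linear: "is_linear S C gc"
  using Cl.gen_linear by (simp add: Pr_eq gc_eq[abs_def])

lemma gu_hpart: "x \<in> hpart G p \<Longrightarrow> gu x \<in> hpart U p"
  using U.gen_hpart by (simp add: Pr_eq gu_eq)

lemma gc_hpart: "x \<in> \<ss> \<Longrightarrow> x \<in> hpart G p \<Longrightarrow> gc x \<in> hpart C p"
  using Cl.gen_hpart[of x p] by (simp add: Pr_eq gc_eq)

lemma gu_closed [simp]: "x \<in> carrier G \<Longrightarrow> gu x \<in> carrier U"
  using linD(1)[OF gu_linear] .

lemma gc_closed [simp]: "x \<in> \<ss> \<Longrightarrow> gc x \<in> carrier C"
  using linD(1)[OF gc_linear] by simp

lemma scomm_gu:
  assumes "x \<in> hpart G p" "y \<in> carrier G" shows "scomm U (gu x) (gu y) = gu (br x y)"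
  using assms(2)
proof (rule hpart_cases)
  have x: "x \<in> carrier G" using assms(1) by (rule hpartD)
  note sl = linD[OF Us.scomm_linear[OF gu_hpart[OF assms(1)]]]
  show "scomm U (gu x) (gu (y \<oplus> y')) = gu (br x (y \<oplus> y'))"
    if "y \<in> carrier G" "y' \<in> carrier G" "scomm U (gu x) (gu y) = gu (br x y)"
      "scomm U (gu x) (gu y') = gu (br x y')" for y y'
    using that x by (simp add: linD[OF gu_linear] sl brD)
  show "scomm U (gu x) (gu y) = gu (br x y)" if y: "y \<in> hpart G q" for y q
  proof -
    have yc: "y \<in> carrier G" using y by (rule hpartD)
    let ?a = "gen x * gen y" and ?b = "const (koszul p q) * gen y * gen x" and ?c = "gen (br x y)"
    have w: "?a \<in> words_in (carrier G)" "?b \<in> words_in (carrier G)" "?c \<in> words_in (carrier G)"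
      using x yc brD(1) by auto
    have "U.cl (?a - ?b - ?c) = U.cl 0"
      by (rule U.cl_rel) (use assms(1) y in \<open>auto simp: lie_rels_def\<close>)
    then have "?a - ?b - ?c - 0 \<in> pres_ideal G (lie_rels G)"
      using w by (subst (asm) U.cl_eq_iff) auto
    then have e: "U.cl ?a = U.cl (?b + ?c)" using w by (subst U.cl_eq_iff) (auto simp: algebra_simps)
    have 1: "U.cl ?a = gu x \<otimes>\<^bsub>U\<^esub> gu y"
      using U.cl_mult[of "gen x" "gen y"] x yc by (simp add: Pr_eq gu_eq)
    have 2: "U.cl ?b = koszul p q \<odot>\<^bsub>U\<^esub> (gu y \<otimes>\<^bsub>U\<^esub> gu x)"
      using U.cl_mult[of "gen y" "gen x"] U.cl_smult[of "gen y * gen x" "koszul p q"] x yc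
      by (simp add: Pr_eq gu_eq mult.assoc)
    have "gu x \<otimes>\<^bsub>U\<^esub> gu y = koszul p q \<odot>\<^bsub>U\<^esub> (gu y \<otimes>\<^bsub>U\<^esub> gu x) \<oplus>\<^bsub>U\<^esub> gu (br x y)"
      using e U.cl_add[OF w(2,3)] unfolding 1 2 by (simp add: Pr_eq gu_eq)
    then show ?thesis using x yc gu_hpart[OF y] brD(1)[OF x yc]
      by (simp add: Us.scomm_hom[OF gu_hpart[OF assms(1)]] Us.parity_hom Us.sm_mult_l Us.add_diff)
  qed
qed

lemma \<nu>_linear: "is_linear L C \<nu>"
  using diag by (simp add: diagonal_morphism_def Let_def)

lemma \<nu>_hpart: "x \<in> \<ll> \<Longrightarrow> x \<in> hpart G p \<Longrightarrow> \<nu> x \<in> hpart C p"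
  using diag by (simp add: diagonal_morphism_def Let_def)

lemma \<nu>_br: "x \<in> \<ll> \<Longrightarrow> y \<in> \<ll> \<Longrightarrow> scomm C (\<nu> x) (\<nu> y) = \<nu> (br x y)"
  using diag by (simp add: diagonal_morphism_def Let_def)

lemma \<nu>_gc: "x \<in> \<ll> \<Longrightarrow> v \<in> \<ss> \<Longrightarrow> scomm C (\<nu> x) (gc v) = gc (br x v)"
  using diag by (simp add: diagonal_morphism_def Let_def)

lemmas \<nu>D = linD[OF \<nu>_linear, unfolded subspace_of_simps]

lemma \<nu>_closed [simp]: "x \<in> \<ll> \<Longrightarrow> \<nu> x \<in> carrier C"
  using linD(1)[OF \<nu>_linear] by simp

subsection \<open>The diagonal embedding\<close>

abbreviation "\<theta> \<equiv> diagonal_gen G B \<ss> \<nu>"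

lemma \<theta>_eq: "\<theta> x = tn (gu x) \<one>\<^bsub>C\<^esub> \<oplus>\<^bsub>T\<^esub> tn \<one>\<^bsub>U\<^esub> (\<nu> x)"
  by (simp add: diagonal_gen_def Let_def)

lemma \<theta>_linear: "is_linear L T \<theta>"
  by (rule linI)
     (use l_carrier in \<open>auto simp: \<theta>_eq linD[OF gu_linear] \<nu>D ST.tn_add_l ST.tn_add_r
       ST.tn_sm_l ST.tn_sm_r ST.Tn.M.a_ac ST.Tn.sm_add_r\<close>)

lemma \<theta>_hpart: "x \<in> hpart L p \<Longrightarrow> \<theta> x \<in> hpart T p"
  using ST.tn_hpart[OF gu_hpart Cs.one_even, of x p] ST.tn_hpart[OF Us.one_even \<nu>_hpart, of x p]
    ST.T.hpartD(3)[of "tn (gu x) \<one>\<^bsub>C\<^esub>" p "tn \<one>\<^bsub>U\<^esub> (\<nu> x)"]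
  by (simp add: \<theta>_eq)

lemma \<theta>_closed [simp]: "x \<in> \<ll> \<Longrightarrow> \<theta> x \<in> carrier T"
  using linD(1)[OF \<theta>_linear] by simp

text \<open>\<open>\<theta> x\<close> acts by a supercommutator on each factor, with a Koszul sign
  for passing \<open>u\<close>. Invariance of both terms of \<open>D\<close> and of
  \<open>z \<otimes> 1\<close> is reduced to this formula.\<close>

lemma scomm_\<theta>:
  assumes x: "x \<in> hpart L p" and u: "u \<in> carrier U" and c: "c \<in> carrier C"
  shows "scomm T (\<theta> x) (tn u c) = tn (scomm U (gu x) u) c \<oplus>\<^bsub>T\<^esub> tn (parity U p u) (scomm C (\<nu> x) c)"
proof -
  have gx: "gu x \<in> hpart U p" and nx: "\<nu> x \<in> hpart C p" using x gu_hpart \<nu>_hpart by auto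
  have "tn (gu x) \<one>\<^bsub>C\<^esub> \<in> hpart T p" "tn \<one>\<^bsub>U\<^esub> (\<nu> x) \<in> hpart T p"
    using ST.tn_hpart[OF gx Cs.one_even] ST.tn_hpart[OF Us.one_even nx] by simp_all
  moreover have "tn u c \<in> carrier T" using u c by simp
  ultimately show ?thesis
    unfolding \<theta>_eq using ST.T.scomm_add_l ST.scomm_tn_l[OF gx u c] ST.scomm_tn_r[OF nx u c] by simp
qed

lemma scomm_\<theta>_\<theta>:
  assumes x: "x \<in> hpart L p" and y: "y \<in> \<ll>"
  shows "scomm T (\<theta> x) (\<theta> y) = \<theta> (br x y)"
proof -
  have xl: "x \<in> \<ll>" "x \<in> hpart G p" using x by auto
  note yc = l_carrier[OF y]
  have sl: "scomm T (\<theta> x) (a \<oplus>\<^bsub>T\<^esub> b) = scomm T (\<theta> x) a \<oplus>\<^bsub>T\<^esub> scomm T (\<theta> x) b"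
    if "a \<in> carrier T" "b \<in> carrier T" for a b
    using linD(2)[OF ST.T.scomm_linear[OF \<theta>_hpart[OF x]] that] .
  have bc: "br x y \<in> carrier G" "br x y \<in> \<ll>" using br_ll[OF xl(1) y] l_carrier by auto
  have "scomm T (\<theta> x) (tn (gu y) \<one>\<^bsub>C\<^esub>) = tn (gu (br x y)) \<one>\<^bsub>C\<^esub>"
    using scomm_\<theta>[OF x, of "gu y" "\<one>\<^bsub>C\<^esub>"] yc scomm_gu[OF xl(2) yc] Cs.scomm_one[OF \<nu>_hpart[OF xl]] bc by simp
  moreover have "scomm T (\<theta> x) (tn \<one>\<^bsub>U\<^esub> (\<nu> y)) = tn \<one>\<^bsub>U\<^esub> (\<nu> (br x y))"
    using scomm_\<theta>[OF x, of "\<one>\<^bsub>U\<^esub>" "\<nu> y"] y \<nu>_br[OF xl(1) y] Us.scomm_one[OF gu_hpart[OF xl(2)]] bc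
    by (simp add: Us.parity_one)
  ultimately show ?thesis unfolding \<theta>_eq[of y] \<theta>_eq[of "br x y"] using sl yc y by simp
qed

sublocale al: alg_map L T \<theta>
  by (intro alg_map.intro alg_map_axioms.intro Ls.cvss_axioms ST.T.calg_axioms \<theta>_linear)

text \<open>By \<open>scomm_\<theta>_\<theta>\<close> the map \<open>\<theta>\<close> respects
  brackets, so the relations of the enveloping algebra of \<open>\<ll>\<close> go to zero and
  \<open>alg_ext T \<theta>\<close> is a well defined algebra morphism.\<close>

sublocale al: pres_map L "lie_rels L" T \<theta>
proof (intro pres_map.intro pres_map_axioms.intro UL.presentation_axioms al.alg_map_axioms)
  fix r assume "r \<in> lie_rels L"
  then obtain x y p q where xy: "x \<in> hpart L p" "y \<in> hpart L q"
    and r: "r = gen x * gen y - const (koszul p q) * gen y * gen x - gen (br x y)"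
    by (auto simp: lie_rels_def)
  have l: "x \<in> \<ll>" "y \<in> \<ll>" "br x y \<in> \<ll>" using xy br_ll by auto
  have "\<theta> x \<otimes>\<^bsub>T\<^esub> \<theta> y \<ominus>\<^bsub>T\<^esub> koszul p q \<odot>\<^bsub>T\<^esub> (\<theta> y \<otimes>\<^bsub>T\<^esub> \<theta> x) = \<theta> (br x y)"
    using scomm_\<theta>_\<theta>[OF xy(1) l(2)] ST.T.scomm_hom[OF \<theta>_hpart[OF xy(1)] \<theta>_closed[OF l(2)]]
      ST.T.parity_hom[OF \<theta>_hpart[OF xy(2)]] ST.T.sm_mult_l[OF \<theta>_closed[OF l(2)] \<theta>_closed[OF l(1)]]
    by simp
  moreover have "al.ev r \<one>\<^bsub>T\<^esub> = (\<theta> x \<otimes>\<^bsub>T\<^esub> \<theta> y \<ominus>\<^bsub>T\<^esub> koszul p q \<odot>\<^bsub>T\<^esub> (\<theta> y \<otimes>\<^bsub>T\<^esub> \<theta> x)) \<ominus>\<^bsub>T\<^esub> \<theta> (br x y)"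
    unfolding r using l \<theta>_closed ST.T.A.one_closed ST.T.A.m_closed
    by (simp add: al.ev_diff al.ev_mult mult.assoc del: ST.T_simps)
  ultimately show "al.ev r \<one>\<^bsub>T\<^esub> = \<zero>\<^bsub>T\<^esub>"
    using \<theta>_closed[OF l(3)] by (simp add: ST.T.diff_eq_zero_iff del: ST.T_simps)
qed

abbreviation "\<alpha> \<equiv> alg_ext T \<theta>"

lemma \<alpha>_linear: "is_linear UL T \<alpha>" and \<alpha>_one: "\<alpha> \<one>\<^bsub>UL\<^esub> = \<one>\<^bsub>T\<^esub>"
  and \<alpha>_mult: "y \<in> carrier UL \<Longrightarrow> y' \<in> carrier UL \<Longrightarrow> \<alpha> (y \<otimes>\<^bsub>UL\<^esub> y') = \<alpha> y \<otimes>\<^bsub>T\<^esub> \<alpha> y'"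
  and \<alpha>_gen: "x \<in> \<ll> \<Longrightarrow> \<alpha> (uea_gen L x) = \<theta> x"
  using al.ext_linear al.ext_one al.ext_mult al.ext_gen[of x] unfolding Pr_eq
  by (auto simp: uea_gen_def uea_class_def)

lemma \<alpha>_closed [simp]: "y \<in> carrier UL \<Longrightarrow> \<alpha> y \<in> carrier T"
  using linD(1)[OF \<alpha>_linear] .

lemma ugl_hpart: "x \<in> hpart L p \<Longrightarrow> uea_gen L x \<in> hpart UL p"
  using UL.gen_hpart[of x p] by (simp add: Pr_eq uea_gen_def uea_class_def)

lemma \<alpha>_hpart: "y \<in> hpart UL p \<Longrightarrow> \<alpha> y \<in> hpart T p"
  using al.act_hpart[OF UL.graded_presentation_axioms ST.T.sspace_axioms _ _ ST.T.one_even, of y p] 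
    ST.T.mult_hpart[OF \<theta>_hpart]
  unfolding Pr_eq alg_ext_def by simp

lemma \<alpha>_parity: "y \<in> carrier UL \<Longrightarrow> \<alpha> (parity UL p y) = parity T p (\<alpha> y)"
  by (rule hom_parity[OF ULs.sspace_axioms ST.T.sspace_axioms \<alpha>_linear \<alpha>_hpart])

lemma \<theta>_\<alpha>_center:
  assumes "x \<in> hpart L p" "y \<in> scenter UL" shows "\<theta> x \<otimes>\<^bsub>T\<^esub> \<alpha> y = parity T p (\<alpha> y) \<otimes>\<^bsub>T\<^esub> \<theta> x"
proof -
  have x: "x \<in> \<ll>" "uea_gen L x \<in> carrier UL" using assms(1) ugl_hpart ULs.hpartD(7) by auto
  have y: "y \<in> carrier UL" using assms(2) by (rule ULs.scenter_closed)
  have "\<theta> x \<otimes>\<^bsub>T\<^esub> \<alpha> y = \<alpha> (uea_gen L x \<otimes>\<^bsub>UL\<^esub> y)" using x y by (simp add: \<alpha>_mult \<alpha>_gen del: ST.T_simps)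
  also have "\<dots> = \<alpha> (parity UL p y \<otimes>\<^bsub>UL\<^esub> uea_gen L x)"
    using ULs.scenterD[OF assms(2) ugl_hpart[OF assms(1)]] by simp
  also have "\<dots> = parity T p (\<alpha> y) \<otimes>\<^bsub>T\<^esub> \<theta> x" using x y by (simp add: \<alpha>_mult \<alpha>_gen \<alpha>_parity del: ST.T_simps)
  finally show ?thesis .
qed

lemma \<theta>_center:
  assumes x: "x \<in> hpart L p" and z: "z \<in> scenter U"
  shows "\<theta> x \<otimes>\<^bsub>T\<^esub> tn z \<one>\<^bsub>C\<^esub> = parity T p (tn z \<one>\<^bsub>C\<^esub>) \<otimes>\<^bsub>T\<^esub> \<theta> x"
proof -
  have zc: "z \<in> carrier U" using z by (rule Us.scenter_closed)
  have gx: "gu x \<in> hpart U p" "\<nu> x \<in> hpart C p" using x gu_hpart \<nu>_hpart by auto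
  have "scomm U (gu x) z = \<zero>\<^bsub>U\<^esub>" using z Us.hpartD(7)[OF gx(1)] by (simp add: scenter_def)
  then have "scomm T (\<theta> x) (tn z \<one>\<^bsub>C\<^esub>) = \<zero>\<^bsub>T\<^esub>"
    using scomm_\<theta>[OF x zc Cs.A.one_closed] Cs.scomm_one[OF gx(2)] zc by simp
  then show ?thesis using zc by (subst (asm) ST.T.scomm_eq_zero_iff[OF \<theta>_hpart[OF x]]) auto
qed

end

text \<open>Moves a sum over \<open>J\<close> to the common index set \<open>I\<close>, where
  several such sums can be added coefficientwise.\<close>

lemma (in combination) comb_reindex:
  assumes "finite J" "\<And>j. j \<in> J \<Longrightarrow> e j \<in> I"
  shows "comb V J (\<lambda>j. F (e j)) t = comb V I F (\<lambda>m. \<Sum>j\<in>J. if m = e j then t j else 0)"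
proof -
  have "comb V J (\<lambda>j. F (e j)) t = (\<Oplus>j\<in>J. comb V I F (\<lambda>m. if m = e j then t j else 0))"
    unfolding comb_def[of V J] by (rule M.add.finprod_cong') (use assms comb_delta in auto)
  then show ?thesis using comb_sum[OF assms(1)] by simp
qed

subsection \<open>Dual bases\<close>

context dirac begin

lemma X_s: "i < n \<Longrightarrow> X i \<in> \<ss>" and Xd_s: "i < n \<Longrightarrow> Xd i \<in> \<ss>"
  and X_hpart: "i < n \<Longrightarrow> X i \<in> hpart G (px i)"
  and form_dual: "i < n \<Longrightarrow> j < n \<Longrightarrow> B (Xd i) (X j) = (if i = j then 1 else 0)"
  using bases by (auto simp: homogeneous_dual_bases_def is_basis_def)

lemma X_carrier [simp]: "i < n \<Longrightarrow> X i \<in> carrier G" and Xd_carrier [simp]: "i < n \<Longrightarrow> Xd i \<in> carrier G"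
  using X_s Xd_s s_carrier by auto

lemma form_sm:
  "x \<in> carrier G \<Longrightarrow> z \<in> carrier G \<Longrightarrow> B (c \<odot> x) z = c * B x z"
  "x \<in> carrier G \<Longrightarrow> z \<in> carrier G \<Longrightarrow> B z (c \<odot> x) = c * B z x"
  using form_lin(2,4)[of x x z c] by auto

lemma form_finsum:
  assumes "\<And>i. i \<in> A \<Longrightarrow> g i \<in> carrier G" "z \<in> carrier G" "finite A"
  shows "B (\<Oplus>i\<in>A. g i) z = (\<Sum>i\<in>A. B (g i) z)" "B z (\<Oplus>i\<in>A. g i) = (\<Sum>i\<in>A. B z (g i))"
proof -
  have "B (\<Oplus>i\<in>A. g i) z = (\<Sum>i\<in>A. B (g i) z) \<and> B z (\<Oplus>i\<in>A. g i) = (\<Sum>i\<in>A. B z (g i))"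
    using assms(3,1)
  proof (induction A rule: finite_induct)
    case empty then show ?case using assms(2) by (simp add: form_zero)
  next
    case (insert i A)
    then have "g \<in> A \<rightarrow> carrier G" by auto
    then show ?case using insert assms(2) M.finsum_closed[of g A] by (simp add: M.finsum_insert form_lin)
  qed
  then show "B (\<Oplus>i\<in>A. g i) z = (\<Sum>i\<in>A. B (g i) z)" "B z (\<Oplus>i\<in>A. g i) = (\<Sum>i\<in>A. B z (g i))" by auto
qed

text \<open>The order of the arguments of \<open>B\<close> matters, since the form is skew on odd
  vectors: coefficients along \<open>X\<close> are read with \<open>Xd\<close> on the left, those
  along \<open>Xd\<close> in \<open>expand_Xd\<close> with \<open>X\<close> on the right.\<close>

lemma expand_X:
  assumes "v \<in> \<ss>" shows "v = (\<Oplus>i\<in>{..<n}. B (Xd i) v \<odot> X i)"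
proof -
  obtain c where v: "v = (\<Oplus>i\<in>{..<n}. c i \<odot> X i)"
    using bases assms by (auto simp: homogeneous_dual_bases_def is_basis_def)
  have "B (Xd j) v = c j" if "j < n" for j
  proof -
    have "B (Xd j) v = (\<Sum>i\<in>{..<n}. B (Xd j) (c i \<odot> X i))"
      unfolding v by (rule form_finsum) (use that in auto)
    also have "\<dots> = (\<Sum>i\<in>{..<n}. if j = i then c i else 0)"
      by (rule sum.cong) (use that form_sm form_dual in auto)
    finally show ?thesis using that by simp
  qed
  then have "(\<Oplus>i\<in>{..<n}. B (Xd i) v \<odot> X i) = (\<Oplus>i\<in>{..<n}. c i \<odot> X i)"
    by (intro M.add.finprod_cong') auto
  then show ?thesis using v by simp
qed

lemma expand_Xd:
  assumes "v \<in> \<ss>" shows "v = (\<Oplus>i\<in>{..<n}. B v (X i) \<odot> Xd i)"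
proof -
  obtain c where v: "v = (\<Oplus>i\<in>{..<n}. c i \<odot> Xd i)"
    using bases assms by (auto simp: homogeneous_dual_bases_def is_basis_def)
  have "B v (X j) = c j" if "j < n" for j
  proof -
    have "B v (X j) = (\<Sum>i\<in>{..<n}. B (c i \<odot> Xd i) (X j))"
      unfolding v by (rule form_finsum) (use that in auto)
    also have "\<dots> = (\<Sum>i\<in>{..<n}. if j = i then c i else 0)"
      by (rule sum.cong) (use that form_sm form_dual in auto)
    finally show ?thesis using that by simp
  qed
  then have "(\<Oplus>i\<in>{..<n}. B v (X i) \<odot> Xd i) = (\<Oplus>i\<in>{..<n}. c i \<odot> Xd i)"
    by (intro M.add.finprod_cong') auto
  then show ?thesis using v by simp
qed

text \<open>Homogeneity is assumed for the \<open>X i\<close> only. The component of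
  \<open>Xd i\<close> of the wrong parity pairs to zero with every \<open>X j\<close>: by evenness
  of the form, or, if \<open>X j\<close> has that parity, because then \<open>j \<noteq> i\<close>.
  So it vanishes by \<open>expand_Xd\<close>.\<close>

lemma Xd_hpart: assumes i: "i < n" shows "Xd i \<in> hpart G (px i)"
proof -
  let ?v = "hproj G (px i + 1) (Xd i)" and ?w = "hproj G (px i) (Xd i)"
  have v: "?v \<in> \<ss>" using s_graded Xd_s[OF i] by (simp add: graded_sub_def)
  have dec: "Xd i = ?w \<oplus> ?v" using hproj_decomp[of "Xd i"] i by (cases "px i") (simp_all add: M.a_comm)
  have "B ?v (X j) = 0" if j: "j < n" for j
  proof (cases "px j = px i + 1")
    case True
    then have "j \<noteq> i" by (cases "px i") auto
    have "B (Xd i) (X j) = B ?w (X j) + B ?v (X j)"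
      by (subst dec) (use i j in \<open>auto intro!: form_lin(1)\<close>)
    moreover have "B ?w (X j) = 0"
      by (rule form_even[OF hproj_in X_hpart[OF j]]) (use i True in \<open>cases "px i"; simp\<close>)+
    ultimately show ?thesis using form_dual[OF i j] \<open>j \<noteq> i\<close> by simp
  next
    case False
    then show ?thesis using i by (intro form_even[OF hproj_in X_hpart[OF j]]) auto
  qed
  then have "?v = (\<Oplus>j\<in>{..<n}. \<zero>)"
    by (subst expand_Xd[OF v]) (rule M.add.finprod_cong', auto)
  then have "?v = \<zero>" by simp
  then have "Xd i = ?w" using dec i by simp
  then show ?thesis using hproj_in[OF Xd_carrier[OF i]] by metis
qed

abbreviation "cx i \<equiv> gc (Xd i)"

lemma cx_closed [simp]: "i < n \<Longrightarrow> cx i \<in> carrier C" by (simp add: Xd_s)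

lemma cx_hpart: "i < n \<Longrightarrow> cx i \<in> hpart C (px i)" by (intro gc_hpart Xd_s Xd_hpart)

lemma gc_expand: "v \<in> \<ss> \<Longrightarrow> gc v = comb C {..<n} cx (\<lambda>i. B v (X i))"
proof -
  assume v: "v \<in> \<ss>"
  interpret cvs2 S C by unfold_locales
  interpret inc: cvs2 S G by unfold_locales
  have "is_linear S G (\<lambda>x. x)" by (rule linI) (simp_all add: s_carrier)
  from inc.lin_comb[OF this, of "{..<n}" Xd]
  have "(\<Oplus>i\<in>{..<n}. B v (X i) \<odot> Xd i) = comb S {..<n} Xd (\<lambda>i. B v (X i))"
    by (simp add: Xd_s) (simp add: comb_def)
  then have "gc v = gc (comb S {..<n} Xd (\<lambda>i. B v (X i)))" using expand_Xd[OF v] by simp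
  also have "\<dots> = comb C {..<n} cx (\<lambda>i. B v (X i))"
    by (rule lin_comb[OF gc_linear]) (simp add: Xd_s)
  finally show ?thesis .
qed

lemma gu_expand: "v \<in> \<ss> \<Longrightarrow> gu v = comb U {..<n} (\<lambda>i. gu (X i)) (\<lambda>i. B (Xd i) v)"
proof -
  assume v: "v \<in> \<ss>"
  interpret cvs2 G U by unfold_locales
  have "gu v = gu (comb G {..<n} X (\<lambda>i. B (Xd i) v))" using expand_X[OF v] by (simp add: comb_def)
  also have "\<dots> = comb U {..<n} (\<lambda>i. gu (X i)) (\<lambda>i. B (Xd i) v)"
    by (rule lin_comb[OF gu_linear]) simp
  finally show ?thesis .
qed

text \<open>By invariance of the form, the matrix of \<open>x\<close> on the dual basis is the
  negative transpose of its matrix on \<open>X\<close>, up to a Koszul sign.\<close>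

lemma form_br_Xd:
  assumes x: "x \<in> hpart L p" and "i < n" "j < n"
  shows "B (br x (Xd i)) (X j) = - koszul p (px i) * B (Xd i) (br x (X j))"
proof -
  have xc: "x \<in> hpart G p" "x \<in> carrier G" using x l_carrier by auto
  have "br x (Xd i) = (- koszul p (px i)) \<odot> br (Xd i) x"
    using br_anti[OF xc(1) Xd_hpart[OF assms(2)]] .
  then have "B (br x (Xd i)) (X j) = - koszul p (px i) * B (br (Xd i) x) (X j)"
    using form_lin(2)[of "br (Xd i) x" "br (Xd i) x" "X j"] brD(1)[of "Xd i" x] xc assms by simp
  then show ?thesis using form_lin(5)[of "Xd i" x "X j"] xc assms by simp
qed

subsection \<open>Invariance of the linear term\<close>

definition linear_term where "linear_term = (\<Oplus>\<^bsub>T\<^esub> i\<in>{..<n}. tn (gu (X i)) (cx i))"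

lemma tn_cx_closed: "i < n \<Longrightarrow> j < n \<Longrightarrow> tn (gu (X i)) (cx j) \<in> carrier T" by simp

lemma linear_term_hpart: "linear_term \<in> hpart T 0"
  unfolding linear_term_def
proof (rule ST.T.submodule_finsum[OF ST.T.hpart_submodule])
  fix i assume "i \<in> {..<n}"
  then show "tn (gu (X i)) (cx i) \<in> hpart T 0"
    using ST.tn_hpart[OF gu_hpart[OF X_hpart] cx_hpart, of i i] by simp
qed

text \<open>The tensor of \<open>X a\<close> and \<open>Xd b\<close> is reached twice: from the
  summand \<open>i = b\<close> by acting on the first factor, and from \<open>i = a\<close> by
  acting on the second. The two coefficients cancel by \<open>form_br_Xd\<close>.\<close>

lemma scomm_linear_term:
  assumes x: "x \<in> hpart L p" shows "scomm T (\<theta> x) linear_term = \<zero>\<^bsub>T\<^esub>"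
proof -
  have xl: "x \<in> \<ll>" "x \<in> hpart G p" "x \<in> carrier G" using x l_carrier by auto
  let ?I = "{..<n} \<times> {..<n}" and ?F = "\<lambda>(i, j). tn (gu (X i)) (cx j)"
  interpret K: combination T ?I ?F by unfold_locales (auto simp: tn_cx_closed)
  let ?s = "\<lambda>i m. (\<Sum>l<n. if m = (l, i) then B (Xd l) (br x (X i)) else 0) +
      koszul p (px i) * (\<Sum>l<n. if m = (i, l) then B (br x (Xd i)) (X l) else 0)"
  have summand: "scomm T (\<theta> x) (tn (gu (X i)) (cx i)) = comb T ?I ?F (?s i)" if i: "i < n" for i
  proof -
    have brs: "br x (X i) \<in> \<ss>" "br x (Xd i) \<in> \<ss>" using br_ls xl X_s Xd_s i by auto
    have "tn (gu (br x (X i))) (cx i) = comb T {..<n} (\<lambda>l. ?F (l, i)) (\<lambda>l. B (Xd l) (br x (X i)))"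
    proof -
      interpret cvs2 U T by unfold_locales
      have "is_linear U T (\<lambda>u. tn u (cx i))" using ST.tn_linear_l[of "cx i"] i by (simp add: is_linear_def)
      from lin_comb[OF this, of "{..<n}" "\<lambda>i. gu (X i)"] show ?thesis by (simp add: gu_expand[OF brs(1)])
    qed
    also have "\<dots> = comb T ?I ?F (\<lambda>m. \<Sum>l<n. if m = (l, i) then B (Xd l) (br x (X i)) else 0)"
      by (rule K.comb_reindex) (use i in auto)
    finally have 1: "tn (gu (br x (X i))) (cx i) = comb T ?I ?F (\<lambda>m. \<Sum>l<n. if m = (l, i) then B (Xd l) (br x (X i)) else 0)" .
    have "tn (gu (X i)) (gc (br x (Xd i))) = comb T {..<n} (\<lambda>l. ?F (i, l)) (\<lambda>l. B (br x (Xd i)) (X l))"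
    proof -
      interpret cvs2 C T by unfold_locales
      have "is_linear C T (\<lambda>u. tn (gu (X i)) u)" using ST.tn_linear_r[of "gu (X i)"] i by (simp add: is_linear_def)
      from lin_comb[OF this, of "{..<n}" cx] show ?thesis by (simp add: gc_expand[OF brs(2)])
    qed
    also have "\<dots> = comb T ?I ?F (\<lambda>m. \<Sum>l<n. if m = (i, l) then B (br x (Xd i)) (X l) else 0)"
      by (rule K.comb_reindex) (use i in auto)
    finally have 2: "tn (gu (X i)) (gc (br x (Xd i))) = comb T ?I ?F (\<lambda>m. \<Sum>l<n. if m = (i, l) then B (br x (Xd i)) (X l) else 0)" .
    have "scomm T (\<theta> x) (tn (gu (X i)) (cx i)) =
        tn (gu (br x (X i))) (cx i) \<oplus>\<^bsub>T\<^esub> koszul p (px i) \<odot>\<^bsub>T\<^esub> tn (gu (X i)) (gc (br x (Xd i)))"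
      using scomm_\<theta>[OF x, of "gu (X i)" "cx i"] i scomm_gu[OF xl(2), of "X i"] \<nu>_gc[OF xl(1) Xd_s[OF i]]
        Us.parity_hom[OF gu_hpart[OF X_hpart[OF i]]] brs
      by (simp add: ST.tn_sm_l)
    then show ?thesis unfolding 1 2 K.comb_scale K.comb_add .
  qed
  interpret cvs2 T T by unfold_locales
  have "scomm T (\<theta> x) linear_term = (\<Oplus>\<^bsub>T\<^esub> i\<in>{..<n}. scomm T (\<theta> x) (tn (gu (X i)) (cx i)))"
    unfolding linear_term_def by (rule lin_finsum[OF ST.T.scomm_linear[OF \<theta>_hpart[OF x]]]) (auto intro: tn_cx_closed)
  also have "\<dots> = (\<Oplus>\<^bsub>T\<^esub> i\<in>{..<n}. comb T ?I ?F (?s i))"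
    by (rule ST.T.M.add.finprod_cong'[OF refl _ summand]) (use K.comb_closed in auto)
  also have "\<dots> = comb T ?I ?F (\<lambda>m. \<Sum>i<n. ?s i m)" by (rule K.comb_sum) simp
  also have "\<dots> = \<zero>\<^bsub>T\<^esub>"
  proof (rule K.comb_zero)
    fix m assume "m \<in> ?I"
    then obtain a b where m: "m = (a, b)" "a < n" "b < n" by auto
    have "(\<Sum>i<n. ?s i m) = (\<Sum>i<n. (if b = i then B (Xd a) (br x (X i)) else 0) +
        (if a = i then koszul p (px i) * B (br x (Xd i)) (X b) else 0))"
    proof (rule sum.cong)
      fix i assume "i \<in> {..<n}"
      have "(\<Sum>l<n. if m = (l, i) then B (Xd l) (br x (X i)) else 0) =
          (\<Sum>l<n. if a = l then (if b = i then B (Xd l) (br x (X i)) else 0) else 0)"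
        by (rule sum.cong) (auto simp: m)
      moreover have "(\<Sum>l<n. if m = (i, l) then B (br x (Xd i)) (X l) else 0) =
          (\<Sum>l<n. if b = l then (if a = i then B (br x (Xd i)) (X l) else 0) else 0)"
        by (rule sum.cong) (auto simp: m)
      ultimately show "?s i m = (if b = i then B (Xd a) (br x (X i)) else 0) +
        (if a = i then koszul p (px i) * B (br x (Xd i)) (X b) else 0)"
        using m by simp
    qed simp
    also have "\<dots> = B (Xd a) (br x (X b)) + koszul p (px a) * B (br x (Xd a)) (X b)"
      using m by (simp add: sum.distrib)
    also have "\<dots> = 0" using form_br_Xd[OF x m(2,3)] by simp
    finally show "(\<Sum>i<n. ?s i m) = 0" .
  qed
  finally show ?thesis .
qed


subsection \<open>The cubic term\<close>

text \<open>The coefficients of the cubic term without the factor \<open>- 1 / 12\<close>. With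
  these signs they are totally super-antisymmetric in the three indices; see
  \<open>tau_swap12\<close> and \<open>tau_swap23\<close>.\<close>

definition tau :: "nat \<Rightarrow> nat \<Rightarrow> nat \<Rightarrow> complex" where
  "tau i j k = koszul (px i) (px j) * (if px k = 1 then - 1 else 1) * B (br (X i) (X j)) (X k)"

abbreviation "tau3 \<equiv> \<lambda>(i, j, k). tau i j k"
abbreviation "I3 \<equiv> {..<n} \<times> {..<n} \<times> {..<n}"

text \<open>The trailing unit is what \<open>foldr\<close> in \<open>quantize\<close> leaves at the
  end of a product; keeping it lets the two expressions match literally.\<close>

definition cube :: "nat \<times> nat \<times> nat \<Rightarrow> 'g free set" where
  "cube = (\<lambda>(i, j, k). cx i \<otimes>\<^bsub>C\<^esub> (cx j \<otimes>\<^bsub>C\<^esub> (cx k \<otimes>\<^bsub>C\<^esub> \<one>\<^bsub>C\<^esub>)))"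

lemma cube_closed: "m \<in> I3 \<Longrightarrow> cube m \<in> carrier C"
  by (auto simp: cube_def)

sublocale K3: combination C I3 cube
  by unfold_locales (auto intro: cube_closed)

lemma form3_even:
  assumes "i < n" "j < n" "k < n" "px i + px j + px k \<noteq> 0" shows "B (br (X i) (X j)) (X k) = 0"
proof (rule form_even[OF br_hpart[OF X_hpart X_hpart] X_hpart])
  show "px i + px j \<noteq> px k" using assms(4) by (metis bit_add_self(1))
qed (use assms in auto)

lemma tau_even: "i < n \<Longrightarrow> j < n \<Longrightarrow> k < n \<Longrightarrow> px i + px j + px k \<noteq> 0 \<Longrightarrow> tau i j k = 0"
  by (simp add: tau_def form3_even)

lemma tau_swap12:
  assumes "i < n" "j < n" "k < n" shows "tau j i k = - koszul (px i) (px j) * tau i j k"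
proof -
  have "B (br (X j) (X i)) (X k) = - koszul (px j) (px i) * B (br (X i) (X j)) (X k)"
    using br_anti[OF X_hpart X_hpart, of j i] form_lin(2)[of "br (X i) (X j)" "br (X i) (X j)" "X k"] assms brD(1)
    by simp
  then show ?thesis by (simp add: tau_def koszul_sym[of "px j"])
qed

text \<open>Invariance and supersymmetry of the form rotate the entry \<open>k\<close> out of the
  bracket. The signs are compared for triples of total parity zero; for the others both sides vanish
  because the form is even.\<close>

lemma tau_swap23:
  assumes "i < n" "j < n" "k < n" shows "tau i k j = - koszul (px j) (px k) * tau i j k"
proof (cases "px i + px j + px k = 0")
  case False
  moreover from False have "px i + px k + px j \<noteq> 0" by (simp add: ac_simps)
  ultimately show ?thesis using tau_even assms by simp
next
  case True
  have c: "X i \<in> carrier G" "X j \<in> carrier G" "X k \<in> carrier G" "br (X i) (X j) \<in> carrier G" "br (X k) (X i) \<in> carrier G"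
    using assms brD(1) by auto
  have "B (br (X i) (X k)) (X j) = - koszul (px i) (px k) * B (br (X k) (X i)) (X j)"
    using br_anti[OF X_hpart X_hpart, of i k] form_lin(2)[OF c(5) c(5) c(2)] assms by simp
  also have "B (br (X k) (X i)) (X j) = B (X k) (br (X i) (X j))"
    by (rule form_lin(5)) (use c in auto)
  also have "\<dots> = koszul (px k) (px i + px j) * B (br (X i) (X j)) (X k)"
    using form_sym[OF X_hpart br_hpart[OF X_hpart X_hpart], of k i j] assms by simp
  finally have "tau i k j = koszul (px i) (px k) * (if px j = 1 then - 1 else 1) *
    (- koszul (px i) (px k) * (koszul (px k) (px i + px j) * B (br (X i) (X j)) (X k)))" by (simp add: tau_def)
  then show ?thesis using True
    by (cases "px i"; cases "px j"; cases "px k") (simp_all add: tau_def)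
qed

lemma permutes_3_cases:
  assumes "\<sigma> permutes {..<3::nat}"
  obtains "\<sigma> 0 = 0" "\<sigma> 1 = 1" "\<sigma> 2 = 2" | "\<sigma> 0 = 1" "\<sigma> 1 = 0" "\<sigma> 2 = 2"
    | "\<sigma> 0 = 0" "\<sigma> 1 = 2" "\<sigma> 2 = 1" | "\<sigma> 0 = 1" "\<sigma> 1 = 2" "\<sigma> 2 = 0"
    | "\<sigma> 0 = 2" "\<sigma> 1 = 0" "\<sigma> 2 = 1" | "\<sigma> 0 = 2" "\<sigma> 1 = 1" "\<sigma> 2 = 0"
proof -
  have "\<sigma> i < 3" if "i < 3" for i using permutes_in_image[OF assms, of i] that by simp
  from this[of 0] this[of 1] this[of 2]
  have "\<sigma> 0 = 0 \<or> \<sigma> 0 = 1 \<or> \<sigma> 0 = 2" "\<sigma> 1 = 0 \<or> \<sigma> 1 = 1 \<or> \<sigma> 1 = 2" "\<sigma> 2 = 0 \<or> \<sigma> 2 = 1 \<or> \<sigma> 2 = 2"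
    by linarith+
  moreover have "\<sigma> 0 \<noteq> \<sigma> 1" "\<sigma> 0 \<noteq> \<sigma> 2" "\<sigma> 1 \<noteq> \<sigma> 2"
    using permutes_inj[OF assms] by (simp_all add: inj_eq)
  ultimately show ?thesis by (elim disjE) (use that in simp_all)
qed

text \<open>The coefficient of \<sigma> in \<open>quantize\<close> for three factors;
  \<open>arrange\<close> below lists the indices in the order in which \<sigma> multiplies
  them.\<close>

definition kappa :: "(nat \<Rightarrow> nat) \<Rightarrow> nat \<Rightarrow> nat \<Rightarrow> nat \<Rightarrow> complex" where
  "kappa \<sigma> i j k = 1 / fact 3 * of_int (sign \<sigma>) *
     (\<Prod>(a, b)\<in>{(a, b). a < b \<and> b < 3 \<and> \<sigma> b < \<sigma> a}.
        koszul ([px i, px j, px k] ! \<sigma> a) ([px i, px j, px k] ! \<sigma> b))"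

definition arrange :: "(nat \<Rightarrow> nat) \<Rightarrow> nat \<Rightarrow> nat \<Rightarrow> nat \<Rightarrow> nat \<times> nat \<times> nat" where
  "arrange \<sigma> i j k = ([i, j, k] ! \<sigma> 0, [i, j, k] ! \<sigma> 1, [i, j, k] ! \<sigma> 2)"

lemma prod_inversions_3:
  fixes g :: "nat \<times> nat \<Rightarrow> complex" and \<sigma> :: "nat \<Rightarrow> nat"
  shows "prod g {(a, b). a < b \<and> b < 3 \<and> \<sigma> b < \<sigma> a} =
    (if \<sigma> 1 < \<sigma> 0 then g (0, 1) else 1) * (if \<sigma> 2 < \<sigma> 0 then g (0, 2) else 1) *
    (if \<sigma> 2 < \<sigma> 1 then g (1, 2) else 1)"
proof -
  have "{(a, b). a < b \<and> b < 3 \<and> \<sigma> b < \<sigma> a} = {x \<in> {(0, 1), (0, 2), (1, 2)}. \<sigma> (snd x) < \<sigma> (fst x)}"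
    by (auto simp: less_Suc_eq numeral_3_eq_3 numeral_2_eq_2)
  then show ?thesis by (simp only:) (subst prod.inter_filter, simp_all add: mult_ac)
qed

lemma arrange_closed: "\<sigma> permutes {..<3} \<Longrightarrow> i < n \<Longrightarrow> j < n \<Longrightarrow> k < n \<Longrightarrow> arrange \<sigma> i j k \<in> I3"
  by (erule permutes_3_cases) (simp_all add: arrange_def)

text \<open>By the total super-antisymmetry of \<open>tau\<close>, every permutation in the quantization map
  contributes a multiple of the same tensor, so the sum over permutations need not be evaluated.\<close>

lemma tau_kappa:
  assumes "\<sigma> permutes {..<3}"
  shows "\<exists>e. \<forall>m\<in>I3. (\<Sum>i<n. \<Sum>j<n. \<Sum>k<n. if m = arrange \<sigma> i j k then tau i j k * kappa \<sigma> i j k else 0) = e * tau3 m"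
proof -
  \<comment> \<open>\<open>sign \<sigma>\<close> stays unevaluated. Each case below only shows that
    the Koszul factors of \<open>tau\<close> and \<open>kappa\<close> cancel and leave plus or minus
    this number.\<close>
  let ?s = "1 / fact 3 * of_int (sign \<sigma>) :: complex"
  have d: "(\<Sum>i<n. \<Sum>j<n. \<Sum>k<n. if a = i \<and> b = j \<and> c = k then h i j k else 0) = h a b c"
    if "a < n" "b < n" "c < n" for a b c and h :: "nat \<Rightarrow> nat \<Rightarrow> nat \<Rightarrow> complex"
  proof -
    have 1: "(\<Sum>k<n. if a = i \<and> b = j \<and> c = k then h i j k else 0) =
        (if b = j then (if a = i then h i j c else 0) else 0)" for i j
      by (cases "a = i \<and> b = j") (use that in auto)
    have 2: "(\<Sum>j<n. if b = j then (if a = i then h i j c else 0) else 0) = (if a = i then h i b c else 0)" for i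
      using that by simp
    show ?thesis unfolding 1 2 using that by simp
  qed
  \<comment> \<open>\<open>(a, b, c)\<close> is the one triple that \<sigma> rearranges into
    \<open>(u, v, w)\<close>, so a single summand survives.\<close>
  have key: "(\<Sum>i<n. \<Sum>j<n. \<Sum>k<n. if (u, v, w) = arrange \<sigma> i j k then tau i j k * kappa \<sigma> i j k else 0) = e * tau u v w"
    if ar: "\<And>i j k. i < n \<Longrightarrow> j < n \<Longrightarrow> k < n \<Longrightarrow> (u, v, w) = arrange \<sigma> i j k \<longleftrightarrow> a = i \<and> b = j \<and> c = k"
      and abc: "a < n" "b < n" "c < n" and t: "tau a b c * kappa \<sigma> a b c = e * tau u v w" for u v w a b c e
  proof -
    have "(\<Sum>i<n. \<Sum>j<n. \<Sum>k<n. if (u, v, w) = arrange \<sigma> i j k then tau i j k * kappa \<sigma> i j k else 0) =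
      (\<Sum>i<n. \<Sum>j<n. \<Sum>k<n. if a = i \<and> b = j \<and> c = k then tau i j k * kappa \<sigma> i j k else 0)"
      by (intro sum.cong refl) (simp add: ar)
    then show ?thesis using d[OF abc, of "\<lambda>i j k. tau i j k * kappa \<sigma> i j k"] t by simp
  qed
  note sw = tau_swap12 tau_swap23
  let ?sum = "\<lambda>m. \<Sum>i<n. \<Sum>j<n. \<Sum>k<n. if m = arrange \<sigma> i j k then tau i j k * kappa \<sigma> i j k else 0"
  have fin: ?thesis if "\<And>u v w. u < n \<Longrightarrow> v < n \<Longrightarrow> w < n \<Longrightarrow> ?sum (u, v, w) = e * tau u v w" for e
    by (rule exI[of _ e]) (use that in auto)
  note defs = arrange_def kappa_def prod_inversions_3
  show ?thesis using assms
  proof (cases rule: permutes_3_cases)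
    case 1
    show ?thesis
    proof (rule fin[of "?s"])
      fix u v w assume m: "u < n" "v < n" "w < n"
      show "?sum (u, v, w) = ?s * tau u v w"
        by (rule key[of _ _ _ u v w])
           (use m  in \<open>auto simp: defs 1 koszul_sym simp del: One_nat_def\<close>)
    qed
  next
    case 2
    show ?thesis
    proof (rule fin[of "- ?s"])
      fix u v w assume m: "u < n" "v < n" "w < n"
      show "?sum (u, v, w) = - ?s * tau u v w"
        by (rule key[of _ _ _ v u w])
           (use m sw(1)[OF m] in \<open>auto simp: defs 2 koszul_sym simp del: One_nat_def\<close>)
    qed
  next
    case 3
    show ?thesis
    proof (rule fin[of "- ?s"])
      fix u v w assume m: "u < n" "v < n" "w < n"
      show "?sum (u, v, w) = - ?s * tau u v w"
        by (rule key[of _ _ _ u w v])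
           (use m sw(2)[OF m] in \<open>auto simp: defs 3 koszul_sym simp del: One_nat_def\<close>)
    qed
  next
    \<comment> \<open>A cyclic permutation is a product of two adjacent transpositions:
      \<open>tau w u v\<close> is compared with \<open>tau u w v\<close>, and that with
      \<open>tau u v w\<close>, so the two minus signs cancel. The reversal in the last case takes
      three such steps.\<close>
    case 4
    show ?thesis
    proof (rule fin[of "?s"])
      fix u v w assume m: "u < n" "v < n" "w < n"
      show "?sum (u, v, w) = ?s * tau u v w"
        by (rule key[of _ _ _ w u v])
           (use m sw(1)[of u w v] sw(2)[of u v w] in \<open>auto simp: defs 4 koszul_def simp del: One_nat_def\<close>)
    qed
  next
    case 5
    show ?thesis
    proof (rule fin[of "?s"])
      fix u v w assume m: "u < n" "v < n" "w < n"
      show "?sum (u, v, w) = ?s * tau u v w"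
        by (rule key[of _ _ _ v w u])
           (use m sw(2)[of v u w] sw(1)[of u v w] in \<open>auto simp: defs 5 koszul_sym simp del: One_nat_def\<close>)
    qed
  next
    case 6
    show ?thesis
    proof (rule fin[of "- ?s"])
      fix u v w assume m: "u < n" "v < n" "w < n"
      show "?sum (u, v, w) = - ?s * tau u v w"
        by (rule key[of _ _ _ w v u])
           (use m sw(1)[of v w u] sw(2)[of v u w] sw(1)[of u v w] in \<open>auto simp: defs 6 koszul_sym simp del: One_nat_def\<close>)
    qed
  qed
qed


text \<open>Coordinates of a quantized product over the index set \<open>I3\<close>; distinct
  permutations may contribute to the same triple when indices coincide, hence the sum in the
  coefficient.\<close>

lemma quantize_3:
  assumes "i < n" "j < n" "k < n"
  shows "quantize S B [Xd i, Xd j, Xd k] [px i, px j, px k] =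
    comb C I3 cube (\<lambda>m. \<Sum>\<sigma>\<in>{\<sigma>. \<sigma> permutes {..<3}}. if m = arrange \<sigma> i j k then kappa \<sigma> i j k else 0)"
proof -
  have nth: "[Xd i, Xd j, Xd k] ! \<sigma> a = Xd ([i, j, k] ! \<sigma> a)" if "\<sigma> permutes {..<3}" "a < 3" for \<sigma> a
  proof -
    have "\<sigma> a < 3" using permutes_in_image[OF that(1), of a] that(2) by simp
    then show ?thesis using nth_map[of "\<sigma> a" "[i, j, k]" Xd] by simp
  qed
  have len: "length [a, b, c] = 3" for a b c :: 'g by simp
  have up: "[0..<3] = [0, 1, 2::nat]" by (simp add: upt_rec)
  have "quantize S B [Xd i, Xd j, Xd k] [px i, px j, px k] =
      (\<Oplus>\<^bsub>C\<^esub> \<sigma>\<in>{\<sigma>. \<sigma> permutes {..<3}}. kappa \<sigma> i j k \<odot>\<^bsub>C\<^esub>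
        foldr (\<lambda>a y. gc ([Xd i, Xd j, Xd k] ! \<sigma> a) \<otimes>\<^bsub>C\<^esub> y) [0..<3] \<one>\<^bsub>C\<^esub>)"
    unfolding quantize_def Let_def kappa_def by (simp only: len)
  also have "\<dots> = (\<Oplus>\<^bsub>C\<^esub> \<sigma>\<in>{\<sigma>. \<sigma> permutes {..<3}}.
      comb C I3 cube (\<lambda>m. if m = arrange \<sigma> i j k then kappa \<sigma> i j k else 0))"
  proof (rule Cs.M.add.finprod_cong'[OF refl])
    fix \<sigma> assume "\<sigma> \<in> {\<sigma>. \<sigma> permutes {..<3::nat}}"
    then have \<sigma>: "\<sigma> permutes {..<3}" by simp
    have "foldr (\<lambda>a y. gc ([Xd i, Xd j, Xd k] ! \<sigma> a) \<otimes>\<^bsub>C\<^esub> y) [0..<3] \<one>\<^bsub>C\<^esub> = cube (arrange \<sigma> i j k)"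
      using nth[OF \<sigma>, of 0] nth[OF \<sigma>, of 1] nth[OF \<sigma>, of 2] by (simp add: up cube_def arrange_def)
    then show "kappa \<sigma> i j k \<odot>\<^bsub>C\<^esub> foldr (\<lambda>a y. gc ([Xd i, Xd j, Xd k] ! \<sigma> a) \<otimes>\<^bsub>C\<^esub> y) [0..<3] \<one>\<^bsub>C\<^esub> =
        comb C I3 cube (\<lambda>m. if m = arrange \<sigma> i j k then kappa \<sigma> i j k else 0)"
      using K3.comb_delta[OF arrange_closed[OF \<sigma> assms]] by simp
  qed (use K3.comb_closed in auto)
  also have "\<dots> = comb C I3 cube (\<lambda>m. \<Sum>\<sigma>\<in>{\<sigma>. \<sigma> permutes {..<3}}. if m = arrange \<sigma> i j k then kappa \<sigma> i j k else 0)"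
    by (rule K3.comb_sum) (simp add: finite_permutations)
  finally show ?thesis .
qed

abbreviation "\<phi> \<equiv> cubic_term G B \<ss> n X px Xd"

text \<open>By \<open>tau_kappa\<close> each permutation contributes a multiple of the same tensor,
  so quantization only rescales it. The scalar \<open>e\<close> is left implicit because commutation
  is a linear condition.\<close>

lemma cubic_term_eq: "\<exists>e. \<phi> = comb C I3 cube (\<lambda>m. e * tau3 m)"
proof -
  let ?P = "{\<sigma>. \<sigma> permutes {..<3::nat}}"
  let ?q = "\<lambda>i j k m. \<Sum>\<sigma>\<in>?P. if m = arrange \<sigma> i j k then kappa \<sigma> i j k else 0"
  have "\<phi> = (- 1 / 12) \<odot>\<^bsub>C\<^esub> (\<Oplus>\<^bsub>C\<^esub> i\<in>{..<n}. \<Oplus>\<^bsub>C\<^esub> j\<in>{..<n}. \<Oplus>\<^bsub>C\<^esub> k\<in>{..<n}.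
       tau i j k \<odot>\<^bsub>C\<^esub> quantize S B [Xd i, Xd j, Xd k] [px i, px j, px k])"
    by (simp add: cubic_term_def Let_def tau_def)
  also have "(\<Oplus>\<^bsub>C\<^esub> i\<in>{..<n}. \<Oplus>\<^bsub>C\<^esub> j\<in>{..<n}. \<Oplus>\<^bsub>C\<^esub> k\<in>{..<n}.
       tau i j k \<odot>\<^bsub>C\<^esub> quantize S B [Xd i, Xd j, Xd k] [px i, px j, px k]) =
      (\<Oplus>\<^bsub>C\<^esub> i\<in>{..<n}. \<Oplus>\<^bsub>C\<^esub> j\<in>{..<n}. \<Oplus>\<^bsub>C\<^esub> k\<in>{..<n}.
       comb C I3 cube (\<lambda>m. tau i j k * ?q i j k m))"
    using K3.comb_closed
    by (intro Cs.M.add.finprod_cong' refl Pi_I Cs.M.finsum_closed)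
       (auto simp: quantize_3 K3.comb_scale)
  also have "\<dots> = comb C I3 cube (\<lambda>m. \<Sum>i<n. \<Sum>j<n. \<Sum>k<n. tau i j k * ?q i j k m)"
    by (simp only: K3.comb_sum finite_lessThan)
  also have "(- 1 / 12) \<odot>\<^bsub>C\<^esub> \<dots> = comb C I3 cube (\<lambda>m. (- 1 / 12) * (\<Sum>i<n. \<Sum>j<n. \<Sum>k<n. tau i j k * ?q i j k m))"
    by (rule K3.comb_scale)
  finally have 1: "\<phi> = comb C I3 cube (\<lambda>m. (- 1 / 12) * (\<Sum>i<n. \<Sum>j<n. \<Sum>k<n. tau i j k * ?q i j k m))" .
  obtain e where e: "\<And>\<sigma> m. \<sigma> \<in> ?P \<Longrightarrow> m \<in> I3 \<Longrightarrow>
      (\<Sum>i<n. \<Sum>j<n. \<Sum>k<n. if m = arrange \<sigma> i j k then tau i j k * kappa \<sigma> i j k else 0) = e \<sigma> * tau3 m"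
    using bchoice[of ?P "\<lambda>\<sigma> e. \<forall>m\<in>I3. (\<Sum>i<n. \<Sum>j<n. \<Sum>k<n. if m = arrange \<sigma> i j k then tau i j k * kappa \<sigma> i j k else 0) = e * tau3 m"]
      tau_kappa by blast
  have 2: "(\<Sum>i<n. \<Sum>j<n. \<Sum>k<n. tau i j k * ?q i j k m) = (\<Sum>\<sigma>\<in>?P. e \<sigma>) * tau3 m" if m: "m \<in> I3" for m
  proof -
    have "(\<Sum>i<n. \<Sum>j<n. \<Sum>k<n. tau i j k * ?q i j k m) =
      (\<Sum>i<n. \<Sum>j<n. \<Sum>k<n. \<Sum>\<sigma>\<in>?P. if m = arrange \<sigma> i j k then tau i j k * kappa \<sigma> i j k else 0)"
      by (simp add: sum_distrib_left if_distrib cong: if_cong)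
    \<comment> \<open>The sum over permutations is pulled outside so that \<open>tau_kappa\<close>
      applies to each of them.\<close>
    also have "\<dots> = (\<Sum>\<sigma>\<in>?P. \<Sum>i<n. \<Sum>j<n. \<Sum>k<n. if m = arrange \<sigma> i j k then tau i j k * kappa \<sigma> i j k else 0)"
      by (simp only: sum.swap[of _ ?P])
    also have "\<dots> = (\<Sum>\<sigma>\<in>?P. e \<sigma> * tau3 m)" by (rule sum.cong) (use e m in auto)
    finally show ?thesis by (simp add: sum_distrib_right)
  qed
  have "\<phi> = comb C I3 cube (\<lambda>m. ((- 1 / 12) * (\<Sum>\<sigma>\<in>?P. e \<sigma>)) * tau3 m)"
    unfolding 1 by (rule K3.comb_cong) (simp only: 2 mult.assoc)
  then show ?thesis by blast
qed

lemma cube_hpart: "i < n \<Longrightarrow> j < n \<Longrightarrow> k < n \<Longrightarrow> cube (i, j, k) \<in> hpart C (px i + px j + px k)"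
  using Cs.mult_hpart[OF cx_hpart Cs.mult_hpart[OF cx_hpart Cs.mult_hpart[OF cx_hpart Cs.one_even]], of i j k]
  by (simp add: cube_def add.assoc)

text \<open>A monomial of odd total parity has coefficient zero by \<open>tau_even\<close>.\<close>

lemma cubic_term_hpart: "\<phi> \<in> hpart C 0"
proof -
  obtain e where e: "\<phi> = comb C I3 cube (\<lambda>m. e * tau3 m)" using cubic_term_eq by blast
  show ?thesis unfolding e comb_def
  proof (rule Cs.submodule_finsum[OF Cs.hpart_submodule])
    fix m assume "m \<in> I3"
    then obtain i j k where m: "m = (i, j, k)" "i < n" "j < n" "k < n" by auto
    show "(e * tau3 m) \<odot>\<^bsub>C\<^esub> cube m \<in> hpart C 0"
    proof (cases "px i + px j + px k = 0")
      case True then show ?thesis using cube_hpart[of i j k] m Cs.hpartD(4) by simp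
    next
      case False
      then show ?thesis using tau_even m Cs.hpartD(2) cube_closed[of m] by simp
    qed
  qed
qed

text \<open>The matrix of the adjoint action of \<open>x\<close> on the dual basis: by
  \<open>expand_Xd\<close>, the coefficient of \<open>[x, Xd a]\<close> along
  \<open>Xd l\<close>.\<close>

definition tau_d :: "'g \<Rightarrow> nat \<Rightarrow> nat \<Rightarrow> complex" where
  "tau_d x a l = B (br x (Xd a)) (X l)"

text \<open>The Leibniz rule \<open>scomm_mult\<close> letter by letter, then
  \<open>\<nu>_gc\<close> and expansion in the dual basis. The trailing unit contributes
  zero.\<close>

lemma scomm_cube:
  assumes x: "x \<in> hpart L p" and abc: "a < n" "b < n" "c < n"
  shows "scomm C (\<nu> x) (cube (a, b, c)) = comb C I3 cube (\<lambda>m.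
    (\<Sum>l<n. if m = (l, b, c) then tau_d x a l else 0) + koszul p (px a) *
    ((\<Sum>l<n. if m = (a, l, c) then tau_d x b l else 0) + koszul p (px b) *
     (\<Sum>l<n. if m = (a, b, l) then tau_d x c l else 0)))"
proof -
  have xl: "x \<in> \<ll>" "x \<in> hpart G p" using x by auto
  have nx: "\<nu> x \<in> hpart C p" using \<nu>_hpart[OF xl] .
  interpret CC: cvs2 C C by unfold_locales
  have brs: "br x (Xd i) \<in> \<ss>" if "i < n" for i using br_ls[OF xl(1) Xd_s[OF that]] .
  have g: "gc (br x (Xd i)) = comb C {..<n} cx (tau_d x i)" if "i < n" for i
    using gc_expand[OF brs[OF that]] by (simp add: tau_d_def[abs_def])
  have sc: "scomm C (\<nu> x) (cx i \<otimes>\<^bsub>C\<^esub> R) = gc (br x (Xd i)) \<otimes>\<^bsub>C\<^esub> R \<oplus>\<^bsub>C\<^esub> koszul p (px i) \<odot>\<^bsub>C\<^esub> (cx i \<otimes>\<^bsub>C\<^esub> scomm C (\<nu> x) R)"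
    if "i < n" "R \<in> carrier C" for i R
    using that Cs.scomm_mult[OF nx, of "cx i" R] \<nu>_gc[OF xl(1) Xd_s] Cs.parity_hom[OF cx_hpart]
      linD(1)[OF Cs.scomm_linear[OF nx]] by (simp add: Cs.sm_mult_l)
  have cl: "gc (br x (Xd i)) \<in> carrier C" if "i < n" for i using brs[OF that] by simp
  have s: "scomm C (\<nu> x) (cube (a, b, c)) =
      gc (br x (Xd a)) \<otimes>\<^bsub>C\<^esub> (cx b \<otimes>\<^bsub>C\<^esub> (cx c \<otimes>\<^bsub>C\<^esub> \<one>\<^bsub>C\<^esub>)) \<oplus>\<^bsub>C\<^esub> koszul p (px a) \<odot>\<^bsub>C\<^esub>
      (cx a \<otimes>\<^bsub>C\<^esub> (gc (br x (Xd b)) \<otimes>\<^bsub>C\<^esub> (cx c \<otimes>\<^bsub>C\<^esub> \<one>\<^bsub>C\<^esub>)) \<oplus>\<^bsub>C\<^esub> koszul p (px b) \<odot>\<^bsub>C\<^esub>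
      (cx a \<otimes>\<^bsub>C\<^esub> (cx b \<otimes>\<^bsub>C\<^esub> (gc (br x (Xd c)) \<otimes>\<^bsub>C\<^esub> \<one>\<^bsub>C\<^esub>))))"
    using abc cl by (simp add: cube_def sc Cs.scomm_one[OF nx] Cs.A.r_distr Cs.sm_mult_r del: Cs.A.r_one)
  have 1: "gc (br x (Xd a)) \<otimes>\<^bsub>C\<^esub> (cx b \<otimes>\<^bsub>C\<^esub> (cx c \<otimes>\<^bsub>C\<^esub> \<one>\<^bsub>C\<^esub>)) =
      comb C I3 cube (\<lambda>m. \<Sum>l<n. if m = (l, b, c) then tau_d x a l else 0)"
  proof -
    have "gc (br x (Xd a)) \<otimes>\<^bsub>C\<^esub> (cx b \<otimes>\<^bsub>C\<^esub> (cx c \<otimes>\<^bsub>C\<^esub> \<one>\<^bsub>C\<^esub>)) = comb C {..<n} (\<lambda>l. cube (l, b, c)) (tau_d x a)"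
      unfolding g[OF abc(1)] cube_def prod.case
      by (rule CC.lin_comb[OF Cs.mult_linear_l]) (use abc in auto)
    also have "\<dots> = comb C I3 cube (\<lambda>m. \<Sum>l<n. if m = (l, b, c) then tau_d x a l else 0)"
      by (rule K3.comb_reindex) (use abc in auto)
    finally show ?thesis .
  qed
  have 2: "cx a \<otimes>\<^bsub>C\<^esub> (gc (br x (Xd b)) \<otimes>\<^bsub>C\<^esub> (cx c \<otimes>\<^bsub>C\<^esub> \<one>\<^bsub>C\<^esub>)) =
      comb C I3 cube (\<lambda>m. \<Sum>l<n. if m = (a, l, c) then tau_d x b l else 0)"
  proof -
    have "is_linear C C (\<lambda>u. cx a \<otimes>\<^bsub>C\<^esub> (u \<otimes>\<^bsub>C\<^esub> (cx c \<otimes>\<^bsub>C\<^esub> \<one>\<^bsub>C\<^esub>)))"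
      by (rule linI) (use abc in \<open>auto simp: Cs.A.l_distr Cs.A.r_distr Cs.sm_mult_l Cs.sm_mult_r simp del: Cs.A.r_one\<close>)
    then have "cx a \<otimes>\<^bsub>C\<^esub> (gc (br x (Xd b)) \<otimes>\<^bsub>C\<^esub> (cx c \<otimes>\<^bsub>C\<^esub> \<one>\<^bsub>C\<^esub>)) = comb C {..<n} (\<lambda>l. cube (a, l, c)) (tau_d x b)"
      unfolding g[OF abc(2)] cube_def prod.case
      by (rule CC.lin_comb) (use abc in auto)
    also have "\<dots> = comb C I3 cube (\<lambda>m. \<Sum>l<n. if m = (a, l, c) then tau_d x b l else 0)"
      by (rule K3.comb_reindex) (use abc in auto)
    finally show ?thesis .
  qed
  have 3: "cx a \<otimes>\<^bsub>C\<^esub> (cx b \<otimes>\<^bsub>C\<^esub> (gc (br x (Xd c)) \<otimes>\<^bsub>C\<^esub> \<one>\<^bsub>C\<^esub>)) =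
      comb C I3 cube (\<lambda>m. \<Sum>l<n. if m = (a, b, l) then tau_d x c l else 0)"
  proof -
    have "is_linear C C (\<lambda>u. cx a \<otimes>\<^bsub>C\<^esub> (cx b \<otimes>\<^bsub>C\<^esub> (u \<otimes>\<^bsub>C\<^esub> \<one>\<^bsub>C\<^esub>)))"
      by (rule linI) (use abc in \<open>auto simp: Cs.A.l_distr Cs.A.r_distr Cs.sm_mult_l Cs.sm_mult_r\<close>)
    then have "cx a \<otimes>\<^bsub>C\<^esub> (cx b \<otimes>\<^bsub>C\<^esub> (gc (br x (Xd c)) \<otimes>\<^bsub>C\<^esub> \<one>\<^bsub>C\<^esub>)) = comb C {..<n} (\<lambda>l. cube (a, b, l)) (tau_d x c)"
      unfolding g[OF abc(3)] cube_def prod.case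
      by (rule CC.lin_comb) (use abc in auto)
    also have "\<dots> = comb C I3 cube (\<lambda>m. \<Sum>l<n. if m = (a, b, l) then tau_d x c l else 0)"
      by (rule K3.comb_reindex) (use abc in auto)
    finally show ?thesis .
  qed
  show ?thesis unfolding s 1 2 3 K3.comb_scale K3.comb_add ..
qed

text \<open>The trilinear form \<open>([x, y], z)\<close> is invariant under \<open>\<ll>\<close>; in coordinates:\<close>

lemma tau_invariant:
  assumes x: "x \<in> hpart L p" and uvw: "u < n" "v < n" "w < n"
  shows "(\<Sum>a<n. tau a v w * tau_d x a u) + koszul p (px u) * (\<Sum>b<n. tau u b w * tau_d x b v) +
    koszul p (px u) * koszul p (px v) * (\<Sum>c<n. tau u v c * tau_d x c w) = 0"
proof -
  have xl: "x \<in> \<ll>" "x \<in> hpart G p" "x \<in> carrier G" using x l_carrier by auto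
  let ?s = "\<lambda>q. if q = 1 then - 1 else 1 :: complex"
  have ex: "br x (X i) = (\<Oplus>a\<in>{..<n}. B (Xd a) (br x (X i)) \<odot> X a)" if "i < n" for i
    by (rule expand_X[OF br_ls[OF xl(1) X_s[OF that]]])
  have d0: "B (Xd a) (br x (X i)) = 0" if "a < n" "i < n" "px a \<noteq> p + px i" for a i
    using form_even[OF Xd_hpart br_hpart[OF xl(2) X_hpart]] that by blast
  have c: "X u \<in> carrier G" "X v \<in> carrier G" "X w \<in> carrier G" using uvw by auto
  note bc = brD(1)
  \<comment> \<open>Evaluates a linear functional at \<open>[x, X i]\<close> through the expansion
    in \<open>X\<close>; it is used once for each slot of the trilinear form.\<close>
  have lin: "h (br x (X i)) = (\<Sum>a<n. B (Xd a) (br x (X i)) * h (X a))"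
    if "i < n" "\<And>y z. y \<in> carrier G \<Longrightarrow> z \<in> carrier G \<Longrightarrow> h (y \<oplus> z) = h y + h z"
      "\<And>c y. y \<in> carrier G \<Longrightarrow> h (c \<odot> y) = c * h y" for h :: "'g \<Rightarrow> complex" and i
  proof -
    have fs: "h (\<Oplus>a\<in>A. g a) = (\<Sum>a\<in>A. h (g a))" if "finite A" "\<And>a. a \<in> A \<Longrightarrow> g a \<in> carrier G" for A g
      using that
    proof (induction A rule: finite_induct)
      case empty then show ?case using \<open>\<And>c y. y \<in> carrier G \<Longrightarrow> h (c \<odot> y) = c * h y\<close>[of \<zero> 0] by simp
    next
      case (insert a A)
      then have "g \<in> A \<rightarrow> carrier G" by auto
      then show ?case using insert M.finsum_closed[of g A] \<open>\<And>y z. y \<in> carrier G \<Longrightarrow> z \<in> carrier G \<Longrightarrow> h (y \<oplus> z) = h y + h z\<close>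
        by (simp add: M.finsum_insert)
    qed
    have "h (\<Oplus>a\<in>{..<n}. B (Xd a) (br x (X i)) \<odot> X a) = (\<Sum>a<n. h (B (Xd a) (br x (X i)) \<odot> X a))"
      by (rule fs) auto
    then show ?thesis using ex[OF that(1)] that(3) by simp
  qed
  \<comment> \<open>\<open>b1\<close>, \<open>b2\<close> and \<open>b3\<close> are the three ways in
    which \<open>x\<close> can act on the trilinear form, before signs.\<close>
  define b1 where "b1 = B (br (br x (X u)) (X v)) (X w)"
  define b2 where "b2 = B (br (X u) (br x (X v))) (X w)"
  define b3 where "b3 = B (br (X u) (X v)) (br x (X w))"
  let ?k = "koszul p"
  \<comment> \<open>\<open>form_br_Xd\<close> moves \<open>x\<close> from \<open>Xd a\<close> to
    \<open>X u\<close> at the price of a minus sign. Terms with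
    \<open>px a \<noteq> p + px u\<close> vanish, so the Koszul sign is constant over the
    sum.\<close>
  have S1: "(\<Sum>a<n. tau a v w * tau_d x a u) = - (?k (p + px u) * koszul (p + px u) (px v) * ?s (px w)) * b1"
  proof -
    have "b1 = (\<Sum>a<n. B (Xd a) (br x (X u)) * B (br (X a) (X v)) (X w))"
      unfolding b1_def by (rule lin[of u "\<lambda>y. B (br y (X v)) (X w)"]) (use uvw c bc in \<open>simp_all add: brD form_lin(1) form_sm\<close>)
    then show ?thesis
    proof (simp only: sum_distrib_left, intro sum.cong refl)
      fix a assume "a \<in> {..<n}"
      then have a: "a < n" by simp
      show "tau a v w * tau_d x a u = - (?k (p + px u) * koszul (p + px u) (px v) * ?s (px w)) * (B (Xd a) (br x (X u)) * B (br (X a) (X v)) (X w))"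
        using d0[OF a uvw(1)] form_br_Xd[OF x a uvw(1)]
        by (cases "px a = p + px u") (simp_all add: tau_def tau_d_def mult_ac)
    qed
  qed
  have S2: "(\<Sum>b<n. tau u b w * tau_d x b v) = - (?k (p + px v) * koszul (px u) (p + px v) * ?s (px w)) * b2"
  proof -
    have "b2 = (\<Sum>a<n. B (Xd a) (br x (X v)) * B (br (X u) (X a)) (X w))"
      unfolding b2_def by (rule lin[of v "\<lambda>y. B (br (X u) y) (X w)"]) (use uvw c bc in \<open>simp_all add: brD form_lin(1) form_sm\<close>)
    then show ?thesis
    proof (simp only: sum_distrib_left, intro sum.cong refl)
      fix a assume "a \<in> {..<n}"
      then have a: "a < n" by simp
      show "tau u a w * tau_d x a v = - (?k (p + px v) * koszul (px u) (p + px v) * ?s (px w)) * (B (Xd a) (br x (X v)) * B (br (X u) (X a)) (X w))"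
        using d0[OF a uvw(2)] form_br_Xd[OF x a uvw(2)]
        by (cases "px a = p + px v") (simp_all add: tau_def tau_d_def mult_ac)
    qed
  qed
  have S3: "(\<Sum>c<n. tau u v c * tau_d x c w) = - (?k (p + px w) * koszul (px u) (px v) * ?s (p + px w)) * b3"
  proof -
    have "b3 = (\<Sum>a<n. B (Xd a) (br x (X w)) * B (br (X u) (X v)) (X a))"
      unfolding b3_def by (rule lin[of w "\<lambda>y. B (br (X u) (X v)) y"]) (use uvw c bc in \<open>simp_all add: form_lin(3) form_sm\<close>)
    then show ?thesis
    proof (simp only: sum_distrib_left, intro sum.cong refl)
      fix a assume "a \<in> {..<n}"
      then have a: "a < n" by simp
      show "tau u v a * tau_d x a w = - (?k (p + px w) * koszul (px u) (px v) * ?s (p + px w)) * (B (Xd a) (br x (X w)) * B (br (X u) (X v)) (X a))"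
        using d0[OF a uvw(3)] form_br_Xd[OF x a uvw(3)]
        by (cases "px a = p + px w") (simp_all add: tau_def tau_d_def mult_ac)
    qed
  qed
  have h: "X u \<in> hpart G (px u)" "X v \<in> hpart G (px v)" "X w \<in> hpart G (px w)" using X_hpart uvw by auto
  have huv: "br (X u) (X v) \<in> hpart G (px u + px v)" using br_hpart h by blast
  have j: "B (br x (br (X u) (X v))) (X w) = b1 + ?k (px u) * b2"
    using br_jacobi[OF xl(2) h(1) c(2)] c xl bc by (simp add: form_lin(1) form_sm b1_def b2_def)
  have "br x (br (X u) (X v)) = (- ?k (px u + px v)) \<odot> br (br (X u) (X v)) x"
    using br_anti[OF xl(2) huv] .
  \<comment> \<open>The Jacobi identity has given the left side as the pairing of
    \<open>[x, [X u, X v]]\<close> with \<open>X w\<close>; invariance of the form now moves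
    \<open>x\<close> over to \<open>X w\<close>.\<close>
  then have j': "b1 + ?k (px u) * b2 = - ?k (px u + px v) * b3"
    using j c xl bc form_lin(5)[of "br (X u) (X v)" x "X w"] by (simp add: form_sm b3_def)
  \<comment> \<open>By evenness all three terms vanish unless \<open>px w = p + px u + px v\<close>.
    In that case \<open>b1\<close> is eliminated and the signs are compared for the eight choices of
    \<open>p\<close>, \<open>px u\<close> and \<open>px v\<close>.\<close>
  show ?thesis
  proof (cases "px w = p + px u + px v")
    case False
    have "b1 = 0" unfolding b1_def
      by (rule form_even[OF br_hpart[OF br_hpart[OF xl(2) h(1)] h(2)] h(3)]) (use False in auto)
    moreover have "b2 = 0" unfolding b2_def
      by (rule form_even[OF br_hpart[OF h(1) br_hpart[OF xl(2) h(2)]] h(3)]) (use False in \<open>auto simp: ac_simps\<close>)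
    moreover have "b3 = 0" unfolding b3_def
      by (rule form_even[OF huv br_hpart[OF xl(2) h(3)]])
         (use False in \<open>metis bit_add_self(2) add.assoc\<close>)
    ultimately show ?thesis using S1 S2 S3 by simp
  next
    case True
    have b1: "b1 = - ?k (px u + px v) * b3 - ?k (px u) * b2" using j' by (simp add: eq_diff_eq)
    show ?thesis unfolding S1 S2 S3 True b1
      by (cases p; cases "px u"; cases "px v") (simp_all add: algebra_simps)
  qed
qed

text \<open>Collecting the coefficient of the monomial \<open>(u, v, w)\<close> over the three
  letters that \<open>x\<close> can hit gives \<open>e\<close> times the sum in
  \<open>tau_invariant\<close>.\<close>

lemma scomm_cubic_term:
  assumes x: "x \<in> hpart L p" shows "scomm C (\<nu> x) \<phi> = \<zero>\<^bsub>C\<^esub>"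
proof -
  obtain e where e: "\<phi> = comb C I3 cube (\<lambda>m. e * tau3 m)" using cubic_term_eq by blast
  have nx: "\<nu> x \<in> hpart C p" using \<nu>_hpart x by auto
  interpret CC: cvs2 C C by unfold_locales
  let ?q = "\<lambda>(a, b, c) m. 
    (\<Sum>l<n. if m = (l, b, c) then tau_d x a l else 0) + koszul p (px a) *
    ((\<Sum>l<n. if m = (a, l, c) then tau_d x b l else 0) + koszul p (px b) *
     (\<Sum>l<n. if m = (a, b, l) then tau_d x c l else 0))"
  have "scomm C (\<nu> x) \<phi> = comb C I3 (\<lambda>m. scomm C (\<nu> x) (cube m)) (\<lambda>m. e * tau3 m)"
    unfolding e by (rule CC.lin_comb[OF Cs.scomm_linear[OF nx] cube_closed])
  also have "\<dots> = comb C I3 (\<lambda>m. comb C I3 cube (?q m)) (\<lambda>m. e * tau3 m)"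
    unfolding comb_def[of C I3 "\<lambda>m. scomm C (\<nu> x) (cube m)"] comb_def[of C I3 "\<lambda>m. comb C I3 cube (?q m)"]
  proof (rule Cs.M.add.finprod_cong'[OF refl])
    fix m assume "m \<in> I3"
    then obtain a b c where m: "m = (a, b, c)" "a < n" "b < n" "c < n" by auto
    show "(e * tau3 m) \<odot>\<^bsub>C\<^esub> scomm C (\<nu> x) (cube m) = (e * tau3 m) \<odot>\<^bsub>C\<^esub> comb C I3 cube (?q m)"
      unfolding m(1) scomm_cube[OF x m(2-4)] by simp
  qed (use K3.comb_closed Cs.sm_closed in auto)
  also have "\<dots> = comb C I3 cube (\<lambda>m. \<Sum>i\<in>I3. e * tau3 i * ?q i m)"
    by (rule comb_comb[OF K3.combination_axioms]) simp
  also have "\<dots> = \<zero>\<^bsub>C\<^esub>"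
  proof (rule K3.comb_zero)
    fix m assume "m \<in> I3"
    then obtain u v w where m: "m = (u, v, w)" "u < n" "v < n" "w < n" by auto
    have q: "?q (a, b, c) m = (if b = v \<and> c = w then tau_d x a u else 0) + koszul p (px a) *
      ((if a = u \<and> c = w then tau_d x b v else 0) + koszul p (px b) * (if a = u \<and> b = v then tau_d x c w else 0))"
      for a b c
    proof -
      have "(\<Sum>l<n. if m = (l, b, c) then tau_d x a l else 0) = (\<Sum>l<n. if u = l then (if b = v \<and> c = w then tau_d x a l else 0) else 0)"
        "(\<Sum>l<n. if m = (a, l, c) then tau_d x b l else 0) = (\<Sum>l<n. if v = l then (if a = u \<and> c = w then tau_d x b l else 0) else 0)"
        "(\<Sum>l<n. if m = (a, b, l) then tau_d x c l else 0) = (\<Sum>l<n. if w = l then (if a = u \<and> b = v then tau_d x c l else 0) else 0)"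
        by (rule sum.cong; auto simp: m)+
      then show ?thesis using m by simp
    qed
    have nest: "(\<Sum>i\<in>I3. h i) = (\<Sum>a<n. \<Sum>b<n. \<Sum>c<n. h (a, b, c))" for h :: "nat \<times> nat \<times> nat \<Rightarrow> complex"
      by (simp add: sum.cartesian_product)
    \<comment> \<open>Each condition fixes two of the three indices and leaves free the index of the
      letter that was hit.\<close>
    have d1: "(\<Sum>a<n. \<Sum>b<n. \<Sum>c<n. if b = v \<and> c = w then h a b c else 0) = (\<Sum>a<n. h a v w)"
      and d2: "(\<Sum>a<n. \<Sum>b<n. \<Sum>c<n. if a = u \<and> c = w then h a b c else 0) = (\<Sum>b<n. h u b w)"
      and d3: "(\<Sum>a<n. \<Sum>b<n. \<Sum>c<n. if a = u \<and> b = v then h a b c else 0) = (\<Sum>c<n. h u v c)"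
      for h :: "nat \<Rightarrow> nat \<Rightarrow> nat \<Rightarrow> complex"
    proof -
      have "(\<Sum>c<n. if b = v \<and> c = w then h a b c else 0) = (if b = v then h a b w else 0)" for a b
        using m by simp
      then show "(\<Sum>a<n. \<Sum>b<n. \<Sum>c<n. if b = v \<and> c = w then h a b c else 0) = (\<Sum>a<n. h a v w)" using m by simp
      have "(\<Sum>c<n. if a = u \<and> c = w then h a b c else 0) = (if a = u then h a b w else 0)" for a b
        using m by simp
      moreover have "(\<Sum>b<n. if a = u then h a b w else 0) = (if a = u then \<Sum>b<n. h a b w else 0)" for a by simp
      ultimately show "(\<Sum>a<n. \<Sum>b<n. \<Sum>c<n. if a = u \<and> c = w then h a b c else 0) = (\<Sum>b<n. h u b w)" using m by simp
      have "(\<Sum>c<n. if a = u \<and> b = v then h a b c else 0) = (if b = v then (if a = u then \<Sum>c<n. h a b c else 0) else 0)" for a b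
        by simp
      then show "(\<Sum>a<n. \<Sum>b<n. \<Sum>c<n. if a = u \<and> b = v then h a b c else 0) = (\<Sum>c<n. h u v c)" using m by simp
    qed
    have "(\<Sum>i\<in>I3. e * tau3 i * ?q i m) = e * (\<Sum>a<n. \<Sum>b<n. \<Sum>c<n. tau a b c * ?q (a, b, c) m)"
      unfolding nest by (simp only: sum_distrib_left mult.assoc prod.case)
    also have "(\<Sum>a<n. \<Sum>b<n. \<Sum>c<n. tau a b c * ?q (a, b, c) m) =
      (\<Sum>a<n. \<Sum>b<n. \<Sum>c<n. (if b = v \<and> c = w then tau a b c * tau_d x a u else 0) +
        ((if a = u \<and> c = w then koszul p (px a) * tau a b c * tau_d x b v else 0) +
        (if a = u \<and> b = v then koszul p (px a) * koszul p (px b) * tau a b c * tau_d x c w else 0)))"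
      unfolding q by (intro sum.cong refl) (simp add: algebra_simps)
    also have "\<dots> = (\<Sum>a<n. tau a v w * tau_d x a u) + ((\<Sum>b<n. koszul p (px u) * tau u b w * tau_d x b v) +
        (\<Sum>c<n. koszul p (px u) * koszul p (px v) * tau u v c * tau_d x c w))"
      by (simp only: sum.distrib d1 d2 d3)
    also have "\<dots> = 0"
      using tau_invariant[OF x m(2-4)] by (simp add: sum_distrib_left mult.assoc add.assoc)
    finally show "(\<Sum>i\<in>I3. e * tau3 i * ?q i m) = 0" by simp
  qed
  finally show ?thesis .
qed

end

text \<open>Only the left factor of \<open>w \<otimes> w'\<close> is expanded at first. In the
  summand with \<open>a\<close>, \<open>D\<close> is moved past \<open>a\<close>; in the one with
  the anticommutator of \<open>K\<close>, it is moved past \<open>w'\<close>. These are the two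
  commutation hypotheses.\<close>

lemma (in superalg) anticommutator_mult:
  assumes c: "D \<in> carrier A" "a \<in> carrier A" "a' \<in> carrier A" "K \<in> carrier A" "K' \<in> carrier A" "w' \<in> carrier A"
    and w: "w = a \<oplus> (D \<otimes> K \<oplus> K \<otimes> D)" and w': "w' = a' \<oplus> (D \<otimes> K' \<oplus> K' \<otimes> D)"
    and comm: "a \<otimes> D = D \<otimes> a" "w' \<otimes> D = D \<otimes> w'"
  shows "w \<otimes> w' = a \<otimes> a' \<oplus> (D \<otimes> (a \<otimes> K' \<oplus> K \<otimes> w') \<oplus> (a \<otimes> K' \<oplus> K \<otimes> w') \<otimes> D)"
proof -
  have 1: "a \<otimes> w' = a \<otimes> a' \<oplus> (D \<otimes> (a \<otimes> K') \<oplus> (a \<otimes> K') \<otimes> D)"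
  proof -
    have "a \<otimes> w' = a \<otimes> a' \<oplus> ((a \<otimes> D) \<otimes> K' \<oplus> a \<otimes> (K' \<otimes> D))"
      unfolding w' using c by (simp add: A.r_distr A.m_assoc)
    then show ?thesis unfolding comm using c by (simp add: A.m_assoc)
  qed
  have 2: "(D \<otimes> K \<oplus> K \<otimes> D) \<otimes> w' = D \<otimes> (K \<otimes> w') \<oplus> (K \<otimes> w') \<otimes> D"
  proof -
    have "(D \<otimes> K \<oplus> K \<otimes> D) \<otimes> w' = D \<otimes> (K \<otimes> w') \<oplus> K \<otimes> (D \<otimes> w')"
      using c by (simp add: A.l_distr A.m_assoc)
    then show ?thesis using c comm(2)[symmetric] by (simp add: A.m_assoc)
  qed
  have "w \<otimes> w' = a \<otimes> w' \<oplus> (D \<otimes> K \<oplus> K \<otimes> D) \<otimes> w'"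
    unfolding w using c by (simp add: A.l_distr)
  then show ?thesis unfolding 1 2 using c by (simp add: A.r_distr A.l_distr M.a_ac)
qed

lemma hom_hproj:
  assumes "sspace V" "sspace W" "is_linear V W \<psi>" "\<And>p x. x \<in> hpart V p \<Longrightarrow> \<psi> x \<in> hpart W p"
    "x \<in> carrier V"
  shows "hproj W p (\<psi> x) = \<psi> (hproj V p x)"
proof -
  interpret V: sspace V by fact
  interpret W: sspace W by fact
  have "x = hproj V p x \<oplus>\<^bsub>V\<^esub> hproj V (p + 1) x"
    using V.hproj_decomp[OF assms(5)] assms(5) by (cases p) (simp_all add: V.M.a_comm)
  then have "\<psi> x = \<psi> (hproj V p x) \<oplus>\<^bsub>W\<^esub> \<psi> (hproj V (p + 1) x)"
    using linD(2)[OF assms(3), of "hproj V p x" "hproj V (p + 1) x"] assms(5) by simp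
  then show ?thesis using assms(4,5) by (intro W.hproj_eqI) auto
qed

context dirac begin

subsection \<open>Commutation with the Dirac operator\<close>

abbreviation "D \<equiv> dirac_operator G B \<ss> n X px Xd"

lemma D_eq: "D = linear_term \<oplus>\<^bsub>T\<^esub> tn \<one>\<^bsub>U\<^esub> \<phi>"
  by (simp add: dirac_operator_def Let_def linear_term_def)

lemma tn_phi_hpart: "tn \<one>\<^bsub>U\<^esub> \<phi> \<in> hpart T 0"
  using ST.tn_hpart[OF Us.one_even cubic_term_hpart] by simp

lemma D_hpart: "D \<in> hpart T 0"
  unfolding D_eq by (rule ST.T.hpartD(3)[OF linear_term_hpart tn_phi_hpart])

lemma D_closed: "D \<in> carrier T" using D_hpart by (rule ST.T.hpartD)

lemma phi_closed: "\<phi> \<in> carrier C" using cubic_term_hpart by (rule Cs.hpartD)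

lemma \<theta>_D_hom: assumes x: "x \<in> hpart L p" shows "\<theta> x \<otimes>\<^bsub>T\<^esub> D = D \<otimes>\<^bsub>T\<^esub> \<theta> x"
proof -
  note t = \<theta>_hpart[OF x]
  have gx: "gu x \<in> hpart U p" using x gu_hpart by auto
  have "scomm T (\<theta> x) (tn \<one>\<^bsub>U\<^esub> \<phi>) = \<zero>\<^bsub>T\<^esub>"
    using scomm_\<theta>[OF x Us.A.one_closed phi_closed] Us.scomm_one[OF gx] scomm_cubic_term[OF x] phi_closed
    by (simp add: Us.parity_one)
  then have "scomm T (\<theta> x) D = \<zero>\<^bsub>T\<^esub>"
    unfolding D_eq using linD(2)[OF ST.T.scomm_linear[OF t] ST.T.hpartD(7)[OF linear_term_hpart] ST.T.hpartD(7)[OF tn_phi_hpart]]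
      scomm_linear_term[OF x] by simp
  then have "\<theta> x \<otimes>\<^bsub>T\<^esub> D = parity T p D \<otimes>\<^bsub>T\<^esub> \<theta> x"
    using ST.T.scomm_eq_zero_iff[OF t D_closed] by simp
  \<comment> \<open>\<open>D\<close> is even, so its supercommutator with an element of any parity
    is the ordinary commutator.\<close>
  also have "parity T p D = D" using ST.T.parity_hom[OF D_hpart] ST.T.sm_one[OF D_closed] by simp
  finally show ?thesis .
qed

lemma \<theta>_D: assumes "x \<in> \<ll>" shows "\<theta> x \<otimes>\<^bsub>T\<^esub> D = D \<otimes>\<^bsub>T\<^esub> \<theta> x"
proof -
  have "x \<in> carrier L" using assms by simp
  then show ?thesis
  proof (rule Ls.hpart_cases)
    show "\<theta> (x \<oplus>\<^bsub>L\<^esub> y) \<otimes>\<^bsub>T\<^esub> D = D \<otimes>\<^bsub>T\<^esub> \<theta> (x \<oplus>\<^bsub>L\<^esub> y)"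
      if "x \<in> carrier L" "y \<in> carrier L" "\<theta> x \<otimes>\<^bsub>T\<^esub> D = D \<otimes>\<^bsub>T\<^esub> \<theta> x" "\<theta> y \<otimes>\<^bsub>T\<^esub> D = D \<otimes>\<^bsub>T\<^esub> \<theta> y" for x y
      using that D_closed linD[OF \<theta>_linear] ST.T.A.l_distr[of "\<theta> x" "\<theta> y" D] ST.T.A.r_distr[of "\<theta> x" "\<theta> y" D]
      by (simp del: ST.T_simps)
  qed (rule \<theta>_D_hom)
qed

lemma \<alpha>_D: assumes "y \<in> carrier UL" shows "\<alpha> y \<otimes>\<^bsub>T\<^esub> D = D \<otimes>\<^bsub>T\<^esub> \<alpha> y"
  using assms
proof (induction y rule: UL.Pr_induct[unfolded Pr_eq, consumes 1, case_names add smult one gen])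
  case (add y y')
  then show ?case using D_closed linD(2)[OF \<alpha>_linear] ST.T.A.l_distr[of "\<alpha> y" "\<alpha> y'" D] ST.T.A.r_distr[of "\<alpha> y" "\<alpha> y'" D]
    by (simp del: ST.T_simps)
next
  case (smult c y)
  then show ?case using D_closed linD(3)[OF \<alpha>_linear] ST.T.sm_mult_l[of "\<alpha> y" D] ST.T.sm_mult_r[of D "\<alpha> y"]
    by (simp del: ST.T_simps)
next
  case one
  then show ?case unfolding \<alpha>_one using D_closed ST.T.A.l_one ST.T.A.r_one by simp
next
  case (gen x y)
  have x: "x \<in> \<ll>" "UL.cl (gen x) \<in> carrier UL" "\<alpha> (UL.cl (gen x)) = \<theta> x"
    using gen(1) \<alpha>_gen[of x] UL.cl_closed[of "gen x"] unfolding Pr_eq by (auto simp: uea_gen_def uea_class_def)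
  have e: "\<alpha> (UL.cl (gen x) \<otimes>\<^bsub>UL\<^esub> y) = \<theta> x \<otimes>\<^bsub>T\<^esub> \<alpha> y" using \<alpha>_mult[OF x(2) gen(2)] x(3) by simp
  have "\<theta> x \<otimes>\<^bsub>T\<^esub> \<alpha> y \<otimes>\<^bsub>T\<^esub> D = \<theta> x \<otimes>\<^bsub>T\<^esub> D \<otimes>\<^bsub>T\<^esub> \<alpha> y"
    using gen x D_closed by (simp add: ST.T.A.m_assoc del: ST.T_simps)
  then show ?case unfolding e \<theta>_D[OF x(1)] using gen x D_closed by (simp add: ST.T.A.m_assoc del: ST.T_simps)
qed

text \<open>On the linear term the sign from passing \<open>cx i\<close> is undone by
  \<open>scenterD'\<close>. The cubic term sits in the second factor and is even, so it passes
  \<open>z\<close> without a sign.\<close>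

lemma center_D: assumes z: "z \<in> scenter U" shows "tn z \<one>\<^bsub>C\<^esub> \<otimes>\<^bsub>T\<^esub> D = D \<otimes>\<^bsub>T\<^esub> tn z \<one>\<^bsub>C\<^esub>"
proof -
  have zc: "z \<in> carrier U" using z by (rule Us.scenter_closed)
  have z1: "tn z \<one>\<^bsub>C\<^esub> \<in> carrier T" using zc by simp
  have 1: "tn z \<one>\<^bsub>C\<^esub> \<otimes>\<^bsub>T\<^esub> tn (gu (X i)) (cx i) = tn (gu (X i)) (cx i) \<otimes>\<^bsub>T\<^esub> tn z \<one>\<^bsub>C\<^esub>" if i: "i < n" for i
  proof -
    have "tn z \<one>\<^bsub>C\<^esub> \<otimes>\<^bsub>T\<^esub> tn (gu (X i)) (cx i) = tn (z \<otimes>\<^bsub>U\<^esub> gu (X i)) (cx i)"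
      using ST.mul.op_tens[OF zc Cs.one_even, of "gu (X i)" "cx i"] i by simp
    moreover have "tn (gu (X i)) (cx i) \<otimes>\<^bsub>T\<^esub> tn z \<one>\<^bsub>C\<^esub> = tn (gu (X i) \<otimes>\<^bsub>U\<^esub> parity U (px i) z) (cx i)"
      using ST.mul.op_tens[OF _ cx_hpart[OF i] zc Cs.A.one_closed, of "gu (X i)"] i by simp
    ultimately show ?thesis using Us.scenterD'[OF z gu_hpart[OF X_hpart[OF i]]] by simp
  qed
  interpret TT: cvs2 T T by unfold_locales
  have "tn z \<one>\<^bsub>C\<^esub> \<otimes>\<^bsub>T\<^esub> linear_term = (\<Oplus>\<^bsub>T\<^esub> i\<in>{..<n}. tn z \<one>\<^bsub>C\<^esub> \<otimes>\<^bsub>T\<^esub> tn (gu (X i)) (cx i))"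
    unfolding linear_term_def by (rule TT.lin_finsum[OF ST.T.mult_linear_r[OF z1]]) (auto intro: tn_cx_closed)
  also have "\<dots> = (\<Oplus>\<^bsub>T\<^esub> i\<in>{..<n}. tn (gu (X i)) (cx i) \<otimes>\<^bsub>T\<^esub> tn z \<one>\<^bsub>C\<^esub>)"
    by (rule ST.T.M.add.finprod_cong'[OF refl _ 1]) (use tn_cx_closed z1 ST.T.A.m_closed in auto)
  also have "\<dots> = linear_term \<otimes>\<^bsub>T\<^esub> tn z \<one>\<^bsub>C\<^esub>"
    unfolding linear_term_def by (rule TT.lin_finsum[OF ST.T.mult_linear_l[OF z1], symmetric]) (auto intro: tn_cx_closed)
  finally have 2: "tn z \<one>\<^bsub>C\<^esub> \<otimes>\<^bsub>T\<^esub> linear_term = linear_term \<otimes>\<^bsub>T\<^esub> tn z \<one>\<^bsub>C\<^esub>" .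
  have 3: "tn z \<one>\<^bsub>C\<^esub> \<otimes>\<^bsub>T\<^esub> tn \<one>\<^bsub>U\<^esub> \<phi> = tn \<one>\<^bsub>U\<^esub> \<phi> \<otimes>\<^bsub>T\<^esub> tn z \<one>\<^bsub>C\<^esub>"
    using ST.mul.op_tens[OF zc Cs.one_even Us.A.one_closed phi_closed]
      ST.mul.op_tens[OF Us.A.one_closed cubic_term_hpart zc Cs.A.one_closed] zc phi_closed by simp
  show ?thesis unfolding D_eq
    using 2 3 z1 ST.T.hpartD(7)[OF linear_term_hpart] ST.T.hpartD(7)[OF tn_phi_hpart]
    by (simp add: ST.T.A.l_distr ST.T.A.r_distr del: ST.T_simps)
qed

subsection \<open>The homomorphism property\<close>

definition invariants where
  "invariants = {A \<in> carrier T. \<forall>x\<in>\<ll>. scomm T (\<theta> x) A = \<zero>\<^bsub>T\<^esub>}"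

text \<open>For homogeneous \<open>x\<close> the condition is multiplicative in \<open>A\<close>,
  which gives closure under products. General \<open>x\<close> follows by components, since
  \<open>\<theta>\<close> preserves parity.\<close>

lemma invariants_iff:
  "A \<in> invariants \<longleftrightarrow> A \<in> carrier T \<and> (\<forall>p. \<forall>x\<in>hpart L p. \<theta> x \<otimes>\<^bsub>T\<^esub> A = parity T p A \<otimes>\<^bsub>T\<^esub> \<theta> x)"
proof (intro iffI conjI allI ballI)
  fix p x assume A: "A \<in> invariants" and x: "x \<in> hpart L p"
  then have "A \<in> carrier T" "scomm T (\<theta> x) A = \<zero>\<^bsub>T\<^esub>" by (auto simp: invariants_def)
  then show "\<theta> x \<otimes>\<^bsub>T\<^esub> A = parity T p A \<otimes>\<^bsub>T\<^esub> \<theta> x"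
    using ST.T.scomm_eq_zero_iff[OF \<theta>_hpart[OF x]] by blast
next
  assume A: "A \<in> carrier T \<and> (\<forall>p. \<forall>x\<in>hpart L p. \<theta> x \<otimes>\<^bsub>T\<^esub> A = parity T p A \<otimes>\<^bsub>T\<^esub> \<theta> x)"
  have "scomm T (\<theta> x) A = \<zero>\<^bsub>T\<^esub>" if x: "x \<in> \<ll>" for x
  proof (rule ST.T.scomm_eq_zeroI)
    fix p
    have "hproj T p (\<theta> x) = \<theta> (hproj L p x)"
      by (rule hom_hproj[OF Ls.sspace_axioms ST.T.sspace_axioms \<theta>_linear \<theta>_hpart]) (use x in auto)
    moreover have "hproj L p x \<in> hpart L p" by (rule Ls.hproj_in) (use x in simp)
    ultimately show "hproj T p (\<theta> x) \<otimes>\<^bsub>T\<^esub> A = parity T p A \<otimes>\<^bsub>T\<^esub> hproj T p (\<theta> x)" using A by metis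
  qed (use A x \<theta>_closed in blast)+
  then show "A \<in> invariants" using A by (simp add: invariants_def)
qed (simp add: invariants_def)

lemma invariants_closed: "A \<in> invariants \<Longrightarrow> A \<in> carrier T"
  by (simp add: invariants_iff)

lemma invariants_add: "A \<in> invariants \<Longrightarrow> A' \<in> invariants \<Longrightarrow> A \<oplus>\<^bsub>T\<^esub> A' \<in> invariants"
  using \<theta>_closed unfolding invariants_iff
  by (auto simp: ST.T.A.l_distr ST.T.A.r_distr ST.T.parity_add simp del: ST.T_simps)

lemma invariants_sm: "A \<in> invariants \<Longrightarrow> c \<odot>\<^bsub>T\<^esub> A \<in> invariants"
  using \<theta>_closed unfolding invariants_iff
  by (auto simp: ST.T.sm_mult_l ST.T.sm_mult_r ST.T.parity_sm simp del: ST.T_simps)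

lemma invariants_mult: "A \<in> invariants \<Longrightarrow> A' \<in> invariants \<Longrightarrow> A \<otimes>\<^bsub>T\<^esub> A' \<in> invariants"
  using \<theta>_closed unfolding invariants_iff
  by (intro conjI allI ballI ST.T.supercommuting_mult ST.T.A.m_closed) auto

lemma invariants_\<alpha>: "y \<in> scenter UL \<Longrightarrow> \<alpha> y \<in> invariants"
  using \<theta>_\<alpha>_center ULs.scenter_closed \<alpha>_closed unfolding invariants_iff by blast

lemma invariants_center: "z \<in> scenter U \<Longrightarrow> tn z \<one>\<^bsub>C\<^esub> \<in> invariants"
  using \<theta>_center Us.scenter_closed unfolding invariants_iff by simp

lemma invariants_zero: "\<zero>\<^bsub>T\<^esub> \<in> invariants"
  using invariants_sm[OF invariants_center[OF Us.scenter_one], of 0] by simp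

text \<open>The relation that singles out \<open>\<eta> z\<close> among the central
  \<open>y\<close>. It is compatible with unit, sums, multiples and products, and uniqueness
  transfers this to \<open>\<eta>\<close>.\<close>

definition cobounded where
  "cobounded z y \<longleftrightarrow> (\<exists>A\<in>invariants. tn z \<one>\<^bsub>C\<^esub> = \<alpha> y \<oplus>\<^bsub>T\<^esub> (D \<otimes>\<^bsub>T\<^esub> A \<oplus>\<^bsub>T\<^esub> A \<otimes>\<^bsub>T\<^esub> D))"

lemma cobounded_one: "cobounded \<one>\<^bsub>U\<^esub> \<one>\<^bsub>UL\<^esub>"
proof -
  have "tn \<one>\<^bsub>U\<^esub> \<one>\<^bsub>C\<^esub> = \<one>\<^bsub>T\<^esub> \<oplus>\<^bsub>T\<^esub> (D \<otimes>\<^bsub>T\<^esub> \<zero>\<^bsub>T\<^esub> \<oplus>\<^bsub>T\<^esub> \<zero>\<^bsub>T\<^esub> \<otimes>\<^bsub>T\<^esub> D)"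
    unfolding ST.T.A.r_null[OF D_closed] ST.T.A.l_null[OF D_closed] by simp
  then show ?thesis unfolding cobounded_def \<alpha>_one using invariants_zero by blast
qed

lemma cobounded_add:
  assumes "cobounded z y" "cobounded z' y'" "z \<in> carrier U" "z' \<in> carrier U" "y \<in> carrier UL" "y' \<in> carrier UL"
  shows "cobounded (z \<oplus>\<^bsub>U\<^esub> z') (y \<oplus>\<^bsub>UL\<^esub> y')"
proof -
  obtain A A' where A: "A \<in> invariants" "tn z \<one>\<^bsub>C\<^esub> = \<alpha> y \<oplus>\<^bsub>T\<^esub> (D \<otimes>\<^bsub>T\<^esub> A \<oplus>\<^bsub>T\<^esub> A \<otimes>\<^bsub>T\<^esub> D)"
    "A' \<in> invariants" "tn z' \<one>\<^bsub>C\<^esub> = \<alpha> y' \<oplus>\<^bsub>T\<^esub> (D \<otimes>\<^bsub>T\<^esub> A' \<oplus>\<^bsub>T\<^esub> A' \<otimes>\<^bsub>T\<^esub> D)"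
    using assms unfolding cobounded_def by blast
  have "tn (z \<oplus>\<^bsub>U\<^esub> z') \<one>\<^bsub>C\<^esub> = tn z \<one>\<^bsub>C\<^esub> \<oplus>\<^bsub>T\<^esub> tn z' \<one>\<^bsub>C\<^esub>" using assms by (simp add: ST.tn_add_l)
  also have "\<dots> = \<alpha> (y \<oplus>\<^bsub>UL\<^esub> y') \<oplus>\<^bsub>T\<^esub> (D \<otimes>\<^bsub>T\<^esub> (A \<oplus>\<^bsub>T\<^esub> A') \<oplus>\<^bsub>T\<^esub> (A \<oplus>\<^bsub>T\<^esub> A') \<otimes>\<^bsub>T\<^esub> D)"
    unfolding A(2,4) using assms A(1,3)[THEN invariants_closed] D_closed
    by (simp add: linD[OF \<alpha>_linear] ST.T.A.l_distr ST.T.A.r_distr ST.T.M.a_ac del: ST.T_simps)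
  finally show ?thesis unfolding cobounded_def using invariants_add[OF A(1,3)] by blast
qed

lemma cobounded_sm:
  assumes "cobounded z y" "z \<in> carrier U" "y \<in> carrier UL"
  shows "cobounded (c \<odot>\<^bsub>U\<^esub> z) (c \<odot>\<^bsub>UL\<^esub> y)"
proof -
  obtain A where A: "A \<in> invariants" "tn z \<one>\<^bsub>C\<^esub> = \<alpha> y \<oplus>\<^bsub>T\<^esub> (D \<otimes>\<^bsub>T\<^esub> A \<oplus>\<^bsub>T\<^esub> A \<otimes>\<^bsub>T\<^esub> D)"
    using assms unfolding cobounded_def by blast
  have "tn (c \<odot>\<^bsub>U\<^esub> z) \<one>\<^bsub>C\<^esub> = c \<odot>\<^bsub>T\<^esub> tn z \<one>\<^bsub>C\<^esub>" using assms by (simp add: ST.tn_sm_l)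
  also have "\<dots> = \<alpha> (c \<odot>\<^bsub>UL\<^esub> y) \<oplus>\<^bsub>T\<^esub> (D \<otimes>\<^bsub>T\<^esub> (c \<odot>\<^bsub>T\<^esub> A) \<oplus>\<^bsub>T\<^esub> (c \<odot>\<^bsub>T\<^esub> A) \<otimes>\<^bsub>T\<^esub> D)"
    unfolding A(2) using assms A(1)[THEN invariants_closed] D_closed
    by (simp add: linD[OF \<alpha>_linear] ST.T.sm_mult_l ST.T.sm_mult_r ST.T.sm_add_r del: ST.T_simps)
  finally show ?thesis unfolding cobounded_def using invariants_sm[OF A(1)] by blast
qed

lemma cobounded_mult:
  assumes "cobounded z y" "cobounded z' y'" "z \<in> scenter U" "z' \<in> scenter U" "y \<in> scenter UL" "y' \<in> scenter UL"
  shows "cobounded (z \<otimes>\<^bsub>U\<^esub> z') (y \<otimes>\<^bsub>UL\<^esub> y')"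
proof -
  obtain A A' where A: "A \<in> invariants" "tn z \<one>\<^bsub>C\<^esub> = \<alpha> y \<oplus>\<^bsub>T\<^esub> (D \<otimes>\<^bsub>T\<^esub> A \<oplus>\<^bsub>T\<^esub> A \<otimes>\<^bsub>T\<^esub> D)"
    "A' \<in> invariants" "tn z' \<one>\<^bsub>C\<^esub> = \<alpha> y' \<oplus>\<^bsub>T\<^esub> (D \<otimes>\<^bsub>T\<^esub> A' \<oplus>\<^bsub>T\<^esub> A' \<otimes>\<^bsub>T\<^esub> D)"
    using assms(1,2) unfolding cobounded_def by blast
  note c = assms(3,4)[THEN Us.scenter_closed] assms(5,6)[THEN ULs.scenter_closed]
  have z1: "tn z' \<one>\<^bsub>C\<^esub> \<in> carrier T" using c by simp
  have "tn (z \<otimes>\<^bsub>U\<^esub> z') \<one>\<^bsub>C\<^esub> = tn z \<one>\<^bsub>C\<^esub> \<otimes>\<^bsub>T\<^esub> tn z' \<one>\<^bsub>C\<^esub>"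
    using ST.mul.op_tens[OF c(1) Cs.one_even c(2) Cs.A.one_closed] c by simp
  also have "\<dots> = \<alpha> y \<otimes>\<^bsub>T\<^esub> \<alpha> y' \<oplus>\<^bsub>T\<^esub> (D \<otimes>\<^bsub>T\<^esub> (\<alpha> y \<otimes>\<^bsub>T\<^esub> A' \<oplus>\<^bsub>T\<^esub> A \<otimes>\<^bsub>T\<^esub> tn z' \<one>\<^bsub>C\<^esub>) \<oplus>\<^bsub>T\<^esub>
      (\<alpha> y \<otimes>\<^bsub>T\<^esub> A' \<oplus>\<^bsub>T\<^esub> A \<otimes>\<^bsub>T\<^esub> tn z' \<one>\<^bsub>C\<^esub>) \<otimes>\<^bsub>T\<^esub> D)"
    by (rule ST.T.anticommutator_mult[OF D_closed \<alpha>_closed[OF c(3)] \<alpha>_closed[OF c(4)]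
        A(1)[THEN invariants_closed] A(3)[THEN invariants_closed] z1 A(2) A(4) \<alpha>_D[OF c(3)] center_D[OF assms(4)]])
  also have "\<alpha> y \<otimes>\<^bsub>T\<^esub> \<alpha> y' = \<alpha> (y \<otimes>\<^bsub>UL\<^esub> y')" using c by (simp add: \<alpha>_mult del: ST.T_simps)
  finally show ?thesis unfolding cobounded_def
    using invariants_add[OF invariants_mult[OF invariants_\<alpha>[OF assms(5)] A(3)]
        invariants_mult[OF A(1) invariants_center[OF assms(4)]]] by blast
qed

end

lemma (in dirac) eta_hom:
  assumes unique: "\<And>z. z \<in> scenter U \<Longrightarrow> \<exists>!y. y \<in> scenter UL \<and> cobounded z y"
    and \<eta>: "\<And>z. z \<in> scenter U \<Longrightarrow> \<eta> z \<in> scenter UL \<and> cobounded z (\<eta> z)"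
  shows "\<eta> \<in> ring_hom (U\<lparr>carrier := scenter U\<rparr>) (UL\<lparr>carrier := scenter UL\<rparr>)"
    and "z \<in> scenter U \<Longrightarrow> \<eta> (c \<odot>\<^bsub>U\<^esub> z) = c \<odot>\<^bsub>UL\<^esub> \<eta> z"
proof -
  have eq: "\<eta> z = y" if "z \<in> scenter U" "y \<in> scenter UL" "cobounded z y" for z y
    using unique[OF that(1)] \<eta>[OF that(1)] that by blast
  note c = Us.scenter_closed ULs.scenter_closed
  show "\<eta> \<in> ring_hom (U\<lparr>carrier := scenter U\<rparr>) (UL\<lparr>carrier := scenter UL\<rparr>)"
  proof (rule ring_hom_memI; simp)
    fix z z' assume z: "z \<in> scenter U" "z' \<in> scenter U"
    note e = \<eta>[OF z(1)] \<eta>[OF z(2)]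
    show "\<eta> (z \<otimes>\<^bsub>U\<^esub> z') = \<eta> z \<otimes>\<^bsub>UL\<^esub> \<eta> z'"
      using e z by (intro eq Us.scenter_mult ULs.scenter_mult cobounded_mult) auto
    show "\<eta> (z \<oplus>\<^bsub>U\<^esub> z') = \<eta> z \<oplus>\<^bsub>UL\<^esub> \<eta> z'"
      using e z c by (intro eq Us.scenter_add ULs.scenter_add cobounded_add) auto
  next
    show "\<eta> \<one>\<^bsub>U\<^esub> = \<one>\<^bsub>UL\<^esub>" by (intro eq Us.scenter_one ULs.scenter_one cobounded_one)
  qed (use \<eta> in simp)
  show "\<eta> (c \<odot>\<^bsub>U\<^esub> z) = c \<odot>\<^bsub>UL\<^esub> \<eta> z" if "z \<in> scenter U" for z c
    using \<eta>[OF that] that c by (intro eq Us.scenter_sm ULs.scenter_sm cobounded_sm) auto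
qed

section \<open>Dirac cohomology\<close>

text \<open>Left multiplication descends modulo a left ideal. The grading \<open>h\<close> is left
  open because \<open>oscillator\<close> replaces the one inherited from the algebra.\<close>

lemma left_quotient_action:
  fixes A :: "'a superspace"
  assumes "calg A" "submodule I CC A" "\<And>a x. a \<in> carrier A \<Longrightarrow> x \<in> I \<Longrightarrow> a \<otimes>\<^bsub>A\<^esub> x \<in> I"
  shows "calg_action A (quot_space A I\<lparr>hpart := h\<rparr>) (\<lambda>c P. \<Union>a\<in>P. I +>\<^bsub>A\<^esub> (c \<otimes>\<^bsub>A\<^esub> a))"
proof -
  interpret A: calg A by fact
  interpret q: quot A I by unfold_locales (use A.submoduleD[OF assms(2)] assms(2) in \<open>auto simp: submodule_def subgroup_def submodule_axioms_def\<close>)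
  let ?N = "q.Q\<lparr>hpart := h\<rparr>" and ?\<nu> = "\<lambda>c P. \<Union>a\<in>P. q.cls (c \<otimes>\<^bsub>A\<^esub> a)"
  interpret Q: cvs q.Q by (rule q.cvs_Q)
  have N: "cvss ?N"
    by (rule cvss.intro, rule cvsI) (simp_all add: Q.M.a_assoc Q.sm_add_l Q.sm_add_r del: q.Q_simps, simp add: Q.M.a_comm del: q.Q_simps)
  have act: "?\<nu> c (q.cls a) = q.cls (c \<otimes>\<^bsub>A\<^esub> a)" if ca: "c \<in> carrier A" "a \<in> carrier A" for c a
  proof (rule q.UN_cls[OF ca(2)])
    fix y assume y: "y \<in> carrier A" "q.cls y = q.cls a"
    have "c \<otimes>\<^bsub>A\<^esub> y \<ominus>\<^bsub>A\<^esub> c \<otimes>\<^bsub>A\<^esub> a = c \<otimes>\<^bsub>A\<^esub> (y \<ominus>\<^bsub>A\<^esub> a)"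
      using ca y by (simp add: a_minus_def A.A.r_distr A.A.r_minus)
    then show "q.cls (c \<otimes>\<^bsub>A\<^esub> y) = q.cls (c \<otimes>\<^bsub>A\<^esub> a)" using ca y assms(3) by (simp add: q.cls_eq_iff)
  qed
  have e: "carrier ?N = q.cls ` carrier A" using q.carrier_Q by simp
  have ops: "q.cls a \<oplus>\<^bsub>q.Q\<^esub> q.cls b = q.cls (a \<oplus>\<^bsub>A\<^esub> b)" "k \<odot>\<^bsub>q.Q\<^esub> q.cls a = q.cls (k \<odot>\<^bsub>A\<^esub> a)"
    if "a \<in> carrier A" "b \<in> carrier A" for a b k
    using that q.cls_add q.smult_Q by simp_all
  show ?thesis
  proof (intro calg_action.intro calg_action_axioms.intro A.calg_axioms N)
    show "is_linear A ?N (\<lambda>a. ?\<nu> a m)" if "m \<in> carrier ?N" for m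
    proof -
      obtain b where "b \<in> carrier A" "m = q.cls b" using \<open>m \<in> carrier ?N\<close> unfolding e by auto
      then show ?thesis
        by (intro linI) (auto simp: act ops A.A.l_distr A.sm_mult_l e simp del: q.Q_simps)
    qed
    show "is_linear ?N ?N (?\<nu> a)" if "a \<in> carrier A" for a
    proof (rule linI)
      fix P k assume "P \<in> carrier ?N"
      then obtain b where b: "b \<in> carrier A" "P = q.cls b" unfolding e by auto
      then show "?\<nu> a P \<in> carrier ?N" using that by (simp add: act e)
      show "?\<nu> a (k \<odot>\<^bsub>?N\<^esub> P) = k \<odot>\<^bsub>?N\<^esub> ?\<nu> a P"
        using that b by (simp add: act ops A.sm_mult_r del: q.Q_simps)
      fix P' assume "P' \<in> carrier ?N"
      then obtain b' where "b' \<in> carrier A" "P' = q.cls b'" unfolding e by auto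
      then show "?\<nu> a (P \<oplus>\<^bsub>?N\<^esub> P') = ?\<nu> a P \<oplus>\<^bsub>?N\<^esub> ?\<nu> a P'"
        using that b by (simp add: act ops A.A.r_distr del: q.Q_simps)
    qed
    show "?\<nu> (a \<otimes>\<^bsub>A\<^esub> b) m = ?\<nu> a (?\<nu> b m)" if "a \<in> carrier A" "b \<in> carrier A" "m \<in> carrier ?N" for a b m
    proof -
      obtain x where x: "x \<in> carrier A" "m = q.cls x" using \<open>m \<in> carrier ?N\<close> unfolding e by auto
      show ?thesis unfolding x(2) act[OF that(2) x(1)] act[OF that(1) A.A.m_closed[OF that(2) x(1)]]
        using act[OF A.A.m_closed[OF that(1,2)] x(1)] that x by (simp add: A.A.m_assoc)
    qed
    show "?\<nu> \<one>\<^bsub>A\<^esub> m = m" if "m \<in> carrier ?N" for m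
    proof -
      obtain x where x: "x \<in> carrier A" "m = q.cls x" using \<open>m \<in> carrier ?N\<close> unfolding e by auto
      show ?thesis unfolding x(2) act[OF A.A.one_closed x(1)] using x by simp
    qed
  qed
qed

text \<open>\<open>d\<close> need not square to zero, which is why the boundaries are intersected
  with the kernel and why induced maps have to respect both conditions.\<close>

locale operator = cvss W for W :: "'w superspace" (structure) +
  fixes d :: "'w \<Rightarrow> 'w"
  assumes d_linear: "is_linear W W d"
begin

abbreviation "Z \<equiv> op_kernel W d"
abbreviation "Bd \<equiv> op_boundaries W d"
abbreviation "H \<equiv> op_cohomology W d"

lemma Z_submodule: "submodule Z CC W"
proof -
  interpret cvs2 W W by unfold_locales
  show ?thesis using lin_kernel_submodule[OF d_linear] by (simp add: op_kernel_def)
qed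

lemma Bd_submodule: "submodule Bd CC W"
proof -
  interpret cvs2 W W by unfold_locales
  note Z = submoduleD[OF Z_submodule]
  note I = submoduleD[OF lin_image_submodule[OF d_linear carrier_is_submodule]]
  show ?thesis unfolding op_boundaries_def
    by (rule submoduleI') (use Z I in auto)
qed

lemma ZW: "w \<in> Z \<Longrightarrow> w \<in> carrier W" by (simp add: op_kernel_def)

sublocale qW: quot W Bd
  by (intro quot.intro quot_axioms.intro cvss_axioms Bd_submodule)

text \<open>Cosets of \<open>Bd\<close> are the same sets in the kernel as in all of
  \<open>W\<close>, so classes of cycles can be compared in the quotient of
  \<open>W\<close>.\<close>

lemma coset_subspace: "Bd +>\<^bsub>subspace_of W Z\<^esub> w = Bd +> w"
  by (simp add: a_r_coset_def r_coset_def)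

lemma quot_H: "quot (subspace_of W Z) Bd"
proof (intro quot.intro quot_axioms.intro cvss_subspace_of Z_submodule)
  interpret sW: cvss "subspace_of W Z" by (rule cvss_subspace_of[OF Z_submodule])
  show "submodule Bd CC (subspace_of W Z)"
    by (rule sW.submoduleI') (use submoduleD[OF Bd_submodule] in \<open>auto simp: op_boundaries_def\<close>)
qed

lemma cvss_H: "cvss H"
  unfolding op_cohomology_def by (rule cvss.intro) (rule quot.cvs_Q[OF quot_H])

lemma carrier_H: "carrier H = qW.cls ` Z"
  unfolding op_cohomology_def using quot.carrier_Q[OF quot_H] coset_subspace by simp

lemma smult_H: "w \<in> Z \<Longrightarrow> c \<odot>\<^bsub>H\<^esub> qW.cls w = qW.cls (c \<odot> w)"
  unfolding op_cohomology_def using quot.smult_Q[OF quot_H, of w c] coset_subspace by simp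

text \<open>If \<open>y - w = d b\<close> is a cycle, then
  \<open>t y - t w = d (t b) = t (d b)\<close> is again a cycle, because \<open>t\<close> preserves
  the kernel of \<open>d\<close>.\<close>

lemma cohomology_map_cls:
  assumes "is_linear W W t" "\<And>w. w \<in> carrier W \<Longrightarrow> t (d w) = d (t w)" "w \<in> Z"
  shows "cohomology_map W d t (qW.cls w) = qW.cls (t w)" "t w \<in> Z"
proof -
  interpret W2: cvs2 W W by unfold_locales
  have tZ: "t w \<in> Z" if "w \<in> Z" for w
    using that assms(2)[of w] linD(1)[OF assms(1)] W2.lin_zero[OF assms(1)] by (simp add: op_kernel_def)
  then show "t w \<in> Z" using assms by blast
  show "cohomology_map W d t (qW.cls w) = qW.cls (t w)"
    unfolding cohomology_map_def
  proof (rule qW.UN_cls[OF ZW[OF assms(3)]])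
    fix y assume y: "y \<in> carrier W" "qW.cls y = qW.cls w"
    then have "y \<ominus> w \<in> Bd" using ZW[OF assms(3)] by (simp add: qW.cls_eq_iff)
    then obtain b where b: "b \<in> carrier W" "y \<ominus> w = d b" "d b \<in> Z" by (auto simp: op_boundaries_def)
    have "t y \<ominus> t w = d (t b)"
      using W2.lin_diff[OF assms(1) y(1) ZW[OF assms(3)]] b(2) assms(2)[OF b(1)] by simp
    moreover have "d (t b) \<in> Z" using tZ[OF b(3)] assms(2)[OF b(1)] by simp
    ultimately have "t y \<ominus> t w \<in> Bd" using linD(1)[OF assms(1) b(1)] by (auto simp: op_boundaries_def)
    then show "qW.cls (t y) = qW.cls (t w)"
      using y ZW[OF assms(3)] linD(1)[OF assms(1)] by (simp add: qW.cls_eq_iff)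
  qed
qed

end

section \<open>Action on the tensor product of \<open>M\<close> with the oscillator module and on
  its cohomology\<close>

locale dirac_module = dirac G B \<ll> \<ss> n X Xd px \<nu>
  for G :: "'g lie_superspace" (structure) and B \<ll> \<ss> n X Xd px \<nu> +
  fixes M :: "'m superspace" and \<rho> :: "'g \<Rightarrow> 'm \<Rightarrow> 'm" and \<uu> \<uu>' :: "'g set"
  assumes M: "supermodule G M \<rho>" and u_s: "\<uu> \<subseteq> \<ss>"
begin

sublocale M: sspace M using M by unfold_locales (simp add: supermodule_def)

lemma \<rho>_lin: "x \<in> carrier G \<Longrightarrow> is_linear M M (\<rho> x)" "m \<in> carrier M \<Longrightarrow> is_linear G M (\<lambda>x. \<rho> x m)"
  using M by (auto simp: supermodule_def)

sublocale MU: pres_rep G "lie_rels G" M \<rho>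
proof -
  interpret f: free_rep M "carrier G" \<rho> by unfold_locales (rule \<rho>_lin)
  have "f.ev r m = \<zero>\<^bsub>M\<^esub>" if r: "r \<in> lie_rels G" and m: "m \<in> carrier M" for r m
  proof -
    obtain x y p q where xy: "x \<in> hpart G p" "y \<in> hpart G q"
      and r: "r = gen x * gen y - const (koszul p q) * gen y * gen x - gen (br x y)"
      using r by (auto simp: lie_rels_def)
    have c: "x \<in> carrier G" "y \<in> carrier G" "br x y \<in> carrier G" using xy hpartD(7) brD(1) by auto
    have "\<rho> (br x y) m = \<rho> x (\<rho> y m) \<ominus>\<^bsub>M\<^esub> koszul p q \<odot>\<^bsub>M\<^esub> \<rho> y (\<rho> x m)"
      using M xy m unfolding supermodule_def by blast
    then show ?thesis unfolding r using c m linD(1)[OF \<rho>_lin(1)]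
      by (simp add: f.ev_diff f.ev_mult f.ev_scale mult.assoc M.diff_eq_zero_iff)
  qed
  then show "pres_rep G (lie_rels G) M \<rho>"
    by (intro pres_rep.intro pres_rep_axioms.intro U.presentation_axioms f.free_rep_axioms \<rho>_lin(2))
qed

abbreviation "\<mu> \<equiv> alg_act M \<rho>"

lemma graded_action_M: "graded_action U M \<mu>"
proof -
  have "calg_action U M \<mu>"
    using MU.act_linear1 MU.act_linear2 MU.act_mult MU.act_one unfolding Pr_eq
    by (intro calg_action.intro calg_action_axioms.intro Us.calg_axioms M.cvss_axioms) auto
  moreover have "\<mu> a m \<in> hpart M (p + q)" if "a \<in> hpart U p" "m \<in> hpart M q" for a m p q
    using MU.act_hpart[OF U.graded_presentation_axioms M.sspace_axioms, of a p m q] that M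
    unfolding Pr_eq supermodule_def by blast
  ultimately show ?thesis
    by (intro graded_action.intro graded_action_axioms.intro Us.superalg_axioms M.sspace_axioms)
qed

abbreviation "osc \<equiv> oscillator S B \<uu> \<uu>'"

lemma osc_action: "calg_action C osc (osc_act S B \<uu>)"
proof -
  let ?G = "{c \<otimes>\<^bsub>C\<^esub> gc v | c v. c \<in> carrier C \<and> v \<in> \<uu>}"
  have G: "?G \<subseteq> carrier C" using u_s by auto
  have I: "submodule (osc_ideal S B \<uu>) CC C"
    unfolding osc_ideal_def by (rule Cs.lspan_submodule[OF G])
  note D = Cs.submoduleD[OF I]
  have left: "a \<otimes>\<^bsub>C\<^esub> x \<in> osc_ideal S B \<uu>" if a: "a \<in> carrier C" and x: "x \<in> osc_ideal S B \<uu>" for a x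
    using x[unfolded osc_ideal_def] G
  proof (induction rule: Cs.lspan_induct)
    case (base x)
    then obtain c v where cv: "x = c \<otimes>\<^bsub>C\<^esub> gc v" "c \<in> carrier C" "v \<in> \<uu>" by auto
    then have "a \<otimes>\<^bsub>C\<^esub> x = (a \<otimes>\<^bsub>C\<^esub> c) \<otimes>\<^bsub>C\<^esub> gc v" using a u_s by (simp add: Cs.A.m_assoc subset_iff)
    then have "a \<otimes>\<^bsub>C\<^esub> x \<in> ?G" using cv a by blast
    then show ?case unfolding osc_ideal_def by (rule subsetD[OF Cs.lspan_superset])
  qed (use a D in \<open>auto simp: Cs.A.r_distr Cs.sm_mult_r\<close>)
  show ?thesis
    using left_quotient_action[OF Cs.calg_axioms I left] unfolding oscillator_def osc_act_def .
qed

sublocale TM: super_tensor_module U C M \<mu> osc "osc_act S B \<uu>"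
  by (intro super_tensor_module.intro ST.super_tensor_axioms graded_action_M osc_action)

abbreviation "W \<equiv> tensor M osc"
abbreviation "act \<equiv> tensor_op C M osc \<mu> (osc_act S B \<uu>)"

sublocale TW: calg_action T W act by (rule TM.calg_action_T)

sublocale O: operator W "act D"
  by (intro operator.intro operator_axioms.intro TM.act.T.cvss_Tn TW.\<mu>2 D_closed)

abbreviation "hact \<equiv> \<lambda>t. cohomology_map W (act D) (act t)"

lemma act_commute:
  assumes "t \<in> carrier T" "t \<otimes>\<^bsub>T\<^esub> D = D \<otimes>\<^bsub>T\<^esub> t" "w \<in> carrier W"
  shows "act t (act D w) = act D (act t w)"
  using TW.\<mu>_mult[OF assms(1) D_closed assms(3)] TW.\<mu>_mult[OF D_closed assms(1,3)] assms(2) by metis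

lemma hact_cls:
  assumes "t \<in> carrier T" "t \<otimes>\<^bsub>T\<^esub> D = D \<otimes>\<^bsub>T\<^esub> t" "w \<in> O.Z"
  shows "hact t (O.qW.cls w) = O.qW.cls (act t w)" "act t w \<in> O.Z"
  using O.cohomology_map_cls[OF TW.\<mu>2[OF assms(1)] act_commute[OF assms(1,2)] assms(3)] by auto

lemma center_closed: "z \<in> scenter U \<Longrightarrow> tn z \<one>\<^bsub>C\<^esub> \<in> carrier T"
  using Us.scenter_closed by simp

lemma hact_cobounded:
  assumes z: "z \<in> scenter U" and y: "y \<in> scenter UL" and cob: "cobounded z y" and v: "v \<in> carrier O.H"
  shows "hact (tn z \<one>\<^bsub>C\<^esub>) v \<in> carrier O.H" "hact (tn z \<one>\<^bsub>C\<^esub>) v = hact (\<alpha> y) v"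
proof -
  obtain w where w: "w \<in> O.Z" "v = O.qW.cls w" using v by (auto simp: O.carrier_H)
  obtain A where A: "A \<in> carrier T" "tn z \<one>\<^bsub>C\<^esub> = \<alpha> y \<oplus>\<^bsub>T\<^esub> (D \<otimes>\<^bsub>T\<^esub> A \<oplus>\<^bsub>T\<^esub> A \<otimes>\<^bsub>T\<^esub> D)"
    using cob invariants_closed unfolding cobounded_def by blast
  have yc: "\<alpha> y \<in> carrier T" by (intro \<alpha>_closed ULs.scenter_closed y)
  note wc = O.ZW[OF w(1)]
  note hz = hact_cls[OF center_closed[OF z] center_D[OF z] w(1)]
  note hy = hact_cls[OF yc \<alpha>_D[OF ULs.scenter_closed[OF y]] w(1)]
  show "hact (tn z \<one>\<^bsub>C\<^esub>) v \<in> carrier O.H" unfolding w(2) hz(1) O.carrier_H using hz(2) by blast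
  interpret WW: cvs2 W W by unfold_locales
  have Dw: "act D w = \<zero>\<^bsub>W\<^esub>" using w(1) by (simp add: op_kernel_def)
  have "act (tn z \<one>\<^bsub>C\<^esub>) w = act (\<alpha> y) w \<oplus>\<^bsub>W\<^esub> (act (D \<otimes>\<^bsub>T\<^esub> A) w \<oplus>\<^bsub>W\<^esub> act (A \<otimes>\<^bsub>T\<^esub> D) w)"
    unfolding A(2)
    using linD(2)[OF TW.\<mu>1[OF wc]] yc A(1) D_closed ST.T.A.m_closed ST.T.M.a_closed by (simp del: ST.T_simps)
  also have "act (A \<otimes>\<^bsub>T\<^esub> D) w = \<zero>\<^bsub>W\<^esub>"
    using TW.\<mu>_mult[OF A(1) D_closed wc] Dw WW.lin_zero[OF TW.\<mu>2[OF A(1)]] by simp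
  also have "act (D \<otimes>\<^bsub>T\<^esub> A) w = act D (act A w)"
    using TW.\<mu>_mult[OF D_closed A(1) wc] .
  finally have e: "act (tn z \<one>\<^bsub>C\<^esub>) w = act (\<alpha> y) w \<oplus>\<^bsub>W\<^esub> act D (act A w)"
    using linD(1)[OF TW.\<mu>2] A(1) D_closed wc by simp
  have Aw: "act A w \<in> carrier W" "act D (act A w) \<in> carrier W"
    using linD(1)[OF TW.\<mu>2[OF A(1)] wc] linD(1)[OF TW.\<mu>2[OF D_closed]] by auto
  have cy: "act (\<alpha> y) w \<in> carrier W" "act (tn z \<one>\<^bsub>C\<^esub>) w \<in> carrier W" using hy(2) hz(2) O.ZW by auto
  have df: "act (tn z \<one>\<^bsub>C\<^esub>) w \<ominus>\<^bsub>W\<^esub> act (\<alpha> y) w = act D (act A w)"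
    unfolding e using TM.act.T.Tn.add_diff cy Aw by simp
  \<comment> \<open>A difference of two cycles: \<open>z \<otimes> 1\<close> and
    \<open>\<alpha> y\<close> both commute with \<open>D\<close>.\<close>
  have "act D (act A w) \<in> O.Z"
    unfolding df[symmetric] by (rule TM.act.T.Tn.submoduleD(6)[OF O.Z_submodule hz(2) hy(2)])
  then have "act (tn z \<one>\<^bsub>C\<^esub>) w \<ominus>\<^bsub>W\<^esub> act (\<alpha> y) w \<in> O.Bd"
    unfolding df op_boundaries_def using Aw by blast
  then have "O.qW.cls (act (tn z \<one>\<^bsub>C\<^esub>) w) = O.qW.cls (act (\<alpha> y) w)"
    using cy by (simp add: O.qW.cls_eq_iff)
  then show "hact (tn z \<one>\<^bsub>C\<^esub>) v = hact (\<alpha> y) v" unfolding w(2) hz(1) hy(1) .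
qed

text \<open>The unit of the Clifford algebra is even, so no sign arises, and the scalar of
  \<open>z\<close> on \<open>M\<close> is its scalar on every pure tensor.\<close>

lemma act_scalar:
  assumes "z \<in> carrier U" "\<And>m. m \<in> carrier M \<Longrightarrow> \<mu> z m = k \<odot>\<^bsub>M\<^esub> m" "w \<in> carrier W"
  shows "act (tn z \<one>\<^bsub>C\<^esub>) w = k \<odot>\<^bsub>W\<^esub> w"
proof -
  have z1: "tn z \<one>\<^bsub>C\<^esub> \<in> carrier T" using assms(1) by simp
  note L = linD[OF TW.\<mu>2[OF z1]]
  show ?thesis using assms(3)
  proof (induction w rule: TM.act.T.Tn_induct)
    case (tens m x)
    have "osc_act S B \<uu> \<one>\<^bsub>C\<^esub> x = x" using TM.N.\<mu>_one tens by blast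
    then show ?case
      using TM.act.op_tens[OF assms(1) Cs.one_even tens] tens assms(2) by (simp add: TM.act.T.tn_sm_l)
  qed (simp_all add: L TM.act.T.Tn.sm_add_r mult.commute)
qed

lemma hact_scalar:
  assumes z: "z \<in> scenter U" and "\<And>m. m \<in> carrier M \<Longrightarrow> \<mu> z m = k \<odot>\<^bsub>M\<^esub> m" and v: "v \<in> carrier O.H"
  shows "hact (tn z \<one>\<^bsub>C\<^esub>) v = k \<odot>\<^bsub>O.H\<^esub> v"
proof -
  obtain w where w: "w \<in> O.Z" "v = O.qW.cls w" using v by (auto simp: O.carrier_H)
  show ?thesis
    using hact_cls(1)[OF center_closed[OF z] center_D[OF z] w(1)] act_scalar[OF Us.scenter_closed[OF z] assms(2) O.ZW[OF w(1)]]
      O.smult_H[OF w(1)] w(2) by simp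
qed

text \<open>Both scalars describe the same operator on \<open>V\<close>, and a nonzero vector of
  \<open>V\<close> distinguishes scalars. The theorem takes \<open>k = \<chi> lam z\<close> and
  \<open>k' = \<chi>l mu (\<eta> z)\<close>.\<close>

lemma infinitesimal_characters_agree:
  assumes z: "z \<in> scenter U" and y: "y \<in> scenter UL" and cob: "cobounded z y"
    and M_scalar: "\<And>m. m \<in> carrier M \<Longrightarrow> \<mu> z m = k \<odot>\<^bsub>M\<^esub> m"
    and V: "submodule V CC O.H" "V \<noteq> {\<zero>\<^bsub>O.H\<^esub>}"
    and V_scalar: "\<And>v. v \<in> V \<Longrightarrow> hact (\<alpha> y) v = k' \<odot>\<^bsub>O.H\<^esub> v"
  shows "k = k'"
proof -
  interpret H: cvss O.H by (rule O.cvss_H)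
  obtain v where v: "v \<in> V" "v \<noteq> \<zero>\<^bsub>O.H\<^esub>" using V(2) H.submoduleD(2)[OF V(1)] by auto
  have vH: "v \<in> carrier O.H" using H.submoduleD(7)[OF V(1) v(1)] .
  have "k \<odot>\<^bsub>O.H\<^esub> v = k' \<odot>\<^bsub>O.H\<^esub> v"
    using hact_scalar[OF z M_scalar vH] hact_cobounded(2)[OF z y cob vH] V_scalar[OF v(1)] by metis
  then show ?thesis by (rule H.sm_cancel[OF _ vH v(2)])
qed

end

theorem theorem1p2p1:
  fixes G :: "'g lie_superspace"
    and B :: "'g \<Rightarrow> 'g \<Rightarrow> complex"
    and \<hh> :: "'g set"
    and \<Phi>pos :: "('g \<Rightarrow> complex) set"
    and f :: "('g \<Rightarrow> complex) \<Rightarrow> int"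
    and r :: nat
    and X Xd :: "nat \<Rightarrow> 'g"
    and px :: "nat \<Rightarrow> bit"
    and \<nu> :: "'g \<Rightarrow> 'g free set"
    and \<eta> :: "'g free set \<Rightarrow> 'g free set"
    and \<ll> \<uu> \<uu>' \<ss> :: "'g set"
    and L S :: "'g lie_superspace"
    and C :: "'g free set superspace"
    and T :: "('g free set \<times> 'g free set \<Rightarrow>\<^sub>0 complex) set superspace"
    and D :: "('g free set \<times> 'g free set \<Rightarrow>\<^sub>0 complex) set"
    and Tinv :: "('g free set \<times> 'g free set \<Rightarrow>\<^sub>0 complex) set set"
    and \<alpha> :: "'g free set \<Rightarrow> ('g free set \<times> 'g free set \<Rightarrow>\<^sub>0 complex) set"
    and cob :: "'g free set \<Rightarrow> 'g free set \<Rightarrow> bool"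
    and \<chi> \<chi>l :: "('g \<Rightarrow> complex) \<Rightarrow> 'g free set \<Rightarrow> complex"
  assumes "basic_classical G"
    and "invariant_form G B"
    and "cartan_subalgebra G \<hh>"
    and "positive_system G \<hh> \<Phi>pos"
    \<comment> \<open>the parabolic subalgebra defined by \<open>f\<close>\<close>
    and "additive_on_root_lattice G \<hh> f"
    and "\<And>a. a \<in> roots G \<hh> \<Longrightarrow> f a > 0 \<Longrightarrow> a \<in> \<Phi>pos"
    and "\<ll> = levi G \<hh> f"
    and "\<uu> = root_sum G \<hh> {a \<in> roots G \<hh>. f a > 0}"
    and "\<uu>' = root_sum G \<hh> {a \<in> roots G \<hh>. f a < 0}"
    and "\<ss> = lspan G (\<uu> \<union> \<uu>')"
    and "L = subspace_of G \<ll>"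
    and "S = subspace_of G \<ss>"
    \<comment> \<open>the cubic Dirac operator and the diagonal embedding\<close>
    and "homogeneous_dual_bases G B \<ss> (2 * r) X px Xd"
    and "diagonal_morphism G B \<ll> \<ss> \<nu>"
    and "C = clifford S B"
    and "T = super_tensor_algebra (uea G) C"
    and "D = dirac_operator G B \<ss> (2 * r) X px Xd"
    and "\<alpha> = alg_ext T (diagonal_gen G B \<ss> \<nu>)"
    and "Tinv = {A \<in> carrier T. \<forall>x\<in>\<ll>. scomm T (diagonal_gen G B \<ss> \<nu> x) A = \<zero>\<^bsub>T\<^esub>}"
    \<comment> \<open>the map \<open>\<eta>\<close>, whose existence and uniqueness is known\<close>
    and "\<And>z y. cob z y \<longleftrightarrow>
           (\<exists>A\<in>Tinv. tens (uea G) C z \<one>\<^bsub>C\<^esub> = \<alpha> y \<oplus>\<^bsub>T\<^esub> (D \<otimes>\<^bsub>T\<^esub> A \<oplus>\<^bsub>T\<^esub> A \<otimes>\<^bsub>T\<^esub> D))"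
    and "\<And>z. z \<in> scenter (uea G) \<Longrightarrow> \<exists>!y. y \<in> scenter (uea L) \<and> cob z y"
    and "\<And>z. z \<in> scenter (uea G) \<Longrightarrow> \<eta> z \<in> scenter (uea L) \<and> cob z (\<eta> z)"
    \<comment> \<open>infinitesimal characters\<close>
    and "\<chi> = inf_char G \<hh> (root_sum G \<hh> \<Phi>pos) (root_sum G \<hh> (uminus ` \<Phi>pos))"
    and "\<chi>l = inf_char L \<hh> (root_sum G \<hh> {a \<in> \<Phi>pos. f a = 0})
                 (root_sum G \<hh> (uminus ` {a \<in> \<Phi>pos. f a = 0}))"
  shows "\<eta> \<in> ring_hom ((uea G)\<lparr>carrier := scenter (uea G)\<rparr>) ((uea L)\<lparr>carrier := scenter (uea L)\<rparr>) \<and>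
    (\<forall>c. \<forall>z\<in>scenter (uea G). \<eta> (c \<odot>\<^bsub>uea G\<^esub> z) = c \<odot>\<^bsub>uea L\<^esub> \<eta> z) \<and>
    (\<forall>(M :: 'm superspace) \<rho> lam W act H hact.
       supermodule G M \<rho> \<and> lam \<in> dual_space G \<hh> \<and>
       (\<forall>z\<in>scenter (uea G). \<forall>m\<in>carrier M. alg_act M \<rho> z m = \<chi> lam z \<odot>\<^bsub>M\<^esub> m) \<and>
       W = tensor M (oscillator S B \<uu> \<uu>') \<and>
       act = tensor_op C M (oscillator S B \<uu> \<uu>') (alg_act M \<rho>) (osc_act S B \<uu>) \<and>
       H = op_cohomology W (act D) \<and>
       hact = (\<lambda>t. cohomology_map W (act D) (act t))
       \<longrightarrow>
       (\<forall>z\<in>scenter (uea G). \<forall>v\<in>carrier H.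
          hact (tens (uea G) C z \<one>\<^bsub>C\<^esub>) v \<in> carrier H \<and>
          hact (tens (uea G) C z \<one>\<^bsub>C\<^esub>) v = hact (\<alpha> (\<eta> z)) v) \<and>
       (\<forall>V mu. sub_supermodule H \<ll> (\<lambda>x. hact (diagonal_gen G B \<ss> \<nu> x)) V \<and> V \<noteq> {\<zero>\<^bsub>H\<^esub>} \<and>
          mu \<in> dual_space G \<hh> \<and>
          (\<forall>y\<in>scenter (uea L). \<forall>v\<in>V. hact (\<alpha> y) v = \<chi>l mu y \<odot>\<^bsub>H\<^esub> v)
          \<longrightarrow> (\<forall>z\<in>scenter (uea G). \<chi> lam z = \<chi>l mu (\<eta> z))))"
proof -
  have lie: "lie_superalgebra G" using assms(1) by (simp add: basic_classical_def)
  interpret g: cartan_grading G \<hh> f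
    by (intro cartan_grading.intro cartan_grading_axioms.intro lie_super.intro lie assms(3,5))
  \<comment> \<open>In terms of degrees under \<open>f\<close>, \<open>\<ll>\<close> is the part of
    degree \<open>0\<close> and \<open>\<ss>\<close> the part of nonzero degree;
    \<open>br_weight_span\<close> then yields both bracket conditions of the locale
    \<open>dirac\<close>.\<close>
  have l: "\<ll> = g.weight_span {0}" using assms(7) g.levi_eq by simp
  have s: "\<ss> = g.weight_span (- {0})" using assms(8-10) g.complement_eq by simp
  have gr: "graded_sub G \<ll>" "graded_sub G \<ss>" unfolding l s by (rule g.weight_span_graded)+
  interpret d: dirac G B \<ll> \<ss> "2 * r" X Xd px \<nu>
    by (intro dirac.intro dirac_axioms.intro g.lie_super_axioms assms(2,13,14) gr)
       (use g.br_weight_span in \<open>auto simp: l s\<close>)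
  note eqs = assms(11,12,15-18)
  have cob: "cob z y \<longleftrightarrow> d.cobounded z y" for z y
    using assms(20)[of z y] unfolding assms(19) d.cobounded_def d.invariants_def unfolding eqs by blast
  have unique: "\<exists>!y. y \<in> scenter (uea (subspace_of G \<ll>)) \<and> d.cobounded z y" if "z \<in> scenter (uea G)" for z
    using assms(21)[OF that] unfolding cob eqs .
  have \<eta>: "\<eta> z \<in> scenter (uea (subspace_of G \<ll>)) \<and> d.cobounded z (\<eta> z)" if "z \<in> scenter (uea G)" for z
    using assms(22)[OF that] unfolding cob eqs .
  have us: "\<uu> \<subseteq> \<ss>" using assms(10) g.lspan_superset[of "\<uu> \<union> \<uu>'"] by auto
  show ?thesis
  proof (intro conjI allI impI ballI)
    show "\<eta> \<in> ring_hom ((uea G)\<lparr>carrier := scenter (uea G)\<rparr>) ((uea L)\<lparr>carrier := scenter (uea L)\<rparr>)"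
      unfolding eqs by (rule d.eta_hom(1)[OF unique \<eta>])
    show "\<eta> (c \<odot>\<^bsub>uea G\<^esub> z) = c \<odot>\<^bsub>uea L\<^esub> \<eta> z" if "z \<in> scenter (uea G)" for c z
      unfolding eqs by (rule d.eta_hom(2)[OF unique \<eta> that])
  next
    fix M :: "'m superspace" and \<rho> lam W act H hact z v
    assume A: "supermodule G M \<rho> \<and> lam \<in> dual_space G \<hh> \<and>
       (\<forall>z\<in>scenter (uea G). \<forall>m\<in>carrier M. alg_act M \<rho> z m = \<chi> lam z \<odot>\<^bsub>M\<^esub> m) \<and>
       W = tensor M (oscillator S B \<uu> \<uu>') \<and>
       act = tensor_op C M (oscillator S B \<uu> \<uu>') (alg_act M \<rho>) (osc_act S B \<uu>) \<and>
       H = op_cohomology W (act D) \<and>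
       hact = (\<lambda>t. cohomology_map W (act D) (act t))"
    then have M: "supermodule G M \<rho>" by blast
    interpret m: dirac_module G B \<ll> \<ss> "2 * r" X Xd px \<nu> M \<rho> \<uu> \<uu>'
      by (intro dirac_module.intro dirac_module_axioms.intro d.dirac_axioms M us)
    assume z: "z \<in> scenter (uea G)" and v: "v \<in> carrier H"
    have "H = m.O.H" "hact = m.hact" using A unfolding eqs by simp_all
    with m.hact_cobounded[OF z \<eta>[OF z, THEN conjunct1] \<eta>[OF z, THEN conjunct2]] v
    show "hact (tens (uea G) C z \<one>\<^bsub>C\<^esub>) v \<in> carrier H"
      "hact (tens (uea G) C z \<one>\<^bsub>C\<^esub>) v = hact (\<alpha> (\<eta> z)) v"
      unfolding eqs by simp_all
  next
    fix M :: "'m superspace" and \<rho> lam W act H hact V mu z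
    assume A: "supermodule G M \<rho> \<and> lam \<in> dual_space G \<hh> \<and>
       (\<forall>z\<in>scenter (uea G). \<forall>m\<in>carrier M. alg_act M \<rho> z m = \<chi> lam z \<odot>\<^bsub>M\<^esub> m) \<and>
       W = tensor M (oscillator S B \<uu> \<uu>') \<and>
       act = tensor_op C M (oscillator S B \<uu> \<uu>') (alg_act M \<rho>) (osc_act S B \<uu>) \<and>
       H = op_cohomology W (act D) \<and>
       hact = (\<lambda>t. cohomology_map W (act D) (act t))"
      and V: "sub_supermodule H \<ll> (\<lambda>x. hact (diagonal_gen G B \<ss> \<nu> x)) V \<and> V \<noteq> {\<zero>\<^bsub>H\<^esub>} \<and>
          mu \<in> dual_space G \<hh> \<and>
          (\<forall>y\<in>scenter (uea L). \<forall>v\<in>V. hact (\<alpha> y) v = \<chi>l mu y \<odot>\<^bsub>H\<^esub> v)"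
      and z: "z \<in> scenter (uea G)"
    then have M: "supermodule G M \<rho>"
      and sc: "\<And>m. m \<in> carrier M \<Longrightarrow> alg_act M \<rho> z m = \<chi> lam z \<odot>\<^bsub>M\<^esub> m" by blast+
    interpret m: dirac_module G B \<ll> \<ss> "2 * r" X Xd px \<nu> M \<rho> \<uu> \<uu>'
      by (intro dirac_module.intro dirac_module_axioms.intro d.dirac_axioms M us)
    have H: "H = m.O.H" "hact = m.hact" using A unfolding eqs by simp_all
    have V': "submodule V CC m.O.H" "V \<noteq> {\<zero>\<^bsub>m.O.H\<^esub>}"
      using V unfolding sub_supermodule_def H by blast+
    have vs: "m.hact (d.\<alpha> (\<eta> z)) v = \<chi>l mu (\<eta> z) \<odot>\<^bsub>m.O.H\<^esub> v" if "v \<in> V" for v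
      using V \<eta>[OF z] that unfolding H eqs by blast
    show "\<chi> lam z = \<chi>l mu (\<eta> z)"
      by (rule m.infinitesimal_characters_agree[OF z \<eta>[OF z, THEN conjunct1] \<eta>[OF z, THEN conjunct2] _ V'])
         (fact sc vs)+
  qed
qed

end
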